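(* (1) Let $a(z)$ and $b(z)$ be two monic complex polynomials of even degree. The coproduct $\Delta: Y\to Y\otimes Y$ of the Yangian $Y=Y(\mathfrak{sl}_2)$ induces an algebra morphism $Y^{ab}\longrightarrow Y^a\otimes Y^b$ between truncated Yangians; that is, there is an algebra morphism $\overline\Delta: Y^{ab}\to Y^a\otimes Y^b$ with $\overline\Delta\circ\pi_{ab}=(\pi_a\otimes\pi_b)\circ\Delta$, where $\pi_c:Y\to Y^c$ denotes the canonical projection. (2) Let $q\in\mathbb C^\times$ be not a root of unity, and let $a(z)$ and $b(z)$ be two complex polynomials of even degree with non-zero constant terms. The coproduct $\Delta:U_q\to U_q\otimes U_q$ of the quantum affine algebra $U_q=U_q(\widehat{\mathfrak{sl}_2})$ induces an algebra morphism $U_q^{ab}\longrightarrow U_q^a\otimes U_q^b$ between truncated quantum affine algebras; that is, there is an algebra morphism $\overline\Delta:U_q^{ab}\to U_q^a\otimes U_q^b$ with $\overline\Delta\circ\pi_{ab}=(\pi_a\otimes\pi_b)\circ\Delta$, where $\pi_c:U_q\to U_q^c$ denotes the canonical projection. Here $ab$ denotes the product polynomial $a(z)b(z)$.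
   Context: All algebras are associative unital over $\mathbb C$, $\otimes=\otimes_{\mathbb C}$, $\mathbb N=\{0,1,2,\dots\}$, $[x,y]=xy-yx$. **Yangian.** $Y$ is the algebra with generators $x^+_n,x^-_n,h_n$ ($n\in\mathbb N$) and relations, for $r,s\in\mathbb N$: $[h_r,h_s]=0$; $[h_0,x^\pm_s]=\pm2x^\pm_s$; $[h_{r+1},x^\pm_s]-[h_r,x^\pm_{s+1}]=\pm(h_rx^\pm_s+x^\pm_sh_r)$; $[x^+_r,x^-_s]=h_{r+s}$; $[x^\pm_{r+1},x^\pm_s]-[x^\pm_r,x^\pm_{s+1}]=\pm(x^\pm_rx^\pm_s+x^\pm_sx^\pm_r)$. Put $h(z)=1+\sum_{n\ge0}h_nz^{-n-1}$ and let $Y^=$ be the (commutative) subalgebra generated by all $h_n$. $Y$ is a Hopf algebra whose coproduct is the algebra morphism determined by $\Delta(x^\pm_0)=x^\pm_0\otimes1+1\otimes x^\pm_0$, $\Delta(h_0)=h_0\otimes1+1\otimes h_0$, $\Delta(x^+_1)=x^+_1\otimes1+1\otimes x^+_1+h_0\otimes x^+_0$. For $m\in\mathbb N$ and a complex Laurent series $a(z)$ in $z^{-1}$ with leading term $z^{2m}$ (e.g. a monic polynomial of degree $2m$), $A^a(z)$ is the unique Laurent series in $z^{-1}$ with leading term $z^m$ and coefficients in $Y^=$ such that $h(z)=\dfrac{a(z)}{A^a(z)A^a(z-1)}$ (expansions in $z^{-1}$). The truncated Yangian $Y^a$ is the quotient of $Y$ by the two-sided ideal generated by the coefficients of all strictly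 negative powers of $z$ in $A^a(z)$. **Quantum affine algebra.** $U_q$ is the algebra with generators $x^\pm_m,\phi^\pm_m$ ($m\in\mathbb Z$) and relations, for $\epsilon\in\{+,-\}$, $m,n\in\mathbb Z$: $\phi^+_m=0$ if $m<0$; $\phi^-_m=0$ if $m>0$; $\phi^+_0\phi^-_0=1$; $[\phi^\pm_m,\phi^\epsilon_n]=0$; $[x^+_m,x^-_n]=\dfrac{\phi^+_{m+n}-\phi^-_{m+n}}{q-q^{-1}}$; $\phi^\epsilon_{m+1}x^\pm_n-q^{\pm2}\phi^\epsilon_mx^\pm_{n+1}=q^{\pm2}x^\pm_n\phi^\epsilon_{m+1}-x^\pm_{n+1}\phi^\epsilon_m$; $x^\pm_{m+1}x^\pm_n-q^{\pm2}x^\pm_mx^\pm_{n+1}=q^{\pm2}x^\pm_nx^\pm_{m+1}-x^\pm_{n+1}x^\pm_m$. Put $\phi^\pm(z)=\sum_{n\in\mathbb Z}\phi^\pm_nz^n$, and define $h_s$ ($s\in\mathbb Z\setminus\{0\}$) by $\phi^\pm(z)=\phi^\pm_0\exp\big(\pm(q-q^{-1})\sum_{\pm s>0}h_sz^s\big)$. $U_q$ is a Hopf algebra whose coproduct is the algebra morphism determined by $\Delta(x^+_0)=x^+_0\otimes1+\phi^+_0\otimes x^+_0$, $\Delta(x^-_0)=1\otimes x^-_0+x^-_0\otimes\phi^-_0$, $\Delta(\phi^\pm_0)=\phi^\pm_0\otimes\phi^\pm_0$, $\Delta(h_{-1})=1\otimes h_{-1}+h_{-1}\otimes1+(q^2-q^{-2})x^-_0\otimes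 x^+_{-1}$, $\Delta(h_1)=1\otimes h_1+h_1\otimes1-(q^2-q^{-2})x^-_1\otimes x^+_0$. For $n\in\mathbb N$ and a complex polynomial $a(z)$ with dominant term $a_{2n}z^{2n}$ and non-zero constant term $a_0$, the series $\mathscr A^{a+}(z)$ and $\mathscr A^{a-}(z)$ are the power series with constant term $1$ in $z$ and in $z^{-1}$ respectively, with coefficients in the commutative subalgebra generated by the $\phi^\pm_m$, determined by $$\phi^+(z)=\frac{\phi^+_0a(z)a_0^{-1}}{\mathscr A^{a+}(z)\mathscr A^{a+}(zq^2)},\qquad \phi^-(z)=\frac{\phi^-_0a(z)a_{2n}^{-1}z^{-2n}}{\mathscr A^{a-}(z)\mathscr A^{a-}(zq^2)}.$$ Write $\mathscr A^{a\pm}(z)=\sum_{k\in\mathbb Z}\mathscr A^{a\pm}_kz^k$ (so $\mathscr A^{a+}_k=0=\mathscr A^{a-}_{-k}$ for $k<0$ and $\mathscr A^{a\pm}_0=1$). The truncated quantum affine algebra $U_q^a$ is the quotient algebra of $U_q$ by the relations: $\mathscr A^{a+}_k=0$ for $k>n$; $\mathscr A^{a-}_k=\mathscr A^{a-}_{-n}\mathscr A^{a+}_{k+n}$ for all $k\in\mathbb Z$; $a_{2n}(\phi^+_0)^2=a_0(\mathscr A^{a+}_n)^2q^{2n}$. *)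

theory Defs
  imports Complex_Main "HOL-Library.Poly_Mapping" "HOL-Computational_Algebra.Polynomial"
    "HOL-Algebra.QuotRing" "HOL-Algebra.Module"
begin

section \<open>Associative unital complex algebras\<close>

text \<open>
  Algebras are represented by records of type \<open>(complex, 'a) module\<close>: a ring in the sense of
  HOL-Algebra (not necessarily commutative) together with a scalar multiplication.
\<close>

type_synonym 'a calg = "(complex, 'a) module"

definition alg_hom :: "'a calg \<Rightarrow> 'b calg \<Rightarrow> ('a \<Rightarrow> 'b) set" where
  "alg_hom A B = {f \<in> ring_hom A B.
     \<forall>c. \<forall>x\<in>carrier A. f (c \<odot>\<^bsub>A\<^esub> x) = c \<odot>\<^bsub>B\<^esub> f x}"

definition is_subalgebra :: "'a calg \<Rightarrow> 'a set \<Rightarrow> bool" where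
  "is_subalgebra A B \<longleftrightarrow> B \<subseteq> carrier A \<and> \<one>\<^bsub>A\<^esub> \<in> B \<and>
     (\<forall>x\<in>B. \<forall>y\<in>B. x \<oplus>\<^bsub>A\<^esub> y \<in> B \<and> x \<otimes>\<^bsub>A\<^esub> y \<in> B) \<and>
     (\<forall>c. \<forall>x\<in>B. c \<odot>\<^bsub>A\<^esub> x \<in> B)"

definition gen_subalgebra :: "'a calg \<Rightarrow> 'a set \<Rightarrow> 'a set" where
  "gen_subalgebra A S = \<Inter>{B. is_subalgebra A B \<and> S \<subseteq> B}"

definition commutator :: "'a calg \<Rightarrow> 'a \<Rightarrow> 'a \<Rightarrow> 'a" where
  "commutator A x y = (x \<otimes>\<^bsub>A\<^esub> y) \<ominus>\<^bsub>A\<^esub> (y \<otimes>\<^bsub>A\<^esub> x)"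

text \<open>
  The quotient by a two-sided ideal \<open>I\<close>. As \<open>A\<close> is unital, ideals of the ring \<open>A\<close> are
  automatically stable under scalars, so the scalar multiplication passes to cosets.
\<close>

definition quot_alg :: "'a calg \<Rightarrow> 'a set \<Rightarrow> 'a set calg" where
  "quot_alg A I =
    \<lparr>carrier = carrier (A Quot I), mult = mult (A Quot I), one = one (A Quot I),
     zero = zero (A Quot I), add = add (A Quot I),
     smult = (\<lambda>c X. \<Union>x\<in>X. I +>\<^bsub>A\<^esub> (c \<odot>\<^bsub>A\<^esub> x))\<rparr>"

text \<open>The monoid algebra: finitely supported formal combinations of elements of a monoid.\<close>

definition monoid_alg :: "('a, 'm) monoid_scheme \<Rightarrow> ('a \<Rightarrow>\<^sub>0 complex) calg" where
  "monoid_alg M =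
    \<lparr>carrier = {p. Poly_Mapping.keys p \<subseteq> carrier M},
     mult = (\<lambda>p r. \<Sum>x\<in>Poly_Mapping.keys p. \<Sum>y\<in>Poly_Mapping.keys r.
        Poly_Mapping.single (x \<otimes>\<^bsub>M\<^esub> y) (Poly_Mapping.lookup p x * Poly_Mapping.lookup r y)),
     one = Poly_Mapping.single \<one>\<^bsub>M\<^esub> 1,
     zero = 0, add = (+),
     smult = (\<lambda>c. Poly_Mapping.map ((*) c))\<rparr>"

definition word_monoid :: "'g list monoid" where
  "word_monoid = \<lparr>carrier = UNIV, mult = (@), one = []\<rparr>"

definition free_alg :: "('g list \<Rightarrow>\<^sub>0 complex) calg" where
  "free_alg = monoid_alg word_monoid"

definition free_gen :: "'g \<Rightarrow> 'g list \<Rightarrow>\<^sub>0 complex" where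
  "free_gen g = Poly_Mapping.single [g] 1"


section \<open>Tensor products of algebras\<close>

text \<open>
  The vector space underlying \<open>monoid_alg (A \<times>\<times> B)\<close> is the free vector space on the set
  \<open>carrier A \<times> carrier B\<close>, with product \<open>(x, y) (x', y') = (x x', y y')\<close> on basis elements.
  The linear span of the bilinearity relators is stable under multiplication by basis elements
  from either side, so it is the two-sided ideal they generate, and the quotient is the tensor
  product over the complex numbers with its usual multiplication.
\<close>

definition bilinear_relators :: "'a calg \<Rightarrow> 'b calg \<Rightarrow> ('a \<times> 'b \<Rightarrow>\<^sub>0 complex) set" where
  "bilinear_relators A B =
     (let e = (\<lambda>x y. Poly_Mapping.single (x, y) (1::complex)) in
       {e (x \<oplus>\<^bsub>A\<^esub> x') y - e x y - e x' y | x x' y.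
          x \<in> carrier A \<and> x' \<in> carrier A \<and> y \<in> carrier B} \<union>
       {e x (y \<oplus>\<^bsub>B\<^esub> y') - e x y - e x y' | x y y'.
          x \<in> carrier A \<and> y \<in> carrier B \<and> y' \<in> carrier B} \<union>
       {e (c \<odot>\<^bsub>A\<^esub> x) y - Poly_Mapping.single (x, y) c | c x y.
          x \<in> carrier A \<and> y \<in> carrier B} \<union>
       {e x (c \<odot>\<^bsub>B\<^esub> y) - Poly_Mapping.single (x, y) c | c x y.
          x \<in> carrier A \<and> y \<in> carrier B})"

definition tensor_ideal :: "'a calg \<Rightarrow> 'b calg \<Rightarrow> ('a \<times> 'b \<Rightarrow>\<^sub>0 complex) set" where
  "tensor_ideal A B = Idl\<^bsub>monoid_alg (A \<times>\<times> B)\<^esub> (bilinear_relators A B)"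

definition tensor_alg :: "'a calg \<Rightarrow> 'b calg \<Rightarrow> ('a \<times> 'b \<Rightarrow>\<^sub>0 complex) set calg" where
  "tensor_alg A B = quot_alg (monoid_alg (A \<times>\<times> B)) (tensor_ideal A B)"

definition pure_tensor :: "'a calg \<Rightarrow> 'b calg \<Rightarrow> 'a \<Rightarrow> 'b \<Rightarrow> ('a \<times> 'b \<Rightarrow>\<^sub>0 complex) set" where
  "pure_tensor A B x y =
     tensor_ideal A B +>\<^bsub>monoid_alg (A \<times>\<times> B)\<^esub> Poly_Mapping.single (x, y) 1"

text \<open>
  For linear maps \<open>f : A \<rightarrow> C\<close> and \<open>g : B \<rightarrow> D\<close>, the map \<open>f \<otimes> g : A \<otimes> B \<rightarrow> C \<otimes> D\<close>. An element of
  \<open>A \<otimes> B\<close> is a coset of formal combinations of pairs, and \<open>f \<otimes> g\<close> sends all its representatives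
  to the same element.
\<close>

definition tensor_map ::
  "'a calg \<Rightarrow> 'b calg \<Rightarrow> 'c calg \<Rightarrow> 'd calg \<Rightarrow> ('a \<Rightarrow> 'c) \<Rightarrow> ('b \<Rightarrow> 'd) \<Rightarrow>
   ('a \<times> 'b \<Rightarrow>\<^sub>0 complex) set \<Rightarrow> ('c \<times> 'd \<Rightarrow>\<^sub>0 complex) set" where
  "tensor_map A B C D f g X =
     the_elem ((\<lambda>p. \<Oplus>\<^bsub>tensor_alg C D\<^esub>k\<in>Poly_Mapping.keys p.
        Poly_Mapping.lookup p k \<odot>\<^bsub>tensor_alg C D\<^esub> pure_tensor C D (f (fst k)) (g (snd k))) ` X)"


section \<open>Formal Laurent series with coefficients in an algebra\<close>

text \<open>
  A series \<open>\<Sum>\<^sub>n f\<^sub>n z\<^sup>n\<close> is the function \<open>f :: int \<Rightarrow> 'a\<close>. Series in \<open>z\<close> have support bounded below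
  and series in \<open>z\<^sup>-\<^sup>1\<close> have support bounded above. The operations below are used for series of the
  same kind only, where all the sums over indices with non-zero terms are finite
  (HOL-Algebra's infinite sums would be zero by convention).
\<close>

type_synonym 'a lser = "int \<Rightarrow> 'a"

definition ls_mult :: "'a calg \<Rightarrow> 'a lser \<Rightarrow> 'a lser \<Rightarrow> 'a lser" where
  "ls_mult A f g = (\<lambda>n. \<Oplus>\<^bsub>A\<^esub>i\<in>{i. f i \<noteq> \<zero>\<^bsub>A\<^esub> \<and> g (n - i) \<noteq> \<zero>\<^bsub>A\<^esub>}. f i \<otimes>\<^bsub>A\<^esub> g (n - i))"

definition ls_one :: "'a calg \<Rightarrow> 'a lser" where
  "ls_one A = (\<lambda>n. if n = 0 then \<one>\<^bsub>A\<^esub> else \<zero>\<^bsub>A\<^esub>)"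

definition ls_power :: "'a calg \<Rightarrow> 'a lser \<Rightarrow> nat \<Rightarrow> 'a lser" where
  "ls_power A f k = (ls_mult A f ^^ k) (ls_one A)"

text \<open>The exponential of a series without constant term.\<close>

definition ls_exp :: "'a calg \<Rightarrow> 'a lser \<Rightarrow> 'a lser" where
  "ls_exp A f = (\<lambda>n. \<Oplus>\<^bsub>A\<^esub>k\<in>{k. ls_power A f k n \<noteq> \<zero>\<^bsub>A\<^esub>}. (1 / fact k) \<odot>\<^bsub>A\<^esub> ls_power A f k n)"

text \<open>
  \<open>f(z - 1)\<close> for a series \<open>f\<close> in \<open>z\<^sup>-\<^sup>1\<close>: each \<open>(z - 1)\<^sup>i\<close> is expanded in \<open>z\<^sup>-\<^sup>1\<close> as
  \<open>\<Sum>\<^sub>j (i gchoose j) (-1)\<^sup>j z\<^sup>i\<^sup>-\<^sup>j\<close>, also for negative \<open>i\<close>.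
\<close>

definition ls_shift :: "'a calg \<Rightarrow> 'a lser \<Rightarrow> 'a lser" where
  "ls_shift A f = (\<lambda>n. \<Oplus>\<^bsub>A\<^esub>i\<in>{i. n \<le> i \<and> f i \<noteq> \<zero>\<^bsub>A\<^esub>}.
     ((of_int i gchoose nat (i - n)) * (-1) ^ nat (i - n)) \<odot>\<^bsub>A\<^esub> f i)"

text \<open>\<open>f(c z)\<close>\<close>

definition ls_scale :: "'a calg \<Rightarrow> complex \<Rightarrow> 'a lser \<Rightarrow> 'a lser" where
  "ls_scale A c f = (\<lambda>n. (c powi n) \<odot>\<^bsub>A\<^esub> f n)"

definition pcoeff :: "complex poly \<Rightarrow> int \<Rightarrow> complex" where
  "pcoeff a n = (if n < 0 then 0 else coeff a (nat n))"


section \<open>Truncated Yangians\<close>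

datatype sign = Pos | Neg

primrec sg :: "sign \<Rightarrow> int" where
  "sg Pos = 1"
| "sg Neg = -1"

datatype Ygen = YX sign nat | YH nat

definition Y_relators :: "'a calg \<Rightarrow> (sign \<Rightarrow> nat \<Rightarrow> 'a) \<Rightarrow> (nat \<Rightarrow> 'a) \<Rightarrow> 'a set" where
  "Y_relators A x h =
     {commutator A (h r) (h s) | r s. True} \<union>
     {commutator A (h 0) (x e s) \<ominus>\<^bsub>A\<^esub> of_int (2 * sg e) \<odot>\<^bsub>A\<^esub> x e s | e s. True} \<union>
     {(commutator A (h (Suc r)) (x e s) \<ominus>\<^bsub>A\<^esub> commutator A (h r) (x e (Suc s))) \<ominus>\<^bsub>A\<^esub>
        of_int (sg e) \<odot>\<^bsub>A\<^esub> (h r \<otimes>\<^bsub>A\<^esub> x e s \<oplus>\<^bsub>A\<^esub> x e s \<otimes>\<^bsub>A\<^esub> h r) | e r s. True} \<union>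
     {commutator A (x Pos r) (x Neg s) \<ominus>\<^bsub>A\<^esub> h (r + s) | r s. True} \<union>
     {(commutator A (x e (Suc r)) (x e s) \<ominus>\<^bsub>A\<^esub> commutator A (x e r) (x e (Suc s))) \<ominus>\<^bsub>A\<^esub>
        of_int (sg e) \<odot>\<^bsub>A\<^esub> (x e r \<otimes>\<^bsub>A\<^esub> x e s \<oplus>\<^bsub>A\<^esub> x e s \<otimes>\<^bsub>A\<^esub> x e r) | e r s. True}"

type_synonym Yel = "(Ygen list \<Rightarrow>\<^sub>0 complex) set"

definition Y_ideal :: Yel where
  "Y_ideal = Idl\<^bsub>free_alg\<^esub>
     (Y_relators free_alg (\<lambda>e n. free_gen (YX e n)) (\<lambda>n. free_gen (YH n)))"

definition Y :: "Yel calg" where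
  "Y = quot_alg free_alg Y_ideal"

definition Yx :: "sign \<Rightarrow> nat \<Rightarrow> Yel" where
  "Yx e n = Y_ideal +>\<^bsub>free_alg\<^esub> free_gen (YX e n)"

definition Yh :: "nat \<Rightarrow> Yel" where
  "Yh n = Y_ideal +>\<^bsub>free_alg\<^esub> free_gen (YH n)"

text \<open>
  The coproduct is characterised as the algebra morphism with the prescribed values. There is at
  most one on \<open>carrier Y\<close>, because the listed elements generate \<open>Y\<close>: \<open>[x\<^sup>+\<^sub>1, x\<^sup>-\<^sub>0] = h\<^sub>1\<close>, and \<open>h\<^sub>0\<close>, \<open>h\<^sub>1\<close>
  produce all \<open>x\<^sup>\<plusminus>\<^sub>n\<close> from \<open>x\<^sup>\<plusminus>\<^sub>0\<close>. The same applies to \<open>U_coproduct\<close> below when \<open>q\<close> is not a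
  root of unity.
\<close>

definition Y_coproduct :: "(Yel \<Rightarrow> (Yel \<times> Yel \<Rightarrow>\<^sub>0 complex) set) \<Rightarrow> bool" where
  "Y_coproduct \<Delta> \<longleftrightarrow>
     (let T = tensor_alg Y Y; t = pure_tensor Y Y in
       \<Delta> \<in> alg_hom Y T \<and>
       (\<forall>e. \<Delta> (Yx e 0) = t (Yx e 0) \<one>\<^bsub>Y\<^esub> \<oplus>\<^bsub>T\<^esub> t \<one>\<^bsub>Y\<^esub> (Yx e 0)) \<and>
       \<Delta> (Yh 0) = t (Yh 0) \<one>\<^bsub>Y\<^esub> \<oplus>\<^bsub>T\<^esub> t \<one>\<^bsub>Y\<^esub> (Yh 0) \<and>
       \<Delta> (Yx Pos 1) = t (Yx Pos 1) \<one>\<^bsub>Y\<^esub> \<oplus>\<^bsub>T\<^esub> t \<one>\<^bsub>Y\<^esub> (Yx Pos 1) \<oplus>\<^bsub>T\<^esub> t (Yh 0) (Yx Pos 0))"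

definition Y_cartan :: "Yel set" where
  "Y_cartan = gen_subalgebra Y (range Yh)"

definition Yh_series :: "Yel lser" where
  "Yh_series = (\<lambda>n. if n > 0 then \<zero>\<^bsub>Y\<^esub> else if n = 0 then \<one>\<^bsub>Y\<^esub> else Yh (nat (- n - 1)))"

text \<open>
  \<open>A\<^sup>a(z)\<close> for a monic polynomial \<open>a\<close> of degree \<open>2m\<close>. The equation
  \<open>h(z) = a(z) / (A(z) A(z-1))\<close> is written with the denominator, an invertible series, cleared.
\<close>

definition Y_A :: "complex poly \<Rightarrow> Yel lser" where
  "Y_A a = (THE A. let m = int (degree a div 2) in
     range A \<subseteq> Y_cartan \<and> A m = \<one>\<^bsub>Y\<^esub> \<and> (\<forall>i>m. A i = \<zero>\<^bsub>Y\<^esub>) \<and>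
     ls_mult Y Yh_series (ls_mult Y A (ls_shift Y A)) = (\<lambda>n. pcoeff a n \<odot>\<^bsub>Y\<^esub> \<one>\<^bsub>Y\<^esub>))"

definition Y_trunc_ideal :: "complex poly \<Rightarrow> Yel set" where
  "Y_trunc_ideal a = Idl\<^bsub>Y\<^esub> {Y_A a i | i. i < 0}"

definition Y_trunc :: "complex poly \<Rightarrow> Yel set calg" where
  "Y_trunc a = quot_alg Y (Y_trunc_ideal a)"

definition Y_proj :: "complex poly \<Rightarrow> Yel \<Rightarrow> Yel set" where
  "Y_proj a y = Y_trunc_ideal a +>\<^bsub>Y\<^esub> y"


section \<open>Truncated quantum affine algebras\<close>

datatype Ugen = UX sign int | UPhi sign int

definition U_relators ::
  "complex \<Rightarrow> 'a calg \<Rightarrow> (sign \<Rightarrow> int \<Rightarrow> 'a) \<Rightarrow> (sign \<Rightarrow> int \<Rightarrow> 'a) \<Rightarrow> 'a set" where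
  "U_relators q A x \<phi> =
     {\<phi> Pos m | m. m < 0} \<union> {\<phi> Neg m | m. m > 0} \<union>
     {\<phi> Pos 0 \<otimes>\<^bsub>A\<^esub> \<phi> Neg 0 \<ominus>\<^bsub>A\<^esub> \<one>\<^bsub>A\<^esub>} \<union>
     {commutator A (\<phi> e m) (\<phi> d n) | e d m n. True} \<union>
     {commutator A (x Pos m) (x Neg n) \<ominus>\<^bsub>A\<^esub>
        (1 / (q - 1 / q)) \<odot>\<^bsub>A\<^esub> (\<phi> Pos (m + n) \<ominus>\<^bsub>A\<^esub> \<phi> Neg (m + n)) | m n. True} \<union>
     {(\<phi> d (m + 1) \<otimes>\<^bsub>A\<^esub> x e n \<ominus>\<^bsub>A\<^esub> (q powi (2 * sg e)) \<odot>\<^bsub>A\<^esub> (\<phi> d m \<otimes>\<^bsub>A\<^esub> x e (n + 1))) \<ominus>\<^bsub>A\<^esub>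
      ((q powi (2 * sg e)) \<odot>\<^bsub>A\<^esub> (x e n \<otimes>\<^bsub>A\<^esub> \<phi> d (m + 1)) \<ominus>\<^bsub>A\<^esub> x e (n + 1) \<otimes>\<^bsub>A\<^esub> \<phi> d m)
      | d e m n. True} \<union>
     {(x e (m + 1) \<otimes>\<^bsub>A\<^esub> x e n \<ominus>\<^bsub>A\<^esub> (q powi (2 * sg e)) \<odot>\<^bsub>A\<^esub> (x e m \<otimes>\<^bsub>A\<^esub> x e (n + 1))) \<ominus>\<^bsub>A\<^esub>
      ((q powi (2 * sg e)) \<odot>\<^bsub>A\<^esub> (x e n \<otimes>\<^bsub>A\<^esub> x e (m + 1)) \<ominus>\<^bsub>A\<^esub> x e (n + 1) \<otimes>\<^bsub>A\<^esub> x e m)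
      | e m n. True}"

type_synonym Uel = "(Ugen list \<Rightarrow>\<^sub>0 complex) set"

definition U_ideal :: "complex \<Rightarrow> Uel" where
  "U_ideal q = Idl\<^bsub>free_alg\<^esub>
     (U_relators q free_alg (\<lambda>e n. free_gen (UX e n)) (\<lambda>e n. free_gen (UPhi e n)))"

definition U :: "complex \<Rightarrow> Uel calg" where
  "U q = quot_alg free_alg (U_ideal q)"

definition Ux :: "complex \<Rightarrow> sign \<Rightarrow> int \<Rightarrow> Uel" where
  "Ux q e n = U_ideal q +>\<^bsub>free_alg\<^esub> free_gen (UX e n)"

text \<open>The map \<open>n \<mapsto> \<phi>\<^sup>e\<^sub>n\<close>, that is, the series \<open>\<phi>\<^sup>e(z)\<close>.\<close>

definition Uphi :: "complex \<Rightarrow> sign \<Rightarrow> Uel lser" where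
  "Uphi q e n = U_ideal q +>\<^bsub>free_alg\<^esub> free_gen (UPhi e n)"

text \<open>
  The elements \<open>h\<^sub>s\<close>, \<open>s \<noteq> 0\<close>; the value at \<open>0\<close>, which is not part of the definition, is
  set to zero to make the family unique.
\<close>

definition Uh :: "complex \<Rightarrow> int \<Rightarrow> Uel" where
  "Uh q = (THE h. range h \<subseteq> carrier (U q) \<and> h 0 = \<zero>\<^bsub>U q\<^esub> \<and>
     (\<forall>e. Uphi q e = (\<lambda>n. Uphi q e 0 \<otimes>\<^bsub>U q\<^esub>
        ls_exp (U q) (\<lambda>s. if sg e * s > 0
          then (of_int (sg e) * (q - 1 / q)) \<odot>\<^bsub>U q\<^esub> h s else \<zero>\<^bsub>U q\<^esub>) n)))"

definition U_coproduct :: "complex \<Rightarrow> (Uel \<Rightarrow> (Uel \<times> Uel \<Rightarrow>\<^sub>0 complex) set) \<Rightarrow> bool" where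
  "U_coproduct q \<Delta> \<longleftrightarrow>
     (let T = tensor_alg (U q) (U q); t = pure_tensor (U q) (U q); i = \<one>\<^bsub>U q\<^esub>;
          x = Ux q; \<phi> = Uphi q; h = Uh q; c = q powi 2 - q powi (-2) in
       \<Delta> \<in> alg_hom (U q) T \<and>
       \<Delta> (x Pos 0) = t (x Pos 0) i \<oplus>\<^bsub>T\<^esub> t (\<phi> Pos 0) (x Pos 0) \<and>
       \<Delta> (x Neg 0) = t i (x Neg 0) \<oplus>\<^bsub>T\<^esub> t (x Neg 0) (\<phi> Neg 0) \<and>
       (\<forall>e. \<Delta> (\<phi> e 0) = t (\<phi> e 0) (\<phi> e 0)) \<and>
       \<Delta> (h (-1)) = t i (h (-1)) \<oplus>\<^bsub>T\<^esub> t (h (-1)) i \<oplus>\<^bsub>T\<^esub> c \<odot>\<^bsub>T\<^esub> t (x Neg 0) (x Pos (-1)) \<and>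
       \<Delta> (h 1) = t i (h 1) \<oplus>\<^bsub>T\<^esub> t (h 1) i \<ominus>\<^bsub>T\<^esub> c \<odot>\<^bsub>T\<^esub> t (x Neg 1) (x Pos 0))"

definition U_cartan :: "complex \<Rightarrow> Uel set" where
  "U_cartan q = gen_subalgebra (U q) {Uphi q e m | e m. True}"

text \<open>
  \<open>\<A>\<^sup>a\<^sup>+(z)\<close> and \<open>\<A>\<^sup>a\<^sup>-(z)\<close>, again with the invertible denominators cleared. In the second
  definition, \<open>pcoeff a (k + int (degree a))\<close> is the coefficient of \<open>z\<^sup>k\<close> in \<open>a(z) z\<^sup>-\<^sup>2\<^sup>n\<close>.
\<close>

definition U_A_pos :: "complex \<Rightarrow> complex poly \<Rightarrow> Uel lser" where
  "U_A_pos q a = (THE A. range A \<subseteq> U_cartan q \<and> A 0 = \<one>\<^bsub>U q\<^esub> \<and> (\<forall>k<0. A k = \<zero>\<^bsub>U q\<^esub>) \<and>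
     ls_mult (U q) (Uphi q Pos) (ls_mult (U q) A (ls_scale (U q) (q\<^sup>2) A)) =
       (\<lambda>k. (pcoeff a k / coeff a 0) \<odot>\<^bsub>U q\<^esub> Uphi q Pos 0))"

definition U_A_neg :: "complex \<Rightarrow> complex poly \<Rightarrow> Uel lser" where
  "U_A_neg q a = (THE A. range A \<subseteq> U_cartan q \<and> A 0 = \<one>\<^bsub>U q\<^esub> \<and> (\<forall>k>0. A k = \<zero>\<^bsub>U q\<^esub>) \<and>
     ls_mult (U q) (Uphi q Neg) (ls_mult (U q) A (ls_scale (U q) (q\<^sup>2) A)) =
       (\<lambda>k. (pcoeff a (k + int (degree a)) / lead_coeff a) \<odot>\<^bsub>U q\<^esub> Uphi q Neg 0))"

definition U_trunc_ideal :: "complex \<Rightarrow> complex poly \<Rightarrow> Uel set" where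
  "U_trunc_ideal q a =
     (let n = int (degree a div 2); A\<^sub>p = U_A_pos q a; A\<^sub>n = U_A_neg q a in
       Idl\<^bsub>U q\<^esub>
         ({A\<^sub>p k | k. k > n} \<union>
          {A\<^sub>n k \<ominus>\<^bsub>U q\<^esub> A\<^sub>n (- n) \<otimes>\<^bsub>U q\<^esub> A\<^sub>p (k + n) | k. True} \<union>
          {lead_coeff a \<odot>\<^bsub>U q\<^esub> (Uphi q Pos 0 \<otimes>\<^bsub>U q\<^esub> Uphi q Pos 0) \<ominus>\<^bsub>U q\<^esub>
             (coeff a 0 * q powi (2 * n)) \<odot>\<^bsub>U q\<^esub> (A\<^sub>p n \<otimes>\<^bsub>U q\<^esub> A\<^sub>p n)}))"

definition U_trunc :: "complex \<Rightarrow> complex poly \<Rightarrow> Uel set calg" where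
  "U_trunc q a = quot_alg (U q) (U_trunc_ideal q a)"

definition U_proj :: "complex \<Rightarrow> complex poly \<Rightarrow> Uel \<Rightarrow> Uel set" where
  "U_proj q a u = U_trunc_ideal q a +>\<^bsub>U q\<^esub> u"

end

theory Submission
  imports Defs "HOL-Computational_Algebra.Formal_Laurent_Series"
begin

text \<open>
  With \<open>E = [x\<^sup>+\<^sub>0, A]\<close> and \<open>F = [A, x\<^sup>-\<^sub>0]\<close> (suitably \<open>q\<close>-deformed in the quantum affine case), the series
  \<open>A\<close> is an entry of a matrix with rows \<open>(A, F)\<close>, \<open>(E, D)\<close> whose quantum determinant is
  \<open>A(z) h(z) A(z - 1) = a(z)\<close>. The key identity is \<open>\<Delta>(A\<^sup>a\<^sup>b) = A\<^sup>a \<otimes> A\<^sup>b + F\<^sup>a \<otimes> E\<^sup>b\<close>. The right-hand side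
  satisfies the defining equation of the left-hand side, because its relations with \<open>\<Delta>(x\<^sup>\<plusminus>\<^sub>0)\<close> and with
  the coproduct of the Cartan element that shifts the indices of \<open>x\<^sup>\<plusminus>\<^sub>n\<close> are those of \<open>A\<close> and because
  quantum determinants multiply; and the equation has only one solution with the given leading
  term. If \<open>A\<^sup>a\<close> and \<open>A\<^sup>b\<close> are polynomials, then so are \<open>F\<^sup>a\<close>, \<open>E\<^sup>b\<close> and therefore the right-hand side.
  In the quantum affine case the same identity, transported along \<open>z \<mapsto> 1/z\<close>, gives \<open>\<Delta>(\<A>\<^sup>-)\<close>, and the
  relations between \<open>\<A>\<^sup>+\<close> and \<open>\<A>\<^sup>-\<close> are inherited because \<open>\<A>\<^sup>-\<^sub>-\<^sub>n\<close> \<open>q\<close>-commutes with \<open>x\<^sup>\<plusminus>\<^sub>0\<close>.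
\<close>

text \<open>The coproduct is given on a few generators only, and a coefficient of A is a complicated
  polynomial in the Cartan elements, so its image has to be recognised through the equation A(z)
  h(z) A(z-1) = a(z). Testing the candidate there seems to require Delta(h(z)). But h(z) = 1 +
  [x^+(z), x^-_0], and the linear relations between A and the x^+_n, taken at coinciding arguments,
  turn A(z) x^+(z) and x^+(z) A(z-1) into E(z) and E(z-1). For A itself these linear relations come
  from those of A(z) A(z-1), a multiple of 1/h(z), by a square-root argument: the lowest coefficient
  of the defect is killed by 1 + 1, or by 1 + q^(2n) in the quantum affine case, and both are
  non-zero when q is not a root of unity. For the candidate, the relation of index 0 is computed and
  then carried to all other indices. The order of the factors in A(z) h(z) A(z-1) is kept
  throughout: until the candidate is identified, its coefficients are not known to commute with each
  other or with Delta(h_n).\<close>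

unbundle fps_syntax

section \<open>Laurent series over complex algebras\<close>

text \<open>
  Algebras of this class need not be unital. A unital algebra \<open>B\<close> is studied inside such an algebra
  through an embedding that sends the unit of \<open>B\<close> to an idempotent \<open>u\<close> with \<open>unit_on u x\<close> for all \<open>x\<close>
  in the image.
\<close>

class calgebra = ring +
  fixes sc :: "complex \<Rightarrow> 'a \<Rightarrow> 'a"
  assumes sc_add_right: "sc c (x + y) = sc c x + sc c y"
    and sc_add_left: "sc (c + d) x = sc c x + sc d x"
    and sc_sc: "sc c (sc d x) = sc (c * d) x"
    and sc_one: "sc 1 x = x"
    and sc_mult_left: "sc c x * y = sc c (x * y)"
    and sc_mult_right: "x * sc c y = sc c (x * y)"
begin

lemma sc_zero_right [simp]: "sc c 0 = 0"
  using sc_add_right[of c 0 0] by simp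

lemma sc_zero_left [simp]: "sc 0 x = 0"
  using sc_add_left[of 0 0 x] by simp

lemma sc_minus_right: "sc c (- x) = - sc c x"
  using sc_add_right[of c x "- x"] by (simp add: eq_neg_iff_add_eq_0 add.commute)

lemma sc_minus_left: "sc (- c) x = - sc c x"
  using sc_add_left[of c "- c" x] by (simp add: eq_neg_iff_add_eq_0 add.commute)

lemma sc_diff_right: "sc c (x - y) = sc c x - sc c y"
  using sc_add_right[of c x "- y"] by (simp add: sc_minus_right)

lemma sc_diff_left: "sc (c - d) x = sc c x - sc d x"
  using sc_add_left[of c "- d" x] by (simp add: sc_minus_left)

lemma sc_sum_right: "sc c (sum f S) = (\<Sum>i\<in>S. sc c (f i))"
  by (induction S rule: infinite_finite_induct) (simp_all add: sc_add_right)

lemma sc_sum_left: "sc (sum f S) x = (\<Sum>i\<in>S. sc (f i) x)"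
  by (induction S rule: infinite_finite_induct) (simp_all add: sc_add_left)

lemma sc_eq_0_iff: "c \<noteq> 0 \<Longrightarrow> sc c x = 0 \<longleftrightarrow> x = 0"
  by (metis sc_sc sc_one sc_zero_right field_class.field_inverse)

lemma sc_cancel: "c \<noteq> 0 \<Longrightarrow> sc c x = sc c y \<longleftrightarrow> x = y"
  by (metis sc_sc sc_one field_class.field_inverse)

lemma sc_half_double: "sc (1/2) (x + x) = x"
  using sc_add_left[of "1/2" "1/2" x] by (simp add: sc_add_right sc_one)

lemma double_eq_0_iff: "x + x = 0 \<longleftrightarrow> x = 0"
  using sc_eq_0_iff[of 2 x] sc_add_left[of 1 1 x] by (simp add: sc_one)

end

section \<open>Order and leading coefficients of Laurent series\<close>

definition ord_ge :: "int \<Rightarrow> 'a::zero fls \<Rightarrow> bool" where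
  "ord_ge a f \<longleftrightarrow> (\<forall>i<a. f $$ i = 0)"

lemma ord_geD: "ord_ge a f \<Longrightarrow> i < a \<Longrightarrow> f $$ i = 0"
  by (simp add: ord_ge_def)

lemma ord_ge_mono: "ord_ge a f \<Longrightarrow> b \<le> a \<Longrightarrow> ord_ge b f"
  by (auto simp: ord_ge_def)

lemma ord_ge_subdegree: "ord_ge (fls_subdegree f) f"
  by (simp add: ord_ge_def)

lemma ord_ge_exists: obtains a where "ord_ge a f"
  using ord_ge_subdegree by blast

lemma ord_ge_add: "ord_ge a f \<Longrightarrow> ord_ge a g \<Longrightarrow> ord_ge a (f + g)" for f :: "'a::monoid_add fls"
  by (simp add: ord_ge_def)

lemma ord_ge_diff: "ord_ge a f \<Longrightarrow> ord_ge a g \<Longrightarrow> ord_ge a (f - g)" for f :: "'a::group_add fls"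
  by (simp add: ord_ge_def)

lemma ord_ge_shift: "ord_ge a f \<Longrightarrow> ord_ge (a - k) (fls_shift k f)"
  by (simp add: ord_ge_def)

lemma ord_ge_const: "a \<le> 0 \<Longrightarrow> ord_ge a (fls_const x)"
  by (simp add: ord_ge_def)

text \<open>The filtration by order is separated. Most vanishing proofs below raise the order of a
  series step by step and end here.\<close>

lemma ord_ge_eq_0: "(\<And>n. ord_ge (a + int n) f) \<Longrightarrow> f = 0"
proof (rule fls_eqI)
  fix i assume "\<And>n. ord_ge (a + int n) f"
  from this[of "nat (i - a + 1)"] show "f $$ i = 0 $$ i"
    by (auto simp: ord_ge_def)
qed

lemma fls_nth_Abs_bounded:
  "(\<And>n. n < N \<Longrightarrow> f n = 0) \<Longrightarrow> Abs_fls f $$ n = f n"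
  by (rule nth_Abs_fls_lower_bound[of N]) simp

text \<open>Any finite set containing the relevant interval may serve as index set, so several
  convolutions can be brought to a common one before their sums are rearranged.\<close>

lemma fls_times_nth_superset:
  fixes f g :: "'a::semiring_0 fls"
  assumes "ord_ge a f" "ord_ge b g" "finite S" "{a..n - b} \<subseteq> S"
  shows "(f * g) $$ n = (\<Sum>i\<in>S. f $$ i * g $$ (n - i))"
proof -
  let ?T = "{fls_subdegree f..n - fls_subdegree g}"
  have "(f * g) $$ n = (\<Sum>i\<in>?T. f $$ i * g $$ (n - i))"
    by (rule fls_times_nth(2))
  also have "\<dots> = (\<Sum>i\<in>S \<union> ?T. f $$ i * g $$ (n - i))"
    by (rule sum.mono_neutral_left) (use assms in auto)
  also have "\<dots> = (\<Sum>i\<in>S. f $$ i * g $$ (n - i))"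
  proof (rule sum.mono_neutral_right)
    show "\<forall>i\<in>S \<union> ?T - S. f $$ i * g $$ (n - i) = 0"
    proof
      fix i assume i: "i \<in> S \<union> ?T - S"
      then have "i \<notin> {a..n - b}"
        using assms(4) by blast
      then have "i < a \<or> n - i < b"
        by auto
      then show "f $$ i * g $$ (n - i) = 0"
        using assms(1,2) by (auto simp: ord_ge_def)
    qed
  qed (use assms in auto)
  finally show ?thesis .
qed

lemma ord_ge_mult:
  fixes f g :: "'a::semiring_0 fls"
  assumes "ord_ge a f" "ord_ge b g"
  shows "ord_ge (a + b) (f * g)"
  unfolding ord_ge_def
  using fls_times_nth_superset[OF assms, of "{}"] by auto

lemma fls_times_nth_lead:
  fixes f g :: "'a::semiring_0 fls"
  assumes "ord_ge a f" "ord_ge b g"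
  shows "(f * g) $$ (a + b) = f $$ a * g $$ b"
  using fls_times_nth_superset[OF assms, of "{a}" "a + b"] by auto

lemma fls_const_times_nth: "(fls_const x * f) $$ n = x * f $$ n" for f :: "'a::semiring_0 fls"
proof -
  obtain b where "ord_ge b f" by (rule ord_ge_exists)
  from fls_times_nth_superset[OF ord_ge_const[of 0 x] this, of "{0..max 0 (n - b)}" n]
  have "(fls_const x * f) $$ n = (\<Sum>i\<in>{0..max 0 (n - b)}. if i = 0 then x * f $$ n else 0)"
    by (auto intro!: sum.cong)
  then show ?thesis by simp
qed

lemma fls_times_const_nth: "(f * fls_const x) $$ n = f $$ n * x" for f :: "'a::semiring_0 fls"
proof -
  obtain b where b: "ord_ge b f" by (rule ord_ge_exists)
  from fls_times_nth_superset[OF b ord_ge_const[of 0 x], of "{min n b..n}" n]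
  have "(f * fls_const x) $$ n = (\<Sum>i\<in>{min n b..n}. if i = n then f $$ n * x else 0)"
    by (auto intro!: sum.cong)
  then show ?thesis by simp
qed

text \<open>\<open>V\<^sub>N\<close> is divisible by every power of the series variable.\<close>

lemma shift_descent:
  fixes V :: "nat \<Rightarrow> 'a::ring fls"
  assumes step: "\<And>N. fls_shift 1 (V N) = V (Suc N)" and ord: "\<And>N. ord_ge b (V N)"
  shows "V N = 0"
proof (rule ord_ge_eq_0)
  fix n
  \<comment> \<open>So \<open>V N\<close> is the n-th power of the variable times
    \<open>V (N + n)\<close>; the lower bound \<open>b\<close> does not depend on the index, hence
    the order of \<open>V N\<close> exceeds every bound.\<close>
  have "fls_shift (int n) (V N) = V (N + n)" for N
  proof (induction n)
    case (Suc n)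
    have "fls_shift (int (Suc n)) (V N) = fls_shift 1 (fls_shift (int n) (V N))"
      by (rule fls_eqI) (simp add: add.assoc add.commute)
    then show ?case by (simp only: Suc step) simp
  qed simp
  then have "V (N + n) $$ (i - int n) = V N $$ i" for i
    by (metis diff_add_cancel fls_shift_nth)
  then have "V N = fls_shift (- int n) (V (N + n))"
    by (intro fls_eqI) simp
  moreover have "ord_ge (b - - int n) (fls_shift (- int n) (V (N + n)))"
    by (rule ord_ge_shift[OF ord])
  ultimately show "ord_ge (b + int n) (V N)"
    by simp
qed

text \<open>The ring need not have a unit, so the inverse \<open>g0'\<close> of the leading
  coefficient is only asked to invert it on the coefficients of \<open>f\<close>.\<close>

lemma fls_left_cancel:
  fixes g f :: "'a::ring fls"
  assumes "ord_ge a g" "\<And>n. g0' * (g $$ a * f $$ n) = f $$ n" "g * f = 0"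
  shows "f = 0"
proof -
  obtain b where b: "ord_ge b f" by (rule ord_ge_exists)
  have "ord_ge (b + int n) f" for n
  proof (induction n)
    case (Suc n)
    then have "g $$ a * f $$ (b + int n) = 0"
      using fls_times_nth_lead[OF assms(1), of "b + int n" f] assms(3) by simp
    then have "f $$ (b + int n) = 0"
      using assms(2)[of "b + int n"] by simp
    show ?case
      unfolding ord_ge_def
    proof (intro allI impI)
      fix i assume "i < b + int (Suc n)"
      then have "i < b + int n \<or> i = b + int n" by auto
      then show "f $$ i = 0"
        using Suc \<open>f $$ (b + int n) = 0\<close> by (auto simp: ord_ge_def)
    qed
  qed (simp add: b)
  then show ?thesis by (rule ord_ge_eq_0)
qed

instantiation fls :: (calgebra) calgebra
begin

definition sc_fls_def: "sc c f = Abs_fls (\<lambda>n. sc c (f $$ n))"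

lemma fls_nth_sc [simp]: "sc c f $$ n = sc c (f $$ n)" for f :: "'a fls"
  unfolding sc_fls_def by (rule fls_nth_Abs_bounded[of "fls_subdegree f"]) simp

lemma ord_ge_sc: "ord_ge a f \<Longrightarrow> ord_ge a (sc c f)" for f :: "'a fls"
  by (simp add: ord_ge_def)

instance
proof
  fix c d :: complex and f g :: "'a fls"
  show "sc c (f + g) = sc c f + sc c g" "sc (c + d) f = sc c f + sc d f"
    "sc c (sc d f) = sc (c * d) f" "sc 1 f = f"
    by (auto intro!: fls_eqI simp: sc_add_right sc_add_left sc_sc sc_one)
  obtain a where a: "ord_ge a f" by (rule ord_ge_exists)
  obtain b where b: "ord_ge b g" by (rule ord_ge_exists)
  have "(sc c f * g) $$ n = sc c (f * g) $$ n" for n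
    by (simp add: fls_times_nth_superset[OF a b, of "{a..n - b}" n]
        fls_times_nth_superset[OF ord_ge_sc[OF a] b, of "{a..n - b}" n] sc_sum_right sc_mult_left)
  then show "sc c f * g = sc c (f * g)"
    by (intro fls_eqI)
  have "(f * sc c g) $$ n = sc c (f * g) $$ n" for n
    by (simp add: fls_times_nth_superset[OF a b, of "{a..n - b}" n]
        fls_times_nth_superset[OF a ord_ge_sc[OF b], of "{a..n - b}" n] sc_sum_right sc_mult_right)
  then show "f * sc c g = sc c (f * g)"
    by (intro fls_eqI)
qed

end

lemma fls_shift_sc: "fls_shift k (sc c f) = sc c (fls_shift k f)"
  by (rule fls_eqI) simp

lemma fls_const_sc: "fls_const (sc c x) = sc c (fls_const x)"
  by (rule fls_eqI) simp

lemma fls_const_diff: "fls_const (x - y) = fls_const x - fls_const y" for x :: "'a::group_add"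
  by (rule fls_eqI) simp

section \<open>Homomorphisms and substitutions acting on Laurent series\<close>

definition fls_map :: "('a \<Rightarrow> 'b) \<Rightarrow> 'a::zero fls \<Rightarrow> 'b::zero fls" where
  "fls_map J f = Abs_fls (\<lambda>n. J (f $$ n))"

locale calg_morph =
  fixes J :: "'a::calgebra \<Rightarrow> 'b::calgebra"
  assumes add: "J (x + y) = J x + J y" and mult: "J (x * y) = J x * J y"
    and sc: "J (sc c x) = sc c (J x)"
begin

lemma zero: "J 0 = 0"
  using add[of 0 0] by simp

lemma minus: "J (- x) = - J x"
  using add[of x "- x"] by (simp add: zero eq_neg_iff_add_eq_0 add.commute)

lemma diff: "J (x - y) = J x - J y"
  using add[of x "- y"] by (simp add: minus)

lemma sum: "J (sum f S) = (\<Sum>i\<in>S. J (f i))"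
  by (induction S rule: infinite_finite_induct) (simp_all add: add zero)

lemma fls_map_nth [simp]: "fls_map J f $$ n = J (f $$ n)"
proof -
  have "J (f $$ i) = 0" if "i < fls_subdegree f" for i
    using that zero by simp
  then show ?thesis
    unfolding fls_map_def by (rule fls_nth_Abs_bounded)
qed

lemma fls_map_ord_ge: "ord_ge a f \<Longrightarrow> ord_ge a (fls_map J f)"
  by (simp add: ord_ge_def zero)

lemma fls_map_shift: "fls_map J (fls_shift k f) = fls_shift k (fls_map J f)"
  by (rule fls_eqI) simp

lemma fls_map_const: "fls_map J (fls_const x) = fls_const (J x)"
  by (rule fls_eqI) (simp add: zero)

lemma fls_map_morph: "calg_morph (fls_map J)"
proof
  fix f g :: "'a fls" and c
  show "fls_map J (f + g) = fls_map J f + fls_map J g" "fls_map J (sc c f) = sc c (fls_map J f)"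
    by (auto intro!: fls_eqI simp: add sc)
  obtain a where a: "ord_ge a f" by (rule ord_ge_exists)
  obtain b where b: "ord_ge b g" by (rule ord_ge_exists)
  have "fls_map J (f * g) $$ n = (fls_map J f * fls_map J g) $$ n" for n
    by (simp add: fls_times_nth_superset[OF a b, of "{a..n - b}" n] sum mult
        fls_times_nth_superset[OF fls_map_ord_ge[OF a] fls_map_ord_ge[OF b], of "{a..n - b}" n])
  then show "fls_map J (f * g) = fls_map J f * fls_map J g"
    by (intro fls_eqI)
qed

end

text \<open>The series variable is central and shared by both images, so commuting coefficients
  suffice. This is applied to the two tensor factors.\<close>

lemma fls_map_commute:
  assumes J1: "calg_morph J1" and J2: "calg_morph J2" and comm: "\<And>x y. J2 y * J1 x = J1 x * J2 y"
  shows "fls_map J2 y * fls_map J1 x = fls_map J1 x * fls_map J2 y"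
proof (rule fls_eqI)
  fix n
  interpret J1: calg_morph J1 by fact
  interpret J2: calg_morph J2 by fact
  obtain a where a: "ord_ge a x" by (rule ord_ge_exists)
  obtain b where b: "ord_ge b y" by (rule ord_ge_exists)
  have "(fls_map J2 y * fls_map J1 x) $$ n = (\<Sum>i\<in>{b..n-a}. J2 (y $$ i) * J1 (x $$ (n - i)))"
    by (simp add: fls_times_nth_superset[OF J2.fls_map_ord_ge[OF b] J1.fls_map_ord_ge[OF a], of "{b..n-a}" n])
  also have "\<dots> = (\<Sum>i\<in>{a..n-b}. J1 (x $$ i) * J2 (y $$ (n - i)))"
    by (rule sum.reindex_bij_witness[of _ "\<lambda>i. n - i" "\<lambda>i. n - i"]) (auto simp: comm)
  also have "\<dots> = (fls_map J1 x * fls_map J2 y) $$ n"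
    by (simp add: fls_times_nth_superset[OF J1.fls_map_ord_ge[OF a] J2.fls_map_ord_ge[OF b], of "{a..n-b}" n])
  finally show "(fls_map J2 y * fls_map J1 x) $$ n = (fls_map J1 x * fls_map J2 y) $$ n" .
qed

text \<open>
  Substitutions such as \<open>z \<mapsto> z - 1\<close> and \<open>z \<mapsto> c z\<close> act on series by a triangular matrix \<open>t\<close>:
  the image of the \<open>i\<close>-th power of the variable is \<open>\<Sum>\<^sub>n t n i w\<^sup>n\<close>.
\<close>

definition fls_tri :: "(int \<Rightarrow> int \<Rightarrow> complex) \<Rightarrow> 'a::calgebra fls \<Rightarrow> 'a fls" where
  "fls_tri t f = Abs_fls (\<lambda>n. \<Sum>i\<in>{fls_subdegree f..n}. sc (t n i) (f $$ i))"

locale triangular =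
  fixes t :: "int \<Rightarrow> int \<Rightarrow> complex"
  assumes tri: "n < i \<Longrightarrow> t n i = 0"
begin

lemma nth: 
  assumes "ord_ge a f" "finite S" "{a..n} \<subseteq> S"
  shows "fls_tri t f $$ n = (\<Sum>i\<in>S. sc (t n i) (f $$ i))"
proof -
  let ?T = "{fls_subdegree f..n}"
  have "fls_tri t f $$ n = (\<Sum>i\<in>?T. sc (t n i) (f $$ i))"
    unfolding fls_tri_def by (rule fls_nth_Abs_bounded[of "fls_subdegree f"]) simp
  also have "\<dots> = (\<Sum>i\<in>S \<union> ?T. sc (t n i) (f $$ i))"
    by (rule sum.mono_neutral_left) (use assms in \<open>auto simp: tri\<close>)
  also have "\<dots> = (\<Sum>i\<in>S. sc (t n i) (f $$ i))"
  proof (rule sum.mono_neutral_right)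
    show "\<forall>i\<in>S \<union> ?T - S. sc (t n i) (f $$ i) = 0"
    proof
      fix i assume "i \<in> S \<union> ?T - S"
      then have "i \<notin> {a..n}"
        using assms(3) by blast
      then have "i < a \<or> n < i"
        by auto
      then show "sc (t n i) (f $$ i) = 0"
        using assms(1) by (auto simp: ord_ge_def tri)
    qed
  qed (use assms in auto)
  finally show ?thesis .
qed

lemma ord: "ord_ge a f \<Longrightarrow> ord_ge a (fls_tri t f)"
  unfolding ord_ge_def[of _ "fls_tri t f"] using nth[of a f "{}"] by auto

lemma lead: "ord_ge a f \<Longrightarrow> fls_tri t f $$ a = sc (t a a) (f $$ a)"
  using nth[of a f "{a}" a] by simp

lemma add: "fls_tri t (f + g) = fls_tri t f + fls_tri t g"
proof (rule fls_eqI)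
  fix n
  obtain a where a: "ord_ge a f" by (rule ord_ge_exists)
  obtain b where b: "ord_ge b g" by (rule ord_ge_exists)
  have "ord_ge (min a b) f" "ord_ge (min a b) g"
    using a b by (auto intro: ord_ge_mono)
  then show "fls_tri t (f + g) $$ n = (fls_tri t f + fls_tri t g) $$ n"
    by (simp add: nth[of "min a b" _ "{min a b..n}"] ord_ge_add sc_add_right sum.distrib)
qed

lemma scale: "fls_tri t (sc c f) = sc c (fls_tri t f)"
proof (rule fls_eqI)
  fix n
  obtain a where a: "ord_ge a f" by (rule ord_ge_exists)
  show "fls_tri t (sc c f) $$ n = (sc c (fls_tri t f)) $$ n"
    by (simp add: nth[OF a, of "{a..n}"] nth[OF ord_ge_sc[OF a], of "{a..n}"] sc_sum_right sc_sc
        mult.commute)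
qed

lemma zero: "fls_tri t 0 = 0"
  using add[of 0 0] by simp

lemma minus: "fls_tri t (- f) = - fls_tri t f"
  using add[of f "- f"] by (simp add: zero eq_neg_iff_add_eq_0 add.commute)

lemma diff: "fls_tri t (f - g) = fls_tri t f - fls_tri t g"
  using add[of f "- g"] by (simp add: minus)

lemma const_mult: "fls_tri t (fls_const x * f) = fls_const x * fls_tri t f"
proof (rule fls_eqI)
  fix n
  obtain a where a: "ord_ge a f" by (rule ord_ge_exists)
  have "ord_ge a (fls_const x * f)"
    using ord_ge_mult[OF ord_ge_const[of 0 x] a] by simp
  then show "fls_tri t (fls_const x * f) $$ n = (fls_const x * fls_tri t f) $$ n"
    by (simp add: fls_const_times_nth nth[OF a, of "{a..n}"] nth[of a _ "{a..n}"]
        sum_distrib_left sc_mult_right)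
qed

lemma mult_const: "fls_tri t (f * fls_const x) = fls_tri t f * fls_const x"
proof (rule fls_eqI)
  fix n
  obtain a where a: "ord_ge a f" by (rule ord_ge_exists)
  have "ord_ge a (f * fls_const x)"
    using ord_ge_mult[OF a ord_ge_const[of 0 x]] by simp
  then show "fls_tri t (f * fls_const x) $$ n = (fls_tri t f * fls_const x) $$ n"
    by (simp add: fls_times_const_nth nth[OF a, of "{a..n}"] nth[of a _ "{a..n}"]
        sum_distrib_right sc_mult_left)
qed

lemma fls_map:
  assumes "calg_morph J"
  shows "fls_map J (fls_tri t f) = fls_tri t (fls_map J f)"
proof (rule fls_eqI)
  fix n
  interpret J: calg_morph J by fact
  obtain a where a: "ord_ge a f" by (rule ord_ge_exists)
  show "fls_map J (fls_tri t f) $$ n = fls_tri t (fls_map J f) $$ n"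
    by (simp add: nth[OF a, of "{a..n}"] nth[OF J.fls_map_ord_ge[OF a], of "{a..n}"] J.sum J.sc)
qed

end

text \<open>The condition says that the image of w^(i+j) is the product of the images of w^i and
  w^j. For z -> z - 1 it is the Vandermonde convolution.\<close>

locale triangular_mult = triangular +
  assumes vandermonde: "t n (i + j) = (\<Sum>a\<in>{i..n - j}. t a i * t (n - a) j)"
begin

lemma mult: "fls_tri t (f * g) = fls_tri t f * fls_tri t g"
proof (rule fls_eqI)
  fix n
  obtain a where a: "ord_ge a f" by (rule ord_ge_exists)
  obtain b where b: "ord_ge b g" by (rule ord_ge_exists)
  \<comment> \<open>A bound for all indices that occur; every sum is extended by zeros to the single
    interval \<open>?B\<close>, over which sums can be interchanged.\<close>
  define N where "N = \<bar>a\<bar> + \<bar>b\<bar> + \<bar>n\<bar>"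
  let ?B = "{-4*N..4*N}"
  have [simp]: "a \<ge> -N" "b \<ge> -N" "n \<le> N" "-N \<le> n" "N \<ge> 0" "a + b \<ge> -N" "n - a \<le> N" "n - b \<le> N" "n - a - b \<le> N"
    by (auto simp: N_def)
  have ab: "ord_ge (a + b) (f * g)"
    by (rule ord_ge_mult[OF a b])
  have vd: "(\<Sum>m\<in>?B. t m i * t (n - m) j) = t n (i + j)" if "i \<ge> a" "j \<ge> b" for i j
  proof -
    have "t n (i + j) = (\<Sum>m\<in>{i..n - j}. t m i * t (n - m) j)" by (rule vandermonde)
    also have "\<dots> = (\<Sum>m\<in>?B. t m i * t (n - m) j)"
    proof (rule sum.mono_neutral_left)
      have "a \<ge> -N" "n - b \<le> N" "N \<ge> 0" by simp_all
      then show "{i..n - j} \<subseteq> ?B" using that by (intro subsetI, unfold atLeastAtMost_iff) linarith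
    qed (auto simp: tri not_le)
    finally show ?thesis by simp
  qed
  have "fls_tri t (f * g) $$ n = (\<Sum>m\<in>?B. sc (t n m) (\<Sum>i\<in>{a..n-b}. f $$ i * g $$ (m - i)))"
  proof -
    have "fls_tri t (f * g) $$ n = (\<Sum>m\<in>{a+b..n}. sc (t n m) ((f * g) $$ m))"
      by (rule nth[OF ab]) auto
    also have "\<dots> = (\<Sum>m\<in>{a+b..n}. sc (t n m) (\<Sum>i\<in>{a..n-b}. f $$ i * g $$ (m - i)))"
      by (intro sum.cong refl arg_cong[where f = "sc _"] fls_times_nth_superset[OF a b]) auto
    also have "\<dots> = (\<Sum>m\<in>?B. sc (t n m) (\<Sum>i\<in>{a..n-b}. f $$ i * g $$ (m - i)))"
    proof (rule sum.mono_neutral_left)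
      have "a + b \<ge> -N" "n \<le> N" "N \<ge> 0" by simp_all
      then show "{a+b..n} \<subseteq> ?B" by (intro subsetI) (unfold atLeastAtMost_iff image_add_atLeastAtMost, linarith)
      show "\<forall>m\<in>?B - {a+b..n}. sc (t n m) (\<Sum>i\<in>{a..n-b}. f $$ i * g $$ (m - i)) = 0"
      proof
        fix m assume "m \<in> ?B - {a+b..n}"
        then consider "m < a + b" | "n < m" by force
        then show "sc (t n m) (\<Sum>i\<in>{a..n-b}. f $$ i * g $$ (m - i)) = 0"
        proof cases
          case 1
          then have "g $$ (m - i) = 0" if "i \<in> {a..n-b}" for i
            using that b by (simp add: ord_ge_def)
          then have "(\<Sum>i\<in>{a..n-b}. f $$ i * g $$ (m - i)) = 0"
            by (intro sum.neutral) simp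
          then show ?thesis by simp
        qed (simp add: tri)
      qed
    qed auto
    finally show ?thesis .
  qed
  also have "\<dots> = (\<Sum>i\<in>{a..n-b}. \<Sum>m\<in>?B. sc (t n m) (f $$ i * g $$ (m - i)))"
    by (subst sum.swap) (simp add: sc_sum_right)
  also have "\<dots> = (\<Sum>i\<in>{a..n-b}. \<Sum>j\<in>{b..n-a}. sc (t n (i + j)) (f $$ i * g $$ j))"
  proof (rule sum.cong[OF refl])
    fix i assume i: "i \<in> {a..n-b}"
    have "(\<Sum>j\<in>{b..n-a}. sc (t n (i + j)) (f $$ i * g $$ j)) = (\<Sum>m\<in>(+) i ` {b..n-a}. sc (t n m) (f $$ i * g $$ (m - i)))"
      by (subst sum.reindex) auto
    also have "\<dots> = (\<Sum>m\<in>?B. sc (t n m) (f $$ i * g $$ (m - i)))"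
    proof (rule sum.mono_neutral_left)
      have "a + b \<ge> -N" "n - a \<le> N" "n - b \<le> N" "n - a - b \<le> N" "n \<le> N" "N \<ge> 0" "-N \<le> n" "a \<ge> -N" by simp_all
      then show "(+) i ` {b..n-a} \<subseteq> ?B" using i by (intro subsetI) (unfold atLeastAtMost_iff image_add_atLeastAtMost, linarith)
      show "\<forall>m\<in>?B - (+) i ` {b..n-a}. sc (t n m) (f $$ i * g $$ (m - i)) = 0"
      proof
        fix m assume "m \<in> ?B - (+) i ` {b..n-a}"
        then have "m \<notin> {b+i..n-a+i}" by (simp add: add.commute)
        then have "m - i < b \<or> n < m" using i by auto
        then show "sc (t n m) (f $$ i * g $$ (m - i)) = 0"
          using b by (auto simp: tri ord_ge_def)
      qed
    qed auto
    finally show "(\<Sum>m\<in>?B. sc (t n m) (f $$ i * g $$ (m - i))) = (\<Sum>j\<in>{b..n-a}. sc (t n (i + j)) (f $$ i * g $$ j))" ..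
  qed
  also have "\<dots> = (\<Sum>i\<in>{a..n-b}. \<Sum>j\<in>{b..n-a}. \<Sum>m\<in>?B. sc (t m i) (f $$ i) * sc (t (n - m) j) (g $$ j))"
    by (intro sum.cong refl) (simp add: vd[symmetric] sc_sum_left sc_mult_left sc_mult_right sc_sc mult.commute)
  also have "\<dots> = (\<Sum>m\<in>?B. (\<Sum>i\<in>{a..n-b}. sc (t m i) (f $$ i)) * (\<Sum>j\<in>{b..n-a}. sc (t (n - m) j) (g $$ j)))"
    unfolding sum_product
    by (rule trans[OF sum.cong[OF refl sum.swap] sum.swap])
  also have "\<dots> = (\<Sum>m\<in>{a..n-b}. (\<Sum>i\<in>{a..n-b}. sc (t m i) (f $$ i)) * (\<Sum>j\<in>{b..n-a}. sc (t (n - m) j) (g $$ j)))"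
  proof (rule sum.mono_neutral_right)
    have "a \<ge> -N" "n - b \<le> N" "N \<ge> 0" by simp_all
    then show "{a..n-b} \<subseteq> ?B" by (intro subsetI) (unfold atLeastAtMost_iff image_add_atLeastAtMost, linarith)
    show "\<forall>m\<in>?B - {a..n-b}. (\<Sum>i\<in>{a..n-b}. sc (t m i) (f $$ i)) * (\<Sum>j\<in>{b..n-a}. sc (t (n - m) j) (g $$ j)) = 0"
    proof
      fix m assume "m \<in> ?B - {a..n-b}"
      then consider "m < a" | "n - m < b" by force
      then show "(\<Sum>i\<in>{a..n-b}. sc (t m i) (f $$ i)) * (\<Sum>j\<in>{b..n-a}. sc (t (n - m) j) (g $$ j)) = 0"
        by cases (auto simp: tri)
    qed
  qed auto
  also have "\<dots> = (fls_tri t f * fls_tri t g) $$ n"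
  proof -
    have "fls_tri t f $$ m = (\<Sum>i\<in>{a..n-b}. sc (t m i) (f $$ i))" 
         "fls_tri t g $$ (n - m) = (\<Sum>j\<in>{b..n-a}. sc (t (n - m) j) (g $$ j))" if "m \<in> {a..n-b}" for m
      by (rule nth[OF a] nth[OF b]; use that in auto)+
    then show ?thesis
      by (subst fls_times_nth_superset[OF ord[OF a] ord[OF b], of "{a..n-b}"]) (auto intro!: sum.cong)
  qed
  finally show "fls_tri t (f * g) $$ n = (fls_tri t f * fls_tri t g) $$ n" .
qed

end

section \<open>Idempotent units, and the equation A g t(A) = c\<close>

definition unit_on :: "'a::times \<Rightarrow> 'a \<Rightarrow> bool" where
  "unit_on u x \<longleftrightarrow> u * x = x \<and> x * u = x"

lemma unit_on_add: "unit_on u x \<Longrightarrow> unit_on u y \<Longrightarrow> unit_on u (x + y)" for u :: "'a::ring"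
  by (simp add: unit_on_def algebra_simps)

lemma unit_on_diff: "unit_on u x \<Longrightarrow> unit_on u y \<Longrightarrow> unit_on u (x - y)" for u :: "'a::ring"
  by (simp add: unit_on_def algebra_simps)

lemma unit_on_minus: "unit_on u x \<Longrightarrow> unit_on u (- x)" for u :: "'a::ring"
  by (simp add: unit_on_def)

lemma unit_on_mult: "unit_on u x \<Longrightarrow> unit_on u y \<Longrightarrow> unit_on u (x * y)" for u :: "'a::ring"
  unfolding unit_on_def by (metis mult.assoc)

lemma unit_on_sc: "unit_on u x \<Longrightarrow> unit_on u (sc c x)" for u :: "'a::calgebra"
  by (simp add: unit_on_def sc_mult_left sc_mult_right)

lemma unit_on_const: "unit_on u x \<Longrightarrow> unit_on (fls_const u) (fls_const x)" for u :: "'a::ring"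
  by (simp add: unit_on_def)

lemma unit_on_shift: "unit_on u f \<Longrightarrow> unit_on u (fls_shift k f)" for u :: "'a::ring fls"
  by (simp add: unit_on_def fls_shifted_times_simps)

lemma unit_on_nth: "unit_on (fls_const u) f \<longleftrightarrow> (\<forall>n. unit_on u (f $$ n))" for u :: "'a::ring"
  by (auto simp: unit_on_def fls_eq_iff fls_const_times_nth fls_times_const_nth)

lemma (in triangular) unit_on: "unit_on (fls_const u) f \<Longrightarrow> unit_on (fls_const u) (fls_tri t f)"
  by (simp add: unit_on_def flip: const_mult mult_const)

lemmas unit_on_intros = unit_on_add unit_on_diff unit_on_minus unit_on_mult unit_on_sc unit_on_const
  unit_on_shift

text \<open>In the lowest degree d of D the equation reads (1 + t d d) D_d = 0. The lemma extracts
  square roots: D is the defect of a relation for A, and the left-hand side of \<open>eq\<close> is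
  the defect of the corresponding relation for the product of A with its image.\<close>

lemma (in triangular) vanish_left:
  fixes A D :: "'a::calgebra fls"
  assumes A: "ord_ge l A" "A $$ l = u" and t: "t l l = 1" "\<And>n. 1 + t n n \<noteq> 0"
    and u: "unit_on (fls_const u) D"
    and eq: "fls_tri t A * D + fls_tri t D * A = 0"
  shows "D = 0"
proof -
  obtain b where b: "ord_ge b D" by (rule ord_ge_exists)
  have uD: "u * D $$ i = D $$ i" "D $$ i * u = D $$ i" for i
    using u unfolding unit_on_nth by (auto simp: unit_on_def)
  have "ord_ge (b + int n) D" for n
  proof (induction n)
    case (Suc n)
    let ?d = "b + int n"
    have "(fls_tri t A * D) $$ (l + ?d) + (fls_tri t D * A) $$ (?d + l) = 0"
      using arg_cong[OF eq, of "\<lambda>f. f $$ (l + ?d)"] by (simp add: add.commute)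
    then have "D $$ ?d + sc (t ?d ?d) (D $$ ?d) = 0"
      unfolding fls_times_nth_lead[OF ord[OF A(1)] Suc] fls_times_nth_lead[OF ord[OF Suc] A(1)]
      by (simp add: lead[OF A(1)] lead[OF Suc] A(2) t(1) sc_one sc_mult_left uD)
    then have "sc (1 + t ?d ?d) (D $$ ?d) = 0"
      by (simp add: sc_add_left sc_one)
    then have D0: "D $$ ?d = 0"
      using t(2) by (simp add: sc_eq_0_iff)
    show ?case
      unfolding ord_ge_def
    proof (intro allI impI)
      fix i assume "i < b + int (Suc n)"
      then have "i < ?d \<or> i = ?d" by auto
      then show "D $$ i = 0"
        using Suc D0 by (auto simp: ord_ge_def)
    qed
  qed (simp add: b)
  then show ?thesis by (rule ord_ge_eq_0)
qed

text \<open>The mirror image, for the relations with x^-, where the product rule leaves the factors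
  on the opposite sides.\<close>

lemma (in triangular) vanish_right:
  fixes A D :: "'a::calgebra fls"
  assumes A: "ord_ge l A" "A $$ l = u" and t: "t l l = 1" "\<And>n. 1 + t n n \<noteq> 0"
    and u: "unit_on (fls_const u) D"
    and eq: "A * fls_tri t D + D * fls_tri t A = 0"
  shows "D = 0"
proof -
  obtain b where b: "ord_ge b D" by (rule ord_ge_exists)
  have uD: "u * D $$ i = D $$ i" "D $$ i * u = D $$ i" for i
    using u unfolding unit_on_nth by (auto simp: unit_on_def)
  have "ord_ge (b + int n) D" for n
  proof (induction n)
    case (Suc n)
    let ?d = "b + int n"
    have "(A * fls_tri t D) $$ (l + ?d) + (D * fls_tri t A) $$ (?d + l) = 0"
      using arg_cong[OF eq, of "\<lambda>f. f $$ (l + ?d)"] by (simp add: add.commute)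
    then have "D $$ ?d + sc (t ?d ?d) (D $$ ?d) = 0"
      unfolding fls_times_nth_lead[OF A(1) ord[OF Suc]] fls_times_nth_lead[OF Suc ord[OF A(1)]]
      by (simp add: lead[OF A(1)] lead[OF Suc] A(2) t(1) sc_one sc_mult_right uD add.commute)
    then have "sc (1 + t ?d ?d) (D $$ ?d) = 0"
      by (simp add: sc_add_left sc_one)
    then have D0: "D $$ ?d = 0"
      using t(2) by (simp add: sc_eq_0_iff)
    show ?case
      unfolding ord_ge_def
    proof (intro allI impI)
      fix i assume "i < b + int (Suc n)"
      then have "i < ?d \<or> i = ?d" by auto
      then show "D $$ i = 0"
        using Suc D0 by (auto simp: ord_ge_def)
    qed
  qed (simp add: b)
  then show ?thesis by (rule ord_ge_eq_0)
qed

text \<open>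
  Changing \<open>A\<close> by \<open>\<delta> w\<^sup>n + \<dots>\<close> changes \<open>A g \<tau>(A)\<close> by \<open>(\<delta> g\<^sub>0 u + t n n u g\<^sub>0 \<delta>) w\<^sup>n\<^sup>+\<^sup>l + \<dots>\<close>.
\<close>

lemma (in triangular) mult_tri_diff:
  fixes A B g :: "'a::calgebra fls"
  assumes A: "ord_ge l A" "A $$ l = u" and B: "ord_ge l B" "B $$ l = u" and g: "ord_ge 0 g"
    and t: "t l l = 1" and AB: "\<And>i. i < n \<Longrightarrow> A $$ i = B $$ i"
  shows "ord_ge (n + l) (A * g * fls_tri t A - B * g * fls_tri t B)"
    and "(A * g * fls_tri t A - B * g * fls_tri t B) $$ (n + l) =
      (A $$ n - B $$ n) * g $$ 0 * u + sc (t n n) (u * g $$ 0 * (A $$ n - B $$ n))"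
proof -
  have AB: "ord_ge n (A - B)"
    using AB by (simp add: ord_ge_def)
  have split: "A * g * fls_tri t A - B * g * fls_tri t B =
      (A - B) * g * fls_tri t A + B * g * fls_tri t (A - B)"
    by (simp add: diff algebra_simps)
  have ABg: "ord_ge n ((A - B) * g)" "((A - B) * g) $$ n = (A - B) $$ n * g $$ 0"
    using ord_ge_mult[OF AB g] fls_times_nth_lead[OF AB g] by simp_all
  have Bg: "ord_ge l (B * g)" "(B * g) $$ l = B $$ l * g $$ 0"
    using ord_ge_mult[OF B(1) g] fls_times_nth_lead[OF B(1) g] by simp_all
  have "ord_ge (n + l) ((A - B) * g * fls_tri t A)"
    by (rule ord_ge_mult[OF ABg(1) ord[OF A(1)]])
  moreover have "ord_ge (l + n) (B * g * fls_tri t (A - B))"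
    by (rule ord_ge_mult[OF Bg(1) ord[OF AB]])
  ultimately show "ord_ge (n + l) (A * g * fls_tri t A - B * g * fls_tri t B)"
    unfolding split by (simp add: ord_ge_add add.commute)
  have "((A - B) * g * fls_tri t A) $$ (n + l) = (A $$ n - B $$ n) * g $$ 0 * u"
    using fls_times_nth_lead[OF ABg(1) ord[OF A(1)]]
    by (simp add: ABg(2) lead[OF A(1)] A(2) t sc_one)
  moreover have "(B * g * fls_tri t (A - B)) $$ (l + n) = sc (t n n) (u * g $$ 0 * (A $$ n - B $$ n))"
    using fls_times_nth_lead[OF Bg(1) ord[OF AB]]
    by (simp add: Bg(2) lead[OF AB] B(2) sc_mult_right)
  ultimately show "(A * g * fls_tri t A - B * g * fls_tri t B) $$ (n + l) =
      (A $$ n - B $$ n) * g $$ 0 * u + sc (t n n) (u * g $$ 0 * (A $$ n - B $$ n))"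
    unfolding split by (simp add: add.commute)
qed

lemma (in triangular) mult_tri_unique:
  fixes A B g :: "'a::calgebra fls"
  assumes A: "ord_ge l A" "A $$ l = u" and B: "ord_ge l B" "B $$ l = u" and g: "ord_ge 0 g"
    and t: "t l l = 1" "\<And>n. 1 + t n n \<noteq> 0"
    and unit: "\<And>n. A $$ n * u = A $$ n" "\<And>n. B $$ n * u = B $$ n" "u * g $$ 0 = g $$ 0" "g $$ 0 * u = g $$ 0"
      "\<And>n. A $$ n * g $$ 0 = g $$ 0 * A $$ n" "\<And>n. B $$ n * g $$ 0 = g $$ 0 * B $$ n"
    and inv: "\<And>n. g' * (g $$ 0 * A $$ n) = A $$ n" "\<And>n. g' * (g $$ 0 * B $$ n) = B $$ n"
    and eq: "A * g * fls_tri t A = B * g * fls_tri t B"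
  shows "A = B"
proof -
  have "ord_ge (l + int n) (A - B)" for n
  proof (induction n)
    case 0
    then show ?case using A B by (simp add: ord_ge_diff)
  next
    case (Suc n)
    let ?n = "l + int n"
    let ?d = "A $$ ?n - B $$ ?n"
    have "?d * g $$ 0 * u + sc (t ?n ?n) (u * g $$ 0 * ?d) = 0"
      using mult_tri_diff(2)[OF A B g t(1), of ?n] Suc eq by (simp add: ord_ge_def)
    moreover have "?d * g $$ 0 * u = g $$ 0 * ?d" "u * g $$ 0 * ?d = g $$ 0 * ?d"
      by (simp_all add: unit algebra_simps)
    ultimately have "sc (1 + t ?n ?n) (g $$ 0 * ?d) = 0"
      by (simp add: sc_add_left sc_one)
    then have "g' * (g $$ 0 * ?d) = 0"
      using t(2)[of ?n] by (simp add: sc_eq_0_iff)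
    then have d: "?d = 0"
      by (simp add: right_diff_distrib inv)
    show ?case
      unfolding ord_ge_def
    proof (intro allI impI)
      fix i assume "i < l + int (Suc n)"
      then have "i < ?n \<or> i = ?n" by auto
      then show "(A - B) $$ i = 0"
        using Suc d by (auto simp: ord_ge_def)
    qed
  qed
  then have "A - B = 0" by (rule ord_ge_eq_0)
  then show ?thesis by simp
qed

text \<open>Successive approximation inside the commutative set \<open>C\<close>: the error in
  degree n + l determines the coefficient of degree n, because 1 + t n n and g_0 are invertible. The
  condition on \<open>c $$ (l + l)\<close> is what the leading coefficient \<open>u\<close>
  forces.\<close>

lemma (in triangular) mult_tri_exists:
  fixes g c :: "'a::calgebra fls"
  assumes C: "0 \<in> C" "u \<in> C" "\<And>x y. x \<in> C \<Longrightarrow> y \<in> C \<Longrightarrow> x + y \<in> C"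
      "\<And>x y. x \<in> C \<Longrightarrow> y \<in> C \<Longrightarrow> x * y \<in> C" "\<And>a x. x \<in> C \<Longrightarrow> sc a x \<in> C"
      "\<And>x y. x \<in> C \<Longrightarrow> y \<in> C \<Longrightarrow> x * y = y * x" "\<And>x. x \<in> C \<Longrightarrow> u * x = x"
    and g: "ord_ge 0 g" "\<And>n. g $$ n \<in> C" "g' \<in> C" "g' * g $$ 0 = u"
    and c: "ord_ge (l + l) c" "\<And>n. c $$ n \<in> C" "c $$ (l + l) = g $$ 0"
    and t: "t l l = 1" "\<And>n. 1 + t n n \<noteq> 0"
  shows "\<exists>A. ord_ge l A \<and> A $$ l = u \<and> (\<forall>n. A $$ n \<in> C) \<and> A * g * fls_tri t A = c"
proof -
  have Csum: "sum p S \<in> C" if "\<And>i. i \<in> S \<Longrightarrow> p i \<in> C" for p :: "int \<Rightarrow> 'a" and S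
    using that by (induction S rule: infinite_finite_induct) (auto simp: C)
  have Cmult: "(p * r) $$ n \<in> C" if "\<And>i. p $$ i \<in> C" "\<And>i. r $$ i \<in> C" for p r :: "'a fls" and n
    by (simp add: fls_times_nth(2) Csum C that)
  have Ctri: "fls_tri t p $$ n \<in> C" if "\<And>i. p $$ i \<in> C" for p :: "'a fls" and n
    using nth[OF ord_ge_subdegree[of p], where n = n and S = "{fls_subdegree p..n}"] by (simp add: Csum C that)
  have Cm: "- x \<in> C" if "x \<in> C" for x
    using C(5)[OF that, of "-1"] by (simp add: sc_minus_left sc_one)
  define good where "good B \<longleftrightarrow> ord_ge l B \<and> B $$ l = u \<and> (\<forall>n. B $$ n \<in> C)" for B :: "'a fls"
  have goodmult: "(B * g * fls_tri t B) $$ n \<in> C" if "good B" for B n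
    using that by (intro Cmult Ctri g) (auto simp: good_def)
  define \<Phi> where "\<Phi> B = B * g * fls_tri t B" for B :: "'a fls"
  \<comment> \<open>By \<open>mult_tri_diff\<close> a change \<delta> in degree n = l + k + 1 moves
    the coefficient of degree n + l by (1 + t n n) g_0 \<delta>; the correction is the \<delta> that
    cancels the error there.\<close>
  define step where "step k B = B + fls_shift (- (l + int (Suc k)))
      (fls_const (sc (1 / (1 + t (l + int (Suc k)) (l + int (Suc k)))) (g' * (c - \<Phi> B) $$ (l + int (Suc k) + l))))"
    for k B
  define B where "B = rec_nat (fls_shift (- l) (fls_const u)) step"
  have B0: "B 0 = fls_shift (- l) (fls_const u)" and BS: "B (Suc k) = step k (B k)" for k
    by (simp_all add: B_def)
  have step_nth: "step k p $$ i = (if i = l + int (Suc k) then p $$ i +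
      sc (1 / (1 + t (l + int (Suc k)) (l + int (Suc k)))) (g' * (c - \<Phi> p) $$ (l + int (Suc k) + l)) else p $$ i)" for k p i
    by (simp add: step_def)
  have good: "good (B k)" for k
  proof (induction k)
    case 0
    then show ?case by (auto simp: good_def B0 ord_ge_def C)
  next
    case (Suc k)
    have "(c - \<Phi> (B k)) $$ n \<in> C" for n
      using C(3)[OF c(2) Cm[OF goodmult[OF Suc]]] by (simp add: \<Phi>_def)
    then have "sc a (g' * (c - \<Phi> (B k)) $$ n) \<in> C" for a n
      by (intro C g)
    then show ?case
      using Suc C(3) unfolding good_def BS step_nth ord_ge_def by simp
  qed
  have inv: "ord_ge (l + int (Suc k) + l) (\<Phi> (B k) - c)" for k
  proof (induction k)
    case 0
    have "\<Phi> (B 0) $$ (l + l) = c $$ (l + l)"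
    proof -
      have o: "ord_ge l (B 0)" "ord_ge l (fls_tri t (B 0))" "B 0 $$ l = u"
        using good[of 0] by (auto simp: good_def ord)
      have "ord_ge (l + 0) (B 0 * g)" by (rule ord_ge_mult[OF o(1) g(1)])
      then have og: "ord_ge l (B 0 * g)" by simp
      have "(B 0 * g * fls_tri t (B 0)) $$ (l + l) = (B 0 * g) $$ l * fls_tri t (B 0) $$ l"
        by (rule fls_times_nth_lead[OF og o(2)])
      also have "(B 0 * g) $$ l = u * g $$ 0"
        using fls_times_nth_lead[OF o(1) g(1)] o(3) by simp
      also have "fls_tri t (B 0) $$ l = u"
        using lead[OF o(1)] o(3) t(1) by (simp add: sc_one)
      finally show ?thesis
        using C g c by (simp add: \<Phi>_def)
    qed
    moreover have "ord_ge (l + l) (\<Phi> (B 0) - c)"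
    proof -
      have o: "ord_ge l (B 0)" using good[of 0] by (simp add: good_def)
      show ?thesis
        using ord_ge_mult[OF ord_ge_mult[OF o g(1)] ord[OF o]] c(1)
        by (simp add: \<Phi>_def ord_ge_diff)
    qed
    ultimately show ?case
      unfolding ord_ge_def
      by (metis (no_types, opaque_lifting) add.commute add.left_commute fls_minus_nth of_nat_1 One_nat_def right_minus_eq zless_add1_eq)
  next
    case (Suc k)
    let ?n = "l + int (Suc k)"
    let ?e = "sc (1 / (1 + t ?n ?n)) (g' * (c - \<Phi> (B k)) $$ (?n + l))"
    have AB: "B (Suc k) $$ i = B k $$ i" if "i < ?n" for i
      using that by (simp add: BS step_nth)
    have d: "B (Suc k) $$ ?n - B k $$ ?n = ?e"
      by (simp add: BS step_nth)
    have gk: "ord_ge l (B k)" "B k $$ l = u" "ord_ge l (B (Suc k))" "B (Suc k) $$ l = u"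
      using good[of k] good[of "Suc k"] by (auto simp: good_def)
    note diff = mult_tri_diff[OF gk(3,4,1,2) g(1) t(1), of ?n, OF AB]
    have cC: "(c - \<Phi> (B k)) $$ i \<in> C" for i
      using C(3)[OF c(2) Cm[OF goodmult[OF good]]] by (simp add: \<Phi>_def)
    have eC: "?e \<in> C" using cC by (intro C g)
    have "\<Phi> (B (Suc k)) $$ (?n + l) - \<Phi> (B k) $$ (?n + l) = ?e * g $$ 0 * u + sc (t ?n ?n) (u * g $$ 0 * ?e)"
      using diff(2) unfolding d \<Phi>_def fls_minus_nth .
    also have "\<dots> = sc (1 + t ?n ?n) (g $$ 0 * ?e)"
    proof -
      have "?e * g $$ 0 * u = u * (?e * g $$ 0)" by (rule C(6)) (intro C g eC)+
      also have "\<dots> = g $$ 0 * ?e" using C(7)[OF C(4)[OF eC g(2)]] C(6)[OF eC g(2)] by simp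
      finally have "?e * g $$ 0 * u = g $$ 0 * ?e" .
      moreover have "u * g $$ 0 * ?e = g $$ 0 * ?e" using C(7)[OF g(2)] by simp
      ultimately show ?thesis by (simp add: sc_add_left sc_one)
    qed
    also have "\<dots> = g $$ 0 * (g' * (c - \<Phi> (B k)) $$ (?n + l))"
      using t(2)[of ?n] by (simp add: sc_mult_right sc_sc sc_one)
    also have "\<dots> = (c - \<Phi> (B k)) $$ (?n + l)"
      using C(6)[OF g(2) g(3), of 0] g(4) C(7)[OF cC] by (simp add: mult.assoc[symmetric])
    finally have eq: "(\<Phi> (B (Suc k)) - c) $$ (?n + l) = 0" by simp
    have "ord_ge (?n + l) (\<Phi> (B (Suc k)) - c)"
      using ord_ge_add[OF diff(1) Suc] by (simp add: \<Phi>_def)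
    then show ?case
      unfolding ord_ge_def
    proof (intro allI impI)
      fix i assume o: "\<forall>i<?n + l. (\<Phi> (B (Suc k)) - c) $$ i = 0" and "i < l + int (Suc (Suc k)) + l"
      then have "i < ?n + l \<or> i = ?n + l" by auto
      then show "(\<Phi> (B (Suc k)) - c) $$ i = 0" using o eq by blast
    qed
  qed
  \<comment> \<open>Stage k fixes all coefficients up to degree l + k, so the approximations have a
    coefficientwise limit.\<close>
  have stable: "B (k + j) $$ i = B k $$ i" if "i \<le> l + int k" for k j i
    by (induction j) (use that in \<open>auto simp: BS step_nth\<close>)
  define A where "A = Abs_fls (\<lambda>i. B (nat (i - l)) $$ i)"
  have A_nth: "A $$ i = B (nat (i - l)) $$ i" for i
    unfolding A_def by (rule fls_nth_Abs_bounded[of l]) (use good in \<open>auto simp: good_def ord_ge_def\<close>)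
  have A_B: "A $$ i = B k $$ i" if "i \<le> l + int k" for i k
  proof (cases "i < l")
    case True
    then show ?thesis using good unfolding A_nth by (simp add: good_def ord_ge_def)
  next
    case False
    then show ?thesis
      using stable[of i "nat (i - l)" "k - nat (i - l)"] that by (simp add: A_nth)
  qed
  have A: "good A"
    using good[of 0] A_B[of _ 0] A_nth good unfolding good_def ord_ge_def by auto
  have "ord_ge (l + l + int k) (\<Phi> A - c)" for k
  proof -
    have gk: "ord_ge l (B k)" "B k $$ l = u" "ord_ge l A" "A $$ l = u"
      using good[of k] A by (auto simp: good_def)
    have "ord_ge (l + int k + l) (\<Phi> A - \<Phi> (B k))"
      unfolding \<Phi>_def by (rule mult_tri_diff(1)[OF gk(3,4,1,2) g(1) t(1)]) (simp add: A_B)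
    from ord_ge_add[OF this ord_ge_mono[OF inv[of k]]] show ?thesis
      by (simp add: algebra_simps)
  qed
  then have "\<Phi> A - c = 0" by (rule ord_ge_eq_0)
  then show ?thesis using A by (auto simp: good_def \<Phi>_def)
qed

section \<open>The coproduct of the series A for the Yangian\<close>

text \<open>The series variable is w = 1/z. Column i lists the coefficients of (z - 1)^(-i), the sum
  over j of ((-i) gchoose j) (-1)^j w^(i+j).\<close>

definition shift_mat :: "int \<Rightarrow> int \<Rightarrow> complex" where
  "shift_mat n i = (if n < i then 0 else (of_int (- i) gchoose nat (n - i)) * (-1) ^ nat (n - i))"

interpretation shift_mat: triangular_mult shift_mat
proof
  fix n i j :: int
  show "shift_mat n i = 0" if "n < i"
    using that by (simp add: shift_mat_def)
  show "shift_mat n (i + j) = (\<Sum>a\<in>{i..n - j}. shift_mat a i * shift_mat (n - a) j)"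
  proof (cases "n < i + j")
    case False
    define k where "k = nat (n - (i + j))"
    have n: "n = i + j + int k"
      using False by (simp add: k_def)
    have "(\<Sum>a\<in>{i..n - j}. shift_mat a i * shift_mat (n - a) j) =
        (\<Sum>m\<in>{..k}. shift_mat (i + int m) i * shift_mat (n - (i + int m)) j)"
    proof (rule sum.reindex_bij_witness[of _ "\<lambda>m. i + int m" "\<lambda>a. nat (a - i)"])
    qed (auto simp: n)
    also have "\<dots> = (\<Sum>m\<in>{..k}. ((of_int (- i) gchoose m) * (of_int (- j) gchoose (k - m))) * (-1) ^ k)"
    proof (rule sum.cong[OF refl])
      fix m assume "m \<in> {..k}"
      then have "m \<le> k" by simp
      then have "nat (int k - int m) = k - m" "(-1::complex) ^ k = (-1) ^ m * (-1) ^ (k - m)"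
        by (simp_all add: nat_diff_distrib flip: power_add)
      then show "shift_mat (i + int m) i * shift_mat (n - (i + int m)) j =
          ((of_int (- i) gchoose m) * (of_int (- j) gchoose (k - m))) * (-1) ^ k"
        using \<open>m \<le> k\<close> by (simp add: shift_mat_def n)
    qed
    also have "\<dots> = (of_int (- i) + of_int (- j) gchoose k) * (-1) ^ k"
      using gbinomial_Vandermonde[of "of_int (- i) :: complex" "of_int (- j)" k]
      by (simp add: atMost_atLeast0 flip: sum_distrib_right)
    also have "\<dots> = shift_mat n (i + j)"
      by (simp add: shift_mat_def n algebra_simps)
    finally show ?thesis ..
  qed (simp add: shift_mat_def)
qed

abbreviation tau :: "'a::calgebra fls \<Rightarrow> 'a fls" where
  "tau \<equiv> fls_tri shift_mat"

lemma shift_mat_diag: "shift_mat n n = 1"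
  by (simp add: shift_mat_def)

text \<open>Pascal's rule, that is, (z - 1)^(1-i) = (z - 1) (z - 1)^(-i) compared
  coefficientwise.\<close>

lemma shift_mat_pascal: "shift_mat (n + 1) i = shift_mat n (i - 1) + shift_mat n i"
proof (cases "n < i")
  case True
  then show ?thesis
    by (cases "n + 1 = i") (simp_all add: shift_mat_def)
next
  case False
  define k where "k = nat (n - i)"
  have n: "n = i + int k" using False by (simp add: k_def)
  show ?thesis
    using gbinomial_Suc_Suc[of "of_int (- i) :: complex" k]
    by (simp add: shift_mat_def n nat_add_distrib algebra_simps)
qed

text \<open>In the variable 1/z, \<open>fls_shift 1\<close> is multiplication by z, and the
  substitution turns z into z - 1.\<close>

lemma tau_shift: "tau (fls_shift 1 f) = fls_shift 1 (tau f) - tau f"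
proof (rule fls_eqI)
  fix n
  obtain a where a: "ord_ge a f" by (rule ord_ge_exists)
  have "tau (fls_shift 1 f) $$ n = (\<Sum>i\<in>{a-1..n}. sc (shift_mat n i) (f $$ (i + 1)))"
    using shift_mat.nth[OF ord_ge_shift[OF a, of 1], of "{a-1..n}" n] by simp
  also have "\<dots> = (\<Sum>i\<in>{a..n+1}. sc (shift_mat n (i - 1)) (f $$ i))"
    by (rule sum.reindex_bij_witness[of _ "\<lambda>i. i - 1" "\<lambda>i. i + 1"]) auto
  also have "\<dots> = (\<Sum>i\<in>{a..n+1}. sc (shift_mat (n + 1) i) (f $$ i)) - (\<Sum>i\<in>{a..n+1}. sc (shift_mat n i) (f $$ i))"
    by (simp add: shift_mat_pascal sc_add_left sum.distrib)
  also have "\<dots> = tau f $$ (n + 1) - tau f $$ n"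
    by (subst (1 2) shift_mat.nth[OF a, of "{a..n+1}"]) auto
  finally show "tau (fls_shift 1 f) $$ n = (fls_shift 1 (tau f) - tau f) $$ n"
    by simp
qed

text \<open>The degrees to be distinguished in a relation between h(z) and x_s: multiplication by z
  reaches degree -1, and the coefficient of h(z) changes its form at degree 0.\<close>

lemma int_pred_cases:
  obtains "n < -1" | "n = -1" | "n = 0" | r where "n = int (Suc r)"
proof -
  show thesis
  proof (cases "n > 0")
    case True
    then show thesis using that(4)[of "nat (n - 1)"] by simp
  qed (use that(1-3) in linarith)
qed

section \<open>Currents x(z), and the relations of the Yangian in generating form\<close>

definition current :: "(nat \<Rightarrow> 'a::calgebra) \<Rightarrow> nat \<Rightarrow> 'a fls" where
  "current x N = Abs_fls (\<lambda>n. if n < 1 then 0 else x (N + nat (n - 1)))"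

lemma current_nth: "current x N $$ n = (if n < 1 then 0 else x (N + nat (n - 1)))"
  unfolding current_def by (rule fls_nth_Abs_bounded[of 1]) simp

lemma current_ord: "ord_ge 1 (current x N)"
  by (simp add: ord_ge_def current_nth)

lemma current_shift: "fls_shift 1 (current x N) = fls_const (x N) + current x (Suc N)"
proof (rule fls_eqI)
  fix n
  show "fls_shift 1 (current x N) $$ n = (fls_const (x N) + current x (Suc N)) $$ n"
  proof (cases "n \<ge> 1")
    case True
    then have "nat n = Suc (nat (n - 1))" by simp
    then show ?thesis using True by (simp add: current_nth)
  qed (auto simp: current_nth)
qed

lemma current_Suc: "current x (Suc N) = fls_shift 1 (current x N) - fls_const (x N)"
  by (simp add: current_shift)

text \<open>Summing the relations over both indices in one and the same variable makes the two
  arguments of the currents equal. The difference of commutators then collapses to boundary terms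
  with x_0, and the result is twice the claim.\<close>

lemma current_commutator:
  assumes rel: "\<And>r s. (x (Suc r) * x s - x s * x (Suc r)) - (x r * x (Suc s) - x (Suc s) * x r) =
    sc \<epsilon> (x r * x s + x s * x r)"
  shows "current x 0 * fls_const (x 0) - fls_const (x 0) * current x 0 = sc \<epsilon> (current x 0 * current x 0)"
proof -
  let ?X = "current x" and ?x = "\<lambda>n. fls_const (x n)"
  \<comment> \<open>The relations with r fixed, summed over s; z x(z) - x_0 is the current of the
    x_(s+1).\<close>
  define V where "V r = (?x (Suc r) * ?X 0 - ?X 0 * ?x (Suc r)) - (?x r * (fls_shift 1 (?X 0) - ?x 0)
    - (fls_shift 1 (?X 0) - ?x 0) * ?x r) - sc \<epsilon> (?x r * ?X 0 + ?X 0 * ?x r)" for r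
  have V: "V r = 0" for r
  proof (rule fls_eqI)
    fix n
    show "V r $$ n = 0 $$ n"
    proof (cases "n \<ge> 1")
      case True
      then have "nat n = Suc (nat (n - 1))" by simp
      then show ?thesis
        using rel[of r "nat (n - 1)"] True
        by (simp add: V_def current_nth fls_times_const_nth fls_const_times_nth algebra_simps)
    qed (auto simp: V_def current_nth fls_times_const_nth fls_const_times_nth)
  qed
  \<comment> \<open>The sum of the \<open>V (r + k)\<close> times z^(-k-1), hence z
    \<open>W r\<close> = \<open>V r\<close> + \<open>W (Suc r)\<close>.\<close>
  define W where "W r = (?X (Suc r) * ?X 0 - ?X 0 * ?X (Suc r)) - (?X r * (fls_shift 1 (?X 0) - ?x 0)
    - (fls_shift 1 (?X 0) - ?x 0) * ?X r) - sc \<epsilon> (?X r * ?X 0 + ?X 0 * ?X r)" for r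
  have "W 0 = 0"
  proof (rule shift_descent)
    show "fls_shift 1 (W N) = W (Suc N)" for N
      using V[of N]
      by (simp add: V_def W_def current_Suc fls_shift_sc fls_shifted_times_simps algebra_simps sc_add_right sc_diff_right)
    have s: "ord_ge (1 - 1) (fls_shift 1 (?X 0))" by (rule ord_ge_shift[OF current_ord])
    then have s2: "ord_ge 0 (fls_shift 1 (?X 0) - ?x 0)" by (auto intro!: ord_ge_diff ord_ge_const)
    then have "ord_ge (1 + 0) (?X N * (fls_shift 1 (?X 0) - ?x 0))" "ord_ge (0 + 1) ((fls_shift 1 (?X 0) - ?x 0) * ?X N)"
      "ord_ge (1 + 1) (?X N * ?X M)" for N M
      by (intro ord_ge_mult current_ord s2)+
    then show "ord_ge 1 (W N)" for N
      unfolding W_def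
      by (intro ord_ge_add ord_ge_diff ord_ge_sc) (auto intro: ord_ge_mono[of 2])
  qed
  then have "(?X 0 * ?x 0 - ?x 0 * ?X 0) + (?X 0 * ?x 0 - ?x 0 * ?X 0) = sc \<epsilon> (?X 0 * ?X 0) + sc \<epsilon> (?X 0 * ?X 0)"
    by (simp add: W_def current_Suc fls_shifted_times_simps algebra_simps sc_add_right)
  then have "(?X 0 * ?x 0 - ?x 0 * ?X 0 - sc \<epsilon> (?X 0 * ?X 0)) + (?X 0 * ?x 0 - ?x 0 * ?X 0 - sc \<epsilon> (?X 0 * ?X 0)) = 0"
    by (simp add: algebra_simps)
  then show ?thesis
    by (simp add: double_eq_0_iff)
qed

locale yangian =
  fixes xp xm h :: "nat \<Rightarrow> 'a::calgebra" and u :: 'a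
  assumes hh: "h r * h s = h s * h r"
    and h0p: "h 0 * xp s - xp s * h 0 = xp s + xp s"
    and h0m: "h 0 * xm s - xm s * h 0 = - (xm s + xm s)"
    and hp: "(h (Suc r) * xp s - xp s * h (Suc r)) - (h r * xp (Suc s) - xp (Suc s) * h r) =
      h r * xp s + xp s * h r"
    and hm: "(h (Suc r) * xm s - xm s * h (Suc r)) - (h r * xm (Suc s) - xm (Suc s) * h r) =
      - (h r * xm s + xm s * h r)"
    and pm: "xp r * xm s - xm s * xp r = h (r + s)"
    and pp: "(xp (Suc r) * xp s - xp s * xp (Suc r)) - (xp r * xp (Suc s) - xp (Suc s) * xp r) =
      xp r * xp s + xp s * xp r"
    and mm: "(xm (Suc r) * xm s - xm s * xm (Suc r)) - (xm r * xm (Suc s) - xm (Suc s) * xm r) =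
      - (xm r * xm s + xm s * xm r)"
    and up: "unit_on u (xp s)" and um: "unit_on u (xm s)"
    and uu: "u * u = u"
begin

definition H :: "'a fls" where
  "H = Abs_fls (\<lambda>n. if n < 0 then 0 else if n = 0 then u else h (nat (n - 1)))"

lemma H_nth: "H $$ n = (if n < 0 then 0 else if n = 0 then u else h (nat (n - 1)))"
  unfolding H_def by (rule fls_nth_Abs_bounded[of 0]) simp

lemma H_ord: "ord_ge 0 H"
  by (simp add: ord_ge_def H_nth)

abbreviation "P s \<equiv> fls_const (xp s)"
abbreviation "M s \<equiv> fls_const (xm s)"
abbreviation "Uc \<equiv> fls_const u"

lemma H_plus: "fls_shift 1 (H * P s - P s * H) - (H * P (Suc s) - P (Suc s) * H) = H * P s + P s * H"
proof (rule fls_eqI)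
  fix n
  consider "n < -1" | "n = -1" | "n = 0" | r where "n = int (Suc r)"
    by (rule int_pred_cases)
  then show "(fls_shift 1 (H * P s - P s * H) - (H * P (Suc s) - P (Suc s) * H)) $$ n = (H * P s + P s * H) $$ n"
  proof cases
    case (4 r)
    then show ?thesis using hp[of r s]
      by (simp add: fls_times_const_nth fls_const_times_nth H_nth nat_add_distrib)
  qed (simp_all add: fls_times_const_nth fls_const_times_nth H_nth up[unfolded unit_on_def] h0p)
qed

lemma H_minus: "fls_shift 1 (H * M s - M s * H) - (H * M (Suc s) - M (Suc s) * H) = - (H * M s + M s * H)"
proof (rule fls_eqI)
  fix n
  consider "n < -1" | "n = -1" | "n = 0" | r where "n = int (Suc r)"
    by (rule int_pred_cases)
  then show "(fls_shift 1 (H * M s - M s * H) - (H * M (Suc s) - M (Suc s) * H)) $$ n = (- (H * M s + M s * H)) $$ n"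
  proof cases
    case (4 r)
    then show ?thesis using hm[of r s]
      by (simp add: fls_times_const_nth fls_const_times_nth H_nth nat_add_distrib)
  qed (simp_all add: fls_times_const_nth fls_const_times_nth H_nth um[unfolded unit_on_def] h0m)
qed

end

text \<open>
  \<open>Dp\<close> is the relation \<open>(z - w + 1) A(z) x\<^sup>+(w) = (z - w) x\<^sup>+(w) A(z) + \<dots>\<close>, where the dots do
  not depend on \<open>w\<close>.
\<close>

locale yangian_plus = yangian +
  fixes A :: "'a fls"
  assumes uA: "unit_on Uc A"
    and Dp: "fls_shift 1 (A * P s - P s * A) - (A * P (Suc s) - P (Suc s) * A) + A * P s = 0"
begin

abbreviation "X \<equiv> current xp"

abbreviation "E \<equiv> P 0 * A - A * P 0"
abbreviation "F \<equiv> A * M 0 - M 0 * A"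
abbreviation "K \<equiv> E * M 0 - M 0 * E"

text \<open>The relation \<open>Dp\<close> at w = z. Multiplication by z carries the defect for
  \<open>X N\<close> to the defect for \<open>X (Suc N)\<close>, so descent applies.\<close>

lemma AX: "A * X 0 = E"
proof -
  obtain a where a: "ord_ge a A" by (rule ord_ge_exists)
  define V where "V N = A * P N - P N * A + A * X N" for N
  have "V 0 = 0"
  proof (rule shift_descent)
    show "fls_shift 1 (V N) = V (Suc N)" for N
      using Dp[of N] by (simp add: V_def current_Suc fls_shifted_times_simps algebra_simps)
    have "ord_ge (a + 0) (A * P N)" "ord_ge (0 + a) (P N * A)" "ord_ge (a + 1) (A * X N)" for N
      by (intro ord_ge_mult a current_ord ord_ge_const order_refl)+
    then show "ord_ge a (V N)" for N
      unfolding V_def by (auto intro!: ord_ge_add ord_ge_diff intro: ord_ge_mono[of "a + 1"])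
  qed
  then show ?thesis by (simp add: V_def algebra_simps)
qed

lemma tau_Dp: "fls_shift 1 (tau A * P s - P s * tau A) - (tau A * P (Suc s) - P (Suc s) * tau A) + P s * tau A = 0"
  using arg_cong[OF Dp[of s], of tau]
  by (simp add: shift_mat.add shift_mat.diff shift_mat.zero tau_shift shift_mat.const_mult shift_mat.mult_const algebra_simps
      del: fls_shift_minus)

lemma tau_E: "tau E = P 0 * tau A - tau A * P 0"
  by (simp add: shift_mat.diff shift_mat.const_mult shift_mat.mult_const)

text \<open>The relation \<open>Dp\<close> at w = z + 1, followed by the substitution z -> z -
  1.\<close>

lemma X_tau: "X 0 * tau A = tau E"
proof -
  obtain a where a: "ord_ge a A" by (rule ord_ge_exists)
  define V where "V N = tau A * P N - P N * tau A + X N * tau A" for N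
  have "V 0 = 0"
  proof (rule shift_descent)
    show "fls_shift 1 (V N) = V (Suc N)" for N
      using tau_Dp[of N] by (simp add: V_def current_Suc fls_shifted_times_simps algebra_simps)
    have "ord_ge (a + 0) (tau A * P N)" "ord_ge (0 + a) (P N * tau A)" "ord_ge (1 + a) (X N * tau A)" for N
      by (intro ord_ge_mult shift_mat.ord a current_ord ord_ge_const order_refl)+
    then show "ord_ge a (V N)" for N
      unfolding V_def by (auto intro!: ord_ge_add ord_ge_diff intro: ord_ge_mono[of "1 + a"])
  qed
  then show ?thesis by (simp add: V_def tau_E algebra_simps)
qed

text \<open>Both sides are A(z) x^+(z) A(z-1).\<close>

lemma EA: "E * tau A = A * tau E"
  by (metis AX X_tau mult.assoc)

text \<open>This combines all relations [x^+_n, x^-_0] = h_n; through it the defining equation of A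
  is evaluated with x^-_0 as the only lowering operator.\<close>

lemma H_X: "H = Uc + (X 0 * M 0 - M 0 * X 0)"
proof (rule fls_eqI)
  fix n
  show "H $$ n = (Uc + (X 0 * M 0 - M 0 * X 0)) $$ n"
    using pm[of "nat (n - 1)" 0]
    by (auto simp: H_nth current_nth fls_times_const_nth fls_const_times_nth)
qed

text \<open>After the substitution of \<open>H_X\<close>, the current x^+ is absorbed by A on its
  left in one term and by tau A on its right in the other. The identity is stated for every A
  satisfying \<open>Dp\<close>, so that it can be applied to the coproduct expression as
  well.\<close>

lemma A_H_tau: "A * H * tau A = (A + K) * tau A - F * tau E"
proof -
  have "A * Uc = A" using uA by (simp add: unit_on_def)
  then have "A * H = A + A * (X 0 * M 0 - M 0 * X 0)"
    by (simp add: H_X distrib_left)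
  then have "A * H * tau A = (A + A * (X 0 * M 0 - M 0 * X 0)) * tau A"
    by simp
  also have "\<dots> = A * tau A + A * X 0 * M 0 * tau A - A * M 0 * (X 0 * tau A)"
    by (simp add: algebra_simps)
  also have "\<dots> = A * tau A + E * M 0 * tau A - (F + M 0 * A) * tau E"
    by (simp only: AX X_tau diff_add_cancel)
  also have "(F + M 0 * A) * tau E = F * tau E + M 0 * (E * tau A)"
    by (simp only: EA distrib_right mult.assoc)
  finally show ?thesis
    by (simp add: algebra_simps)
qed

lemma P_X: "P 0 * X 0 - X 0 * P 0 = - (X 0 * X 0)"
  using current_commutator[of xp 1] pp by (simp add: sc_one algebra_simps)

text \<open>With E = A x^+, the two parts [x^+_0, A] x^+ and A [x^+_0, x^+] of the commutator are A
  (x^+)^2 and -A (x^+)^2.\<close>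

lemma eE: "P 0 * E = E * P 0"
proof -
  have "P 0 * (A * X 0) - (A * X 0) * P 0 = E * X 0 + A * (P 0 * X 0 - X 0 * P 0)"
    by (simp add: algebra_simps)
  also have "\<dots> = 0"
    by (simp add: P_X AX[symmetric] mult.assoc)
  finally show ?thesis
    by (simp add: AX)
qed

end

locale yangian_A = yangian +
  fixes A c :: "'a fls" and l :: int
  assumes uA: "unit_on Uc A"
    and A_lead: "ord_ge l A" "A $$ l = u"
    and hA: "fls_const (h s) * A = A * fls_const (h s)"
    and A_tau: "tau A * A = A * tau A"
    and HA: "H * (A * tau A) = c"
    and cP: "P s * c = c * P s" and cM: "M s * c = c * M s"
    and HAc: "A * H = H * A"
begin

text \<open>A tau A is c/h, and c commutes with x^+_s. Multiplying by h from the left, which is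
  injective, turns the claim into \<open>H_plus\<close>.\<close>

lemma Pi_plus: "fls_shift 1 (A * tau A * P s - P s * (A * tau A)) - (A * tau A * P (Suc s) - P (Suc s) * (A * tau A))
    + P s * (A * tau A) + A * tau A * P s = 0" (is "?Q = 0")
proof (rule fls_left_cancel[OF H_ord])
  let ?T = "A * tau A"
  show "H * ?Q = 0"
  proof -
    have "H * ?Q = fls_shift 1 (H * ?T * P s - H * P s * ?T) - (H * ?T * P (Suc s) - H * P (Suc s) * ?T) + H * P s * ?T + H * ?T * P s"
      by (simp add: fls_shifted_times_simps algebra_simps)
    also have "\<dots> = - ((fls_shift 1 (H * P s - P s * H) - (H * P (Suc s) - P (Suc s) * H)) * ?T)
        + H * P s * ?T + P s * H * ?T"
      by (simp add: HA fls_shifted_times_simps algebra_simps flip: cP)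
    also have "\<dots> = 0"
      unfolding H_plus by (simp add: algebra_simps)
    finally show ?thesis .
  qed
  have "unit_on Uc ?Q"
    by (intro unit_on_intros shift_mat.unit_on uA up)
  then have "unit_on u (?Q $$ n)" for n
    unfolding unit_on_nth by (rule spec)
  then show "u * (H $$ 0 * ?Q $$ n) = ?Q $$ n" for n
    by (simp only: unit_on_def H_nth) simp
qed

lemma Pi_minus: "fls_shift 1 (A * tau A * M s - M s * (A * tau A)) - (A * tau A * M (Suc s) - M (Suc s) * (A * tau A))
    - M s * (A * tau A) - A * tau A * M s = 0" (is "?Q = 0")
proof (rule fls_left_cancel[OF H_ord])
  let ?T = "A * tau A"
  show "H * ?Q = 0"
  proof -
    have "H * ?Q = fls_shift 1 (H * ?T * M s - H * M s * ?T) - (H * ?T * M (Suc s) - H * M (Suc s) * ?T) - H * M s * ?T - H * ?T * M s"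
      by (simp add: fls_shifted_times_simps algebra_simps)
    also have "\<dots> = - ((fls_shift 1 (H * M s - M s * H) - (H * M (Suc s) - M (Suc s) * H)) * ?T)
        - H * M s * ?T - M s * H * ?T"
      by (simp add: HA fls_shifted_times_simps algebra_simps flip: cM)
    also have "\<dots> = 0"
      unfolding H_minus by (simp add: algebra_simps)
    finally show ?thesis .
  qed
  have "unit_on Uc ?Q"
    by (intro unit_on_intros shift_mat.unit_on uA um)
  then have "unit_on u (?Q $$ n)" for n
    unfolding unit_on_nth by (rule spec)
  then show "u * (H $$ 0 * ?Q $$ n) = ?Q $$ n" for n
    by (simp only: unit_on_def H_nth) simp
qed

lemmas tau_simps = shift_mat.add shift_mat.diff shift_mat.minus shift_mat.zero tau_shift
  shift_mat.const_mult shift_mat.mult_const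

text \<open>The square root of \<open>Pi_plus\<close>: for the defect D of the claim, tau A D + tau
  D A is the defect for A tau A, which vanishes.\<close>

lemma A_plus: "fls_shift 1 (A * P s - P s * A) - (A * P (Suc s) - P (Suc s) * A) + A * P s = 0" (is "?D = 0")
proof (rule shift_mat.vanish_left[OF A_lead])
  have AA: "tau A * (A * y) = A * (tau A * y)" for y
    by (simp add: A_tau flip: mult.assoc)
  have "tau ?D = fls_shift 1 (tau A * P s - P s * tau A) - (tau A * P (Suc s) - P (Suc s) * tau A) + P s * tau A"
    by (simp add: tau_simps algebra_simps del: fls_shift_minus)
  then have "tau A * ?D + tau ?D * A = tau A * ?D + (fls_shift 1 (tau A * P s - P s * tau A) - (tau A * P (Suc s) - P (Suc s) * tau A) + P s * tau A) * A"
    by simp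
  also have "\<dots> = fls_shift 1 (A * tau A * P s - P s * (A * tau A)) - (A * tau A * P (Suc s) - P (Suc s) * (A * tau A))
    + P s * (A * tau A) + A * tau A * P s"
    by (simp add: fls_shifted_times_simps algebra_simps A_tau AA)
  finally show "tau A * ?D + tau ?D * A = 0"
    by (simp only: Pi_plus)
  show "unit_on Uc ?D"
    by (intro unit_on_intros uA up)
qed (simp_all add: shift_mat_diag)

lemma A_minus: "fls_shift 1 (A * M s - M s * A) - (A * M (Suc s) - M (Suc s) * A) - M s * A = 0" (is "?D = 0")
proof (rule shift_mat.vanish_right[OF A_lead])
  have AA: "tau A * (A * y) = A * (tau A * y)" for y
    by (simp add: A_tau flip: mult.assoc)
  have "tau ?D = fls_shift 1 (tau A * M s - M s * tau A) - (tau A * M (Suc s) - M (Suc s) * tau A) - tau A * M s"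
    by (simp add: tau_simps algebra_simps del: fls_shift_minus)
  then have "A * tau ?D + ?D * tau A = A * (fls_shift 1 (tau A * M s - M s * tau A) - (tau A * M (Suc s) - M (Suc s) * tau A) - tau A * M s) + ?D * tau A"
    by simp
  also have "\<dots> = fls_shift 1 (A * tau A * M s - M s * (A * tau A)) - (A * tau A * M (Suc s) - M (Suc s) * (A * tau A))
    - M s * (A * tau A) - A * tau A * M s"
    by (simp add: fls_shifted_times_simps algebra_simps A_tau AA)
  finally show "A * tau ?D + ?D * tau A = 0"
    by (simp only: Pi_minus)
  show "unit_on Uc ?D"
    by (intro unit_on_intros uA um)
qed (simp_all add: shift_mat_diag)

sublocale yangian_plus xp xm h u A
  by unfold_locales (rule uA A_plus)+

text \<open>The mirror image of \<open>eE\<close>; here the current stands on the left, F = x^-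
  A.\<close>

lemma fF: "M 0 * F = F * M 0"
proof -
  let ?Y = "current xm"
  obtain a where a: "ord_ge a A" by (rule ord_ge_exists)
  define V where "V N = A * M N - M N * A - ?Y N * A" for N
  have "V 0 = 0"
  proof (rule shift_descent)
    show "fls_shift 1 (V N) = V (Suc N)" for N
      using A_minus[of N] by (simp add: V_def current_Suc fls_shifted_times_simps algebra_simps)
    have "ord_ge (a + 0) (A * M N)" "ord_ge (0 + a) (M N * A)" "ord_ge (1 + a) (?Y N * A)" for N
      by (intro ord_ge_mult a current_ord ord_ge_const order_refl)+
    then show "ord_ge a (V N)" for N
      unfolding V_def by (auto intro!: ord_ge_add ord_ge_diff intro: ord_ge_mono[of "1 + a"])
  qed
  then have YA: "?Y 0 * A = F"
    by (simp add: V_def)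
  have "M 0 * (?Y 0 * A) - ?Y 0 * A * M 0 = (M 0 * ?Y 0 - ?Y 0 * M 0) * A - ?Y 0 * F"
    by (simp add: algebra_simps)
  also have "M 0 * ?Y 0 - ?Y 0 * M 0 = ?Y 0 * ?Y 0"
    using current_commutator[of xm "-1"] mm by (simp add: sc_minus_left sc_one algebra_simps)
  also have "?Y 0 * ?Y 0 * A - ?Y 0 * F = 0"
    by (simp add: YA mult.assoc)
  finally show ?thesis
    by (simp add: YA)
qed

lemma qdet: "(A + K) * tau A - F * tau E = c"
  using A_H_tau HA HAc by (simp add: mult.assoc)

end

context yangian
begin

text \<open>The coefficient of z^(-2) in log h(z). Unlike h_1, it shifts the index of x^+_s and
  x^-_s without quadratic corrections.\<close>

definition "t = h 1 - sc (1/2) (h 0 * h 0)"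

lemma t_plus: "t * xp s - xp s * t = xp (Suc s) + xp (Suc s)"
proof -
  have "h 0 * h 0 * xp s - xp s * (h 0 * h 0) = h 0 * (h 0 * xp s - xp s * h 0) + (h 0 * xp s - xp s * h 0) * h 0"
    by (simp add: algebra_simps)
  also have "\<dots> = (h 0 * xp s + xp s * h 0) + (h 0 * xp s + xp s * h 0)"
    unfolding h0p by (simp add: algebra_simps)
  finally have "sc (1/2) (h 0 * h 0 * xp s - xp s * (h 0 * h 0)) = h 0 * xp s + xp s * h 0"
    by (simp only: sc_half_double)
  moreover have "t * xp s - xp s * t = ((h (Suc 0) * xp s - xp s * h (Suc 0)) -
      (h 0 * xp (Suc s) - xp (Suc s) * h 0)) + (h 0 * xp (Suc s) - xp (Suc s) * h 0) -
      sc (1/2) (h 0 * h 0 * xp s - xp s * (h 0 * h 0))"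
    by (simp add: t_def sc_diff_right sc_mult_left sc_mult_right algebra_simps)
  ultimately show ?thesis
    unfolding hp unfolding h0p by simp
qed

lemma t_minus: "t * xm s - xm s * t = - (xm (Suc s) + xm (Suc s))"
proof -
  have "h 0 * h 0 * xm s - xm s * (h 0 * h 0) = h 0 * (h 0 * xm s - xm s * h 0) + (h 0 * xm s - xm s * h 0) * h 0"
    by (simp add: algebra_simps)
  also have "\<dots> = - (h 0 * xm s + xm s * h 0) + - (h 0 * xm s + xm s * h 0)"
    unfolding h0m by (simp add: algebra_simps)
  finally have "sc (1/2) (h 0 * h 0 * xm s - xm s * (h 0 * h 0)) = - (h 0 * xm s + xm s * h 0)"
    by (simp only: sc_half_double)
  moreover have "t * xm s - xm s * t = ((h (Suc 0) * xm s - xm s * h (Suc 0)) -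
      (h 0 * xm (Suc s) - xm (Suc s) * h 0)) + (h 0 * xm (Suc s) - xm (Suc s) * h 0) -
      sc (1/2) (h 0 * h 0 * xm s - xm s * (h 0 * h 0))"
    by (simp add: t_def sc_diff_right sc_mult_left sc_mult_right algebra_simps)
  ultimately show ?thesis
    unfolding hm unfolding h0m by simp
qed

end

text \<open>
  The relations between the entries of the monodromy matrix with rows \<open>(A, F)\<close> and \<open>(E, D)\<close> that
  the computation of the coproduct uses. Here \<open>Z\<close> is multiplication by \<open>z\<close> and \<open>\<tau>\<close> is the
  substitution \<open>z \<mapsto> z - 1\<close>, and the letters stand for
  \<open>x\<^sup>+\<^sub>0, x\<^sup>-\<^sub>0, x\<^sup>+\<^sub>1, x\<^sup>-\<^sub>1, h\<^sub>0, h\<^sub>1, h\<^sub>1 - h\<^sub>0\<^sup>2/2\<close>.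
\<close>

locale yang_monodromy =
  fixes Z \<tau> :: "'r::calgebra \<Rightarrow> 'r" and e f e1 f1 h0 h1 t A c :: 'r
  assumes Z_diff: "Z (x - y) = Z x - Z y" and Z_left: "Z x * y = Z (x * y)" and Z_right: "x * Z y = Z (x * y)"
    and tau_diff: "\<tau> (x - y) = \<tau> x - \<tau> y" and tau_mult: "\<tau> (x * y) = \<tau> x * \<tau> y"
    and tau_e: "\<tau> e = e" and tau_f: "\<tau> f = f"
    and ef: "e * f = f * e + h0" and h0A: "h0 * A = A * h0" and h0e: "h0 * e = e * h0 + (e + e)"
    and h0f: "h0 * f = f * h0 - (f + f)"
    and tA: "t * A = A * t" and te: "t * e = e * t + (e1 + e1)" and tf: "t * f = f * t - (f1 + f1)"
    and e1f: "e1 * f = f * e1 + h1" and h1A: "h1 * A = A * h1"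
    and Ae1: "A * e1 = e1 * A + A * e - Z (e * A - A * e)"
    and Af1: "A * f1 = f1 * A + Z (A * f - f * A) - f * A"
    and eE: "e * (e * A - A * e) = (e * A - A * e) * e"
    and fF: "f * (A * f - f * A) = (A * f - f * A) * f"
    and EA: "(e * A - A * e) * \<tau> A = A * \<tau> (e * A - A * e)"
    and A_tau: "\<tau> A * A = A * \<tau> A"
    and qdet: "(A + ((e * A - A * e) * f - f * (e * A - A * e))) * \<tau> A - (A * f - f * A) * \<tau> (e * A - A * e) = c"
    and fc: "f * c = c * f"
begin

definition "E = e * A - A * e"
definition "F = A * f - f * A"
definition "K = E * f - f * E"
definition "D = A + K"

lemma tau_add: "\<tau> (x + y) = \<tau> x + \<tau> y"
  using tau_diff[of x "0 - y"] tau_diff[of 0 y] tau_diff[of 0 0] by simp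

lemma eE': "e * E = E * e" and fF': "f * F = F * f"
  using eE fF by (simp_all add: E_def F_def)

text \<open>The Jacobi identity for e, A and f, in which [e, f] = h_0 commutes with A.\<close>

lemma Ke: "F * e = e * F - K"
proof -
  have "F * e - e * F + K = A * (f * e - e * f) - (f * e - e * f) * A"
    by (simp add: F_def K_def E_def algebra_simps)
  also have "\<dots> = 0"
    by (simp add: ef algebra_simps h0A)
  finally show ?thesis by (simp add: algebra_simps)
qed

lemma tE: "t * E = E * t + (Z E - A * e) + (Z E - A * e)"
proof -
  have "t * E - E * t = (t * e - e * t) * A - A * (t * e - e * t)"
    by (simp add: E_def algebra_simps tA) (simp add: tA flip: mult.assoc)
  also have "\<dots> = (e1 * A - A * e1) + (e1 * A - A * e1)"
    by (simp add: te algebra_simps)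
  also have "e1 * A - A * e1 = Z E - A * e"
    by (simp add: Ae1 E_def)
  finally show ?thesis by (simp add: algebra_simps)
qed

lemma tF: "t * F = F * t - (Z F - f * A) - (Z F - f * A)"
proof -
  have "t * F - F * t = A * (t * f - f * t) - (t * f - f * t) * A"
    by (simp add: F_def algebra_simps tA) (simp add: tA flip: mult.assoc)
  also have "\<dots> = - (A * f1 - f1 * A) - (A * f1 - f1 * A)"
    by (simp add: tf algebra_simps)
  also have "A * f1 - f1 * A = Z F - f * A"
    by (simp add: Af1 F_def)
  finally show ?thesis by (simp add: algebra_simps)
qed

text \<open>The commutator of t with the identity [e, E] = 0: since t raises the index of e, it
  produces the relation between E and e1, doubled.\<close>

lemma Ee1: "E * e1 = e1 * E - E * e"
proof -
  have "t * (e * E) - (e * E) * t = t * (E * e) - (E * e) * t"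
    by (simp add: eE')
  then have "(t * e - e * t) * E + e * (t * E - E * t) = (t * E - E * t) * e + E * (t * e - e * t)"
    by (simp add: algebra_simps)
  then have "(e1 * E + e * (Z E - A * e)) + (e1 * E + e * (Z E - A * e)) = ((Z E - A * e) * e + E * e1) + ((Z E - A * e) * e + E * e1)"
    unfolding te tE by (simp add: algebra_simps)
  then have "(e1 * E + e * (Z E - A * e) - (Z E - A * e) * e - E * e1) + (e1 * E + e * (Z E - A * e) - (Z E - A * e) * e - E * e1) = 0"
    by (simp add: algebra_simps)
  then have "e1 * E + e * (Z E - A * e) - (Z E - A * e) * e - E * e1 = 0"
    by (simp only: double_eq_0_iff)
  then have "e1 * E + (e * (Z E - A * e) - (Z E - A * e) * e) - E * e1 = 0"
    by (simp only: add_diff_eq)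
  moreover have "e * (Z E - A * e) - (Z E - A * e) * e = - (E * e)"
  proof -
    have "e * (Z E - A * e) - (Z E - A * e) * e = Z (e * E) - Z (E * e) - (e * A - A * e) * e"
      by (simp add: Z_left Z_right algebra_simps)
    then show ?thesis by (simp add: eE' flip: E_def)
  qed
  ultimately show ?thesis by (simp only:) (simp add: algebra_simps)
qed

lemma Fe1: "F * e1 = e1 * F - Z K + F * e + A * h0"
proof -
  have "F * e1 - e1 * F = (A * e1 - e1 * A) * f - f * (A * e1 - e1 * A) - (A * (e1 * f - f * e1) - (e1 * f - f * e1) * A)"
    by (simp add: F_def algebra_simps)
  also have "A * e1 - e1 * A = A * e - Z E"
    by (simp add: Ae1 E_def)
  also have "A * (e1 * f - f * e1) - (e1 * f - f * e1) * A = 0"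
    by (simp add: e1f h1A)
  also have "(A * e - Z E) * f - f * (A * e - Z E) - 0 = - Z K + F * e + A * h0"
    by (simp add: K_def Z_left Z_right Z_diff F_def ef algebra_simps)
  finally show ?thesis by (simp add: algebra_simps)
qed

lemma h0F: "h0 * F = F * h0 - (F + F)"
proof -
  have "h0 * F - F * h0 = A * (h0 * f - f * h0) - (h0 * f - f * h0) * A + (h0 * A - A * h0) * f - f * (h0 * A - A * h0)"
    by (simp add: F_def algebra_simps)
  then show "h0 * F = F * h0 - (F + F)"
    by (simp add: h0A h0f F_def algebra_simps)
qed

lemma Kf: "K * f = f * K - (F + F)"
proof -
  have K: "K = e * F - F * e" using Ke by (simp add: algebra_simps)
  have "K * f - f * K = (e * f - f * e) * F - F * (e * f - f * e) + (e * (F * f - f * F) - (F * f - f * F) * e)"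
    by (simp add: K algebra_simps)
  also have "\<dots> = - (F + F)"
    by (simp add: fF' ef h0F)
  finally show ?thesis by (simp add: algebra_simps)
qed

lemma Df: "D * f = f * D - F"
  using Kf by (simp add: D_def F_def algebra_simps)

lemma tau_E: "\<tau> E = e * \<tau> A - \<tau> A * e" and tau_F: "\<tau> F = \<tau> A * f - f * \<tau> A"
  and tau_K: "\<tau> K = \<tau> E * f - f * \<tau> E" and tau_D: "\<tau> D = \<tau> A + \<tau> K"
  by (simp_all add: E_def F_def K_def D_def tau_diff tau_mult tau_e tau_f tau_add)

lemma EA': "E * \<tau> A = A * \<tau> E"
  using EA by (simp add: E_def)

lemma qdet1: "D * \<tau> A - F * \<tau> E = c"
  using qdet by (simp add: D_def K_def E_def F_def)

text \<open>The commutator of f with E tau A = A tau E converts one expansion of the quantum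
  determinant into the other.\<close>

lemma qdet2: "A * \<tau> D - E * \<tau> F = c"
proof -
  have "(E * \<tau> A) * f - f * (E * \<tau> A) = (A * \<tau> E) * f - f * (A * \<tau> E)"
    by (simp only: EA')
  then have "K * \<tau> A + E * \<tau> F = F * \<tau> E + A * \<tau> K"
    unfolding tau_K tau_F by (simp add: K_def F_def algebra_simps)
  then show ?thesis
    unfolding qdet1[symmetric] tau_D by (simp add: D_def algebra_simps A_tau)
qed

text \<open>The commutator of f with the quantum determinant, which vanishes because f commutes with
  c.\<close>

lemma DF: "D * \<tau> F = F * \<tau> D"
proof -
  have "(D * \<tau> A - F * \<tau> E) * f - f * (D * \<tau> A - F * \<tau> E) = 0"
    by (simp add: qdet1 fc)
  moreover have "(D * \<tau> A - F * \<tau> E) * f - f * (D * \<tau> A - F * \<tau> E) =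
     (D * f - f * D) * \<tau> A + D * \<tau> F - F * \<tau> K - (F * f - f * F) * \<tau> E"
    unfolding tau_K tau_F by (simp add: algebra_simps)
  ultimately show ?thesis
    unfolding tau_D by (simp add: Df fF' algebra_simps)
qed

end

section \<open>Product of two Yangian monodromy matrices with mutually commuting entries\<close>

locale yang_coproduct =
  C1: yang_monodromy Z \<tau> e f e1 f1 h0 h1 t A1 c1 + C2: yang_monodromy Z \<tau> e f e1 f1 h0 h1 t A2 c2 +
  J1: calg_morph J1 + J2: calg_morph J2
  for Z \<tau> :: "'r::calgebra \<Rightarrow> 'r" and e f e1 f1 h0 h1 t A1 c1 A2 c2 and J1 J2 :: "'r \<Rightarrow> 's::calgebra" +
  fixes Z' \<tau>' :: "'s \<Rightarrow> 's"
  assumes comm: "J2 y * J1 x = J1 x * J2 y"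
    and Z'_diff: "Z' (p - q) = Z' p - Z' q" and Z'_left: "Z' p * q = Z' (p * q)" and Z'_right: "p * Z' q = Z' (p * q)"
    and tau'_add: "\<tau>' (p + q) = \<tau>' p + \<tau>' q" and tau'_mult: "\<tau>' (p * q) = \<tau>' p * \<tau>' q"
    and J1_Z: "J1 (Z x) = Z' (J1 x)" and J2_Z: "J2 (Z x) = Z' (J2 x)"
    and J1_tau: "J1 (\<tau> x) = \<tau>' (J1 x)" and J2_tau: "J2 (\<tau> x) = \<tau>' (J2 x)"
begin

definition "\<A> = J1 A1 * J2 A2 + J1 C1.F * J2 C2.E"

lemma comm': "J2 y * (J1 x * w) = J1 x * (J2 y * w)"
  by (metis comm mult.assoc)

lemma J1_mult': "J1 x * (J1 y * w) = J1 (x * y) * w" and J2_mult': "J2 x * (J2 y * w) = J2 (x * y) * w"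
  by (simp_all add: J1.mult J2.mult mult.assoc)

lemma Z'_add: "Z' (x + y) = Z' x + Z' y"
  using Z'_diff[of x "0 - y"] Z'_diff[of 0 y] Z'_diff[of 0 0] by simp

lemma Z'_minus: "Z' (- x) = - Z' x"
  using Z'_diff[of 0 x] Z'_diff[of 0 0] by simp

text \<open>Each product is first sorted into the form J1(word) J2(word), so that the relations of
  either factor can rewrite whole words; \<open>expand\<close> then opens the results up. Applied
  the other way round, the words to be rewritten would be torn apart.\<close>

lemmas collect = distrib_left distrib_right left_diff_distrib right_diff_distrib mult.assoc comm comm'
  J1.mult[symmetric] J2.mult[symmetric] J1_mult' J2_mult' minus_mult_left[symmetric] minus_mult_right[symmetric]

lemmas expand = J1.add J2.add J1.diff J2.diff J1.minus J2.minus J1_Z J2_Z Z'_left Z'_right Z'_add Z'_diff Z'_minus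
  distrib_left distrib_right left_diff_distrib right_diff_distrib

lemma Ae: "A1 * e = e * A1 - C1.E" "A2 * e = e * A2 - C2.E"
  by (simp_all add: C1.E_def C2.E_def)

lemma Af: "A1 * f = f * A1 + C1.F" "A2 * f = f * A2 + C2.F"
  by (simp_all add: C1.F_def C2.F_def)

text \<open>The operator is the coproduct of t, see \<open>Psi_t\<close>. The terms with z in
  [t, F1] and [t, E2] cancel, and the rest is cancelled by the commutator of -2 f tensor e with A1
  tensor A2; f tensor e commutes with F1 tensor E2.\<close>

lemma t_A:
  "(J1 t + J2 t - J1 f * J2 e - J1 f * J2 e) * \<A> = \<A> * (J1 t + J2 t - J1 f * J2 e - J1 f * J2 e)"
  unfolding \<A>_def
  by (simp add: collect, simp add: C1.tA C2.tA C1.tF C2.tE Ae Af C1.fF' C2.eE' expand algebra_simps)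

text \<open>The relation \<open>Dp\<close> of index 0 for the candidate, and the place where the
  prescribed value of the coproduct at x^+_1 enters.\<close>

lemma A_e1: 
  assumes e: "\<e> = J1 e + J2 e" and e1: "\<e>1 = J1 e1 + J2 e1 + J1 h0 * J2 e"
  shows "Z' (\<A> * \<e> - \<e> * \<A>) - (\<A> * \<e>1 - \<e>1 * \<A>) + \<A> * \<e> = 0"
  unfolding \<A>_def e e1
  by (simp add: collect,
    simp add: C1.Ae1 C2.Ae1 Ae C1.Ke C1.Fe1 C2.Ee1 C2.eE' C1.h0A C1.h0F flip: C1.E_def C2.E_def,
    simp add: expand algebra_simps)

lemma E_coproduct: "(J1 e + J2 e) * \<A> - \<A> * (J1 e + J2 e) = J1 C1.E * J2 A2 + J1 C1.D * J2 C2.E"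
  unfolding \<A>_def
  by (simp add: collect, simp add: Ae C1.Ke C2.eE' C1.D_def expand algebra_simps)

lemma F_coproduct: "\<A> * (J1 f + J2 f) - (J1 f + J2 f) * \<A> = J1 C1.F * J2 C2.D + J1 A1 * J2 C2.F"
proof -
  have Ef: "C2.E * f = f * C2.E + C2.K" by (simp add: C2.K_def)
  show ?thesis
    unfolding \<A>_def
    by (simp add: collect, simp add: Af Ef C1.fF' C2.D_def expand algebra_simps)
qed

lemma D_coproduct:
  "\<A> + ((J1 C1.E * J2 A2 + J1 C1.D * J2 C2.E) * (J1 f + J2 f) - (J1 f + J2 f) * (J1 C1.E * J2 A2 + J1 C1.D * J2 C2.E))
    = J1 C1.D * J2 C2.D + J1 C1.E * J2 C2.F"
proof -
  have Ef: "C1.E * f = f * C1.E + C1.K" "C2.E * f = f * C2.E + C2.K" by (simp_all add: C1.K_def C2.K_def)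
  have DA: "C1.D = A1 + C1.K" "C2.D = A2 + C2.K" by (simp_all add: C1.D_def C2.D_def)
  show ?thesis
    unfolding \<A>_def
    by (simp add: collect, simp add: Af Ef C1.Kf DA expand algebra_simps)
qed

text \<open>Two groups of terms cancel by E tau A = A tau E and D tau F = F tau D in the first
  factor. The other two contain both expansions of the first quantum determinant, and c1 (D2 tau A2
  - F2 tau E2) is left.\<close>

lemma qdet_coproduct:
  "(J1 C1.D * J2 C2.D + J1 C1.E * J2 C2.F) * \<tau>' \<A> - (J1 C1.F * J2 C2.D + J1 A1 * J2 C2.F) *
    \<tau>' (J1 C1.E * J2 A2 + J1 C1.D * J2 C2.E) = J1 c1 * J2 c2"
proof -
  have AD: "A1 * \<tau> C1.D = C1.E * \<tau> C1.F + (C1.D * \<tau> A1 - C1.F * \<tau> C1.E)"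
    using C1.qdet1 C1.qdet2 by (simp add: algebra_simps)
  show ?thesis
    unfolding \<A>_def tau'_add tau'_mult J1_tau[symmetric] J2_tau[symmetric]
    unfolding C1.qdet1[symmetric] C2.qdet1[symmetric]
    by (simp add: collect, simp add: AD C1.EA' C1.DF J1.diff J2.diff J1.add algebra_simps)
qed

end

sublocale yangian_A \<subseteq> mono: yang_monodromy "fls_shift 1" tau "P 0" "M 0" "P 1" "M 1"
  "fls_const (h 0)" "fls_const (h 1)" "fls_const t" A c
proof
  fix x y :: "'a fls"
  show "fls_shift 1 (x - y) = fls_shift 1 x - fls_shift 1 y" "fls_shift 1 x * y = fls_shift 1 (x * y)"
    "x * fls_shift 1 y = fls_shift 1 (x * y)"
    by (simp_all add: fls_shifted_times_simps)
  show "tau (x - y) = tau x - tau y" "tau (x * y) = tau x * tau y"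
    by (simp_all add: shift_mat.diff shift_mat.mult)
  have tau_const: "tau (fls_const a) = fls_const a" for a :: 'a
  proof (rule fls_eqI)
    fix n
    have "(0::complex) gchoose nat n = 0" if "0 < n"
      using that by (cases "nat n") simp_all
    then show "tau (fls_const a) $$ n = fls_const a $$ n"
      using shift_mat.nth[OF ord_ge_const[of 0 a], where n = n and S = "{0..max 0 n}"]
      by (simp add: if_distrib[of "sc _"] sum.delta shift_mat_def sc_one cong: if_cong)
  qed
  show "tau (P 0) = P 0" "tau (M 0) = M 0"
    by (rule tau_const)+
  show "P 0 * M 0 = M 0 * P 0 + fls_const (h 0)" "P 1 * M 0 = M 0 * P 1 + fls_const (h 1)"
    using pm[of 0 0] pm[of 1 0] by (simp_all add: algebra_simps flip: fls_plus_const)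
  show "fls_const (h 0) * A = A * fls_const (h 0)" "fls_const (h 1) * A = A * fls_const (h 1)"
    by (rule hA)+
  show "fls_const (h 0) * P 0 = P 0 * fls_const (h 0) + (P 0 + P 0)"
    "fls_const (h 0) * M 0 = M 0 * fls_const (h 0) - (M 0 + M 0)"
    using h0p[of 0] h0m[of 0] by (simp_all add: diff_eq_eq fls_const_diff flip: fls_plus_const)
  show "fls_const t * P 0 = P 0 * fls_const t + (P 1 + P 1)" "fls_const t * M 0 = M 0 * fls_const t - (M 1 + M 1)"
    using t_plus[of 0] t_minus[of 0] by (simp_all add: diff_eq_eq fls_const_diff flip: fls_plus_const)
  show "fls_const t * A = A * fls_const t"
  proof (rule fls_eqI)
    fix n
    have "h s * A $$ n = A $$ n * h s" for s
      using hA[of s] by (simp add: fls_eq_iff fls_const_times_nth fls_times_const_nth)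
    then show "(fls_const t * A) $$ n = (A * fls_const t) $$ n"
      by (simp add: t_def fls_const_times_nth fls_times_const_nth left_diff_distrib right_diff_distrib
        sc_mult_left sc_mult_right) (metis mult.assoc)
  qed
  show "A * P 1 = P 1 * A + A * P 0 - fls_shift 1 E"
    using A_plus[of 0] by (simp add: algebra_simps)
  show "A * M 1 = M 1 * A + fls_shift 1 F - M 0 * A"
    using A_minus[of 0] by (simp add: algebra_simps)
qed (rule eE fF EA A_tau qdet cM)+

section \<open>The Yangian coproduct of A\<close>

lemma yangian_image:
  assumes "yangian xp xm h u" "calg_morph J"
  shows "yangian (\<lambda>n. J (xp n)) (\<lambda>n. J (xm n)) (\<lambda>n. J (h n)) (J u)"
proof -
  interpret yangian xp xm h u by fact
  interpret J: calg_morph J by fact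
  show ?thesis
  proof
    fix r s
    show "J (h r) * J (h s) = J (h s) * J (h r)"
      using hh by (simp flip: J.mult)
    show "J (h 0) * J (xp s) - J (xp s) * J (h 0) = J (xp s) + J (xp s)"
      "J (h 0) * J (xm s) - J (xm s) * J (h 0) = - (J (xm s) + J (xm s))"
      using h0p h0m by (simp_all only: flip: J.mult J.diff J.add J.minus)
    show "J (h (Suc r)) * J (xp s) - J (xp s) * J (h (Suc r)) - (J (h r) * J (xp (Suc s)) - J (xp (Suc s)) * J (h r)) =
      J (h r) * J (xp s) + J (xp s) * J (h r)"
      "J (h (Suc r)) * J (xm s) - J (xm s) * J (h (Suc r)) - (J (h r) * J (xm (Suc s)) - J (xm (Suc s)) * J (h r)) =
      - (J (h r) * J (xm s) + J (xm s) * J (h r))"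
      using hp hm by (simp_all only: flip: J.mult J.diff J.add J.minus)
    show "J (xp r) * J (xm s) - J (xm s) * J (xp r) = J (h (r + s))"
      using pm by (simp only: flip: J.mult J.diff J.add J.minus)
    show "J (xp (Suc r)) * J (xp s) - J (xp s) * J (xp (Suc r)) - (J (xp r) * J (xp (Suc s)) - J (xp (Suc s)) * J (xp r)) =
       J (xp r) * J (xp s) + J (xp s) * J (xp r)"
      "J (xm (Suc r)) * J (xm s) - J (xm s) * J (xm (Suc r)) - (J (xm r) * J (xm (Suc s)) - J (xm (Suc s)) * J (xm r)) =
       - (J (xm r) * J (xm s) + J (xm s) * J (xm r))"
      using pp mm by (simp_all only: flip: J.mult J.diff J.add J.minus)
    show "unit_on (J u) (J (xp s))" "unit_on (J u) (J (xm s))" "J u * J u = J u"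
      using up um uu by (simp_all add: unit_on_def flip: J.mult)
  qed
qed

text \<open>\<open>Psi\<close> will be the coproduct followed by the two projections, and
  \<open>J1\<close>, \<open>J2\<close> the maps y -> y tensor 1 and y -> 1 tensor y followed by the
  same projections.\<close>

locale yangian_coproduct =
  Y1: yangian_A xp xm h u A1 c1 l1 + Y2: yangian_A xp xm h u A2 c2 l2 +
  J1: calg_morph J1 + J2: calg_morph J2 + Psi: calg_morph Psi
  for xp xm h :: "nat \<Rightarrow> 'a::calgebra" and u A1 c1 l1 A2 c2 l2 and J1 J2 Psi :: "'a \<Rightarrow> 'b::calgebra" +
  assumes commJ: "J2 y * J1 x = J1 x * J2 y"
    and Psi_xp: "Psi (xp 0) = J1 (xp 0) + J2 (xp 0)"
    and Psi_xm: "Psi (xm 0) = J1 (xm 0) + J2 (xm 0)"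
    and Psi_h: "Psi (h 0) = J1 (h 0) + J2 (h 0)"
    and Psi_xp1: "Psi (xp 1) = J1 (xp 1) + J2 (xp 1) + J1 (h 0) * J2 (xp 0)"
    and units: "J1 u = Psi u" "J2 u = Psi u"
begin

sublocale S1: calg_morph "fls_map J1" by (rule J1.fls_map_morph)
sublocale S2: calg_morph "fls_map J2" by (rule J2.fls_map_morph)

sublocale yang_coproduct "fls_shift 1" tau "Y1.P 0" "Y1.M 0" "Y1.P 1" "Y1.M 1"
  "fls_const (h 0)" "fls_const (h 1)" "fls_const Y1.t" A1 c1 A2 c2 "fls_map J1" "fls_map J2" "fls_shift 1" tau
proof
  fix x y :: "'a fls"
  show "fls_map J2 y * fls_map J1 x = fls_map J1 x * fls_map J2 y"
    by (rule fls_map_commute[OF J1.calg_morph_axioms J2.calg_morph_axioms commJ])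
  show "fls_map J1 (fls_shift 1 x) = fls_shift 1 (fls_map J1 x)" "fls_map J2 (fls_shift 1 x) = fls_shift 1 (fls_map J2 x)"
    by (rule J1.fls_map_shift J2.fls_map_shift)+
  show "fls_map J1 (tau x) = tau (fls_map J1 x)" "fls_map J2 (tau x) = tau (fls_map J2 x)"
    by (rule shift_mat.fls_map, unfold_locales)+
next
  fix p q :: "'b fls"
  show "fls_shift 1 (p - q) = fls_shift 1 p - fls_shift 1 q" "fls_shift 1 p * q = fls_shift 1 (p * q)"
    "p * fls_shift 1 q = fls_shift 1 (p * q)"
    by (simp_all add: fls_shifted_times_simps)
  show "tau (p + q) = tau p + tau q" "tau (p * q) = tau p * tau q"
    by (simp_all add: shift_mat.add shift_mat.mult)
qed

sublocale T: yangian "\<lambda>n. Psi (xp n)" "\<lambda>n. Psi (xm n)" "\<lambda>n. Psi (h n)" "Psi u"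
  by (rule yangian_image) unfold_locales

text \<open>The image of h_1 is computed from [x^+_1, x^-_0]; the term h_0 tensor h_0 that appears
  in it is removed by half of the square of the image of h_0.\<close>

lemma Psi_t: "Psi Y1.t = J1 Y1.t + J2 Y1.t - J1 (xm 0) * J2 (xp 0) - J1 (xm 0) * J2 (xp 0)"
proof -
  have "h 1 = xp 1 * xm 0 - xm 0 * xp 1" "h 0 * xm 0 - xm 0 * h 0 = - (xm 0 + xm 0)" "h 0 = xp 0 * xm 0 - xm 0 * xp 0"
    using Y1.pm[of 1 0] Y1.h0m[of 0] Y1.pm[of 0 0] by simp_all
  then have h1: "J1 (h 1) = J1 (xp 1) * J1 (xm 0) - J1 (xm 0) * J1 (xp 1)" "J2 (h 1) = J2 (xp 1) * J2 (xm 0) - J2 (xm 0) * J2 (xp 1)"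
      "Psi (h 1) = Psi (xp 1) * Psi (xm 0) - Psi (xm 0) * Psi (xp 1)"
    and h0: "J2 (h 0) = J2 (xp 0) * J2 (xm 0) - J2 (xm 0) * J2 (xp 0)"
    and h0m: "J1 (h 0) * J1 (xm 0) - J1 (xm 0) * J1 (h 0) = - (J1 (xm 0) + J1 (xm 0))"
    by (simp_all only: flip: J1.mult J2.mult Psi.mult J1.diff J2.diff Psi.diff J1.add J1.minus)
  have comm': "J2 y * (J1 x * w) = J1 x * (J2 y * w)" for x y w
    by (metis commJ mult.assoc)
  have "Psi (h 1) = J1 (h 1) + J2 (h 1) + (J1 (h 0) * J1 (xm 0) - J1 (xm 0) * J1 (h 0)) * J2 (xp 0)
      + J1 (h 0) * (J2 (xp 0) * J2 (xm 0) - J2 (xm 0) * J2 (xp 0))"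
    unfolding h1 Psi_xp1 Psi_xm by (simp add: algebra_simps commJ comm')
  then have P1: "Psi (h 1) = J1 (h 1) + J2 (h 1) - J1 (xm 0) * J2 (xp 0) - J1 (xm 0) * J2 (xp 0) + J1 (h 0) * J2 (h 0)"
    unfolding h0m h0[symmetric] by (simp add: algebra_simps)
  have "Psi (h 0) * Psi (h 0) = J1 (h 0) * J1 (h 0) + J2 (h 0) * J2 (h 0) + (J1 (h 0) * J2 (h 0) + J1 (h 0) * J2 (h 0))"
    unfolding Psi_h by (simp add: algebra_simps commJ)
  then have "sc (1/2) (Psi (h 0) * Psi (h 0)) = sc (1/2) (J1 (h 0) * J1 (h 0)) + sc (1/2) (J2 (h 0) * J2 (h 0)) + J1 (h 0) * J2 (h 0)"
    using sc_half_double[of "J1 (h 0) * J2 (h 0)"] by (simp add: sc_add_right)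
  then show ?thesis
    by (simp add: Y1.t_def Psi.diff Psi.sc Psi.mult J1.diff J1.sc J1.mult J2.diff J2.sc J2.mult P1[unfolded One_nat_def])
qed

text \<open>The image of t commutes with the candidate, so its commutator with the relation of index
  s is twice the relation of index s + 1.\<close>

lemma A_plus_coproduct: "fls_shift 1 (\<A> * T.P s - T.P s * \<A>) - (\<A> * T.P (Suc s) - T.P (Suc s) * \<A>) + \<A> * T.P s = 0"
proof (induction s)
  case 0
  show ?case
    using A_e1[OF refl refl]
    by (simp add: J1.fls_map_const J2.fls_map_const Psi_xp Psi_xp1[unfolded One_nat_def] flip: fls_plus_const)
next
  case (Suc s)
  let ?t = "fls_const (Psi Y1.t)"
  let ?D = "\<lambda>s. fls_shift 1 (\<A> * T.P s - T.P s * \<A>) - (\<A> * T.P (Suc s) - T.P (Suc s) * \<A>) + \<A> * T.P s"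
  have tA: "?t * \<A> = \<A> * ?t"
    using t_A by (simp add: J1.fls_map_const J2.fls_map_const Psi_t fls_const_diff flip: fls_plus_const)
  have tA': "?t * (\<A> * x) = \<A> * (?t * x)" for x
    by (simp add: tA flip: mult.assoc)
  have tP: "?t * T.P n - T.P n * ?t = T.P (Suc n) + T.P (Suc n)" for n
  proof -
    have "Psi (Y1.t * xp n - xp n * Y1.t) = Psi (xp (Suc n) + xp (Suc n))"
      by (simp only: Y1.t_plus)
    then show ?thesis
      by (simp add: Psi.diff Psi.mult Psi.add flip: fls_const_diff fls_plus_const)
  qed
  have "?t * ?D s - ?D s * ?t = fls_shift 1 (\<A> * (?t * T.P s - T.P s * ?t) - (?t * T.P s - T.P s * ?t) * \<A>)
     - (\<A> * (?t * T.P (Suc s) - T.P (Suc s) * ?t) - (?t * T.P (Suc s) - T.P (Suc s) * ?t) * \<A>)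
     + \<A> * (?t * T.P s - T.P s * ?t)"
    by (simp add: algebra_simps fls_shifted_times_simps tA tA' del: fls_const_mult_const)
  also have "\<dots> = ?D (Suc s) + ?D (Suc s)"
    unfolding tP by (simp add: algebra_simps)
  finally have "?D (Suc s) + ?D (Suc s) = 0"
    unfolding Suc by simp
  then show ?case
    by (simp only: double_eq_0_iff)
qed

lemma unit_images:
  assumes "unit_on u x"
  shows "unit_on (Psi u) (J1 x)" "unit_on (Psi u) (J2 x)" "unit_on (Psi u) (Psi x)"
proof -
  have "u * x = x" "x * u = x" using assms by (simp_all add: unit_on_def)
  then show "unit_on (Psi u) (Psi x)"
    by (simp add: unit_on_def flip: Psi.mult)
  show "unit_on (Psi u) (J1 x)"
    using \<open>u * x = x\<close> \<open>x * u = x\<close> by (simp add: unit_on_def flip: units(1) J1.mult)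
  show "unit_on (Psi u) (J2 x)"
    using \<open>u * x = x\<close> \<open>x * u = x\<close> by (simp add: unit_on_def flip: units(2) J2.mult)
qed

lemma unit_A: "unit_on T.Uc \<A>"
proof -
  have "unit_on Y1.Uc Y1.F" "unit_on Y1.Uc Y2.E"
    by (intro unit_on_intros Y1.up Y1.um Y1.uA Y2.uA)+
  then show ?thesis
    using Y1.uA Y2.uA unfolding \<A>_def Y1.mono.F_def Y2.mono.E_def
    by (intro unit_on_add unit_on_mult) (auto simp: unit_on_nth unit_images simp del: fls_minus_nth)
qed

sublocale TA: yangian_plus "\<lambda>n. Psi (xp n)" "\<lambda>n. Psi (xm n)" "\<lambda>n. Psi (h n)" "Psi u" \<A>
  by unfold_locales (rule unit_A A_plus_coproduct)+

lemma T_P0: "T.P 0 = fls_map J1 (Y1.P 0) + fls_map J2 (Y1.P 0)"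
  and T_M0: "T.M 0 = fls_map J1 (Y1.M 0) + fls_map J2 (Y1.M 0)"
  by (simp_all add: Psi_xp Psi_xm J1.fls_map_const J2.fls_map_const flip: fls_plus_const)

lemma A_H_coproduct: "\<A> * T.H * tau \<A> = fls_map J1 c1 * fls_map J2 c2"
  unfolding TA.A_H_tau T_P0 T_M0 E_coproduct F_coproduct D_coproduct by (rule qdet_coproduct)

text \<open>F1 starts at least one degree later than A1, since the leading coefficient u of A1
  commutes with x^-_0; the second summand therefore does not reach the leading degree.\<close>

lemma A_lead: "ord_ge (l1 + l2) \<A>" "\<A> $$ (l1 + l2) = Psi u"
proof -
  have F: "ord_ge l1 (fls_map J1 Y1.mono.F)" "fls_map J1 Y1.mono.F $$ l1 = 0"
    using Y1.A_lead Y1.um unfolding Y1.mono.F_def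
    by (auto simp: ord_ge_def fls_const_times_nth fls_times_const_nth J1.zero unit_on_def)
  have E: "ord_ge l2 (fls_map J2 Y2.mono.E)"
    using Y2.A_lead unfolding Y2.mono.E_def
    by (auto simp: ord_ge_def fls_const_times_nth fls_times_const_nth J2.zero)
  have A: "ord_ge l1 (fls_map J1 A1)" "ord_ge l2 (fls_map J2 A2)"
    using Y1.A_lead Y2.A_lead by (auto intro: J1.fls_map_ord_ge J2.fls_map_ord_ge)
  show "ord_ge (l1 + l2) \<A>"
    unfolding \<A>_def by (intro ord_ge_add ord_ge_mult A E F)
  show "\<A> $$ (l1 + l2) = Psi u"
    unfolding \<A>_def fls_plus_nth fls_times_nth_lead[OF A] fls_times_nth_lead[OF F(1) E] F(2)
    using Y1.A_lead(2) Y2.A_lead(2) T.uu by (simp add: units)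
qed

theorem coproduct_A:
  assumes "yangian_A xp xm h u A c (l1 + l2)" and c: "fls_map Psi c = fls_map J1 c1 * fls_map J2 c2"
  shows "fls_map Psi A = \<A>"
proof -
  interpret G: yangian_A xp xm h u A c "l1 + l2" by fact
  interpret S: calg_morph "fls_map Psi" by (rule Psi.fls_map_morph)
  have unit: "unit_on (Psi u) (\<A> $$ n)" "unit_on (Psi u) (fls_map Psi A $$ n)" for n
    using unit_A G.uA unfolding unit_on_nth by (auto intro: unit_images)
  have H: "fls_map Psi Y1.H = T.H"
    by (rule fls_eqI) (simp add: Y1.H_nth T.H_nth Psi.zero)
  have "fls_map Psi A * T.H * tau (fls_map Psi A) = fls_map Psi (A * Y1.H * tau A)"
    by (simp add: S.mult H shift_mat.fls_map[OF Psi.calg_morph_axioms])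
  also have "A * Y1.H * tau A = c"
    using G.HA G.HAc by (simp add: mult.assoc)
  finally have eq: "fls_map Psi A * T.H * tau (fls_map Psi A) = \<A> * T.H * tau \<A>"
    unfolding A_H_coproduct c .
  show ?thesis
    by (rule shift_mat.mult_tri_unique[of "l1 + l2" "fls_map Psi A" "Psi u" \<A> T.H "Psi u"])
      (use unit G.A_lead in \<open>auto simp: A_lead T.H_ord T.H_nth unit_on_def T.uu shift_mat_diag eq intro: Psi.fls_map_ord_ge\<close>)
qed

end

section \<open>The coproduct of the series A for the quantum affine algebra\<close>

text \<open>
  The analogue of \<open>yang_monodromy\<close>: here \<open>\<tau>\<close> is \<open>z \<mapsto> q\<^sup>2 z\<close>, and the letters stand for
  \<open>x\<^sup>+\<^sub>0, x\<^sup>-\<^sub>0, x\<^sup>+\<^sub>1, x\<^sup>-\<^sub>1, \<phi>\<^sup>+\<^sub>0, \<phi>\<^sup>-\<^sub>0, h\<^sub>1, [x\<^sup>+\<^sub>0, x\<^sup>-\<^sub>1]\<close>.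
\<close>

locale qaff_monodromy =
  fixes q :: complex and Z \<tau> :: "'r::calgebra \<Rightarrow> 'r" and e f e1 f1 k k' h \<psi> A c :: 'r
  assumes q0: "q \<noteq> 0" and q2: "q - 1/q \<noteq> 0" "q + 1/q \<noteq> 0"
    and Z_diff: "Z (x - y) = Z x - Z y" and Z_left: "Z x * y = Z (x * y)" and Z_right: "x * Z y = Z (x * y)"
    and Z_sc: "Z (sc a x) = sc a (Z x)"
    and tau_diff: "\<tau> (x - y) = \<tau> x - \<tau> y" and tau_mult: "\<tau> (x * y) = \<tau> x * \<tau> y" and tau_sc: "\<tau> (sc a x) = sc a (\<tau> x)"
    and tau_e: "\<tau> e = e" and tau_f: "\<tau> f = f" and tau_k: "\<tau> k' = k'"
    and ef: "sc q (e * f - f * e) - sc (1/q) (e * f - f * e) = k - k'"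
    and ke: "k * e = sc q (sc q (e * k))" and kf: "k * f = sc (1/q) (sc (1/q) (f * k))"
    and k'e: "k' * e = sc (1/q) (sc (1/q) (e * k'))" and k'f: "k' * f = sc q (sc q (f * k'))"
    and kA: "k * A = A * k" and k'A: "k' * A = A * k'"
    and ef1: "e * f1 = f1 * e + \<psi>" and \<psi>A: "\<psi> * A = A * \<psi>"
    and \<psi>f: "\<psi> * f = sc (1/q) (sc (1/q) (f * \<psi>)) - (sc q (k * f1) + sc (1/q) (k * f1))"
    and kf1: "k * f1 = sc (1/q) (sc (1/q) (f1 * k))" and k'f1: "k' * f1 = sc q (sc q (f1 * k'))"
    and f1f: "f1 * f = sc (1/q) (sc (1/q) (f * f1))"
    and he: "h * e = e * h + (sc q e1 + sc (1/q) e1)" and hf: "h * f = f * h - (sc q f1 + sc (1/q) f1)"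
    and hA: "h * A = A * h" and hk: "h * k = k * h" and hk': "h * k' = k' * h"
    and Ae: "A * e - e * A = Z (sc (1/q) (sc (1/q) (A * e1)) - e1 * A)"
    and Af: "A * f - f * A = Z (A * f1 - sc (1/q) (sc (1/q) (f1 * A)))"
    and eE: "e * (sc q (e * A) - sc (1/q) (A * e)) = (sc q (e * A) - sc (1/q) (A * e)) * e"
    and Ff: "(A * f - f * A) * f = sc (1/q) (sc (1/q) (f * (A * f - f * A)))"
    and EA: "(sc q (e * A) - sc (1/q) (A * e)) * \<tau> A = A * \<tau> (sc q (e * A) - sc (1/q) (A * e))"
    and A_tau: "\<tau> A * A = A * \<tau> A"
    and qdet: "(k' * A + ((sc q (e * A) - sc (1/q) (A * e)) * f - f * (sc q (e * A) - sc (1/q) (A * e)))) * \<tau> A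
      - (A * f - f * A) * \<tau> (sc q (e * A) - sc (1/q) (A * e)) = c"
    and fc: "c * f = sc (1/q) (sc (1/q) (f * c))"
begin

abbreviation "Q \<equiv> sc q"
abbreviation "R \<equiv> sc (1/q)"

definition "E = Q (e * A) - R (A * e)"
definition "F = A * f - f * A"
definition "K = E * f - f * E"
definition "D = k' * A + K"

lemma Z_add: "Z (x + y) = Z x + Z y"
  using Z_diff[of x "0 - y"] Z_diff[of 0 y] Z_diff[of 0 0] by simp

lemma Z_minus: "Z (- x) = - Z x"
  using Z_diff[of 0 x] Z_diff[of 0 0] by simp

lemma tau_add: "\<tau> (x + y) = \<tau> x + \<tau> y"
  using tau_diff[of x "0 - y"] tau_diff[of 0 y] tau_diff[of 0 0] by simp

lemma QR: "Q (R x) = x" "R (Q x) = x" 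
  using q0 by (simp_all add: sc_sc sc_one)

lemma QR_cancel: "Q x - R x = Q y - R y \<longleftrightarrow> x = y" "Q x + R x = Q y + R y \<longleftrightarrow> x = y"
  using sc_cancel[OF q2(1), of x y] sc_cancel[OF q2(2), of x y]
  by (simp_all add: sc_add_left sc_diff_left)

lemmas lin = sc_add_right sc_diff_right sc_minus_right sc_mult_left sc_mult_right QR
  Z_left Z_right Z_add Z_diff Z_minus Z_sc distrib_left distrib_right left_diff_distrib right_diff_distrib

lemma eE': "e * E = E * e" and Ff': "F * f = R (R (f * F))"
  using eE Ff by (simp_all add: E_def F_def)

lemma Ae': "A * e = Q (Q (e * A)) - Q E"
  by (simp add: E_def lin)

lemma kE: "k * E = Q (Q (E * k))" and k'E: "k' * E = R (R (E * k'))"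
  and kF: "k * F = R (R (F * k))" and k'F: "k' * F = Q (Q (F * k'))"
proof -
  have k: "k * (A * x) = A * (k * x)" "k * (e * x) = Q (Q (e * (k * x)))" "k * (f * x) = R (R (f * (k * x)))" for x
    using kA ke kf by (metis mult.assoc sc_mult_left)+
  have k': "k' * (A * x) = A * (k' * x)" "k' * (e * x) = R (R (e * (k' * x)))" "k' * (f * x) = Q (Q (f * (k' * x)))" for x
    using k'A k'e k'f by (metis mult.assoc sc_mult_left)+
  show "k * E = Q (Q (E * k))" "k' * E = R (R (E * k'))" "k * F = R (R (F * k))" "k' * F = Q (Q (F * k'))"
    unfolding E_def F_def by (simp_all add: lin mult.assoc k k' ke kf k'e k'f kA k'A)
qed

text \<open>[E, f] and the q-commutator of e with F differ by (q - 1/q) [e, f] A = (k - k') A,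
  because [e, f] commutes with A. This trades k' for k.\<close>

lemma D_k: "D = k * A + Q (e * F) - R (F * e)"
proof -
  have "(Q (e * f - f * e) - R (e * f - f * e)) * A = Q ((e * f - f * e) * A) - R (A * (e * f - f * e))"
  proof -
    have "Q ((e * f - f * e) * A) - R ((e * f - f * e) * A) = Q (A * (e * f - f * e)) - R (A * (e * f - f * e))"
      using arg_cong[OF ef, of "\<lambda>y. y * A"] arg_cong[OF ef, of "\<lambda>y. A * y"]
      by (simp add: left_diff_distrib right_diff_distrib sc_mult_left sc_mult_right kA k'A
          flip: sc_diff_right)
    then have "(e * f - f * e) * A = A * (e * f - f * e)"
      by (simp only: QR_cancel)
    then show ?thesis by (simp add: left_diff_distrib sc_mult_left)
  qed
  then have "Q ((e * f - f * e) * A) - R (A * (e * f - f * e)) = (k - k') * A"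
    by (simp only: ef)
  moreover have "k' * A + K - (Q (e * F) - R (F * e)) = k' * A + (Q ((e * f - f * e) * A) - R (A * (e * f - f * e)))"
    by (simp add: K_def E_def F_def lin algebra_simps)
  ultimately have "k' * A + K - (Q (e * F) - R (F * e)) = k' * A + (k - k') * A"
    by (simp only:)
  then show ?thesis
    by (simp add: D_def algebra_simps)
qed

lemma gF: "R ((e * f - f * e) * F - F * (e * f - f * e)) = - (k * F) - F * k'"
proof -
  let ?g = "e * f - f * e"
  have "Q (?g * F - F * ?g) - R (?g * F - F * ?g) = (Q ?g - R ?g) * F - F * (Q ?g - R ?g)"
    by (simp add: lin)
  also have "\<dots> = (k - k') * F - F * (k - k')"
    by (simp only: ef)
  also have "\<dots> = Q (Q (- (k * F) - F * k')) - R (Q (- (k * F) - F * k'))"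
    by (simp add: lin kF k'F algebra_simps)
  finally have "?g * F - F * ?g = Q (- (k * F) - F * k')"
    by (simp only: QR_cancel)
  then show ?thesis by (simp only: QR)
qed

text \<open>Computed from the second form of D: F q-commutes with f, and the commutators of e with f
  are collected in \<open>gF\<close>.\<close>

lemma Df: "D * f = R (R (f * D)) - F * k'"
proof -
  have kAf: "k * A * f = k * F + R (R (f * (k * A)))"
  proof -
    have "k * A * f = k * (F + f * A)"
      by (simp add: F_def algebra_simps)
    also have "\<dots> = k * F + (k * f) * A"
      by (simp add: algebra_simps)
    finally show ?thesis by (simp add: kf lin mult.assoc)
  qed
  have "Q (e * F * f) - R (F * e * f) - R (R (f * (Q (e * F) - R (F * e)))) = 
      R ((e * f - f * e) * F - F * (e * f - f * e)) + (Q (e * (F * f - R (R (f * F)))) - R ((F * f - R (R (f * F))) * e))"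
    by (simp add: lin algebra_simps)
  also have "\<dots> = - (k * F) - F * k'"
    unfolding gF Ff' by (simp add: lin)
  finally have *: "Q (e * F * f) - R (F * e * f) = R (R (f * (Q (e * F) - R (F * e)))) - k * F - F * k'"
    by (simp add: algebra_simps)
  have "D * f = k * A * f + (Q (e * F * f) - R (F * e * f))"
    by (simp add: D_k lin algebra_simps)
  also have "\<dots> = R (R (f * D)) - F * k'"
    unfolding * kAf by (simp add: D_k lin algebra_simps)
  finally show ?thesis .
qed

lemma tau_E: "\<tau> E = Q (e * \<tau> A) - R (\<tau> A * e)" and tau_F: "\<tau> F = \<tau> A * f - f * \<tau> A"
  and tau_K: "\<tau> K = \<tau> E * f - f * \<tau> E" and tau_D: "\<tau> D = k' * \<tau> A + \<tau> K"
  by (simp_all add: E_def F_def K_def D_def tau_diff tau_mult tau_e tau_f tau_add tau_sc tau_k)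

lemma EA': "E * \<tau> A = A * \<tau> E"
  using EA by (simp add: E_def)

lemma qdet1: "D * \<tau> A - F * \<tau> E = c"
  using qdet by (simp add: D_def K_def E_def F_def)

lemma qdet2: "A * \<tau> D - E * \<tau> F = c"
proof -
  have "(E * \<tau> A) * f - f * (E * \<tau> A) = (A * \<tau> E) * f - f * (A * \<tau> E)"
    by (simp only: EA')
  then have "K * \<tau> A + E * \<tau> F = F * \<tau> E + A * \<tau> K"
    unfolding tau_K tau_F by (simp add: K_def F_def algebra_simps)
  moreover have "A * (k' * \<tau> A) = k' * A * \<tau> A"
    by (simp only: k'A flip: mult.assoc)
  ultimately show ?thesis
    unfolding qdet1[symmetric] tau_D by (simp add: D_def algebra_simps)
qed

lemma DF: "D * \<tau> F = F * \<tau> D"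
proof -
  have "(D * \<tau> A - F * \<tau> E) * f - R (R (f * (D * \<tau> A - F * \<tau> E))) = 0"
    by (simp add: qdet1 fc)
  moreover have "(D * \<tau> A - F * \<tau> E) * f - R (R (f * (D * \<tau> A - F * \<tau> E))) =
     (D * f - R (R (f * D))) * \<tau> A + D * \<tau> F - F * \<tau> K - (F * f - R (R (f * F))) * \<tau> E"
    unfolding tau_K tau_F by (simp add: lin algebra_simps)
  ultimately show ?thesis
    unfolding tau_D by (simp add: Df Ff' algebra_simps)
qed

text \<open>F is a multiple of z. In the tensor product this factor z can be handed over to the
  other tensor factor.\<close>

lemma F_Z: "F = Z (A * f1 - R (R (f1 * A)))"
  using Af by (simp add: F_def)

text \<open>The commutator [h, E] is a combination of e1 A and A e1; the relation \<open>Ae\<close>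
  removes e1 from it, at the price of a factor z.\<close>

lemma hE: "Z (h * E - E * h) = (e * A - A * e) + Q (Q (e * A - A * e))"
proof -
  have "h * E - E * h = Q ((h * e - e * h) * A) - R (A * (h * e - e * h)) + (Q (e * (h * A - A * h)) - R ((h * A - A * h) * e))"
    by (simp add: E_def lin algebra_simps)
  also have "\<dots> = Q ((Q e1 + R e1) * A) - R (A * (Q e1 + R e1))"
    by (simp add: hA he)
  finally have "Z (h * E - E * h) = - (Z (R (R (A * e1)) - e1 * A) + Q (Q (Z (R (R (A * e1)) - e1 * A))))"
    by (simp add: lin)
  then show ?thesis
    unfolding Ae[symmetric] by (simp add: lin algebra_simps)
qed

lemma hF: "h * F - F * h = - (Q (A * f1 - f1 * A) + R (A * f1 - f1 * A))"
proof -
  have "h * F - F * h = A * (h * f - f * h) - (h * f - f * h) * A + ((h * A - A * h) * f - f * (h * A - A * h))"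
    by (simp add: F_def lin algebra_simps)
  then show ?thesis by (simp add: hA hf lin algebra_simps)
qed

text \<open>The commutator of h with F f = q^(-2) f F, where h raises the index of f; the factor q +
  1/q is cancelled at the end.\<close>

lemma Ff1: "F * f1 = f1 * F"
proof -
  have "h * (F * f) - F * f * h = R (R (h * (f * F) - f * F * h))"
    by (simp add: Ff' lin)
  then have "(h * F - F * h) * f + F * (h * f - f * h) = R (R ((h * f - f * h) * F + f * (h * F - F * h)))"
    by (simp add: lin algebra_simps)
  then have "Q ((A * f1 - f1 * A) * f + F * f1) + R ((A * f1 - f1 * A) * f + F * f1) =
      Q (R (R (f1 * F + f * (A * f1 - f1 * A)))) + R (R (R (f1 * F + f * (A * f1 - f1 * A))))"
    unfolding hF hf by (simp add: lin algebra_simps)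
  then have *: "(A * f1 - f1 * A) * f + F * f1 = R (R (f1 * F + f * (A * f1 - f1 * A)))"
    by (simp only: QR_cancel)
  have "(A * f1 - f1 * A) * f - R (R (f * (A * f1 - f1 * A))) = R (R (F * f1)) - f1 * F
      + (A * (f1 * f - R (R (f * f1))) - (f1 * f - R (R (f * f1))) * A)"
    by (simp add: F_def lin algebra_simps)
  then have "(A * f1 - f1 * A) * f = R (R (f * (A * f1 - f1 * A))) + (R (R (F * f1)) - f1 * F)"
    by (simp add: f1f diff_eq_eq)
  note ** = this
  define X where "X = (A * f1 - f1 * A) * f"
  define Y where "Y = f * (A * f1 - f1 * A)"
  have X: "X = R (R Y) + (R (R (F * f1)) - f1 * F)"
    using ** by (simp only: X_def Y_def)
  have "X + F * f1 = R (R (f1 * F + Y))"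
    using * by (simp only: X_def Y_def)
  then have "R (R Y) + (R (R (F * f1)) - f1 * F) + F * f1 = R (R (f1 * F)) + R (R Y)"
    by (simp only: X sc_add_right)
  then have *: "R (R (F * f1)) + F * f1 = R (R (f1 * F)) + f1 * F"
    by (simp add: algebra_simps)
  have "Q (R (R (F * f1)) + F * f1) = Q (R (R (f1 * F)) + f1 * F)"
    unfolding * ..
  then have "Q (F * f1) + R (F * f1) = Q (f1 * F) + R (f1 * F)"
    by (simp only: sc_add_right QR add.commute)
  then show ?thesis by (simp only: QR_cancel)
qed

lemma Ef1: "Z (E * f1) = R (R (Z (f1 * E))) + D - k * A"
proof -
  have "E * f1 - R (R (f1 * E)) = Q (e * (A * f1 - R (R (f1 * A)))) - R ((A * f1 - R (R (f1 * A))) * e)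
      + R ((e * f1 - f1 * e) * A - A * (e * f1 - f1 * e))"
    by (simp add: E_def lin algebra_simps)
  also have "(e * f1 - f1 * e) * A - A * (e * f1 - f1 * e) = 0"
    by (simp add: ef1 \<psi>A)
  finally have "Z (E * f1 - R (R (f1 * E))) = Q (e * F) - R (F * e)"
    by (simp add: F_Z lin)
  then show ?thesis
    by (simp add: D_k lin algebra_simps)
qed

lemma hD: "Z (h * D - D * h) = (e * F - F * e) + Q (Q (e * F - F * e)) - (Q (Z (E * f1 - f1 * E)) + R (Z (E * f1 - f1 * E)))"
proof -
  have "h * (k' * A) = k' * A * h"
    by (metis hA hk' mult.assoc)
  then have "h * D - D * h = (h * E - E * h) * f - f * (h * E - E * h) + E * (h * f - f * h) - (h * f - f * h) * E"
    by (simp add: D_def K_def algebra_simps)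
  also have "\<dots> = (h * E - E * h) * f - f * (h * E - E * h) - (Q (E * f1 - f1 * E) + R (E * f1 - f1 * E))"
    by (simp add: hf lin)
  finally have "Z (h * D - D * h) = Z (h * E - E * h) * f - f * Z (h * E - E * h) - (Q (Z (E * f1 - f1 * E)) + R (Z (E * f1 - f1 * E)))"
    by (simp add: lin)
  also have "Z (h * E - E * h) * f - f * Z (h * E - E * h) = (e * F - F * e) + Q (Q (e * F - F * e))
       + (((e * f - f * e) * A - A * (e * f - f * e)) + Q (Q ((e * f - f * e) * A - A * (e * f - f * e))))"
    unfolding hE by (simp add: F_def lin algebra_simps)
  also have "(e * f - f * e) * A - A * (e * f - f * e) = 0"
  proof -
    have "Q ((e * f - f * e) * A) - R ((e * f - f * e) * A) = Q (A * (e * f - f * e)) - R (A * (e * f - f * e))"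
      using arg_cong[OF ef, of "\<lambda>y. y * A"] arg_cong[OF ef, of "\<lambda>y. A * y"]
      by (simp add: left_diff_distrib right_diff_distrib sc_mult_left sc_mult_right kA k'A
          flip: sc_diff_right)
    then show ?thesis by (simp only: QR_cancel) simp
  qed
  finally show ?thesis by simp
qed

lemma f1D: "Z (f1 * D - D * f1) = Q (Q (k * F))"
proof -
  have \<psi>F: "Q (\<psi> * F) - R (F * \<psi>) = - (k * (A * f1 - f1 * A)) - Q (Q (k * (A * f1 - f1 * A)))"
  proof -
    have "\<psi> * F - R (R (F * \<psi>)) = A * (\<psi> * f - R (R (f * \<psi>))) - (\<psi> * f - R (R (f * \<psi>))) * A
       + ((\<psi> * A - A * \<psi>) * f - R (R (f * (\<psi> * A - A * \<psi>))))"
      by (simp add: F_def lin algebra_simps)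
    also have "\<dots> = - (A * (Q (k * f1) + R (k * f1)) - (Q (k * f1) + R (k * f1)) * A)"
      by (simp add: \<psi>A \<psi>f lin)
    also have "\<dots> = - (Q (k * (A * f1 - f1 * A)) + R (k * (A * f1 - f1 * A)))"
      by (simp add: lin algebra_simps) (simp add: kA flip: mult.assoc)
    finally have "Q (\<psi> * F - R (R (F * \<psi>))) = Q (- (Q (k * (A * f1 - f1 * A)) + R (k * (A * f1 - f1 * A))))"
      by simp
    then show ?thesis by (simp add: lin algebra_simps)
  qed
  have "f1 * D - D * f1 = (f1 * k * A - k * A * f1) + Q ((f1 * e - e * f1) * F) - R (F * (f1 * e - e * f1))
     + (Q (e * (f1 * F - F * f1)) - R ((f1 * F - F * f1) * e))"
    by (simp add: D_k lin algebra_simps)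
  also have "\<dots> = (Q (Q (k * f1 * A)) - k * A * f1) - (Q (\<psi> * F) - R (F * \<psi>))"
    by (simp add: Ff1 ef1 kf1 lin)
  also have "\<dots> = Q (Q (k * (A * f1 - R (R (f1 * A)))))"
    unfolding \<psi>F by (simp add: lin algebra_simps)
  finally show ?thesis by (simp add: F_Z lin)
qed

end

locale qaff_tensor =
  C1: qaff_monodromy q Z \<tau> e f e1 f1 k k' h \<psi> A1 c1 + C2: qaff_monodromy q Z \<tau> e f e1 f1 k k' h \<psi> A2 c2 +
  J1: calg_morph J1 + J2: calg_morph J2
  for q and Z \<tau> :: "'r::calgebra \<Rightarrow> 'r" and e f e1 f1 k k' h \<psi> A1 c1 A2 c2 and J1 J2 :: "'r \<Rightarrow> 's::calgebra" +
  fixes Z' \<tau>' :: "'s \<Rightarrow> 's"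
  assumes comm: "J2 y * J1 x = J1 x * J2 y"
    and Z'_diff: "Z' (p - r) = Z' p - Z' r" and Z'_left: "Z' p * r = Z' (p * r)" and Z'_right: "p * Z' r = Z' (p * r)"
    and Z'_sc: "Z' (sc a p) = sc a (Z' p)"
    and tau'_add: "\<tau>' (p + r) = \<tau>' p + \<tau>' r" and tau'_mult: "\<tau>' (p * r) = \<tau>' p * \<tau>' r"
    and J1_Z: "J1 (Z x) = Z' (J1 x)" and J2_Z: "J2 (Z x) = Z' (J2 x)"
    and J1_tau: "J1 (\<tau> x) = \<tau>' (J1 x)" and J2_tau: "J2 (\<tau> x) = \<tau>' (J2 x)"
begin

abbreviation "Q \<equiv> sc q"
abbreviation "R \<equiv> sc (1/q)"

definition "\<A> = J1 A1 * J2 A2 + J1 C1.F * J2 C2.E"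
definition "\<E> = J1 C1.E * J2 A2 + J1 C1.D * J2 C2.E"
text \<open>The coproduct of h_1, with q^2 - q^(-2) written through \<open>Q\<close> and
  \<open>R\<close> so that the rewriting can treat it.\<close>

definition "\<h> = J1 h + J2 h - (Q (Q (J1 f1 * J2 e)) - R (R (J1 f1 * J2 e)))"

lemma comm': "J2 y * (J1 x * w) = J1 x * (J2 y * w)"
  by (metis comm mult.assoc)

lemma J1_mult': "J1 x * (J1 y * w) = J1 (x * y) * w" and J2_mult': "J2 x * (J2 y * w) = J2 (x * y) * w"
  by (simp_all add: J1.mult J2.mult mult.assoc)

lemma Z'_add: "Z' (x + y) = Z' x + Z' y"
  using Z'_diff[of x "0 - y"] Z'_diff[of 0 y] Z'_diff[of 0 0] by simp

lemma Z'_minus: "Z' (- x) = - Z' x"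
  using Z'_diff[of 0 x] Z'_diff[of 0 0] by simp

lemma QR: "Q (R x) = x" "R (Q x) = x" for x :: 's
  using C1.q0 by (simp_all add: sc_sc sc_one)

lemmas lin = sc_add_right sc_diff_right sc_minus_right sc_mult_left sc_mult_right QR
  distrib_left distrib_right left_diff_distrib right_diff_distrib

lemmas collect = lin mult.assoc comm comm'
  J1.mult[symmetric] J2.mult[symmetric] J1_mult' J2_mult' minus_mult_left[symmetric] minus_mult_right[symmetric]

lemmas expand = J1.add J2.add J1.diff J2.diff J1.minus J2.minus J1.sc J2.sc J1_Z J2_Z Z'_left Z'_right Z'_add Z'_diff Z'_minus
  Z'_sc lin

lemma Af: "A1 * f = f * A1 + C1.F" "A2 * f = f * A2 + C2.F"
  by (simp_all add: C1.F_def C2.F_def)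

lemma h_A: "\<h> * \<A> = \<A> * \<h>"
proof -
  have "\<h> * \<A> - \<A> * \<h> = J1 (h * C1.F - C1.F * h) * J2 C2.E + J1 C1.F * J2 (h * C2.E - C2.E * h)
     - (Q (Q (J1 (f1 * A1) * J2 (e * A2) - J1 (A1 * f1) * J2 (A2 * e)))
       - R (R (J1 (f1 * A1) * J2 (e * A2) - J1 (A1 * f1) * J2 (A2 * e))))"
    unfolding \<A>_def \<h>_def
    by (simp add: collect, simp add: C1.hA C2.hA C1.Ff1 C2.eE' expand algebra_simps)
  \<comment> \<open>The factor z of F1 passes to the second tensor factor, since z [h, E2], but not
    [h, E2], is expressed without e1 by \<open>hE\<close>.\<close>
  also have "J1 C1.F * J2 (h * C2.E - C2.E * h) = J1 (A1 * f1 - R (R (f1 * A1))) * J2 (Z (h * C2.E - C2.E * h))"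
    by (subst C1.F_Z) (simp add: J1_Z J2_Z Z'_left Z'_right)
  finally show ?thesis
    unfolding C1.hF C2.hE by (simp add: C2.Ae' expand algebra_simps)
qed

lemma E_coproduct: "Q ((J1 e + J1 k * J2 e) * \<A>) - R (\<A> * (J1 e + J1 k * J2 e)) = \<E>"
proof -
  have D: "C1.D = k * A1 + C1.Q (e * C1.F) - C1.R (C1.F * e)" by (rule C1.D_k)
  have E: "C1.Q (e * A1) = C1.E + C1.R (A1 * e)" "C2.Q (e * A2) = C2.E + C2.R (A2 * e)"
    by (simp_all add: C1.E_def C2.E_def)
  have "Q ((J1 e + J1 k * J2 e) * \<A>) - R (\<A> * (J1 e + J1 k * J2 e)) =
     J1 (C1.Q (e * A1) - C1.R (A1 * e)) * J2 A2 + J1 (k * A1) * J2 (C2.Q (e * A2) - C2.R (A2 * e))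
     + J1 (C1.Q (e * C1.F) - C1.R (C1.F * e)) * J2 C2.E"
    unfolding \<A>_def
    by (simp add: collect, simp add: C1.kA C1.kF C2.eE' expand algebra_simps)
  then show ?thesis
    by (simp add: E D \<E>_def expand algebra_simps)
qed

lemma F_coproduct: "\<A> * (J2 f + J1 f * J2 k') - (J2 f + J1 f * J2 k') * \<A> = J1 A1 * J2 C2.F + J1 C1.F * J2 C2.D"
proof -
  have Ef: "C2.E * f = f * C2.E + C2.K" by (simp add: C2.K_def)
  show ?thesis
    unfolding \<A>_def
    by (simp add: collect, simp add: Af Ef C1.Ff' C2.k'E C2.k'A C2.D_def expand algebra_simps)
qed

lemma D_coproduct:
  "J1 k' * J2 k' * \<A> + (\<E> * (J2 f + J1 f * J2 k') - (J2 f + J1 f * J2 k') * \<E>)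
    = J1 C1.D * J2 C2.D + J1 C1.E * J2 C2.F"
proof -
  have Ef: "C1.E * f = f * C1.E + C1.K" "C2.E * f = f * C2.E + C2.K" by (simp_all add: C1.K_def C2.K_def)
  have D: "C2.D = k' * A2 + C2.K" by (simp add: C2.D_def)
  have K: "C1.K = C1.D - A1 * k'" by (simp add: C1.D_def C1.k'A)
  show ?thesis
    unfolding \<A>_def \<E>_def
    by (simp add: collect,
      simp add: Af Ef C1.Df D K C1.k'F C2.k'E C1.k'A C2.k'A expand algebra_simps)
qed

lemma qdet_coproduct:
  "(J1 C1.D * J2 C2.D + J1 C1.E * J2 C2.F) * \<tau>' \<A> - (J1 A1 * J2 C2.F + J1 C1.F * J2 C2.D) * \<tau>' \<E> = J1 c1 * J2 c2"
proof -
  have AD: "A1 * \<tau> C1.D = C1.E * \<tau> C1.F + (C1.D * \<tau> A1 - C1.F * \<tau> C1.E)"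
    using C1.qdet1 C1.qdet2 by (simp add: algebra_simps)
  show ?thesis
    unfolding \<A>_def \<E>_def tau'_add tau'_mult J1_tau[symmetric] J2_tau[symmetric]
    unfolding C1.qdet1[symmetric] C2.qdet1[symmetric]
    by (simp add: collect, simp add: AD C1.EA' C1.DF J1.diff J2.diff J1.add algebra_simps)
qed

text \<open>For a series commuting with h, the commutator [h, E] is a combination of e1 A and A e1,
  so this identity amounts to the relation of A with x^+ of index 0. The detour through h is made
  because the coproduct is prescribed at h_1 and not at x^+_1.\<close>

lemma h_E: "Z' (\<h> * \<E> - \<E> * \<h>) = ((J1 e + J1 k * J2 e) * \<A> - \<A> * (J1 e + J1 k * J2 e))
   + Q (Q ((J1 e + J1 k * J2 e) * \<A> - \<A> * (J1 e + J1 k * J2 e)))"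
proof -
  have Z'J: "Z' (J1 x * w) = J1 (Z x) * w" for x w
    by (simp add: J1_Z Z'_left)
  have *: "\<h> * \<E> - \<E> * \<h> = J1 (h * C1.E - C1.E * h) * J2 A2 + J1 (h * C1.D - C1.D * h) * J2 C2.E + J1 C1.D * J2 (h * C2.E - C2.E * h)
     - (Q (Q (J1 (f1 * C1.E) * J2 (e * A2) - J1 (C1.E * f1) * J2 (A2 * e) + J1 (f1 * C1.D - C1.D * f1) * J2 (C2.E * e)))
       - R (R (J1 (f1 * C1.E) * J2 (e * A2) - J1 (C1.E * f1) * J2 (A2 * e) + J1 (f1 * C1.D - C1.D * f1) * J2 (C2.E * e))))"
    unfolding \<E>_def \<h>_def
    by (simp add: collect, simp add: C1.hA C2.hA C2.eE' expand algebra_simps)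
  have "Z' (\<h> * \<E> - \<E> * \<h>) = J1 (Z (h * C1.E - C1.E * h)) * J2 A2 + J1 (Z (h * C1.D - C1.D * h)) * J2 C2.E + J1 C1.D * J2 (Z (h * C2.E - C2.E * h))
     - (Q (Q (J1 (Z (f1 * C1.E)) * J2 (e * A2) - J1 (Z (C1.E * f1)) * J2 (A2 * e) + J1 (Z (f1 * C1.D - C1.D * f1)) * J2 (C2.E * e)))
       - R (R (J1 (Z (f1 * C1.E)) * J2 (e * A2) - J1 (Z (C1.E * f1)) * J2 (A2 * e) + J1 (Z (f1 * C1.D - C1.D * f1)) * J2 (C2.E * e))))"
    unfolding * by (simp only: Z'_add Z'_diff Z'_sc J1_Z J2_Z Z'_left Z'_right)
  also have "\<dots> = J1 (e * A1 - A1 * e + C1.Q (C1.Q (e * A1 - A1 * e))) * J2 A2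
     + J1 (e * C1.F - C1.F * e + C1.Q (C1.Q (e * C1.F - C1.F * e)) -
        (C1.Q (C1.R (C1.R (Z (f1 * C1.E))) + C1.D - k * A1 - Z (f1 * C1.E)) + C1.R (C1.R (C1.R (Z (f1 * C1.E))) + C1.D - k * A1 - Z (f1 * C1.E)))) * J2 C2.E
     + J1 C1.D * J2 (e * A2 - A2 * e + C2.Q (C2.Q (e * A2 - A2 * e)))
     - (Q (Q (J1 (Z (f1 * C1.E)) * J2 (e * A2) - J1 (C1.R (C1.R (Z (f1 * C1.E))) + C1.D - k * A1) * J2 (A2 * e) + J1 (C1.Q (C1.Q (k * C1.F))) * J2 (C2.E * e)))
       - R (R (J1 (Z (f1 * C1.E)) * J2 (e * A2) - J1 (C1.R (C1.R (Z (f1 * C1.E))) + C1.D - k * A1) * J2 (A2 * e) + J1 (C1.Q (C1.Q (k * C1.F))) * J2 (C2.E * e))))"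
    unfolding C1.hE C2.hE C1.hD C1.f1D C1.Z_diff[of "C1.E * f1"] C1.Ef1 ..
  also have "\<dots> = ((J1 e + J1 k * J2 e) * \<A> - \<A> * (J1 e + J1 k * J2 e))
   + Q (Q ((J1 e + J1 k * J2 e) * \<A> - \<A> * (J1 e + J1 k * J2 e)))"
    unfolding \<A>_def C2.Ae'
    by (simp add: collect, simp add: C1.kA C1.kF C2.eE' C2.Ae' expand algebra_simps)
  finally show ?thesis .
qed

end

section \<open>The substitution z -> p z, and the relations of the quantum affine algebra in
  generating form\<close>

definition scale_mat :: "complex \<Rightarrow> int \<Rightarrow> int \<Rightarrow> complex" where
  "scale_mat p n i = (if n = i then p powi n else 0)"

lemma triangular_mult_scale_mat: "p \<noteq> 0 \<Longrightarrow> triangular_mult (scale_mat p)"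
proof
  fix n i j :: int
  assume p: "p \<noteq> 0"
  show "scale_mat p n i = 0" if "n < i"
    using that by (simp add: scale_mat_def)
  have "(\<Sum>a\<in>{i..n - j}. scale_mat p a i * scale_mat p (n - a) j) =
      (\<Sum>a\<in>{i..n - j}. if a = i then scale_mat p n (i + j) else 0)"
    by (rule sum.cong) (use p in \<open>auto simp: scale_mat_def power_int_add\<close>)
  then show "scale_mat p n (i + j) = (\<Sum>a\<in>{i..n - j}. scale_mat p a i * scale_mat p (n - a) j)"
    by (auto simp: scale_mat_def)
qed

lemma scale_nth: 
  assumes "p \<noteq> 0"
  shows "fls_tri (scale_mat p) f $$ n = sc (p powi n) (f $$ n)"
proof -
  interpret triangular_mult "scale_mat p" by (rule triangular_mult_scale_mat) fact
  obtain a where a: "ord_ge a f" by (rule ord_ge_exists)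
  have "sc (scale_mat p n i) (f $$ i) = (if i = n then sc (p powi n) (f $$ n) else 0)" for i
    by (simp add: scale_mat_def)
  then show ?thesis
    using nth[OF a, where n = n and S = "{min a n..n}"] by simp
qed

text \<open>If \<open>x(z) = x\<^sub>0 + z y(z)\<close>, the relation reads \<open>x(z) x\<^sub>0 - r x\<^sub>0 x(z) = (1 - r) x(z)\<^sup>2\<close>.\<close>

lemma q_current_commutator:
  fixes x :: "nat \<Rightarrow> 'a::calgebra"
  assumes rel: "\<And>m n. x (Suc m) * x n - sc r (x m * x (Suc n)) = sc r (x n * x (Suc m)) - x (Suc n) * x m"
  defines "X \<equiv> \<lambda>N. fls_shift 1 (current x N)"
  shows "sc r (X 0 * fls_const (x 0)) - fls_const (x 0) * X 0 = sc r (X 0 * X 0) - X 0 * X 0"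
proof -
  let ?x = "\<lambda>n. fls_const (x n)" and ?Z = "fls_shift (- 1)"
  have X_nth: "X N $$ n = (if n < 0 then 0 else x (N + nat n))" for N n
    by (simp add: X_def current_nth)
  have X_step: "X N = ?x N + ?Z (X (Suc N))" for N
  proof -
    have "?Z (X (Suc N)) = current x (Suc N)"
      by (simp add: X_def)
    then show ?thesis
      by (simp only: X_def current_shift[of _ N])
  qed
  define V where "V m = ?Z (?x (Suc m) * X 0) - sc r (?x m * (X 0 - ?x 0)) - sc r (?Z (X 0 * ?x (Suc m))) + (X 0 - ?x 0) * ?x m" for m
  have V: "V m = 0" for m
  proof (rule fls_eqI)
    fix n
    show "V m $$ n = 0 $$ n"
    proof (cases "n \<ge> 1")
      case True
      then have "nat n = Suc (nat (n - 1))" by simp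
      then show ?thesis
        using rel[of m "nat (n - 1)"] True
        by (simp add: V_def X_nth fls_times_const_nth fls_const_times_nth algebra_simps)
    next
      case False
      then have "n < 0 \<or> n = 0" by auto
      then show ?thesis
        by (auto simp: V_def X_nth fls_times_const_nth fls_const_times_nth)
    qed
  qed
  \<comment> \<open>\<open>V\<close> is the relation summed over n; here the other index is summed
    as well, in the same variable, so that \<open>W m\<close> = \<open>V m\<close> + z
    \<open>W (Suc m)\<close>.\<close>
  define W where "W m = ?Z (X (Suc m) * X 0) - sc r (X m * (X 0 - ?x 0)) - sc r (?Z (X 0 * X (Suc m))) + (X 0 - ?x 0) * X m" for m
  have "W 0 = 0"
  proof (rule shift_descent)
    fix m
    have "W m = ?Z ((?x (Suc m) + ?Z (X (Suc (Suc m)))) * X 0) - sc r ((?x m + ?Z (X (Suc m))) * (X 0 - ?x 0))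
        - sc r (?Z (X 0 * (?x (Suc m) + ?Z (X (Suc (Suc m)))))) + (X 0 - ?x 0) * (?x m + ?Z (X (Suc m)))"
      unfolding W_def by (simp only: X_step[symmetric])
    also have "\<dots> = V m + ?Z (W (Suc m))"
      unfolding V_def W_def
      by (simp add: distrib_left distrib_right left_diff_distrib right_diff_distrib sc_add_right sc_diff_right
          fls_shifted_times_simps fls_shift_sc algebra_simps)
    finally show "fls_shift 1 (W m) = W (Suc m)"
      by (simp add: V)
    have X: "ord_ge 0 (X N)" for N
      by (simp add: ord_ge_def X_nth)
    have "ord_ge (0 + 0 - - 1) (fls_shift (- 1) (X N * X M))" for N M
      by (intro ord_ge_shift ord_ge_mult X)
    then have "ord_ge 0 (fls_shift (- 1) (X N * X M))" for N M
      by (auto intro: ord_ge_mono[of 1])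
    moreover have "ord_ge (0 + 0) (X m * (X 0 - ?x 0))" "ord_ge (0 + 0) ((X 0 - ?x 0) * X m)"
      by (intro ord_ge_mult ord_ge_diff X ord_ge_const order_refl)+
    ultimately show "ord_ge 0 (W m)"
      unfolding W_def by (auto intro!: ord_ge_add ord_ge_diff ord_ge_sc)
  qed
  moreover have "W 0 = ?Z (X (Suc 0)) * X 0 - sc r (X 0 * (X 0 - ?x 0)) - sc r (X 0 * ?Z (X (Suc 0))) + (X 0 - ?x 0) * X 0"
    by (simp add: W_def fls_shifted_times_simps)
  moreover have "?Z (X (Suc 0)) = X 0 - ?x 0"
    using X_step[of 0] by simp
  ultimately have "((X 0 - ?x 0) * X 0 - sc r (X 0 * (X 0 - ?x 0))) + ((X 0 - ?x 0) * X 0 - sc r (X 0 * (X 0 - ?x 0))) = 0"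
    by (simp only:) (simp add: algebra_simps)
  then have "(X 0 - ?x 0) * X 0 - sc r (X 0 * (X 0 - ?x 0)) = 0"
    by (simp only: double_eq_0_iff)
  then show ?thesis
    by (simp add: left_diff_distrib right_diff_distrib sc_diff_right algebra_simps)
qed

locale qaff =
  fixes q :: complex and xp xm php phm :: "int \<Rightarrow> 'a::calgebra" and u :: 'a
  assumes q0: "q \<noteq> 0" and qn: "0 < (j::nat) \<Longrightarrow> q ^ j \<noteq> 1"
    and php0: "m < 0 \<Longrightarrow> php m = 0" and phm0: "m > 0 \<Longrightarrow> phm m = 0"
    and kk': "php 0 * phm 0 = u"
    and php_php: "php m * php n = php n * php m" and php_phm: "php m * phm n = phm n * php m"
    and phm_phm: "phm m * phm n = phm n * phm m"
    and pm: "xp m * xm n - xm n * xp m = sc (1 / (q - 1/q)) (php (m + n) - phm (m + n))"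
    and php_xp: "php (m + 1) * xp n - sc (q\<^sup>2) (php m * xp (n + 1)) = sc (q\<^sup>2) (xp n * php (m + 1)) - xp (n + 1) * php m"
    and phm_xp: "phm (m + 1) * xp n - sc (q\<^sup>2) (phm m * xp (n + 1)) = sc (q\<^sup>2) (xp n * phm (m + 1)) - xp (n + 1) * phm m"
    and php_xm: "php (m + 1) * xm n - sc (1 / q\<^sup>2) (php m * xm (n + 1)) = sc (1 / q\<^sup>2) (xm n * php (m + 1)) - xm (n + 1) * php m"
    and phm_xm: "phm (m + 1) * xm n - sc (1 / q\<^sup>2) (phm m * xm (n + 1)) = sc (1 / q\<^sup>2) (xm n * phm (m + 1)) - xm (n + 1) * phm m"
    and pp: "xp (m + 1) * xp n - sc (q\<^sup>2) (xp m * xp (n + 1)) = sc (q\<^sup>2) (xp n * xp (m + 1)) - xp (n + 1) * xp m"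
    and mm: "xm (m + 1) * xm n - sc (1 / q\<^sup>2) (xm m * xm (n + 1)) = sc (1 / q\<^sup>2) (xm n * xm (m + 1)) - xm (n + 1) * xm m"
    and up: "unit_on u (xp n)" and um: "unit_on u (xm n)" and uphp: "unit_on u (php n)" and uphm: "unit_on u (phm n)"
begin

abbreviation "P n \<equiv> fls_const (xp n)"
abbreviation "M n \<equiv> fls_const (xm n)"
abbreviation "Uc \<equiv> fls_const u"
abbreviation "p \<equiv> q\<^sup>2"
abbreviation "taq \<equiv> fls_tri (scale_mat p)"
abbreviation "Z \<equiv> fls_shift (- 1) :: 'a fls \<Rightarrow> 'a fls"
abbreviation "k \<equiv> php 0"
abbreviation "k' \<equiv> phm 0"

lemma p0: "p \<noteq> 0"
  using q0 by simp

sublocale scale: triangular_mult "scale_mat p"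
  by (rule triangular_mult_scale_mat[OF p0])

text \<open>If q^(2n) = -1 then q^(4n) = 1, hence n = 0, and then 1 = -1. These are the factors 1 +
  t n n by which the square-root arguments divide.\<close>

lemma pn: "1 + p powi n \<noteq> 0"
proof
  assume "1 + p powi n = 0"
  then have "p powi n = -1" by (simp add: eq_neg_iff_add_eq_0 add.commute)
  then have "p powi n * p powi n = 1" by simp
  then have "q powi (4 * n) = 1"
    using q0 by (simp add: power_int_mult_distrib power_int_power power_int_power' flip: power_int_add)
  then have "n = 0"
    using qn[of "nat (4 * n)"] qn[of "nat (- 4 * n)"]
    by (cases n rule: int_cases3) (auto simp: power_int_def power_inverse)
  then show False using \<open>p powi n = -1\<close> by simp
qed

lemma scale_diag: "scale_mat p n n = p powi n"
  by (simp add: scale_mat_def)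

lemma tau_Z: "taq (Z f) = sc p (Z (taq f))" for f :: "'a fls"
  by (rule fls_eqI) (use q0 in \<open>simp add: scale_nth[OF p0] sc_sc power_int_diff\<close>)

lemma q1: "q - 1/q \<noteq> 0" "q + 1/q \<noteq> 0"
proof -
  have "q * q \<noteq> 1" "q * q \<noteq> -1"
    using qn[of 2] qn[of 4] by (auto simp: power2_eq_square power4_eq_xxxx)
  then show "q - 1/q \<noteq> 0" "q + 1/q \<noteq> 0"
    using q0 by (auto simp: field_simps add_eq_0_iff)
qed

lemma sc_p: "sc p x = sc q (sc q x)" "sc (1/p) x = sc (1/q) (sc (1/q) x)" for x :: "'b::calgebra"
  by (simp_all add: sc_sc power2_eq_square)

lemma sc_pp: "sc p (sc (1/p) x) = x" "sc (1/p) (sc p x) = x" for x :: "'b::calgebra"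
  using p0 by (simp_all add: sc_sc sc_one)

lemma sc_qp: "sc q (sc (1/p) x) = sc (1/q) x" "sc (1/q) (sc p x) = sc q x" for x :: "'b::calgebra"
  using q0 by (simp_all add: sc_sc power2_eq_square)

text \<open>The case m = -1 of the relations, where phi^+_(-1) = 0.\<close>

lemma kp: "k * xp n = sc p (xp n * k)" and km: "k * xm n = sc (1/p) (xm n * k)"
  using php_xp[of "-1" n] php_xm[of "-1" n] by (simp_all add: php0)

text \<open>The case m = 0 of the relations, where phi^-_1 = 0.\<close>

lemma k'p: "k' * xp n = sc (1/p) (xp n * k')" and k'm: "k' * xm n = sc p (xm n * k')"
proof -
  have "sc p (k' * xp n) = xp n * k'" "sc (1/p) (k' * xm n) = xm n * k'"
    using phm_xp[of 0 "n - 1"] phm_xm[of 0 "n - 1"] by (simp_all add: phm0)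
  then show "k' * xp n = sc (1/p) (xp n * k')" "k' * xm n = sc p (xm n * k')"
    by (metis sc_pp)+
qed

definition \<Phi> :: "'a fls" where "\<Phi> = Abs_fls php"

lemma \<Phi>_nth: "\<Phi> $$ n = php n"
  unfolding \<Phi>_def by (rule fls_nth_Abs_bounded[of 0]) (simp add: php0)

lemma \<Phi>_ord: "ord_ge 0 \<Phi>"
  by (simp add: ord_ge_def \<Phi>_nth php0)

lemma \<Phi>_xp: "\<Phi> * P n - sc p (Z (\<Phi> * P (n + 1))) = sc p (P n * \<Phi>) - Z (P (n + 1) * \<Phi>)"
  (is "?lhs = ?rhs")
proof (rule fls_eqI)
  fix i
  show "?lhs $$ i = ?rhs $$ i"
    using php_xp[where m = "i - 1" and n = n]
    by (simp add: fls_times_const_nth fls_const_times_nth \<Phi>_nth)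
qed

lemma \<Phi>_xm: "\<Phi> * M n - sc (1/p) (Z (\<Phi> * M (n + 1))) = sc (1/p) (M n * \<Phi>) - Z (M (n + 1) * \<Phi>)"
  (is "?lhs = ?rhs")
proof (rule fls_eqI)
  fix i
  show "?lhs $$ i = ?rhs $$ i"
    using php_xm[where m = "i - 1" and n = n]
    by (simp add: fls_times_const_nth fls_const_times_nth \<Phi>_nth)
qed

text \<open>The element h_1: k' inverts k = phi^+_0, so this is the first coefficient of the
  logarithm of phi^+(z)/phi^+_0 divided by q - 1/q.\<close>

definition "h = sc (1 / (q - 1/q)) (k' * php 1)"

lemma k'k: "k' * (k * x) = x" if "unit_on u x"
  using that by (simp add: kk' php_phm[symmetric] unit_on_def flip: mult.assoc)

lemma h_xp: "h * xp n - xp n * h = sc q (xp (n + 1)) + sc (1/q) (xp (n + 1))"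
proof -
  have "php 1 * xp n - sc p (k * xp (n + 1)) = sc p (xp n * php 1) - xp (n + 1) * k"
    using php_xp[of 0 n] by simp
  then have "php 1 * xp n - sc p (xp n * php 1) = sc p (k * xp (n + 1)) - xp (n + 1) * k"
    by (simp add: algebra_simps)
  then have "k' * (php 1 * xp n - sc p (xp n * php 1)) = k' * (sc p (k * xp (n + 1)) - sc (1/p) (k * xp (n + 1)))"
    by (simp add: kp sc_pp)
  then have "k' * php 1 * xp n - sc p (k' * xp n) * php 1 = sc p (k' * (k * xp (n + 1))) - sc (1/p) (k' * (k * xp (n + 1)))"
    by (simp add: right_diff_distrib sc_mult_left sc_mult_right mult.assoc)
  then have "k' * php 1 * xp n - xp n * (k' * php 1) = sc p (xp (n + 1)) - sc (1/p) (xp (n + 1))"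
    by (simp add: k'k[OF up] k'p sc_pp mult.assoc)
  then have "h * xp n - xp n * h = sc (1 / (q - 1/q)) (sc p (xp (n + 1)) - sc (1/p) (xp (n + 1)))"
    by (simp add: h_def sc_mult_left sc_mult_right flip: sc_diff_right)
  also have "\<dots> = sc (1 / (q - 1/q) * (p - 1/p)) (xp (n + 1))"
    by (simp add: sc_sc flip: sc_diff_left)
  also have "1 / (q - 1/q) * (p - 1/p) = q + 1/q"
    using q1 q0 by (simp add: power2_eq_square divide_simps) (simp add: algebra_simps)
  finally show ?thesis by (simp add: sc_add_left)
qed

lemma h_xm: "h * xm n - xm n * h = - (sc q (xm (n + 1)) + sc (1/q) (xm (n + 1)))"
proof -
  have "php 1 * xm n - sc (1/p) (k * xm (n + 1)) = sc (1/p) (xm n * php 1) - xm (n + 1) * k"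
    using php_xm[of 0 n] by simp
  then have "php 1 * xm n - sc (1/p) (xm n * php 1) = sc (1/p) (k * xm (n + 1)) - xm (n + 1) * k"
    by (simp add: algebra_simps)
  then have "k' * (php 1 * xm n - sc (1/p) (xm n * php 1)) = k' * (sc (1/p) (k * xm (n + 1)) - sc p (k * xm (n + 1)))"
    by (simp add: km sc_pp)
  then have "k' * php 1 * xm n - sc (1/p) (k' * xm n) * php 1 = sc (1/p) (k' * (k * xm (n + 1))) - sc p (k' * (k * xm (n + 1)))"
    by (simp add: right_diff_distrib sc_mult_left sc_mult_right mult.assoc)
  then have "k' * php 1 * xm n - xm n * (k' * php 1) = sc (1/p) (xm (n + 1)) - sc p (xm (n + 1))"
    by (simp add: k'k[OF um] k'm sc_pp mult.assoc)
  then have "h * xm n - xm n * h = sc (1 / (q - 1/q)) (sc (1/p) (xm (n + 1)) - sc p (xm (n + 1)))"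
    by (simp add: h_def sc_mult_left sc_mult_right flip: sc_diff_right)
  also have "\<dots> = sc (1 / (q - 1/q) * (1/p - p)) (xm (n + 1))"
    by (simp add: sc_sc flip: sc_diff_left)
  also have "1 / (q - 1/q) * (1/p - p) = - (q + 1/q)"
    using q1 q0 by (simp add: power2_eq_square divide_simps) (simp add: algebra_simps)
  finally show ?thesis by (simp add: sc_diff_left sc_minus_left)
qed

end

locale qaff_plus = qaff +
  fixes A :: "'a fls"
  assumes uA: "unit_on Uc A"
    and k'A: "fls_const k' * A = A * fls_const k'"
    and Dp: "A * P (int n) - P (int n) * A = Z (sc (1/p) (A * P (int n + 1)) - P (int n + 1) * A)"
begin

abbreviation "X N \<equiv> fls_shift 1 (current (\<lambda>n. xp (int n)) N)"
abbreviation "E \<equiv> sc q (P 0 * A) - sc (1/q) (A * P 0)"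
abbreviation "F \<equiv> A * M 0 - M 0 * A"
abbreviation "K \<equiv> E * M 0 - M 0 * E"

lemma X_step: "X N = P (int N) + Z (X (Suc N))"
proof -
  have "Z (X (Suc N)) = current (\<lambda>n. xp (int n)) (Suc N)"
    by simp
  then show ?thesis
    by (simp only: current_shift[of _ N])
qed

lemma X_ord: "ord_ge 0 (X N)"
  using ord_ge_shift[OF current_ord, of 1] by simp

text \<open>The relation \<open>Dp\<close> at coinciding arguments. Of A x^+(z) the multiple 1 -
  q^(-2) survives; multiplication by q makes it q - 1/q.\<close>

lemma AX: "sc q (A * X 0) - sc (1/q) (A * X 0) = E"
proof -
  obtain a where a: "ord_ge a A" by (rule ord_ge_exists)
  define V where "V N = A * X N - sc (1/p) (A * X N) - P (int N) * A + sc (1/p) (A * P (int N))" for N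
  have "V 0 = 0"
  proof (rule shift_descent)
    fix N
    have "V N = (A * P (int N) - P (int N) * A) + Z (A * X (Suc N) - sc (1/p) (A * X (Suc N)))"
      unfolding V_def X_step[of N]
      by (simp add: fls_shifted_times_simps fls_shift_sc algebra_simps sc_add_right)
    also have "\<dots> = Z (V (Suc N))"
      unfolding Dp V_def by (simp add: algebra_simps)
    finally show "fls_shift 1 (V N) = V (Suc N)" by simp
    have "ord_ge (a + 0) (A * P (int N))" "ord_ge (0 + a) (P (int N) * A)" "ord_ge (a + 0) (A * X N)"
      by (intro ord_ge_mult a X_ord ord_ge_const order_refl)+
    then show "ord_ge a (V N)"
      unfolding V_def by (auto intro!: ord_ge_add ord_ge_diff ord_ge_sc)
  qed
  then have "sc q (V 0) = 0" by simp
  then show ?thesis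
    by (simp add: V_def sc_add_right sc_diff_right sc_qp algebra_simps)
qed

lemma tau_Dp: "taq A * P (int n) - P (int n) * taq A = Z (taq A * P (int n + 1) - sc p (P (int n + 1) * taq A))"
proof -
  have "taq (A * P (int n) - P (int n) * A) = taq (Z (sc (1/p) (A * P (int n + 1)) - P (int n + 1) * A))"
    by (simp only: Dp)
  then show ?thesis
    by (simp add: tau_Z scale.diff scale.scale scale.const_mult scale.mult_const sc_diff_right fls_shift_sc sc_pp)
qed

lemma tau_E: "taq E = sc q (P 0 * taq A) - sc (1/q) (taq A * P 0)"
  by (simp add: scale.diff scale.const_mult scale.mult_const scale.scale)

lemma X_tau: "sc q (X 0 * taq A) - sc (1/q) (X 0 * taq A) = taq E"
proof -
  obtain a where a: "ord_ge a A" by (rule ord_ge_exists)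
  define V where "V N = sc p (X N * taq A) - X N * taq A + taq A * P (int N) - sc p (P (int N) * taq A)" for N
  have "V 0 = 0"
  proof (rule shift_descent)
    fix N
    have "V N = (taq A * P (int N) - P (int N) * taq A) + Z (sc p (X (Suc N) * taq A) - X (Suc N) * taq A)"
      unfolding V_def X_step[of N]
      by (simp add: fls_shifted_times_simps fls_shift_sc algebra_simps sc_add_right)
    also have "\<dots> = Z (V (Suc N))"
      unfolding tau_Dp V_def by (simp add: algebra_simps)
    finally show "fls_shift 1 (V N) = V (Suc N)" by simp
    have "ord_ge (a + 0) (taq A * P (int N))" "ord_ge (0 + a) (P (int N) * taq A)" "ord_ge (0 + a) (X N * taq A)"
      by (intro ord_ge_mult scale.ord a X_ord ord_ge_const order_refl)+
    then show "ord_ge a (V N)"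
      unfolding V_def by (auto intro!: ord_ge_add ord_ge_diff ord_ge_sc)
  qed
  then have "sc (1/q) (V 0) = 0" by simp
  then show ?thesis
    unfolding tau_E by (simp add: V_def sc_add_right sc_diff_right sc_qp algebra_simps)
qed

lemma EA: "E * taq A = A * taq E"
proof -
  have "E * taq A = (sc q (A * X 0) - sc (1/q) (A * X 0)) * taq A"
    by (simp only: AX)
  also have "\<dots> = A * (sc q (X 0 * taq A) - sc (1/q) (X 0 * taq A))"
    by (simp add: left_diff_distrib right_diff_distrib sc_mult_left sc_mult_right mult.assoc)
  finally show ?thesis
    by (simp only: X_tau)
qed

text \<open>In degree 0 the commutator contributes k - k', so the constant to be added is k'. This
  is the origin of the summand k' A in the entry D.\<close>

lemma \<Phi>_X: "\<Phi> = fls_const k' + (sc (q - 1/q) (X 0 * M 0) - sc (q - 1/q) (M 0 * X 0))"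
proof (rule fls_eqI)
  fix n
  have "sc (q - 1/q) (xp n * xm 0 - xm 0 * xp n) = php n - phm n"
    using pm[of n 0] q1 by (simp add: sc_sc sc_one)
  then show "\<Phi> $$ n = (fls_const k' + (sc (q - 1/q) (X 0 * M 0) - sc (q - 1/q) (M 0 * X 0))) $$ n"
    by (auto simp: \<Phi>_nth current_nth fls_times_const_nth fls_const_times_nth sc_diff_right php0 phm0
      not_less le_less)
qed

lemma A_\<Phi>_tau: "A * \<Phi> * taq A = (fls_const k' * A + K) * taq A - F * taq E"
proof -
  have AX': "sc (q - 1/q) (A * X 0) = E" and X_tau': "sc (q - 1/q) (X 0 * taq A) = taq E"
    using AX X_tau by (simp_all only: sc_diff_left)
  have "A * \<Phi> * taq A = A * fls_const k' * taq A + sc (q - 1/q) (A * X 0) * M 0 * taq A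
      - (A * M 0) * sc (q - 1/q) (X 0 * taq A)"
    by (simp add: \<Phi>_X algebra_simps sc_mult_left sc_mult_right)
  also have "\<dots> = A * fls_const k' * taq A + E * M 0 * taq A - (F + M 0 * A) * taq E"
    unfolding AX' X_tau' by simp
  also have "(F + M 0 * A) * taq E = F * taq E + M 0 * (E * taq A)"
    by (simp only: EA distrib_right mult.assoc)
  finally show ?thesis
    by (simp only: k'A[symmetric]) (simp only: distrib_right left_diff_distrib mult.assoc add_diff_eq diff_diff_eq add.commute add.left_commute diff_add_eq)
qed

text \<open>With G = (q - 1/q) x^+(z) one has E = A G, and the current relation becomes e G = q^2 G
  e - q G^2. In q e A G the term A G^2 arising from q e A = E + q^(-1) A e cancels the last
  one.\<close>

lemma eE: "P 0 * E = E * P 0"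
proof -
  have X: "sc p (X 0 * P 0) - P 0 * X 0 = sc p (X 0 * X 0) - X 0 * X 0"
    using q_current_commutator[of "\<lambda>n. xp (int n)" p] pp[of "int _" "int _"] by (simp add: add.commute)
  define G where "G = sc q (X 0) - sc (1/q) (X 0)"
  have AG: "A * G = E"
    using AX by (simp add: G_def right_diff_distrib sc_mult_right)
  have "P 0 * G = sc p (G * P 0) - (sc q (sc p (X 0 * X 0) - X 0 * X 0) - sc (1/q) (sc p (X 0 * X 0) - X 0 * X 0))"
    unfolding X[symmetric]
    by (simp add: G_def left_diff_distrib right_diff_distrib sc_mult_left sc_mult_right sc_diff_right sc_sc mult.commute)
  also have "sc q (sc p (X 0 * X 0) - X 0 * X 0) - sc (1/q) (sc p (X 0 * X 0) - X 0 * X 0) = sc q (G * G)"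
    using q0 by (simp add: G_def left_diff_distrib right_diff_distrib sc_mult_left sc_mult_right sc_diff_right sc_sc
        power2_eq_square)
  finally have eG: "P 0 * G = sc p (G * P 0) - sc q (G * G)" .
  have "sc q (P 0 * (A * G)) = sc q (P 0 * A) * G"
    by (simp add: sc_mult_left mult.assoc)
  also have "sc q (P 0 * A) = E + sc (1/q) (A * P 0)"
    by simp
  also have "(E + sc (1/q) (A * P 0)) * G = E * G + sc (1/q) (A * (sc p (G * P 0) - sc q (G * G)))"
    by (simp only: distrib_right sc_mult_left mult.assoc eG)
  also have "\<dots> = sc q (A * G * P 0)"
    using q0 by (simp only: AG[symmetric]) (simp add: right_diff_distrib sc_mult_right sc_diff_right sc_qp mult.assoc sc_sc sc_one power2_eq_square)
  finally show ?thesis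
    unfolding AG by (rule iffD1[OF sc_cancel[OF q0]])
qed

end

locale qaff_A = qaff +
  fixes A c :: "'a fls"
  assumes uA: "unit_on Uc A"
    and A_lead: "ord_ge 0 A" "A $$ 0 = u"
    and phA: "fls_const (php m) * A = A * fls_const (php m)" "fls_const (phm m) * A = A * fls_const (phm m)"
    and A_tau: "taq A * A = A * taq A"
    and \<Phi>A: "\<Phi> * (A * taq A) = c" and \<Phi>Ac: "A * \<Phi> = \<Phi> * A"
    and cP: "c * P n = sc p (P n * c)" and cM: "c * M n = sc (1/p) (M n * c)"
begin

text \<open>The parameter is r = q^2 for x^+ and r = q^(-2) for x^-. Multiplied by \<Phi>, the claim
  reduces to the relation of \<Phi> with x; here c q-commutes with x rather than commuting with
  it.\<close>

lemma Pi_rel: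
  fixes x :: "int \<Rightarrow> 'a"
  assumes r: "r \<noteq> 0" and ux: "\<And>n. unit_on u (x n)"
    and \<Phi>x: "\<And>n. \<Phi> * fls_const (x n) - sc r (Z (\<Phi> * fls_const (x (n + 1)))) =
      sc r (fls_const (x n) * \<Phi>) - Z (fls_const (x (n + 1)) * \<Phi>)"
    and cx: "\<And>n. c * fls_const (x n) = sc r (fls_const (x n) * c)"
  shows "(A * taq A) * fls_const (x n) - fls_const (x n) * (A * taq A) -
    Z (sc (1/r) ((A * taq A) * fls_const (x (n + 1))) - sc r (fls_const (x (n + 1)) * (A * taq A))) = 0" (is "?Q = 0")
proof (rule fls_left_cancel[OF \<Phi>_ord])
  let ?T = "A * taq A" and ?x = "fls_const (x n)" and ?y = "fls_const (x (n + 1))"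
  have rr: "sc r (sc (1/r) y) = y" "sc (1/r) (sc r y) = y" for y :: "'a fls"
    using r by (simp_all add: sc_sc sc_one)
  have "\<Phi> * ?Q = \<Phi> * ?T * ?x - \<Phi> * ?x * ?T - Z (sc (1/r) (\<Phi> * ?T * ?y) - sc r (\<Phi> * ?y * ?T))"
    by (simp add: fls_shifted_times_simps fls_shift_sc sc_mult_right right_diff_distrib mult.assoc)
  also have "\<dots> = c * ?x - Z (sc (1/r) (c * ?y)) - (\<Phi> * ?x - sc r (Z (\<Phi> * ?y))) * ?T"
    unfolding \<Phi>A by (simp add: fls_shifted_times_simps fls_shift_sc sc_mult_left left_diff_distrib)
  also have "(\<Phi> * ?x - sc r (Z (\<Phi> * ?y))) * ?T = sc r (?x * c) - Z (?y * c)"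
    unfolding \<Phi>x \<Phi>A[symmetric] by (simp add: fls_shifted_times_simps fls_shift_sc sc_mult_left left_diff_distrib mult.assoc)
  finally show "\<Phi> * ?Q = 0"
    by (simp add: cx rr)
  have "unit_on Uc ?Q"
    by (intro unit_on_intros scale.unit_on uA ux)
  then have "unit_on u (?Q $$ n)" for n
    unfolding unit_on_nth by (rule spec)
  then show "k' * (\<Phi> $$ 0 * ?Q $$ n) = ?Q $$ n" for n
    unfolding \<Phi>_nth by (rule k'k)
qed

lemma AA: "taq A * (A * y) = A * (taq A * y)"
  by (simp only: A_tau flip: mult.assoc)

lemma scale_mat00: "scale_mat p 0 0 = 1"
  by (simp add: scale_mat_def)

text \<open>The square root of \<open>Pi_rel\<close>, as in the Yangian case; the lowest coefficient
  of the defect is now killed by 1 + q^(2n).\<close>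

lemma A_plus: "A * P n - P n * A - Z (sc (1/p) (A * P (n + 1)) - P (n + 1) * A) = 0" (is "?D = 0")
proof (rule scale.vanish_left[OF A_lead])
  have "taq ?D = taq A * P n - P n * taq A - Z (taq A * P (n + 1) - sc p (P (n + 1) * taq A))"
    by (simp add: tau_Z scale.diff scale.scale scale.const_mult scale.mult_const sc_diff_right fls_shift_sc sc_pp)
  then have "taq A * ?D + taq ?D * A = taq A * ?D + (taq A * P n - P n * taq A - Z (taq A * P (n + 1) - sc p (P (n + 1) * taq A))) * A"
    by simp
  also have "\<dots> = (A * taq A) * P n - P n * (A * taq A) -
    Z (sc (1/p) ((A * taq A) * P (n + 1)) - sc p (P (n + 1) * (A * taq A)))"
    by (simp add: fls_shifted_times_simps fls_shift_sc sc_mult_left sc_mult_right algebra_simps A_tau AA)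
  also have "\<dots> = 0"
    by (rule Pi_rel) (rule p0 up \<Phi>_xp cP)+
  finally show "taq A * ?D + taq ?D * A = 0" .
  show "unit_on Uc ?D"
    by (intro unit_on_intros uA up)
  show "1 + scale_mat p n n \<noteq> 0" for n
    unfolding scale_diag by (rule pn)
qed (rule scale_mat00)

lemma A_minus: "A * M n - M n * A - Z (A * M (n + 1) - sc (1/p) (M (n + 1) * A)) = 0" (is "?D = 0")
proof (rule scale.vanish_right[OF A_lead])
  have "taq ?D = taq A * M n - M n * taq A - Z (sc p (taq A * M (n + 1)) - M (n + 1) * taq A)"
    by (simp add: tau_Z scale.diff scale.scale scale.const_mult scale.mult_const sc_diff_right fls_shift_sc sc_pp)
  then have "A * taq ?D + ?D * taq A = A * (taq A * M n - M n * taq A - Z (sc p (taq A * M (n + 1)) - M (n + 1) * taq A)) + ?D * taq A"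
    by simp
  also have "\<dots> = (A * taq A) * M n - M n * (A * taq A) -
    Z (sc (1 / (1/p)) ((A * taq A) * M (n + 1)) - sc (1/p) (M (n + 1) * (A * taq A)))"
    by (simp add: fls_shifted_times_simps fls_shift_sc sc_mult_left sc_mult_right algebra_simps A_tau AA)
  also have "\<dots> = 0"
    by (rule Pi_rel) (use p0 um \<Phi>_xm cM in \<open>auto\<close>)
  finally show "A * taq ?D + ?D * taq A = 0" .
  show "unit_on Uc ?D"
    by (intro unit_on_intros uA um)
  show "1 + scale_mat p n n \<noteq> 0" for n
    unfolding scale_diag by (rule pn)
qed (rule scale_mat00)

sublocale qaff_plus q xp xm php phm u A
  by unfold_locales (use uA phA A_plus[of "int _"] in \<open>simp_all\<close>)

lemma Ff: "F * M 0 = sc (1/p) (M 0 * F)"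
proof -
  let ?Y = "\<lambda>N. fls_shift 1 (current (\<lambda>n. xm (int n)) N)"
  have Y_step: "?Y N = M (int N) + Z (?Y (Suc N))" for N
  proof -
    have "Z (?Y (Suc N)) = current (\<lambda>n. xm (int n)) (Suc N)"
      by simp
    then show ?thesis
      by (simp only: current_shift[of _ N])
  qed
  obtain a where a: "ord_ge a A" by (rule ord_ge_exists)
  define V where "V N = A * M (int N) - sc (1/p) (M (int N) * A) - (?Y N * A - sc (1/p) (?Y N * A))" for N
  have "V 0 = 0"
  proof (rule shift_descent)
    fix N
    have "V N = (A * M (int N) - M (int N) * A) - Z (?Y (Suc N) * A - sc (1/p) (?Y (Suc N) * A))"
      unfolding V_def Y_step[of N]
      by (simp add: fls_shifted_times_simps fls_shift_sc algebra_simps sc_add_right)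
    also have "\<dots> = Z (V (Suc N))"
      using A_minus[of "int N"] by (simp add: V_def algebra_simps)
    finally show "fls_shift 1 (V N) = V (Suc N)" by simp
    have "ord_ge (a + 0) (A * M (int N))" "ord_ge (0 + a) (M (int N) * A)" "ord_ge (0 + a) (?Y N * A)"
      by (intro ord_ge_mult a ord_ge_const order_refl ord_ge_shift[OF current_ord, of 1, simplified])+
    then show "ord_ge a (V N)"
      unfolding V_def by (auto intro!: ord_ge_add ord_ge_diff ord_ge_sc)
  qed
  \<comment> \<open>The current x^- without its constant term; the vanishing of \<open>V 0\<close>
    says F = (1 - q^(-2)) G A, and the current relation q-commutes G past x^-_0 up to G^2.\<close>
  define G where "G = ?Y 0 - M 0"
  have F: "F = G * A - sc (1/p) (G * A)"
    using \<open>V 0 = 0\<close> by (simp add: V_def G_def left_diff_distrib sc_diff_right algebra_simps)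
  have "sc (1/p) (?Y 0 * M 0) - M 0 * ?Y 0 = sc (1/p) (?Y 0 * ?Y 0) - ?Y 0 * ?Y 0"
    using q_current_commutator[of "\<lambda>n. xm (int n)" "1/p"] mm[of "int _" "int _"] by (simp add: add.commute)
  moreover have "?Y 0 = G + M 0" by (simp add: G_def)
  ultimately have "sc (1/p) ((G + M 0) * M 0) - M 0 * (G + M 0) = sc (1/p) ((G + M 0) * (G + M 0)) - (G + M 0) * (G + M 0)"
    by (simp only:)
  then have G: "G * M 0 = sc (1/p) (M 0 * G) + sc (1/p) (G * G) - G * G"
    by (simp add: distrib_left distrib_right sc_add_right algebra_simps)
  have "G * A * M 0 = G * F + G * M 0 * A"
    by (simp add: algebra_simps)
  also have "\<dots> = G * (G * A - sc (1/p) (G * A)) + (sc (1/p) (M 0 * G) + sc (1/p) (G * G) - G * G) * A"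
    by (simp only: F G)
  also have "\<dots> = sc (1/p) (M 0 * (G * A))"
    by (simp add: algebra_simps sc_mult_left sc_mult_right)
  finally have *: "G * A * M 0 = sc (1/p) (M 0 * (G * A))" .
  have "F * M 0 = G * A * M 0 - sc (1/p) (G * A * M 0)"
    unfolding F by (simp add: left_diff_distrib sc_mult_left)
  also have "\<dots> = sc (1/p) (M 0 * (G * A - sc (1/p) (G * A)))"
    unfolding * by (simp add: right_diff_distrib sc_diff_right sc_mult_right)
  finally show ?thesis
    unfolding F .
qed

lemma qdet: "(fls_const k' * A + K) * taq A - F * taq E = c"
  using A_\<Phi>_tau \<Phi>A \<Phi>Ac by (simp add: mult.assoc)

lemma h_A: "fls_const h * A = A * fls_const h"
proof -
  have "fls_const h = sc (1 / (q - 1/q)) (fls_const k' * fls_const (php 1))"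
    by (simp add: h_def fls_const_sc)
  then show ?thesis
    using phA by (simp add: sc_mult_left sc_mult_right del: fls_const_mult_const) (metis mult.assoc)
qed

end

sublocale qaff_A \<subseteq> mono: qaff_monodromy q "Z" taq "P 0" "M 0" "P 1" "M 1" "fls_const k" "fls_const k'" "fls_const h"
  "fls_const (xp 0 * xm 1 - xm 1 * xp 0)" A c
proof
  fix x y :: "'a fls" and a :: complex
  show "q \<noteq> 0" "q - 1/q \<noteq> 0" "q + 1/q \<noteq> 0"
    by (rule q0 q1)+
  show "Z (x - y) = Z x - Z y" "Z x * y = Z (x * y)" "x * Z y = Z (x * y)" "Z (sc a x) = sc a (Z x)"
    by (simp_all add: fls_shifted_times_simps fls_shift_sc)
  show "taq (x - y) = taq x - taq y" "taq (x * y) = taq x * taq y" "taq (sc a x) = sc a (taq x)"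
    by (simp_all add: scale.diff scale.mult scale.scale)
  have "taq (fls_const a) = fls_const a" for a :: 'a
    by (rule fls_eqI) (simp add: scale_nth[OF p0] sc_one)
  then show "taq (P 0) = P 0" "taq (M 0) = M 0" "taq (fls_const k') = fls_const k'"
    by simp_all
  have \<psi>: "xp 0 * xm n - xm n * xp 0 = sc (1 / (q - 1/q)) (php n - phm n)" for n
    using pm[of 0 n] by simp
  have "sc q (xp 0 * xm 0 - xm 0 * xp 0) - sc (1/q) (xp 0 * xm 0 - xm 0 * xp 0) = k - k'"
    unfolding sc_diff_left[symmetric] \<psi> using q1 by (simp add: sc_sc sc_one)
  from arg_cong[OF this, of fls_const] show "sc q (P 0 * M 0 - M 0 * P 0) - sc (1/q) (P 0 * M 0 - M 0 * P 0) = fls_const k - fls_const k'"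
    by (simp add: fls_const_diff fls_const_sc)
  show "fls_const k * P 0 = sc q (sc q (P 0 * fls_const k))" "fls_const k * M 0 = sc (1/q) (sc (1/q) (M 0 * fls_const k))"
    "fls_const k' * P 0 = sc (1/q) (sc (1/q) (P 0 * fls_const k'))" "fls_const k' * M 0 = sc q (sc q (M 0 * fls_const k'))"
    "fls_const k * M 1 = sc (1/q) (sc (1/q) (M 1 * fls_const k))" "fls_const k' * M 1 = sc q (sc q (M 1 * fls_const k'))"
    by (simp_all add: kp km k'p k'm fls_const_sc flip: sc_p)
  show "fls_const k * A = A * fls_const k" "fls_const k' * A = A * fls_const k'" "fls_const h * A = A * fls_const h"
    by (rule phA h_A)+
  show "P 0 * M 1 = M 1 * P 0 + fls_const (xp 0 * xm 1 - xm 1 * xp 0)"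
    by (simp add: fls_const_diff)
  have phm1: "phm 1 = 0" by (rule phm0) simp
  have \<psi>c: "fls_const (xp 0 * xm 1 - xm 1 * xp 0) = sc (1 / (q - 1/q)) (fls_const (php 1))"
    unfolding \<psi> by (simp add: phm1 fls_const_sc)
  show "fls_const (xp 0 * xm 1 - xm 1 * xp 0) * A = A * fls_const (xp 0 * xm 1 - xm 1 * xp 0)"
    unfolding \<psi>c using phA by (simp add: sc_mult_left sc_mult_right)
  have "php 1 * xm 0 - sc (1/p) (xm 0 * php 1) = sc (1/p) (k * xm 1) - sc p (k * xm 1)"
    using php_xm[of 0 0] by (simp add: km sc_pp algebra_simps)
  then have "sc (1 / (q - 1/q)) (php 1 * xm 0 - sc (1/p) (xm 0 * php 1)) = sc (1 / (q - 1/q) * (1/p - p)) (k * xm 1)"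
    by (simp add: sc_sc flip: sc_diff_left)
  also have "1 / (q - 1/q) * (1/p - p) = - (q + 1/q)"
    using q1 q0 by (simp add: power2_eq_square divide_simps) (simp add: algebra_simps)
  finally have "sc (1 / (q - 1/q)) (php 1 * xm 0) = sc (1 / (q - 1/q)) (sc (1/p) (xm 0 * php 1)) - (sc q (k * xm 1) + sc (1/q) (k * xm 1))"
    by (simp add: sc_diff_right sc_minus_left sc_diff_left diff_eq_eq)
  from arg_cong[OF this, of fls_const] show "fls_const (xp 0 * xm 1 - xm 1 * xp 0) * M 0 = sc (1/q) (sc (1/q) (M 0 * fls_const (xp 0 * xm 1 - xm 1 * xp 0)))
      - (sc q (fls_const k * M 1) + sc (1/q) (fls_const k * M 1))"
    unfolding \<psi>c by (simp add: sc_mult_left sc_mult_right fls_const_sc fls_const_diff sc_sc power2_eq_square mult.commute mult.assoc flip: fls_plus_const)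
  have "xm 1 * xm 0 + xm 1 * xm 0 = sc (1/p) (xm 0 * xm 1) + sc (1/p) (xm 0 * xm 1)"
    using mm[of 0 0] by (simp add: algebra_simps)
  then have "xm 1 * xm 0 = sc (1/p) (xm 0 * xm 1)"
    by (metis sc_half_double)
  then show "M 1 * M 0 = sc (1/q) (sc (1/q) (M 0 * M 1))"
    by (simp add: fls_const_sc flip: sc_p)
  show "fls_const h * P 0 = P 0 * fls_const h + (sc q (P 1) + sc (1/q) (P 1))"
    "fls_const h * M 0 = M 0 * fls_const h - (sc q (M 1) + sc (1/q) (M 1))"
    using arg_cong[OF h_xp[of 0], of fls_const] arg_cong[OF h_xm[of 0], of fls_const]
    by (simp_all add: fls_const_diff fls_const_sc diff_eq_eq flip: fls_plus_const)
  show "fls_const h * fls_const k = fls_const k * fls_const h" "fls_const h * fls_const k' = fls_const k' * fls_const h"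
    by (simp_all add: h_def sc_mult_left sc_mult_right) (metis mult.assoc php_phm php_php phm_phm)+
  show "A * P 0 - P 0 * A = Z (sc (1/q) (sc (1/q) (A * P 1)) - P 1 * A)"
    using A_plus[of 0] by (simp add: sc_p)
  show "A * M 0 - M 0 * A = Z (A * M 1 - sc (1/q) (sc (1/q) (M 1 * A)))"
    using A_minus[of 0] by (simp add: sc_p)
  show "F * M 0 = sc (1/q) (sc (1/q) (M 0 * F))"
    using Ff by (simp add: sc_p)
  show "c * M 0 = sc (1/q) (sc (1/q) (M 0 * c))"
    using cM[of 0] by (simp add: sc_p)
qed (rule eE EA A_tau qdet)+

lemma qaff_image:
  assumes "qaff q xp xm php phm u" "calg_morph J"
  shows "qaff q (\<lambda>n. J (xp n)) (\<lambda>n. J (xm n)) (\<lambda>n. J (php n)) (\<lambda>n. J (phm n)) (J u)"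
proof -
  interpret qaff q xp xm php phm u by fact
  interpret J: calg_morph J by fact
  note img = J.mult[symmetric] J.diff[symmetric] J.add[symmetric] J.minus[symmetric] J.sc[symmetric]
  show ?thesis
  proof
    fix m n
    show "J (xp m) * J (xm n) - J (xm n) * J (xp m) = sc (1 / (q - 1/q)) (J (php (m + n)) - J (phm (m + n)))"
      using pm[of m n] by (simp only: img)
    show "J (php (m + 1)) * J (xp n) - sc p (J (php m) * J (xp (n + 1))) = sc p (J (xp n) * J (php (m + 1))) - J (xp (n + 1)) * J (php m)"
      using php_xp[of m n] by (simp only: img)
    show "J (phm (m + 1)) * J (xp n) - sc p (J (phm m) * J (xp (n + 1))) = sc p (J (xp n) * J (phm (m + 1))) - J (xp (n + 1)) * J (phm m)"
      using phm_xp[of m n] by (simp only: img)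
    show "J (php (m + 1)) * J (xm n) - sc (1/p) (J (php m) * J (xm (n + 1))) = sc (1/p) (J (xm n) * J (php (m + 1))) - J (xm (n + 1)) * J (php m)"
      using php_xm[of m n] by (simp only: img)
    show "J (phm (m + 1)) * J (xm n) - sc (1/p) (J (phm m) * J (xm (n + 1))) = sc (1/p) (J (xm n) * J (phm (m + 1))) - J (xm (n + 1)) * J (phm m)"
      using phm_xm[of m n] by (simp only: img)
    show "J (xp (m + 1)) * J (xp n) - sc p (J (xp m) * J (xp (n + 1))) = sc p (J (xp n) * J (xp (m + 1))) - J (xp (n + 1)) * J (xp m)"
      using pp[of m n] by (simp only: img)
    show "J (xm (m + 1)) * J (xm n) - sc (1/p) (J (xm m) * J (xm (n + 1))) = sc (1/p) (J (xm n) * J (xm (m + 1))) - J (xm (n + 1)) * J (xm m)"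
      using mm[of m n] by (simp only: img)
    show "unit_on (J u) (J (xp n))" "unit_on (J u) (J (xm n))" "unit_on (J u) (J (php n))" "unit_on (J u) (J (phm n))"
      using up um uphp uphm by (simp_all add: unit_on_def flip: J.mult)
    show "J (php m) * J (php n) = J (php n) * J (php m)" "J (php m) * J (phm n) = J (phm n) * J (php m)"
      "J (phm m) * J (phm n) = J (phm n) * J (phm m)"
      by (simp_all only: img php_php[of m n] php_phm[of m n] phm_phm[of m n])
    show "J (php m) = 0" if "m < 0" using that by (simp add: php0 J.zero)
    show "J (phm m) = 0" if "m > 0" using that by (simp add: phm0 J.zero)
  qed (auto simp: q0 qn kk' simp flip: J.mult)
qed

text \<open>The involution \<open>z \<mapsto> 1/z\<close> exchanging \<open>x\<^sup>\<plusminus>\<^sub>n\<close> with \<open>x\<^sup>\<minusplus>\<^sub>-\<^sub>n\<close> and \<open>\<phi>\<^sup>\<plusminus>\<^sub>n\<close> with \<open>\<phi>\<^sup>\<minusplus>\<^sub>-\<^sub>n\<close>.\<close>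

lemma qaff_swap:
  assumes "qaff q xp xm php phm u"
  shows "qaff q (\<lambda>n. xm (- n)) (\<lambda>n. xp (- n)) (\<lambda>n. phm (- n)) (\<lambda>n. php (- n)) u"
proof -
  interpret qaff q xp xm php phm u by fact
  show ?thesis
  proof
    fix m n
    show "xm (- m) * xp (- n) - xp (- n) * xm (- m) = sc (1 / (q - 1/q)) (phm (- (m + n)) - php (- (m + n)))"
    proof -
      have "xm (- m) * xp (- n) - xp (- n) * xm (- m) = - (xp (- n) * xm (- m) - xm (- m) * xp (- n))"
        by simp
      also have "\<dots> = sc (1 / (q - 1/q)) (phm (- (m + n)) - php (- (m + n)))"
        unfolding pm by (simp add: add.commute flip: sc_minus_right)
      finally show ?thesis .
    qed
    have swap: "y * b - sc (1/r) (a * x) = sc (1/r) (b * y) - x * a"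
      if "a * x - sc r (y * b) = sc r (x * a) - b * y" "r \<noteq> 0" for a b x y :: 'a and r
    proof -
      have "sc (- (1/r)) (a * x - sc r (y * b)) = sc (- (1/r)) (sc r (x * a) - b * y)"
        using that by simp
      then show ?thesis
        using that(2) by (simp add: sc_diff_right sc_sc sc_minus_left sc_one algebra_simps)
    qed
    have *: "- (m + 1) + 1 = - m" "- (n + 1) + 1 = - n" by simp_all
    show "phm (- (m + 1)) * xm (- n) - sc p (phm (- m) * xm (- (n + 1))) = sc p (xm (- n) * phm (- (m + 1))) - xm (- (n + 1)) * phm (- m)"
      using swap[OF phm_xm[of "- (m + 1)" "- (n + 1)", unfolded *]] p0 by simp
    show "php (- (m + 1)) * xm (- n) - sc p (php (- m) * xm (- (n + 1))) = sc p (xm (- n) * php (- (m + 1))) - xm (- (n + 1)) * php (- m)"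
      using swap[OF php_xm[of "- (m + 1)" "- (n + 1)", unfolded *]] p0 by simp
    show "phm (- (m + 1)) * xp (- n) - sc (1/p) (phm (- m) * xp (- (n + 1))) = sc (1/p) (xp (- n) * phm (- (m + 1))) - xp (- (n + 1)) * phm (- m)"
      using swap[OF phm_xp[of "- (m + 1)" "- (n + 1)", unfolded *]] p0 by simp
    show "php (- (m + 1)) * xp (- n) - sc (1/p) (php (- m) * xp (- (n + 1))) = sc (1/p) (xp (- n) * php (- (m + 1))) - xp (- (n + 1)) * php (- m)"
      using swap[OF php_xp[of "- (m + 1)" "- (n + 1)", unfolded *]] p0 by simp
    show "xm (- (m + 1)) * xm (- n) - sc p (xm (- m) * xm (- (n + 1))) = sc p (xm (- n) * xm (- (m + 1))) - xm (- (n + 1)) * xm (- m)"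
      using swap[OF mm[of "- (m + 1)" "- (n + 1)", unfolded *]] p0 by simp
    show "xp (- (m + 1)) * xp (- n) - sc (1/p) (xp (- m) * xp (- (n + 1))) = sc (1/p) (xp (- n) * xp (- (m + 1))) - xp (- (n + 1)) * xp (- m)"
      using swap[OF pp[of "- (m + 1)" "- (n + 1)", unfolded *]] p0 by simp
    show "phm (- 0) * php (- 0) = u"
      using kk' by (simp add: php_phm[symmetric])
  qed (auto simp: q0 qn php0 phm0 php_php phm_phm php_phm up um uphp uphm)
qed

section \<open>The quantum affine coproduct of A\<close>

locale qaff_coproduct =
  Y1: qaff_A q xp xm php phm u A1 c1 + Y2: qaff_A q xp xm php phm u A2 c2 +
  J1: calg_morph J1 + J2: calg_morph J2 + Psi: calg_morph Psi
  for q and xp xm php phm :: "int \<Rightarrow> 'a::calgebra" and u A1 c1 A2 c2 and J1 J2 Psi :: "'a \<Rightarrow> 'b::calgebra" +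
  assumes commJ: "J2 y * J1 x = J1 x * J2 y"
    and Psi_xp: "Psi (xp 0) = J1 (xp 0) + J1 (php 0) * J2 (xp 0)"
    and Psi_xm: "Psi (xm 0) = J2 (xm 0) + J1 (xm 0) * J2 (phm 0)"
    and Psi_k: "Psi (php 0) = J1 (php 0) * J2 (php 0)"
    and Psi_k': "Psi (phm 0) = J1 (phm 0) * J2 (phm 0)"
    and Psi_h: "Psi Y1.h = J1 Y1.h + J2 Y1.h - sc (q\<^sup>2 - 1/q\<^sup>2) (J1 (xm 1) * J2 (xp 0))"
    and units: "J1 u = Psi u" "J2 u = Psi u"
begin

abbreviation "Z' \<equiv> fls_shift (- 1) :: 'b fls \<Rightarrow> 'b fls"

sublocale S1: calg_morph "fls_map J1" by (rule J1.fls_map_morph)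
sublocale S2: calg_morph "fls_map J2" by (rule J2.fls_map_morph)

sublocale qaff_tensor q "Y1.Z" "Y1.taq" "Y1.P 0" "Y1.M 0" "Y1.P 1" "Y1.M 1" "fls_const (php 0)" "fls_const (phm 0)"
  "fls_const Y1.h" "fls_const (xp 0 * xm 1 - xm 1 * xp 0)" A1 c1 A2 c2 "fls_map J1" "fls_map J2" Z' "fls_tri (scale_mat (q\<^sup>2))"
proof
  fix x y :: "'a fls"
  show "fls_map J2 y * fls_map J1 x = fls_map J1 x * fls_map J2 y"
    by (rule fls_map_commute[OF J1.calg_morph_axioms J2.calg_morph_axioms commJ])
  show "fls_map J1 (Y1.Z x) = Z' (fls_map J1 x)" "fls_map J2 (Y1.Z x) = Z' (fls_map J2 x)"
    by (rule J1.fls_map_shift J2.fls_map_shift)+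
  show "fls_map J1 (Y1.taq x) = fls_tri (scale_mat (q\<^sup>2)) (fls_map J1 x)" "fls_map J2 (Y1.taq x) = fls_tri (scale_mat (q\<^sup>2)) (fls_map J2 x)"
    by (rule Y1.scale.fls_map, unfold_locales)+
next
  fix p r :: "'b fls" and a :: complex
  show "Z' (p - r) = Z' p - Z' r" "Z' p * r = Z' (p * r)" "p * Z' r = Z' (p * r)" "Z' (sc a p) = sc a (Z' p)"
    by (simp_all add: fls_shifted_times_simps fls_shift_sc)
  show "fls_tri (scale_mat (q\<^sup>2)) (p + r) = fls_tri (scale_mat (q\<^sup>2)) p + fls_tri (scale_mat (q\<^sup>2)) r"
    "fls_tri (scale_mat (q\<^sup>2)) (p * r) = fls_tri (scale_mat (q\<^sup>2)) p * fls_tri (scale_mat (q\<^sup>2)) r"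
    by (simp_all add: Y1.scale.add Y1.scale.mult)
qed

sublocale T: qaff q "\<lambda>n. Psi (xp n)" "\<lambda>n. Psi (xm n)" "\<lambda>n. Psi (php n)" "\<lambda>n. Psi (phm n)" "Psi u"
  by (rule qaff_image) unfold_locales

lemma unit_images:
  assumes "unit_on u x"
  shows "unit_on (Psi u) (J1 x)" "unit_on (Psi u) (J2 x)" "unit_on (Psi u) (Psi x)"
proof -
  have "u * x = x" "x * u = x" using assms by (simp_all add: unit_on_def)
  then show "unit_on (Psi u) (Psi x)"
    by (simp add: unit_on_def flip: Psi.mult)
  show "unit_on (Psi u) (J1 x)"
    using \<open>u * x = x\<close> \<open>x * u = x\<close> by (simp add: unit_on_def flip: units(1) J1.mult)
  show "unit_on (Psi u) (J2 x)"
    using \<open>u * x = x\<close> \<open>x * u = x\<close> by (simp add: unit_on_def flip: units(2) J2.mult)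
qed

lemma unit_A: "unit_on T.Uc \<A>"
proof -
  have "unit_on Y1.Uc Y1.mono.F" "unit_on Y1.Uc Y2.mono.E"
    unfolding Y1.mono.F_def Y2.mono.E_def by (intro unit_on_intros Y1.up Y1.um Y1.uA Y2.uA)+
  then show ?thesis
    using Y1.uA Y2.uA unfolding \<A>_def
    by (intro unit_on_add unit_on_mult) (auto simp: unit_on_nth unit_images simp del: fls_minus_nth)
qed

lemma T_P0: "T.P 0 = fls_map J1 (Y1.P 0) + fls_map J1 (fls_const (php 0)) * fls_map J2 (Y1.P 0)"
  and T_M0: "T.M 0 = fls_map J2 (Y1.M 0) + fls_map J1 (Y1.M 0) * fls_map J2 (fls_const (phm 0))"
  and T_k: "fls_const (Psi (php 0)) = fls_map J1 (fls_const (php 0)) * fls_map J2 (fls_const (php 0))"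
  and T_k': "fls_const (Psi (phm 0)) = fls_map J1 (fls_const (phm 0)) * fls_map J2 (fls_const (phm 0))"
  by (simp_all add: Psi_xp Psi_xm Psi_k Psi_k' J1.fls_map_const J2.fls_map_const flip: fls_plus_const)

lemma T_h: "fls_const (Psi Y1.h) = \<h>"
  unfolding \<h>_def Psi_h
  by (simp add: J1.fls_map_const J2.fls_map_const fls_const_diff fls_const_sc sc_diff_left power2_eq_square
      flip: fls_plus_const) (simp add: sc_sc)

lemma k_A: "fls_const (Psi (php 0)) * \<A> = \<A> * fls_const (Psi (php 0))"
  and k'_A: "fls_const (Psi (phm 0)) * \<A> = \<A> * fls_const (Psi (phm 0))"
  unfolding \<A>_def T_k T_k'
  by (simp only: collect, simp only: Y1.mono.kA Y2.mono.kA Y1.mono.kF Y2.mono.kE Y1.mono.k'A Y2.mono.k'A Y1.mono.k'F Y2.mono.k'E expand)+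

text \<open>Index 0 is read off from \<open>h_E\<close>. The image of h_1 commutes with the
  candidate, so its commutator with the relation of one index is q + 1/q times the relation of the
  next, and q + 1/q is invertible.\<close>

lemma A_plus_coproduct: "\<A> * T.P (int n) - T.P (int n) * \<A> = Z' (sc (1/q\<^sup>2) (\<A> * T.P (int n + 1)) - T.P (int n + 1) * \<A>)"
proof -
  have cancel: "x = y" if "sc q x + sc (1/q) x = sc q y + sc (1/q) y" for x y :: "'b fls"
    using that T.q1(2) by (simp add: sc_cancel flip: sc_add_left)
  have hP: "\<h> * T.P n - T.P n * \<h> = sc q (T.P (n + 1)) + sc (1/q) (T.P (n + 1))" for n
  proof -
    have "Psi (Y1.h * xp n - xp n * Y1.h) = Psi (sc q (xp (n + 1)) + sc (1/q) (xp (n + 1)))"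
      by (simp only: Y1.h_xp)
    then show ?thesis
      unfolding T_h[symmetric]
      by (simp add: Psi.diff Psi.mult Psi.add Psi.sc flip: fls_const_diff fls_const_sc fls_plus_const)
  qed
  have hA': "\<h> * (\<A> * x) = \<A> * (\<h> * x)" for x
    by (simp only: h_A flip: mult.assoc)
  show ?thesis
  proof (induction n)
    case 0
    let ?e = "T.P 0" and ?e1 = "T.P 1"
    have E: "\<E> = sc q (?e * \<A>) - sc (1/q) (\<A> * ?e)"
      unfolding T_P0 E_coproduct ..
    have "\<h> * \<E> - \<E> * \<h> = sc q ((\<h> * ?e - ?e * \<h>) * \<A>) - sc (1/q) (\<A> * (\<h> * ?e - ?e * \<h>))"
      unfolding E by (simp add: sc_mult_left sc_mult_right sc_diff_right algebra_simps h_A hA' del: fls_const_mult_const)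
    also have "\<dots> = sc q (sc q (?e1 * \<A>) - sc (1/q) (\<A> * ?e1)) + sc (1/q) (sc q (?e1 * \<A>) - sc (1/q) (\<A> * ?e1))"
      unfolding hP using Y1.q0
      by (simp add: sc_mult_left sc_mult_right sc_diff_right sc_add_right distrib_left distrib_right sc_sc)
    finally have "sc q (Z' (sc q (?e1 * \<A>) - sc (1/q) (\<A> * ?e1))) + sc (1/q) (Z' (sc q (?e1 * \<A>) - sc (1/q) (\<A> * ?e1)))
        = Z' (\<h> * \<E> - \<E> * \<h>)"
      by (simp add: fls_shift_sc)
    also have "\<dots> = (?e * \<A> - \<A> * ?e) + sc q (sc q (?e * \<A> - \<A> * ?e))"
      unfolding h_E T_P0 ..
    also have "\<dots> = sc q (sc q (?e * \<A> - \<A> * ?e)) + sc (1/q) (sc q (?e * \<A> - \<A> * ?e))"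
      using Y1.q0 by (simp add: sc_sc sc_one)
    finally have "Z' (sc q (?e1 * \<A>) - sc (1/q) (\<A> * ?e1)) = sc q (?e * \<A> - \<A> * ?e)"
      by (rule cancel)
    then have "sc (1/q) (Z' (sc q (?e1 * \<A>) - sc (1/q) (\<A> * ?e1))) = ?e * \<A> - \<A> * ?e"
      using Y1.q0 by (simp add: sc_sc sc_one)
    then have "Z' (?e1 * \<A> - sc (1/q\<^sup>2) (\<A> * ?e1)) = ?e * \<A> - \<A> * ?e"
      using Y1.q0 by (simp add: fls_shift_sc sc_diff_right sc_sc sc_one power2_eq_square)
    then show ?case
      by (simp add: algebra_simps)
  next
    case (Suc n)
    define m where "m = int n"
    define x y z where "x = T.P m" "y = T.P (m + 1)" "z = T.P (m + 1 + 1)"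
    let ?D = "\<A> * x - x * \<A> - Z' (sc (1/q\<^sup>2) (\<A> * y) - y * \<A>)"
    let ?D' = "\<A> * y - y * \<A> - Z' (sc (1/q\<^sup>2) (\<A> * z) - z * \<A>)"
    have h: "\<h> * x - x * \<h> = sc q y + sc (1/q) y" "\<h> * y - y * \<h> = sc q z + sc (1/q) z"
      using hP[of m] hP[of "m + 1"] by (simp_all add: x_y_z_def)
    have "\<h> * ?D - ?D * \<h> = \<A> * (\<h> * x - x * \<h>) - (\<h> * x - x * \<h>) * \<A>
        - Z' (sc (1/q\<^sup>2) (\<A> * (\<h> * y - y * \<h>)) - (\<h> * y - y * \<h>) * \<A>)"
      by (simp add: sc_mult_left sc_mult_right sc_diff_right algebra_simps h_A hA' fls_shifted_times_simps fls_shift_sc)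
    also have "\<dots> = sc q ?D' + sc (1/q) ?D'"
      unfolding h
      by (simp add: sc_mult_left sc_mult_right sc_diff_right sc_add_right distrib_left distrib_right fls_shift_sc)
        (simp add: sc_sc mult.commute algebra_simps)
    finally have "\<h> * ?D - ?D * \<h> = sc q ?D' + sc (1/q) ?D'" .
    moreover have "?D = 0"
      using Suc by (simp add: x_y_z_def m_def)
    ultimately have "sc q ?D' + sc (1/q) ?D' = sc q 0 + sc (1/q) 0"
      by (simp only: mult_zero_left mult_zero_right diff_self sc_zero_right add_0)
    then have "?D' = 0"
      by (rule cancel)
    then show ?case
      by (simp add: x_y_z_def m_def algebra_simps)
  qed
qed

sublocale TA: qaff_plus q "\<lambda>n. Psi (xp n)" "\<lambda>n. Psi (xm n)" "\<lambda>n. Psi (php n)" "\<lambda>n. Psi (phm n)" "Psi u" \<A>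
  by unfold_locales (rule unit_A A_plus_coproduct k'_A)+

lemma A_\<Phi>_coproduct: "\<A> * T.\<Phi> * T.taq \<A> = fls_map J1 c1 * fls_map J2 c2"
  unfolding TA.A_\<Phi>_tau T_P0 T_M0 E_coproduct F_coproduct T_k' D_coproduct by (rule qdet_coproduct)

lemma A_lead: "ord_ge 0 \<A>" "\<A> $$ 0 = Psi u"
proof -
  have F: "ord_ge 0 (fls_map J1 Y1.mono.F)" "fls_map J1 Y1.mono.F $$ 0 = 0"
    using Y1.A_lead Y1.um unfolding Y1.mono.F_def
    by (auto simp: ord_ge_def fls_const_times_nth fls_times_const_nth J1.zero unit_on_def)
  have E: "ord_ge 0 (fls_map J2 Y2.mono.E)"
    using Y2.A_lead unfolding Y2.mono.E_def
    by (auto simp: ord_ge_def fls_const_times_nth fls_times_const_nth J2.zero)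
  have A: "ord_ge 0 (fls_map J1 A1)" "ord_ge 0 (fls_map J2 A2)"
    using Y1.A_lead Y2.A_lead by (auto intro: J1.fls_map_ord_ge J2.fls_map_ord_ge)
  show "ord_ge 0 \<A>"
    unfolding \<A>_def using ord_ge_mult[OF A] ord_ge_mult[OF F(1) E] by (auto intro: ord_ge_add)
  have "Psi u * Psi u = Psi u"
    using unit_images(3)[of "php 0 * phm 0"] Y1.kk' Y1.uphp[of 0] Y1.uphm[of 0]
    by (simp add: unit_on_def flip: Psi.mult) (metis Y1.kk' mult.assoc Psi.mult)
  then show "\<A> $$ 0 = Psi u"
    using fls_times_nth_lead[OF A] fls_times_nth_lead[OF F(1) E] F(2) Y1.A_lead(2) Y2.A_lead(2)
    unfolding \<A>_def fls_plus_nth by (simp add: units)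
qed

theorem coproduct_A:
  assumes "qaff_A q xp xm php phm u A c" and c: "fls_map Psi c = fls_map J1 c1 * fls_map J2 c2"
  shows "fls_map Psi A = \<A>"
proof -
  interpret G: qaff_A q xp xm php phm u A c by fact
  interpret S: calg_morph "fls_map Psi" by (rule Psi.fls_map_morph)
  have unit: "unit_on (Psi u) (\<A> $$ n)" "unit_on (Psi u) (fls_map Psi A $$ n)" for n
    using unit_A G.uA unfolding unit_on_nth by (auto intro: unit_images)
  have \<Phi>: "fls_map Psi Y1.\<Phi> = T.\<Phi>"
    by (rule fls_eqI) (simp add: Y1.\<Phi>_nth T.\<Phi>_nth)
  have "fls_map Psi A * T.\<Phi> * T.taq (fls_map Psi A) = fls_map Psi (A * Y1.\<Phi> * Y1.taq A)"
    by (simp add: S.mult \<Phi> Y1.scale.fls_map[OF Psi.calg_morph_axioms])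
  also have "A * Y1.\<Phi> * Y1.taq A = c"
    using G.\<Phi>A G.\<Phi>Ac by (simp add: mult.assoc)
  finally have eq: "fls_map Psi A * T.\<Phi> * T.taq (fls_map Psi A) = \<A> * T.\<Phi> * T.taq \<A>"
    unfolding A_\<Phi>_coproduct c .
  have kG: "Psi (php 0) * fls_map Psi A $$ n = fls_map Psi A $$ n * Psi (php 0)" for n
    using G.phA(1)[of 0] by (simp add: fls_eq_iff fls_const_times_nth fls_times_const_nth flip: Psi.mult)
  have kA: "Psi (php 0) * \<A> $$ n = \<A> $$ n * Psi (php 0)" for n
    using k_A by (simp add: fls_eq_iff fls_const_times_nth fls_times_const_nth)
  show ?thesis
  proof (rule Y1.scale.mult_tri_unique[of 0 "fls_map Psi A" "Psi u" \<A> T.\<Phi> "Psi (phm 0)"])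
    show "ord_ge 0 (fls_map Psi A)" "fls_map Psi A $$ 0 = Psi u"
      using G.A_lead by (auto intro: Psi.fls_map_ord_ge)
    show "scale_mat (q\<^sup>2) 0 0 = 1" "1 + scale_mat (q\<^sup>2) n n \<noteq> 0" for n
      using T.pn by (simp_all add: scale_mat_def)
    show "Psi (phm 0) * (T.\<Phi> $$ 0 * fls_map Psi A $$ n) = fls_map Psi A $$ n"
      "Psi (phm 0) * (T.\<Phi> $$ 0 * \<A> $$ n) = \<A> $$ n" for n
      unfolding T.\<Phi>_nth by (rule T.k'k unit)+
    show "fls_map Psi A $$ n * T.\<Phi> $$ 0 = T.\<Phi> $$ 0 * fls_map Psi A $$ n" 
      "\<A> $$ n * T.\<Phi> $$ 0 = T.\<Phi> $$ 0 * \<A> $$ n" for n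
      unfolding T.\<Phi>_nth by (rule kG[symmetric] kA[symmetric])+
    show "Psi u * T.\<Phi> $$ 0 = T.\<Phi> $$ 0" "T.\<Phi> $$ 0 * Psi u = T.\<Phi> $$ 0"
      using T.uphp[of 0] by (simp_all add: T.\<Phi>_nth unit_on_def)
    show "fls_map Psi A $$ n * Psi u = fls_map Psi A $$ n" "\<A> $$ n * Psi u = \<A> $$ n" for n
      using unit[of n] unfolding unit_on_def by blast+
  qed (rule A_lead T.\<Phi>_ord eq)+
qed

end

section \<open>Algebras as subsets of a type\<close>

locale calg = ring A for A :: "'a calg" (structure) +
  assumes smult_closed: "x \<in> carrier A \<Longrightarrow> c \<odot> x \<in> carrier A"
    and smult_add_right: "x \<in> carrier A \<Longrightarrow> y \<in> carrier A \<Longrightarrow> c \<odot> (x \<oplus> y) = c \<odot> x \<oplus> c \<odot> y"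
    and smult_add_left: "x \<in> carrier A \<Longrightarrow> (c + d) \<odot> x = c \<odot> x \<oplus> d \<odot> x"
    and smult_smult: "x \<in> carrier A \<Longrightarrow> c \<odot> (d \<odot> x) = (c * d) \<odot> x"
    and smult_one: "x \<in> carrier A \<Longrightarrow> 1 \<odot> x = x"
    and smult_mult_left: "x \<in> carrier A \<Longrightarrow> y \<in> carrier A \<Longrightarrow> (c \<odot> x) \<otimes> y = c \<odot> (x \<otimes> y)"
    and smult_mult_right: "x \<in> carrier A \<Longrightarrow> y \<in> carrier A \<Longrightarrow> x \<otimes> (c \<odot> y) = c \<odot> (x \<otimes> y)"

text \<open>
  The product of all algebras whose carrier is a subset of \<open>'a\<close> is an algebra on a type, and each of
  the factors embeds into it by a homomorphism that is not unital.
\<close>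

typedef 'a pr = "{f :: 'a calg \<Rightarrow> 'a. \<forall>B. f B \<in> (if calg B then carrier B else {undefined})}"
proof
  show "(\<lambda>B. if calg B then zero B else undefined) \<in> {f. \<forall>B. f B \<in> (if calg B then carrier B else {undefined})}"
    by (auto simp: calg.axioms(1) ring.ring_simprules(2))
qed

definition pr_mk :: "('a calg \<Rightarrow> 'a) \<Rightarrow> 'a pr" where
  "pr_mk f = Abs_pr (\<lambda>B. if calg B then f B else undefined)"

lemma Rep_pr_mk: "(\<And>B. calg B \<Longrightarrow> f B \<in> carrier B) \<Longrightarrow> Rep_pr (pr_mk f) B = (if calg B then f B else undefined)"
  unfolding pr_mk_def by (subst Abs_pr_inverse) auto

lemma Rep_pr_closed: "calg B \<Longrightarrow> Rep_pr x B \<in> carrier B"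
  using Rep_pr[of x] by (auto dest!: spec[of _ B])

lemma Rep_pr_undefined: "\<not> calg B \<Longrightarrow> Rep_pr x B = undefined"
  using Rep_pr[of x] by (auto dest!: spec[of _ B])

lemma pr_eqI: "(\<And>B. calg B \<Longrightarrow> Rep_pr x B = Rep_pr y B) \<Longrightarrow> x = y"
  by (metis Rep_pr_inject Rep_pr_undefined ext)

instantiation pr :: (type) calgebra
begin

definition "zero_pr = pr_mk (\<lambda>B. \<zero>\<^bsub>B\<^esub>)"
definition "plus_pr x y = pr_mk (\<lambda>B. Rep_pr x B \<oplus>\<^bsub>B\<^esub> Rep_pr y B)"
definition "uminus_pr x = pr_mk (\<lambda>B. \<ominus>\<^bsub>B\<^esub> Rep_pr x B)"
definition "minus_pr x y = pr_mk (\<lambda>B. Rep_pr x B \<ominus>\<^bsub>B\<^esub> Rep_pr y B)"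
definition "times_pr x y = pr_mk (\<lambda>B. Rep_pr x B \<otimes>\<^bsub>B\<^esub> Rep_pr y B)"
definition "sc_pr c x = pr_mk (\<lambda>B. c \<odot>\<^bsub>B\<^esub> Rep_pr x B)"

lemma Rep_pr_ops:
  assumes "calg B"
  shows "Rep_pr 0 B = \<zero>\<^bsub>B\<^esub>" "Rep_pr (x + y) B = Rep_pr x B \<oplus>\<^bsub>B\<^esub> Rep_pr y B" "Rep_pr (- x) B = \<ominus>\<^bsub>B\<^esub> Rep_pr x B"
    "Rep_pr (x - y) B = Rep_pr x B \<ominus>\<^bsub>B\<^esub> Rep_pr y B" "Rep_pr (x * y) B = Rep_pr x B \<otimes>\<^bsub>B\<^esub> Rep_pr y B"
    "Rep_pr (sc c x) B = c \<odot>\<^bsub>B\<^esub> Rep_pr x B"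
proof -
  have [simp]: "ring C" if "calg C" for C :: "'a calg" using calg.axioms(1)[OF that] .
  show "Rep_pr 0 B = \<zero>\<^bsub>B\<^esub>" "Rep_pr (x + y) B = Rep_pr x B \<oplus>\<^bsub>B\<^esub> Rep_pr y B" "Rep_pr (- x) B = \<ominus>\<^bsub>B\<^esub> Rep_pr x B"
    "Rep_pr (x - y) B = Rep_pr x B \<ominus>\<^bsub>B\<^esub> Rep_pr y B" "Rep_pr (x * y) B = Rep_pr x B \<otimes>\<^bsub>B\<^esub> Rep_pr y B"
    "Rep_pr (sc c x) B = c \<odot>\<^bsub>B\<^esub> Rep_pr x B"
    using assms
    by (simp_all add: zero_pr_def plus_pr_def uminus_pr_def minus_pr_def times_pr_def sc_pr_def Rep_pr_mk
        Rep_pr_closed ring.ring_simprules calg.smult_closed)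
qed

instance
proof
  fix x y z :: "'a pr" and c d :: complex
  note ops = Rep_pr_ops Rep_pr_closed calg.axioms(1) ring.ring_simprules
  show "x + y + z = x + (y + z)"
    by (rule pr_eqI) (simp add: ops)
  show "x + y = y + x"
    by (rule pr_eqI) (simp add: ops)
  show "0 + x = x"
    by (rule pr_eqI) (simp add: ops)
  show "- x + x = 0"
    by (rule pr_eqI) (simp add: ops)
  show "x - y = x + - y"
    by (rule pr_eqI) (simp add: ops)
  show "x * y * z = x * (y * z)"
    by (rule pr_eqI) (simp add: ops)
  show "(x + y) * z = x * z + y * z"
    by (rule pr_eqI) (simp add: ops)
  show "x * (y + z) = x * y + x * z"
    by (rule pr_eqI) (simp add: ops)
  show "sc c (x + y) = sc c x + sc c y"
    by (rule pr_eqI) (simp add: ops calg.smult_add_right)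
  show "sc (c + d) x = sc c x + sc d x"
    by (rule pr_eqI) (simp add: ops calg.smult_add_left)
  show "sc c (sc d x) = sc (c * d) x"
    by (rule pr_eqI) (simp add: ops calg.smult_smult)
  show "sc 1 x = x"
    by (rule pr_eqI) (simp add: ops calg.smult_one)
  show "sc c x * y = sc c (x * y)"
    by (rule pr_eqI) (simp add: ops calg.smult_mult_left)
  show "x * sc c y = sc c (x * y)"
    by (rule pr_eqI) (simp add: ops calg.smult_mult_right)
qed

end

definition lift :: "'a calg \<Rightarrow> 'a \<Rightarrow> 'a pr" where
  "lift A a = pr_mk (\<lambda>B. if B = A then a else \<zero>\<^bsub>B\<^esub>)"

abbreviation lower :: "'a calg \<Rightarrow> 'a pr \<Rightarrow> 'a" where
  "lower A x \<equiv> Rep_pr x A"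

context calg
begin

lemma calg_self: "calg A"
  by unfold_locales

lemmas lower_closed = Rep_pr_closed[OF calg_self]
lemmas lower_ops = Rep_pr_ops[OF calg_self]

lemma Rep_lift: "a \<in> carrier A \<Longrightarrow> Rep_pr (lift A a) B = (if calg B then if B = A then a else \<zero>\<^bsub>B\<^esub> else undefined)"
  unfolding lift_def by (subst Rep_pr_mk) (auto simp: calg.axioms(1) ring.ring_simprules(2))

lemma lower_lift: "a \<in> carrier A \<Longrightarrow> lower A (lift A a) = a"
  by (simp add: Rep_lift calg_self)

lemma lift_inj: "a \<in> carrier A \<Longrightarrow> b \<in> carrier A \<Longrightarrow> lift A a = lift A b \<longleftrightarrow> a = b"
  by (metis lower_lift)

lemma smult_zero_right: "c \<odot> \<zero> = \<zero>"
proof -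
  have "c \<odot> \<zero> = c \<odot> (\<zero> \<oplus> \<zero>)" by simp
  also have "\<dots> = c \<odot> \<zero> \<oplus> c \<odot> \<zero>" by (rule smult_add_right) simp_all
  finally show ?thesis
    by (metis add.l_cancel_one' smult_closed zero_closed)
qed

lemma lift_zero: "lift A \<zero> = 0"
  by (rule pr_eqI) (simp add: Rep_lift Rep_pr_ops)

lemma lift_add: "a \<in> carrier A \<Longrightarrow> b \<in> carrier A \<Longrightarrow> lift A (a \<oplus> b) = lift A a + lift A b"
  by (rule pr_eqI) (auto simp: Rep_lift Rep_pr_ops calg.axioms(1) ring.ring_simprules)

lemma lift_uminus: "a \<in> carrier A \<Longrightarrow> lift A (\<ominus> a) = - lift A a"
  by (rule pr_eqI) (auto simp: Rep_lift Rep_pr_ops calg.axioms(1) ring.ring_simprules ring.minus_zero)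

lemma lift_minus: "a \<in> carrier A \<Longrightarrow> b \<in> carrier A \<Longrightarrow> lift A (a \<ominus> b) = lift A a - lift A b"
  by (simp add: minus_eq lift_add lift_uminus)

lemma lift_mult: "a \<in> carrier A \<Longrightarrow> b \<in> carrier A \<Longrightarrow> lift A (a \<otimes> b) = lift A a * lift A b"
  by (rule pr_eqI) (auto simp: Rep_lift Rep_pr_ops calg.axioms(1) ring.ring_simprules)

lemma lift_smult: "a \<in> carrier A \<Longrightarrow> lift A (c \<odot> a) = sc c (lift A a)"
  by (rule pr_eqI) (auto simp: Rep_lift Rep_pr_ops smult_closed calg.smult_zero_right)

lemma lift_sum: "(\<And>i. i \<in> S \<Longrightarrow> f i \<in> carrier A) \<Longrightarrow> lift A (\<Oplus>i\<in>S. f i) = (\<Sum>i\<in>S. lift A (f i))"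
proof (induction S rule: infinite_finite_induct)
  case (infinite S)
  then show ?case by (simp add: lift_zero finsum_infinite)
next
  case (insert x S)
  then show ?case by (simp add: lift_add finsum_closed Pi_def)
qed (simp add: lift_zero)

lemma lift_unit: "a \<in> carrier A \<Longrightarrow> unit_on (lift A \<one>) (lift A a)"
  by (simp add: unit_on_def flip: lift_mult)

lemmas lift_simps = lift_zero lift_add lift_uminus lift_minus lift_mult lift_smult

lemma lift_eq_0_iff: "a \<in> carrier A \<Longrightarrow> lift A a = 0 \<longleftrightarrow> a = \<zero>"
  using lift_inj[of a \<zero>] by (simp add: lift_zero)

end

lemma alg_homD:
  assumes "f \<in> alg_hom A B" "x \<in> carrier A"
  shows "f x \<in> carrier B" "y \<in> carrier A \<Longrightarrow> f (x \<oplus>\<^bsub>A\<^esub> y) = f x \<oplus>\<^bsub>B\<^esub> f y"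
    "y \<in> carrier A \<Longrightarrow> f (x \<otimes>\<^bsub>A\<^esub> y) = f x \<otimes>\<^bsub>B\<^esub> f y" "f (c \<odot>\<^bsub>A\<^esub> x) = c \<odot>\<^bsub>B\<^esub> f x"
  using assms by (auto simp: alg_hom_def ring_hom_def Pi_def)

lemma alg_homI:
  assumes "\<And>x. x \<in> carrier A \<Longrightarrow> f x \<in> carrier B" 
    "\<And>x y. x \<in> carrier A \<Longrightarrow> y \<in> carrier A \<Longrightarrow> f (x \<oplus>\<^bsub>A\<^esub> y) = f x \<oplus>\<^bsub>B\<^esub> f y"
    "\<And>x y. x \<in> carrier A \<Longrightarrow> y \<in> carrier A \<Longrightarrow> f (x \<otimes>\<^bsub>A\<^esub> y) = f x \<otimes>\<^bsub>B\<^esub> f y"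
    "\<And>c x. x \<in> carrier A \<Longrightarrow> f (c \<odot>\<^bsub>A\<^esub> x) = c \<odot>\<^bsub>B\<^esub> f x" "f \<one>\<^bsub>A\<^esub> = \<one>\<^bsub>B\<^esub>"
  shows "f \<in> alg_hom A B"
  using assms by (auto simp: alg_hom_def ring_hom_def Pi_def)

lemma alg_hom_one: "f \<in> alg_hom A B \<Longrightarrow> f \<one>\<^bsub>A\<^esub> = \<one>\<^bsub>B\<^esub>"
  by (simp add: alg_hom_def ring_hom_def)

lemma alg_hom_comp:
  assumes f: "f \<in> alg_hom A B" and g: "g \<in> alg_hom B C"
  shows "(\<lambda>x. g (f x)) \<in> alg_hom A C"
  by (rule alg_homI) (simp_all add: alg_homD(1-4)[OF f] alg_homD(1-4)[OF g] alg_hom_one[OF f] alg_hom_one[OF g])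

text \<open>\<open>lower A\<close> is a homomorphism on the whole product, so the composite is
  multiplicative on the entire type and the results about type-level algebras apply.\<close>

lemma calg_morph_alg_hom:
  assumes "calg A" "calg B" "f \<in> alg_hom A B"
  shows "calg_morph (\<lambda>x. lift B (f (lower A x)))"
proof -
  interpret A: calg A by fact
  interpret B: calg B by fact
  show ?thesis
    by unfold_locales (simp_all add: A.lower_ops A.lower_closed alg_homD[OF assms(3)] B.lift_simps)
qed

lemma alg_hom_zero:
  assumes "calg A" "calg B" "f \<in> alg_hom A B"
  shows "f \<zero>\<^bsub>A\<^esub> = \<zero>\<^bsub>B\<^esub>"
proof -
  interpret A: calg A by fact
  interpret B: calg B by fact
  show ?thesis
    using calg_morph.zero[OF calg_morph_alg_hom[OF assms]] alg_homD(1)[OF assms(3)]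
    by (simp add: A.lower_ops B.lift_eq_0_iff)
qed

lemma alg_hom_uminus:
  assumes "calg A" "calg B" "f \<in> alg_hom A B" "x \<in> carrier A"
  shows "f (\<ominus>\<^bsub>A\<^esub> x) = \<ominus>\<^bsub>B\<^esub> f x"
proof -
  interpret A: calg A by fact
  interpret B: calg B by fact
  have "f (\<ominus>\<^bsub>A\<^esub> x) \<oplus>\<^bsub>B\<^esub> f x = \<zero>\<^bsub>B\<^esub>"
    using alg_hom_zero[OF assms(1-3)] assms(4) by (simp add: A.l_neg flip: alg_homD(2)[OF assms(3)])
  then show ?thesis
    using assms alg_homD(1)[OF assms(3)] by (metis A.a_inv_closed B.minus_equality)
qed

lemma alg_hom_minus:
  assumes "calg A" "calg B" "f \<in> alg_hom A B" "x \<in> carrier A" "y \<in> carrier A"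
  shows "f (x \<ominus>\<^bsub>A\<^esub> y) = f x \<ominus>\<^bsub>B\<^esub> f y"
proof -
  interpret A: calg A by fact
  interpret B: calg B by fact
  show ?thesis
    using assms by (simp add: A.minus_eq B.minus_eq alg_homD[OF assms(3)] alg_hom_uminus[OF assms(1-3)])
qed

section \<open>Quotients and monoid algebras\<close>

text \<open>The quotient algebra copies the ring fields of \<open>FactRing\<close> into a record
  with scalars, and the ring axioms depend on these fields alone.\<close>

lemma ring_cong:
  assumes "ring R" and eq: "carrier S = carrier R" "mult S = mult R" "one S = one R" "zero S = zero R" "add S = add R"
  shows "ring S"
proof -
  interpret R: ring R by fact
  show ?thesis
  proof (rule ringI)
    show "abelian_group S"
    proof (rule abelian_groupI)
      show "\<exists>y\<in>carrier S. y \<oplus>\<^bsub>S\<^esub> x = \<zero>\<^bsub>S\<^esub>" if "x \<in> carrier S" for x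
        using that R.l_neg R.a_inv_closed unfolding eq by blast
    qed (auto simp: eq R.a_ac)
    show "monoid S"
      by (rule monoidI) (auto simp: eq R.m_assoc)
  qed (auto simp: eq R.l_distr R.r_distr)
qed

locale calg_ideal = calg A + ideal I A for A :: "'a calg" (structure) and I
begin

definition "proj x = I +> x"

lemma quot_carrier: "X \<in> carrier (quot_alg A I) \<longleftrightarrow> (\<exists>x\<in>carrier A. X = proj x)"
  by (auto simp: quot_alg_def FactRing_def A_RCOSETS_def' proj_def)

lemma proj_eq_iff:
  assumes "x \<in> carrier A" "y \<in> carrier A"
  shows "proj x = proj y \<longleftrightarrow> x \<ominus> y \<in> I"
  using quotient_eq_iff_same_a_r_cos[OF is_ideal assms] by (auto simp: proj_def)

text \<open>The scalar c acts as left multiplication by c times the unit.\<close>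

lemma I_smult: "x \<in> I \<Longrightarrow> c \<odot> x \<in> I"
  using I_l_closed[of x "c \<odot> \<one>"] a_subset by (auto simp: smult_closed smult_mult_left)

lemma smult_minus: "x \<in> carrier A \<Longrightarrow> y \<in> carrier A \<Longrightarrow> c \<odot> x \<ominus> c \<odot> y = c \<odot> (x \<ominus> y)"
proof -
  assume xy: "x \<in> carrier A" "y \<in> carrier A"
  have "lift A (c \<odot> x \<ominus> c \<odot> y) = lift A (c \<odot> (x \<ominus> y))"
    using xy by (simp add: lift_simps smult_closed sc_diff_right)
  then show ?thesis
    using xy by (simp add: lift_inj smult_closed)
qed

lemma proj_mem: "x \<in> carrier A \<Longrightarrow> x \<in> proj x"
  unfolding proj_def by (rule a_rcos_self) 

lemma mem_proj: "x \<in> carrier A \<Longrightarrow> y \<in> proj x \<Longrightarrow> y \<in> carrier A \<and> proj y = proj x"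
  unfolding proj_def using a_elemrcos_carrier[of x y] a_repr_independence'[of y x] by simp

lemma quot_ops:
  "x \<in> carrier A \<Longrightarrow> y \<in> carrier A \<Longrightarrow> proj x \<oplus>\<^bsub>quot_alg A I\<^esub> proj y = proj (x \<oplus> y)"
  "x \<in> carrier A \<Longrightarrow> y \<in> carrier A \<Longrightarrow> proj x \<otimes>\<^bsub>quot_alg A I\<^esub> proj y = proj (x \<otimes> y)"
  "\<one>\<^bsub>quot_alg A I\<^esub> = proj \<one>" "\<zero>\<^bsub>quot_alg A I\<^esub> = proj \<zero>"
  "x \<in> carrier A \<Longrightarrow> c \<odot>\<^bsub>quot_alg A I\<^esub> proj x = proj (c \<odot> x)"
proof -
  show "x \<in> carrier A \<Longrightarrow> y \<in> carrier A \<Longrightarrow> proj x \<oplus>\<^bsub>quot_alg A I\<^esub> proj y = proj (x \<oplus> y)"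
    by (simp add: quot_alg_def FactRing_def proj_def a_rcos_sum)
  show "x \<in> carrier A \<Longrightarrow> y \<in> carrier A \<Longrightarrow> proj x \<otimes>\<^bsub>quot_alg A I\<^esub> proj y = proj (x \<otimes> y)"
    by (simp add: quot_alg_def FactRing_def proj_def rcoset_mult_add)
  show "\<one>\<^bsub>quot_alg A I\<^esub> = proj \<one>"
    by (simp add: quot_alg_def FactRing_def proj_def)
  show "\<zero>\<^bsub>quot_alg A I\<^esub> = proj \<zero>"
    using a_rcos_zero[OF is_ideal, of \<zero>] by (simp add: quot_alg_def FactRing_def proj_def zero_closed additive_subgroup.zero_closed[OF is_additive_subgroup])
  assume x: "x \<in> carrier A"
  have "c \<odot>\<^bsub>quot_alg A I\<^esub> proj x = (\<Union>y\<in>proj x. proj (c \<odot> y))"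
    by (simp add: quot_alg_def proj_def)
  also have "\<dots> = (\<Union>y\<in>proj x. proj (c \<odot> x))"
  proof (rule SUP_cong[OF refl])
    fix y assume "y \<in> proj x"
    then have y: "y \<in> carrier A" "proj y = proj x" using mem_proj[OF x] by auto
    then have "y \<ominus> x \<in> I" using proj_eq_iff x by simp
    then show "proj (c \<odot> y) = proj (c \<odot> x)"
      using x y by (simp add: proj_eq_iff smult_closed smult_minus I_smult)
  qed
  also have "\<dots> = proj (c \<odot> x)" using proj_mem[OF x] by auto
  finally show "c \<odot>\<^bsub>quot_alg A I\<^esub> proj x = proj (c \<odot> x)" .
qed

lemma calg_quot: "calg (quot_alg A I)"
proof -
  interpret Q: ring "quot_alg A I"
    by (rule ring_cong[OF quotient_is_ring]) (simp_all add: quot_alg_def)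
  show ?thesis
    by unfold_locales
      (auto simp: quot_carrier quot_ops smult_closed smult_add_right smult_add_left smult_smult smult_one
        smult_mult_left smult_mult_right)
qed

lemma proj_hom: "proj \<in> alg_hom A (quot_alg A I)"
  by (rule alg_homI) (auto simp: quot_carrier quot_ops)

lemma proj_zero_iff: "x \<in> carrier A \<Longrightarrow> proj x = \<zero>\<^bsub>quot_alg A I\<^esub> \<longleftrightarrow> x \<in> I"
  by (simp add: quot_ops proj_eq_iff minus_eq)

text \<open>f is constant on each coset of I, so its image of a coset is a singleton and
  \<open>the_elem\<close> is well defined on it.\<close>

lemma factor:
  assumes B: "calg B" and f: "f \<in> alg_hom A B" and I: "\<And>x. x \<in> I \<Longrightarrow> f x = \<zero>\<^bsub>B\<^esub>"
  shows "x \<in> carrier A \<Longrightarrow> the_elem (f ` proj x) = f x"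
    and "(\<lambda>X. the_elem (f ` X)) \<in> alg_hom (quot_alg A I) B"
proof -
  interpret B: calg B by fact
  have img: "f ` proj x = {f x}" if x: "x \<in> carrier A" for x
  proof -
    have "f y = f x" if "y \<in> proj x" for y
    proof -
      have y: "y \<in> carrier A" "proj y = proj x" using mem_proj[OF x that] by auto
      then have "f (y \<ominus> x) = \<zero>\<^bsub>B\<^esub>" using proj_eq_iff x I by simp
      then have "f y \<ominus>\<^bsub>B\<^esub> f x = \<zero>\<^bsub>B\<^esub>"
        using alg_hom_minus[OF calg_self B f y(1) x] by simp
      then show "f y = f x"
        using alg_homD(1)[OF f] x y
        by (metis B.lift_inj B.lift_minus B.lift_zero right_minus_eq)
    qed
    then show ?thesis using proj_mem[OF x] by blast
  qed
  show *: "the_elem (f ` proj x) = f x" if "x \<in> carrier A" for x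
    by (simp add: img[OF that])
  show "(\<lambda>X. the_elem (f ` X)) \<in> alg_hom (quot_alg A I) B"
    by (rule alg_homI) (auto simp: quot_carrier quot_ops * alg_homD[OF f] alg_hom_one[OF f] smult_closed)
qed

end

text \<open>The kernel of f is an ideal containing the generators.\<close>

lemma genideal_hom_zero:
  assumes A: "calg A" and B: "calg B" and f: "f \<in> alg_hom A B" and S: "S \<subseteq> carrier A" "\<And>x. x \<in> S \<Longrightarrow> f x = \<zero>\<^bsub>B\<^esub>"
    and x: "x \<in> Idl\<^bsub>A\<^esub> S"
  shows "f x = \<zero>\<^bsub>B\<^esub>"
proof -
  interpret A: calg A by fact
  interpret B: calg B by fact
  interpret ring_hom_ring A B f
    by (rule ring_hom_ringI2) (use f in \<open>auto simp: alg_hom_def intro: A.ring_axioms B.ring_axioms\<close>)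
  have "Idl\<^bsub>A\<^esub> S \<subseteq> a_kernel A B f"
  proof (rule A.genideal_minimal[OF kernel_is_ideal])
    show "S \<subseteq> a_kernel A B f"
      unfolding a_kernel_def' using S by blast
  qed
  then show ?thesis using x unfolding a_kernel_def' by blast
qed

lemma monoid_alg_mult_superset:
  assumes "finite S" "Poly_Mapping.keys p \<subseteq> S" "finite T" "Poly_Mapping.keys r \<subseteq> T"
  shows "p \<otimes>\<^bsub>monoid_alg M\<^esub> r = (\<Sum>x\<in>S. \<Sum>y\<in>T.
     Poly_Mapping.single (x \<otimes>\<^bsub>M\<^esub> y) (Poly_Mapping.lookup p x * Poly_Mapping.lookup r y))"
proof -
  have "(\<Sum>y\<in>Poly_Mapping.keys r. Poly_Mapping.single (x \<otimes>\<^bsub>M\<^esub> y) (Poly_Mapping.lookup p x * Poly_Mapping.lookup r y))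
      = (\<Sum>y\<in>T. Poly_Mapping.single (x \<otimes>\<^bsub>M\<^esub> y) (Poly_Mapping.lookup p x * Poly_Mapping.lookup r y))" for x
    by (rule sum.mono_neutral_left) (use assms in \<open>auto simp: in_keys_iff\<close>)
  then have "p \<otimes>\<^bsub>monoid_alg M\<^esub> r = (\<Sum>x\<in>Poly_Mapping.keys p. \<Sum>y\<in>T.
     Poly_Mapping.single (x \<otimes>\<^bsub>M\<^esub> y) (Poly_Mapping.lookup p x * Poly_Mapping.lookup r y))"
    by (simp add: monoid_alg_def)
  also have "\<dots> = (\<Sum>x\<in>S. \<Sum>y\<in>T.
     Poly_Mapping.single (x \<otimes>\<^bsub>M\<^esub> y) (Poly_Mapping.lookup p x * Poly_Mapping.lookup r y))"
    by (rule sum.mono_neutral_left) (use assms in \<open>auto simp: in_keys_iff\<close>)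
  finally show ?thesis .
qed

lemma monoid_alg_add_left:
  "(p + p') \<otimes>\<^bsub>monoid_alg M\<^esub> r = p \<otimes>\<^bsub>monoid_alg M\<^esub> r + p' \<otimes>\<^bsub>monoid_alg M\<^esub> r"
proof -
  let ?S = "Poly_Mapping.keys p \<union> Poly_Mapping.keys p'" and ?T = "Poly_Mapping.keys r"
  show ?thesis
    using keys_add[of p p']
    by (simp add: monoid_alg_mult_superset[of ?S _ ?T] lookup_add distrib_right single_add sum.distrib)
qed

lemma monoid_alg_add_right:
  "r \<otimes>\<^bsub>monoid_alg M\<^esub> (p + p') = r \<otimes>\<^bsub>monoid_alg M\<^esub> p + r \<otimes>\<^bsub>monoid_alg M\<^esub> p'"
proof -
  let ?S = "Poly_Mapping.keys p \<union> Poly_Mapping.keys p'" and ?T = "Poly_Mapping.keys r"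
  show ?thesis
    using keys_add[of p p']
    by (simp add: monoid_alg_mult_superset[of ?T _ ?S] lookup_add distrib_left single_add sum.distrib)
qed

lemma monoid_alg_single_mult:
  "Poly_Mapping.single x c \<otimes>\<^bsub>monoid_alg M\<^esub> Poly_Mapping.single y d = Poly_Mapping.single (x \<otimes>\<^bsub>M\<^esub> y) (c * d)"
  by (simp add: monoid_alg_mult_superset[of "{x}" _ "{y}"])

lemma monoid_alg_simps:
  "carrier (monoid_alg M) = {p. Poly_Mapping.keys p \<subseteq> carrier M}"
  "\<one>\<^bsub>monoid_alg M\<^esub> = Poly_Mapping.single \<one>\<^bsub>M\<^esub> 1" "\<zero>\<^bsub>monoid_alg M\<^esub> = 0"
  "p \<oplus>\<^bsub>monoid_alg M\<^esub> r = p + r"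
  by (simp_all add: monoid_alg_def)

lemma monoid_alg_smult: "Poly_Mapping.lookup (c \<odot>\<^bsub>monoid_alg M\<^esub> p) x = c * Poly_Mapping.lookup p x"
  by (simp add: monoid_alg_def map.rep_eq when_def)

lemma monoid_alg_smult_single: "c \<odot>\<^bsub>monoid_alg M\<^esub> Poly_Mapping.single x d = Poly_Mapping.single x (c * d)"
  by (rule poly_mapping_eqI) (simp add: monoid_alg_smult lookup_single when_def)

lemma monoid_alg_smult_add: "c \<odot>\<^bsub>monoid_alg M\<^esub> (p + r) = c \<odot>\<^bsub>monoid_alg M\<^esub> p + c \<odot>\<^bsub>monoid_alg M\<^esub> r"
  by (rule poly_mapping_eqI) (simp add: monoid_alg_smult lookup_add distrib_left)

lemma poly_mapping_sum_single: "p = (\<Sum>x\<in>Poly_Mapping.keys p. Poly_Mapping.single x (Poly_Mapping.lookup p x))"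
  by (rule poly_mapping_eqI) (simp add: lookup_sum lookup_single when_def in_keys_iff)

lemma monoid_alg_induct [consumes 1, case_names zero add]:
  assumes "p \<in> carrier (monoid_alg M)" "P 0"
    and add: "\<And>x c p. x \<in> carrier M \<Longrightarrow> p \<in> carrier (monoid_alg M) \<Longrightarrow> P p \<Longrightarrow> P (Poly_Mapping.single x c + p)"
  shows "P p"
proof -
  have "P (\<Sum>x\<in>S. Poly_Mapping.single x (Poly_Mapping.lookup p x)) \<and> (\<Sum>x\<in>S. Poly_Mapping.single x (Poly_Mapping.lookup p x)) \<in> carrier (monoid_alg M)"
    if "finite S" "S \<subseteq> carrier M" for S
    using that
  proof (induction S rule: finite_induct)
    case (insert x S)
    then show ?case
      using keys_add[of "Poly_Mapping.single x (Poly_Mapping.lookup p x)" "\<Sum>x\<in>S. Poly_Mapping.single x (Poly_Mapping.lookup p x)"]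
      by (auto intro!: add simp: monoid_alg_simps split: if_splits)
  qed (simp add: assms monoid_alg_simps)
  from this[of "Poly_Mapping.keys p"] show ?thesis
    using assms(1) unfolding poly_mapping_sum_single[of p, symmetric] by (simp add: monoid_alg_simps)
qed

lemma monoid_alg_zero_mult: "0 \<otimes>\<^bsub>monoid_alg M\<^esub> p = 0" "p \<otimes>\<^bsub>monoid_alg M\<^esub> 0 = 0"
  by (simp_all add: monoid_alg_def)

lemma monoid_alg_smult_zero: "c \<odot>\<^bsub>monoid_alg M\<^esub> 0 = 0"
  by (rule poly_mapping_eqI) (simp add: monoid_alg_smult)

text \<open>The identities are additive in every argument, so they are checked on basis elements and
  extended one argument at a time by induction.\<close>

lemma calg_monoid_alg:
  assumes "monoid M"
  shows "calg (monoid_alg M)"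
proof -
  interpret M: monoid M by fact
  let ?A = "monoid_alg M"
  have zero_closed: "0 \<in> carrier ?A"
    by (simp add: monoid_alg_simps)
  have single: "Poly_Mapping.single x c \<in> carrier ?A" if "x \<in> carrier M" for x c
    using that by (simp add: monoid_alg_simps)
  have add_closed: "p + r \<in> carrier ?A" if "p \<in> carrier ?A" "r \<in> carrier ?A" for p r
    using that keys_add[of p r] by (auto simp: monoid_alg_simps)
  have single_closed: "Poly_Mapping.single x c \<otimes>\<^bsub>?A\<^esub> r \<in> carrier ?A" if "x \<in> carrier M" "r \<in> carrier ?A" for x c r
    using that(2)
    by (induction r rule: monoid_alg_induct)
      (auto simp: monoid_alg_add_right monoid_alg_single_mult monoid_alg_zero_mult single zero_closed that intro!: add_closed)
  have mult_closed: "p \<otimes>\<^bsub>?A\<^esub> r \<in> carrier ?A" if "p \<in> carrier ?A" "r \<in> carrier ?A" for p r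
    using that(1)
    by (induction p rule: monoid_alg_induct)
      (auto simp: monoid_alg_add_left monoid_alg_zero_mult single_closed zero_closed that intro!: add_closed)
  have assoc1: "(Poly_Mapping.single x c \<otimes>\<^bsub>?A\<^esub> Poly_Mapping.single y d) \<otimes>\<^bsub>?A\<^esub> s = Poly_Mapping.single x c \<otimes>\<^bsub>?A\<^esub> (Poly_Mapping.single y d \<otimes>\<^bsub>?A\<^esub> s)"
    if "x \<in> carrier M" "y \<in> carrier M" "s \<in> carrier ?A" for x y c d s
    using that(3)
    by (induction s rule: monoid_alg_induct)
      (simp_all add: monoid_alg_add_right monoid_alg_single_mult monoid_alg_zero_mult that M.m_assoc mult.assoc)
  have assoc2: "(Poly_Mapping.single x c \<otimes>\<^bsub>?A\<^esub> r) \<otimes>\<^bsub>?A\<^esub> s = Poly_Mapping.single x c \<otimes>\<^bsub>?A\<^esub> (r \<otimes>\<^bsub>?A\<^esub> s)"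
    if "x \<in> carrier M" "r \<in> carrier ?A" "s \<in> carrier ?A" for x c r s
    using that(2)
    by (induction r rule: monoid_alg_induct)
      (simp_all add: monoid_alg_add_right monoid_alg_add_left monoid_alg_zero_mult assoc1 that)
  have assoc: "(p \<otimes>\<^bsub>?A\<^esub> r) \<otimes>\<^bsub>?A\<^esub> s = p \<otimes>\<^bsub>?A\<^esub> (r \<otimes>\<^bsub>?A\<^esub> s)"
    if "p \<in> carrier ?A" "r \<in> carrier ?A" "s \<in> carrier ?A" for p r s
    using that(1)
    by (induction p rule: monoid_alg_induct)
      (simp_all add: monoid_alg_add_left monoid_alg_zero_mult assoc2 that)
  have one_left: "Poly_Mapping.single \<one>\<^bsub>M\<^esub> 1 \<otimes>\<^bsub>?A\<^esub> p = p" and one_right: "p \<otimes>\<^bsub>?A\<^esub> Poly_Mapping.single \<one>\<^bsub>M\<^esub> 1 = p" if "p \<in> carrier ?A" for p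
    using that by (induction p rule: monoid_alg_induct)
      (simp_all add: monoid_alg_add_left monoid_alg_add_right monoid_alg_single_mult monoid_alg_zero_mult)
  have smult_single_left: "(c \<odot>\<^bsub>?A\<^esub> p) \<otimes>\<^bsub>?A\<^esub> Poly_Mapping.single y d = c \<odot>\<^bsub>?A\<^esub> (p \<otimes>\<^bsub>?A\<^esub> Poly_Mapping.single y d)"
    "Poly_Mapping.single y d \<otimes>\<^bsub>?A\<^esub> (c \<odot>\<^bsub>?A\<^esub> p) = c \<odot>\<^bsub>?A\<^esub> (Poly_Mapping.single y d \<otimes>\<^bsub>?A\<^esub> p)"
    if "p \<in> carrier ?A" for c p y d
    using that by (induction p rule: monoid_alg_induct)
      (simp_all add: monoid_alg_add_left monoid_alg_add_right monoid_alg_single_mult monoid_alg_zero_mult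
        monoid_alg_smult_add monoid_alg_smult_single monoid_alg_smult_zero mult.left_commute mult.assoc)
  have smult_left: "(c \<odot>\<^bsub>?A\<^esub> p) \<otimes>\<^bsub>?A\<^esub> r = c \<odot>\<^bsub>?A\<^esub> (p \<otimes>\<^bsub>?A\<^esub> r)"
    if "p \<in> carrier ?A" "r \<in> carrier ?A" for c p r
    using that(2) by (induction r rule: monoid_alg_induct)
      (simp_all add: monoid_alg_add_left monoid_alg_add_right monoid_alg_zero_mult
        monoid_alg_smult_add monoid_alg_smult_zero smult_single_left that)
  have smult_right: "r \<otimes>\<^bsub>?A\<^esub> (c \<odot>\<^bsub>?A\<^esub> p) = c \<odot>\<^bsub>?A\<^esub> (r \<otimes>\<^bsub>?A\<^esub> p)"
    if "p \<in> carrier ?A" "r \<in> carrier ?A" for c p r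
    using that(2) by (induction r rule: monoid_alg_induct)
      (simp_all add: monoid_alg_add_left monoid_alg_add_right monoid_alg_zero_mult
        monoid_alg_smult_add monoid_alg_smult_zero smult_single_left that)
  have ring: "ring ?A"
  proof (rule ringI)
    show "abelian_group ?A"
    proof (rule abelian_groupI)
      fix p assume "p \<in> carrier ?A"
      then show "\<exists>y\<in>carrier ?A. y \<oplus>\<^bsub>?A\<^esub> p = \<zero>\<^bsub>?A\<^esub>"
        by (intro bexI[of _ "- p"]) (simp_all add: monoid_alg_simps)
    qed (auto simp: add_closed monoid_alg_simps(3,4) add_ac, simp add: monoid_alg_simps)
    show "monoid ?A"
      by (rule monoidI) (simp_all add: mult_closed assoc one_left one_right monoid_alg_simps(2) single)
  qed (simp_all add: monoid_alg_simps(4) monoid_alg_add_left monoid_alg_add_right)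
  then interpret ring ?A .
  show ?thesis
  proof
    fix p r :: "'a \<Rightarrow>\<^sub>0 complex" and c d :: complex
    show "c \<odot>\<^bsub>?A\<^esub> p \<in> carrier ?A" if "p \<in> carrier ?A"
      using that by (auto simp: monoid_alg_simps in_keys_iff monoid_alg_smult)
    show "c \<odot>\<^bsub>?A\<^esub> (p \<oplus>\<^bsub>?A\<^esub> r) = c \<odot>\<^bsub>?A\<^esub> p \<oplus>\<^bsub>?A\<^esub> c \<odot>\<^bsub>?A\<^esub> r"
      by (simp add: monoid_alg_simps monoid_alg_smult_add)
    show "(c + d) \<odot>\<^bsub>?A\<^esub> p = c \<odot>\<^bsub>?A\<^esub> p \<oplus>\<^bsub>?A\<^esub> d \<odot>\<^bsub>?A\<^esub> p" "c \<odot>\<^bsub>?A\<^esub> (d \<odot>\<^bsub>?A\<^esub> p) = (c * d) \<odot>\<^bsub>?A\<^esub> p" "1 \<odot>\<^bsub>?A\<^esub> p = p"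
      by (auto intro!: poly_mapping_eqI simp: monoid_alg_simps monoid_alg_smult lookup_add distrib_right)
  qed (simp_all add: smult_left smult_right)
qed

text \<open>The universal property of the monoid algebra. Sums over the keys are compared after
  \<open>lift\<close>, where they become sums in a type and can be extended to a common index
  set.\<close>

lemma monoid_alg_hom:
  assumes M: "monoid M" and B: "calg B" and \<eta>: "\<And>x. x \<in> carrier M \<Longrightarrow> \<eta> x \<in> carrier B"
    "\<And>x y. x \<in> carrier M \<Longrightarrow> y \<in> carrier M \<Longrightarrow> \<eta> (x \<otimes>\<^bsub>M\<^esub> y) = \<eta> x \<otimes>\<^bsub>B\<^esub> \<eta> y" "\<eta> \<one>\<^bsub>M\<^esub> = \<one>\<^bsub>B\<^esub>"
  defines "L \<equiv> \<lambda>p. \<Oplus>\<^bsub>B\<^esub>k\<in>Poly_Mapping.keys p. Poly_Mapping.lookup p k \<odot>\<^bsub>B\<^esub> \<eta> k"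
  shows "L \<in> alg_hom (monoid_alg M) B" and "x \<in> carrier M \<Longrightarrow> L (Poly_Mapping.single x c) = c \<odot>\<^bsub>B\<^esub> \<eta> x"
proof -
  interpret B: calg B by fact
  interpret M: monoid M by fact
  interpret A: calg "monoid_alg M" by (rule calg_monoid_alg[OF M])
  have closed: "L p \<in> carrier B" if "p \<in> carrier (monoid_alg M)" for p
    unfolding L_def using that \<eta> by (auto intro!: B.finsum_closed B.smult_closed simp: monoid_alg_simps)
  have lift_L: "lift B (L p) = (\<Sum>k\<in>S. sc (Poly_Mapping.lookup p k) (lift B (\<eta> k)))"
    if "p \<in> carrier (monoid_alg M)" "finite S" "Poly_Mapping.keys p \<subseteq> S" for p S
  proof -
    have k: "k \<in> carrier M" if "k \<in> Poly_Mapping.keys p" for k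
      using that \<open>p \<in> _\<close> by (auto simp: monoid_alg_simps)
    have "lift B (L p) = (\<Sum>k\<in>Poly_Mapping.keys p. sc (Poly_Mapping.lookup p k) (lift B (\<eta> k)))"
      unfolding L_def using k \<eta> by (simp add: B.lift_sum B.smult_closed B.lift_smult)
    also have "\<dots> = (\<Sum>k\<in>S. sc (Poly_Mapping.lookup p k) (lift B (\<eta> k)))"
      by (rule sum.mono_neutral_left) (use that in \<open>auto simp: in_keys_iff\<close>)
    finally show ?thesis .
  qed
  have single: "L (Poly_Mapping.single x c) = c \<odot>\<^bsub>B\<^esub> \<eta> x" if "x \<in> carrier M" for x c
  proof -
    have "lift B (L (Poly_Mapping.single x c)) = lift B (c \<odot>\<^bsub>B\<^esub> \<eta> x)"
      using that \<eta> by (subst lift_L[of _ "{x}"]) (auto simp: monoid_alg_simps B.lift_smult)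
    then show ?thesis
      using that \<eta> closed[of "Poly_Mapping.single x c"] by (simp add: B.lift_inj B.smult_closed monoid_alg_simps)
  qed
  then show "x \<in> carrier M \<Longrightarrow> L (Poly_Mapping.single x c) = c \<odot>\<^bsub>B\<^esub> \<eta> x" .
  have L_add: "L (p + r) = L p \<oplus>\<^bsub>B\<^esub> L r" if pr: "p \<in> carrier (monoid_alg M)" "r \<in> carrier (monoid_alg M)" for p r
  proof -
    let ?S = "Poly_Mapping.keys p \<union> Poly_Mapping.keys r"
    have pr': "p + r \<in> carrier (monoid_alg M)"
      using A.add.m_closed[OF pr] by (simp add: monoid_alg_simps(4))
    have "lift B (L (p + r)) = lift B (L p \<oplus>\<^bsub>B\<^esub> L r)"
      using pr pr' keys_add[of p r]
      by (simp add: lift_L[of _ ?S] B.lift_add closed lookup_add sc_add_left sum.distrib)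
    then show ?thesis
      using pr pr' closed by (simp add: B.lift_inj)
  qed
  have L0: "L 0 = \<zero>\<^bsub>B\<^esub>"
    by (simp add: L_def)
  show "L \<in> alg_hom (monoid_alg M) B"
  proof (rule alg_homI)
    fix p r :: "'a \<Rightarrow>\<^sub>0 complex" and c assume p: "p \<in> carrier (monoid_alg M)"
    show "L p \<in> carrier B" by (rule closed[OF p])
    show "L (c \<odot>\<^bsub>monoid_alg M\<^esub> p) = c \<odot>\<^bsub>B\<^esub> L p"
    proof -
      have "lift B (L (c \<odot>\<^bsub>monoid_alg M\<^esub> p)) = lift B (c \<odot>\<^bsub>B\<^esub> L p)"
        using p A.smult_closed[OF p, of c]
        by (subst lift_L[of _ "Poly_Mapping.keys p"])
          (auto simp: in_keys_iff monoid_alg_smult B.lift_smult closed lift_L[of p "Poly_Mapping.keys p"] sc_sum_right sc_sc)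
      then show ?thesis
        using p A.smult_closed[OF p, of c] by (simp add: B.lift_inj closed B.smult_closed)
    qed
    assume r: "r \<in> carrier (monoid_alg M)"
    show "L (p \<oplus>\<^bsub>monoid_alg M\<^esub> r) = L p \<oplus>\<^bsub>B\<^esub> L r"
      using L_add[OF p r] by (simp add: monoid_alg_simps)
    have sc: "Poly_Mapping.single x c \<in> carrier (monoid_alg M)" if "x \<in> carrier M" for x c
      using that by (simp add: monoid_alg_simps)
    have *: "L (Poly_Mapping.single x c \<otimes>\<^bsub>monoid_alg M\<^esub> r) = L (Poly_Mapping.single x c) \<otimes>\<^bsub>B\<^esub> L r" if x: "x \<in> carrier M" for x c
      using r
    proof (induction r rule: monoid_alg_induct)
      case zero
      then show ?case using x by (simp add: monoid_alg_zero_mult L0 closed sc)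
    next
      case (add y d r)
      have s: "Poly_Mapping.single x c \<otimes>\<^bsub>monoid_alg M\<^esub> r \<in> carrier (monoid_alg M)" "Poly_Mapping.single (x \<otimes>\<^bsub>M\<^esub> y) (c * d) \<in> carrier (monoid_alg M)"
        using add x by (auto intro!: A.m_closed sc)
      then show ?case
        using add x \<eta>
        by (simp add: monoid_alg_add_right monoid_alg_single_mult L_add sc single closed B.r_distr B.smult_mult_left
          B.smult_mult_right B.smult_closed B.smult_smult mult.commute)
    qed
    show "L (p \<otimes>\<^bsub>monoid_alg M\<^esub> r) = L p \<otimes>\<^bsub>B\<^esub> L r"
      using p
    proof (induction p rule: monoid_alg_induct)
      case zero
      then show ?case using r by (simp add: monoid_alg_zero_mult L0 closed)
    next
      case (add y d p)
      then show ?case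
        using r
        by (simp add: monoid_alg_add_left L_add sc closed B.l_distr * A.m_closed)
    qed
  next
    show "L \<one>\<^bsub>monoid_alg M\<^esub> = \<one>\<^bsub>B\<^esub>"
      by (simp add: monoid_alg_simps single \<eta> B.smult_one)
  qed
qed

section \<open>Tensor products and series with coefficients in an algebra\<close>

locale calg_tensor = A: calg A + B: calg B for A :: "'a calg" and B :: "'b calg"
begin

abbreviation "N \<equiv> monoid_alg (A \<times>\<times> B)"
abbreviation "e x y \<equiv> Poly_Mapping.single (x, y) (1::complex)"

lemma monoid_AB: "monoid (A \<times>\<times> B)"
  by (rule DirProd_monoid) unfold_locales

sublocale N: calg N
  by (rule calg_monoid_alg[OF monoid_AB])

lemma single_closed: "x \<in> carrier A \<Longrightarrow> y \<in> carrier B \<Longrightarrow> Poly_Mapping.single (x, y) c \<in> carrier N"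
  by (simp add: monoid_alg_simps)

lemma N_minus: "p \<in> carrier N \<Longrightarrow> r \<in> carrier N \<Longrightarrow> p \<ominus>\<^bsub>N\<^esub> r = p - r"
proof -
  assume "p \<in> carrier N" and r: "r \<in> carrier N"
  have "- r \<in> carrier N" using r by (simp add: monoid_alg_simps)
  then have "\<ominus>\<^bsub>N\<^esub> r = - r"
    using r by (intro N.minus_equality) (simp_all add: monoid_alg_simps)
  then show ?thesis by (simp add: N.minus_eq monoid_alg_simps)
qed

lemma relators_closed: "bilinear_relators A B \<subseteq> carrier N"
proof -
  have "p - r \<in> carrier N" if "p \<in> carrier N" "r \<in> carrier N" for p r
    using N.minus_closed[OF that] N_minus[OF that] by simp
  then show ?thesis
    unfolding bilinear_relators_def Let_def
    by (auto simp: single_closed A.smult_closed B.smult_closed)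
qed

sublocale I: calg_ideal N "tensor_ideal A B"
  by (intro calg_ideal.intro N.calg_self) (simp add: tensor_ideal_def N.genideal_ideal relators_closed)

sublocale T: calg "tensor_alg A B"
  using I.calg_quot by (simp add: tensor_alg_def)

abbreviation "t \<equiv> pure_tensor A B"

lemma t_proj: "t x y = I.proj (e x y)"
  by (simp add: pure_tensor_def I.proj_def)

lemma t_closed: "x \<in> carrier A \<Longrightarrow> y \<in> carrier B \<Longrightarrow> t x y \<in> carrier (tensor_alg A B)"
  using alg_homD(1)[OF I.proj_hom single_closed] by (simp add: t_proj tensor_alg_def)

lemma relator_eq:
  assumes "p - r \<in> bilinear_relators A B" "p \<in> carrier N" "r \<in> carrier N"
  shows "I.proj p = I.proj r"
proof -
  have "p - r \<in> tensor_ideal A B"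
    using assms(1) N.genideal_self[OF relators_closed] unfolding tensor_ideal_def by blast
  then show ?thesis
    using assms(2,3) by (simp add: I.proj_eq_iff N_minus)
qed

lemma single_plus_closed: "p \<in> carrier N \<Longrightarrow> r \<in> carrier N \<Longrightarrow> p + r \<in> carrier N"
  using N.add.m_closed[of p r] by (simp add: monoid_alg_simps)

lemma t_add_left: "x \<in> carrier A \<Longrightarrow> x' \<in> carrier A \<Longrightarrow> y \<in> carrier B \<Longrightarrow>
    t (x \<oplus>\<^bsub>A\<^esub> x') y = t x y \<oplus>\<^bsub>tensor_alg A B\<^esub> t x' y"
proof -
  assume x: "x \<in> carrier A" "x' \<in> carrier A" "y \<in> carrier B"
  have "I.proj (e (x \<oplus>\<^bsub>A\<^esub> x') y) = I.proj (e x y + e x' y)"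
    by (rule relator_eq)
      (use x in \<open>auto simp: bilinear_relators_def Let_def single_closed diff_diff_eq intro!: single_plus_closed\<close>)
  then show ?thesis
    using x by (simp add: t_proj tensor_alg_def I.quot_ops single_closed monoid_alg_simps)
qed

lemma t_add_right: "x \<in> carrier A \<Longrightarrow> y \<in> carrier B \<Longrightarrow> y' \<in> carrier B \<Longrightarrow>
    t x (y \<oplus>\<^bsub>B\<^esub> y') = t x y \<oplus>\<^bsub>tensor_alg A B\<^esub> t x y'"
proof -
  assume x: "x \<in> carrier A" "y \<in> carrier B" "y' \<in> carrier B"
  have "I.proj (e x (y \<oplus>\<^bsub>B\<^esub> y')) = I.proj (e x y + e x y')"
    by (rule relator_eq)
      (use x in \<open>auto simp: bilinear_relators_def Let_def single_closed diff_diff_eq intro!: single_plus_closed\<close>)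
  then show ?thesis
    using x by (simp add: t_proj tensor_alg_def I.quot_ops single_closed monoid_alg_simps)
qed

lemma t_smult_left: "x \<in> carrier A \<Longrightarrow> y \<in> carrier B \<Longrightarrow> t (c \<odot>\<^bsub>A\<^esub> x) y = c \<odot>\<^bsub>tensor_alg A B\<^esub> t x y"
proof -
  assume x: "x \<in> carrier A" "y \<in> carrier B"
  have "I.proj (e (c \<odot>\<^bsub>A\<^esub> x) y) = I.proj (Poly_Mapping.single (x, y) c)"
    by (rule relator_eq)
      (use x in \<open>auto simp: bilinear_relators_def Let_def single_closed A.smult_closed\<close>)
  then show ?thesis
    using x by (simp add: t_proj tensor_alg_def I.quot_ops single_closed monoid_alg_smult_single)
qed

lemma t_smult_right: "x \<in> carrier A \<Longrightarrow> y \<in> carrier B \<Longrightarrow> t x (c \<odot>\<^bsub>B\<^esub> y) = c \<odot>\<^bsub>tensor_alg A B\<^esub> t x y"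
proof -
  assume x: "x \<in> carrier A" "y \<in> carrier B"
  have "I.proj (e x (c \<odot>\<^bsub>B\<^esub> y)) = I.proj (Poly_Mapping.single (x, y) c)"
    by (rule relator_eq)
      (use x in \<open>auto simp: bilinear_relators_def Let_def single_closed B.smult_closed\<close>)
  then show ?thesis
    using x by (simp add: t_proj tensor_alg_def I.quot_ops single_closed monoid_alg_smult_single)
qed

lemma t_mult: "x \<in> carrier A \<Longrightarrow> x' \<in> carrier A \<Longrightarrow> y \<in> carrier B \<Longrightarrow> y' \<in> carrier B \<Longrightarrow>
    t x y \<otimes>\<^bsub>tensor_alg A B\<^esub> t x' y' = t (x \<otimes>\<^bsub>A\<^esub> x') (y \<otimes>\<^bsub>B\<^esub> y')"
  by (simp add: t_proj tensor_alg_def I.quot_ops single_closed monoid_alg_single_mult)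

lemma t_one: "t \<one>\<^bsub>A\<^esub> \<one>\<^bsub>B\<^esub> = \<one>\<^bsub>tensor_alg A B\<^esub>"
  by (simp add: t_proj tensor_alg_def I.quot_ops monoid_alg_simps)

lemma left_hom: "(\<lambda>x. t x \<one>\<^bsub>B\<^esub>) \<in> alg_hom A (tensor_alg A B)"
  by (rule alg_homI) (simp_all add: t_closed t_add_left t_mult t_smult_left t_one)

lemma right_hom: "(\<lambda>y. t \<one>\<^bsub>A\<^esub> y) \<in> alg_hom B (tensor_alg A B)"
  by (rule alg_homI) (simp_all add: t_closed t_add_right t_mult t_smult_right t_one)

lemma left_right: "x \<in> carrier A \<Longrightarrow> y \<in> carrier B \<Longrightarrow>
    t x \<one>\<^bsub>B\<^esub> \<otimes>\<^bsub>tensor_alg A B\<^esub> t \<one>\<^bsub>A\<^esub> y = t x y"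
  and right_left: "x \<in> carrier A \<Longrightarrow> y \<in> carrier B \<Longrightarrow>
    t \<one>\<^bsub>A\<^esub> y \<otimes>\<^bsub>tensor_alg A B\<^esub> t x \<one>\<^bsub>B\<^esub> = t x y"
  by (simp_all add: t_mult)

end

text \<open>The map (x, y) -> f x tensor g y is multiplicative, and its linear extension kills the
  bilinearity relators. It therefore induces a map on cosets, which is the one picked out by
  \<open>the_elem\<close> in \<open>tensor_map\<close>.\<close>

lemma tensor_map_hom:
  assumes "calg A" "calg B" "calg C" "calg D" and f: "f \<in> alg_hom A C" and g: "g \<in> alg_hom B D"
  shows "tensor_map A B C D f g \<in> alg_hom (tensor_alg A B) (tensor_alg C D)"
    and "x \<in> carrier A \<Longrightarrow> y \<in> carrier B \<Longrightarrow>
      tensor_map A B C D f g (pure_tensor A B x y) = pure_tensor C D (f x) (g y)"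
proof -
  interpret S: calg_tensor A B by (rule calg_tensor.intro) fact+
  interpret R: calg_tensor C D by (rule calg_tensor.intro) fact+
  define \<eta> where "\<eta> k = pure_tensor C D (f (fst k)) (g (snd k))" for k
  define L where "L = (\<lambda>p. \<Oplus>\<^bsub>tensor_alg C D\<^esub>k\<in>Poly_Mapping.keys p. Poly_Mapping.lookup p k \<odot>\<^bsub>tensor_alg C D\<^esub> \<eta> k)"
  note fg = alg_homD[OF f] alg_homD[OF g] alg_hom_one[OF f] alg_hom_one[OF g]
  have L: "L \<in> alg_hom S.N (tensor_alg C D)"
    and single: "x \<in> carrier A \<Longrightarrow> y \<in> carrier B \<Longrightarrow> L (Poly_Mapping.single (x, y) c) = c \<odot>\<^bsub>tensor_alg C D\<^esub> \<eta> (x, y)" for x y c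
    unfolding L_def
    by (rule monoid_alg_hom[OF S.monoid_AB R.T.calg_self];
        auto simp: \<eta>_def R.t_closed R.t_mult R.t_one fg)+
  have L1: "L (S.e x y) = R.t (f x) (g y)" if "x \<in> carrier A" "y \<in> carrier B" for x y
    using that by (simp add: single \<eta>_def R.T.smult_one R.t_closed fg)
  have Lsub: "L (p - r) = L p \<ominus>\<^bsub>tensor_alg C D\<^esub> L r" if "p \<in> carrier S.N" "r \<in> carrier S.N" for p r
    using alg_hom_minus[OF S.N.calg_self R.T.calg_self L that] S.N_minus[OF that] by simp
  have sub_closed: "p - r \<in> carrier S.N" if "p \<in> carrier S.N" "r \<in> carrier S.N" for p r
    using S.N.minus_closed[OF that] S.N_minus[OF that] by simp
  have "L p = \<zero>\<^bsub>tensor_alg C D\<^esub>" if "p \<in> bilinear_relators A B" for p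
  proof -
    have cancel: "x \<oplus>\<^bsub>tensor_alg C D\<^esub> y \<ominus>\<^bsub>tensor_alg C D\<^esub> x \<ominus>\<^bsub>tensor_alg C D\<^esub> y = \<zero>\<^bsub>tensor_alg C D\<^esub>"
      if "x \<in> carrier (tensor_alg C D)" "y \<in> carrier (tensor_alg C D)" for x y
      using that R.T.lift_eq_0_iff[of "x \<oplus>\<^bsub>tensor_alg C D\<^esub> y \<ominus>\<^bsub>tensor_alg C D\<^esub> x \<ominus>\<^bsub>tensor_alg C D\<^esub> y"]
      by (simp add: R.T.lift_simps)
    have cancel2: "x \<ominus>\<^bsub>tensor_alg C D\<^esub> x = \<zero>\<^bsub>tensor_alg C D\<^esub>" if "x \<in> carrier (tensor_alg C D)" for x
      using that R.T.lift_eq_0_iff[of "x \<ominus>\<^bsub>tensor_alg C D\<^esub> x"] by (simp add: R.T.lift_simps)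
    have K1: "L (S.e (x \<oplus>\<^bsub>A\<^esub> x') y - S.e x y - S.e x' y) = \<zero>\<^bsub>tensor_alg C D\<^esub>" (is "L ?p = _")
      if c: "x \<in> carrier A" "x' \<in> carrier A" "y \<in> carrier B" for x x' y
    proof -
      have "L ?p = L (S.e (x \<oplus>\<^bsub>A\<^esub> x') y) \<ominus>\<^bsub>tensor_alg C D\<^esub> L (S.e x y) \<ominus>\<^bsub>tensor_alg C D\<^esub> L (S.e x' y)"
        using c by (simp only: Lsub sub_closed S.single_closed S.A.a_closed)
      then show ?thesis
        using c by (simp only: L1 fg S.A.a_closed) (simp only: R.t_add_left R.t_closed cancel fg)
    qed
    have K2: "L (S.e x (y \<oplus>\<^bsub>B\<^esub> y') - S.e x y - S.e x y') = \<zero>\<^bsub>tensor_alg C D\<^esub>" (is "L ?p = _")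
      if c: "x \<in> carrier A" "y \<in> carrier B" "y' \<in> carrier B" for x y y'
    proof -
      have "L ?p = L (S.e x (y \<oplus>\<^bsub>B\<^esub> y')) \<ominus>\<^bsub>tensor_alg C D\<^esub> L (S.e x y) \<ominus>\<^bsub>tensor_alg C D\<^esub> L (S.e x y')"
        using c by (simp only: Lsub sub_closed S.single_closed S.B.a_closed)
      then show ?thesis
        using c by (simp only: L1 fg S.B.a_closed) (simp only: R.t_add_right R.t_closed cancel fg)
    qed
    have single': "L (Poly_Mapping.single (x, y) c) = c \<odot>\<^bsub>tensor_alg C D\<^esub> R.t (f x) (g y)"
      if "x \<in> carrier A" "y \<in> carrier B" for x y c
      using that by (simp add: single \<eta>_def)
    have K3: "L (S.e (c \<odot>\<^bsub>A\<^esub> x) y - Poly_Mapping.single (x, y) c) = \<zero>\<^bsub>tensor_alg C D\<^esub>" (is "L ?p = _")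
      if c: "x \<in> carrier A" "y \<in> carrier B" for x y c
    proof -
      have "L ?p = L (S.e (c \<odot>\<^bsub>A\<^esub> x) y) \<ominus>\<^bsub>tensor_alg C D\<^esub> L (Poly_Mapping.single (x, y) c)"
        using c by (simp only: Lsub S.single_closed S.A.smult_closed)
      then show ?thesis
        using c by (simp only: single' L1 fg S.A.smult_closed) (simp only: R.t_smult_left R.t_closed R.T.smult_closed R.T.smult_one cancel2 fg)
    qed
    have K4: "L (S.e x (c \<odot>\<^bsub>B\<^esub> y) - Poly_Mapping.single (x, y) c) = \<zero>\<^bsub>tensor_alg C D\<^esub>" (is "L ?p = _")
      if c: "x \<in> carrier A" "y \<in> carrier B" for x y c
    proof -
      have "L ?p = L (S.e x (c \<odot>\<^bsub>B\<^esub> y)) \<ominus>\<^bsub>tensor_alg C D\<^esub> L (Poly_Mapping.single (x, y) c)"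
        using c by (simp only: Lsub S.single_closed S.B.smult_closed)
      then show ?thesis
        using c by (simp only: single' L1 fg S.B.smult_closed) (simp only: R.t_smult_right R.t_closed R.T.smult_closed R.T.smult_one cancel2 fg)
    qed
    show ?thesis
      using that unfolding bilinear_relators_def Let_def
      by (elim UnE CollectE exE conjE) (simp_all only: K1 K2 K3 K4)
  qed
  then have zero: "L p = \<zero>\<^bsub>tensor_alg C D\<^esub>" if "p \<in> tensor_ideal A B" for p
    using genideal_hom_zero[OF S.N.calg_self R.T.calg_self L S.relators_closed] that by (simp add: tensor_ideal_def)
  have map: "tensor_map A B C D f g = (\<lambda>X. the_elem (L ` X))"
    unfolding tensor_map_def L_def \<eta>_def ..
  show "tensor_map A B C D f g \<in> alg_hom (tensor_alg A B) (tensor_alg C D)"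
    using S.I.factor(2)[OF R.T.calg_self L zero] unfolding map tensor_alg_def[of A B] .
  show "tensor_map A B C D f g (pure_tensor A B x y) = pure_tensor C D (f x) (g y)"
    if "x \<in> carrier A" "y \<in> carrier B"
    unfolding map S.t_proj using that by (simp add: S.I.factor(1)[OF R.T.calg_self L zero] S.single_closed L1)
qed

context calg_ideal
begin

interpretation Q: calg "quot_alg A I"
  by (rule calg_quot)

definition "LP x = lift (quot_alg A I) (proj x)"

lemma proj_closed: "x \<in> carrier A \<Longrightarrow> proj x \<in> carrier (quot_alg A I)"
  by (rule alg_homD(1)[OF proj_hom])

lemma LP_simps:
  "x \<in> carrier A \<Longrightarrow> y \<in> carrier A \<Longrightarrow> LP (x \<oplus> y) = LP x + LP y"
  "x \<in> carrier A \<Longrightarrow> y \<in> carrier A \<Longrightarrow> LP (x \<ominus> y) = LP x - LP y"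
  "x \<in> carrier A \<Longrightarrow> y \<in> carrier A \<Longrightarrow> LP (x \<otimes> y) = LP x * LP y"
  "x \<in> carrier A \<Longrightarrow> LP (c \<odot> x) = sc c (LP x)"
  unfolding LP_def
  by (simp_all add: alg_homD[OF proj_hom] alg_hom_minus[OF calg_self calg_quot proj_hom] Q.lift_simps proj_closed)

lemma LP_one: "LP \<one> = lift (quot_alg A I) \<one>\<^bsub>quot_alg A I\<^esub>"
  by (simp add: LP_def alg_hom_one[OF proj_hom])

lemma LP_commutator: "x \<in> carrier A \<Longrightarrow> y \<in> carrier A \<Longrightarrow> LP (commutator A x y) = LP x * LP y - LP y * LP x"
  by (simp add: commutator_def LP_simps)

lemma LP_zero: "x \<in> I \<Longrightarrow> LP x = 0"
  using proj_zero_iff[of x] a_subset by (auto simp: LP_def Q.lift_zero)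

lemma LP_unit: "x \<in> carrier A \<Longrightarrow> unit_on (LP \<one>) (LP x)"
  unfolding LP_one by (simp add: LP_def Q.lift_unit proj_closed)

end

section \<open>From integer-indexed families over an algebra to Laurent series\<close>

context calg
begin

text \<open>With s = 1 the family is read as a series in z, with s = -1 as a series in 1/z; both
  become Laurent series with finitely many negative exponents.\<close>

definition ser :: "int \<Rightarrow> (int \<Rightarrow> 'a) \<Rightarrow> 'a pr fls" where
  "ser s f = Abs_fls (\<lambda>n. lift A (f (s * n)))"

lemma ser_nth: "(\<And>n. n < N \<Longrightarrow> f (s * n) = \<zero>) \<Longrightarrow> ser s f $$ n = lift A (f (s * n))"
  unfolding ser_def by (rule fls_nth_Abs_bounded[of N]) (simp add: lift_zero)

lemma ser_ord_ge: "(\<And>n. n < N \<Longrightarrow> f (s * n) = \<zero>) \<Longrightarrow> ord_ge N (ser s f)"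
  by (simp add: ord_ge_def ser_nth[of N] lift_zero)

lemma ser_inj:
  assumes "s * s = 1" "\<And>n. f n \<in> carrier A" "\<And>n. g n \<in> carrier A"
    "\<And>n. n < N \<Longrightarrow> f (s * n) = \<zero>" "\<And>n. n < N \<Longrightarrow> g (s * n) = \<zero>" "ser s f = ser s g"
  shows "f = g"
proof
  fix n
  have "lift A (f (s * (s * n))) = lift A (g (s * (s * n)))"
    using assms(6) by (metis ser_nth[of N f s, OF assms(4)] ser_nth[of N g s, OF assms(5)])
  then show "f n = g n"
    using assms by (simp add: lift_inj flip: mult.assoc)
qed

lemma ls_mult_closed: "(\<And>n. f n \<in> carrier A) \<Longrightarrow> (\<And>n. g n \<in> carrier A) \<Longrightarrow> ls_mult A f g n \<in> carrier A"
  by (auto simp: ls_mult_def intro!: finsum_closed)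

text \<open>The bounds place the support set in the definition of \<open>ls_mult\<close> inside the
  image of a finite interval, so the sum there is finite and can be compared with the convolution of
  Laurent series.\<close>

lemma lift_ls_mult:
  assumes s: "s * s = 1" and f: "\<And>n. f n \<in> carrier A" and g: "\<And>n. g n \<in> carrier A"
    and N: "\<And>n. n < N \<Longrightarrow> f (s * n) = \<zero>" and M: "\<And>n. n < M \<Longrightarrow> g (s * n) = \<zero>"
  shows "lift A (ls_mult A f g (s * n)) = (ser s f * ser s g) $$ n"
proof -
  have ss: "s * (s * i) = i" for i using s by (simp flip: mult.assoc)
  let ?S = "{i. f i \<noteq> \<zero> \<and> g (s * n - i) \<noteq> \<zero>}" and ?T = "(*) s ` {N..n - M}"
  have gi: "g (s * n - i) = g (s * (n - s * i))" for i
    by (simp add: right_diff_distrib ss)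
  have sub: "?S \<subseteq> ?T"
  proof
    fix i assume i: "i \<in> ?S"
    have "\<not> s * i < N" using i N[of "s * i"] by (auto simp: ss)
    moreover have "\<not> n - s * i < M" using i M[of "n - s * i"] by (auto simp: gi)
    ultimately show "i \<in> ?T"
      by (intro image_eqI[of _ _ "s * i"]) (auto simp: ss)
  qed
  have "lift A (ls_mult A f g (s * n)) = (\<Sum>i\<in>?S. lift A (f i) * lift A (g (s * n - i)))"
    unfolding ls_mult_def using f g by (simp add: lift_sum lift_mult)
  also have "\<dots> = (\<Sum>i\<in>?T. lift A (f i) * lift A (g (s * n - i)))"
    by (rule sum.mono_neutral_left[OF _ sub]) (auto simp: lift_zero)
  also have "\<dots> = (\<Sum>j\<in>{N..n - M}. lift A (f (s * j)) * lift A (g (s * (n - j))))"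
  proof (subst sum.reindex)
    show "inj_on ((*) s) {N..n - M}"
      by (rule inj_onI) (metis ss)
  qed (simp add: right_diff_distrib)
  also have "\<dots> = (ser s f * ser s g) $$ n"
  proof -
    have "ord_ge N (ser s f)" "ord_ge M (ser s g)"
      by (simp_all add: ser_ord_ge[of N] ser_ord_ge[of M] N M)
    then show ?thesis
      by (simp add: fls_times_nth_superset[of N _ M _ "{N..n - M}"] ser_nth[of N f] ser_nth[of M g] N M)
  qed
  finally show ?thesis .
qed

lemma ls_mult_bound:
  assumes "s * s = 1" "\<And>n. f n \<in> carrier A" "\<And>n. g n \<in> carrier A"
    "\<And>n. n < N \<Longrightarrow> f (s * n) = \<zero>" "\<And>n. n < M \<Longrightarrow> g (s * n) = \<zero>" "n < N + M"
  shows "ls_mult A f g (s * n) = \<zero>"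
proof -
  have "lift A (ls_mult A f g (s * n)) = (ser s f * ser s g) $$ n"
    by (rule lift_ls_mult[of s f g N M]) (use assms in simp_all)
  also have "\<dots> = 0"
  proof -
    have "ord_ge N (ser s f)" "ord_ge M (ser s g)"
      using assms by (simp_all add: ser_ord_ge[of N] ser_ord_ge[of M])
    then show ?thesis
      using ord_ge_mult assms(6) by (blast dest: ord_geD)
  qed
  finally show ?thesis
    using assms by (simp add: lift_eq_0_iff ls_mult_closed)
qed

lemma ser_mult:
  assumes "s * s = 1" "\<And>n. f n \<in> carrier A" "\<And>n. g n \<in> carrier A"
    "\<And>n. n < N \<Longrightarrow> f (s * n) = \<zero>" "\<And>n. n < M \<Longrightarrow> g (s * n) = \<zero>"
  shows "ser s (ls_mult A f g) = ser s f * ser s g"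
proof (rule fls_eqI)
  fix n
  have "ser s (ls_mult A f g) $$ n = lift A (ls_mult A f g (s * n))"
    by (rule ser_nth[of "N + M"], rule ls_mult_bound[of s f g N M]) (use assms in simp_all)
  also have "\<dots> = (ser s f * ser s g) $$ n"
    by (rule lift_ls_mult[of s f g N M]) (use assms in simp_all)
  finally show "ser s (ls_mult A f g) $$ n = (ser s f * ser s g) $$ n" .
qed

lemma ls_scale_closed: "(\<And>n. f n \<in> carrier A) \<Longrightarrow> ls_scale A c f n \<in> carrier A"
  by (simp add: ls_scale_def smult_closed)

lemma ls_scale_bound: "f n = \<zero> \<Longrightarrow> ls_scale A c f n = \<zero>"
  by (simp add: ls_scale_def smult_zero_right)

lemma ser_scale:
  assumes "c \<noteq> 0" "\<And>n. f n \<in> carrier A" "\<And>n. n < N \<Longrightarrow> f (s * n) = \<zero>"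
  shows "ser s (ls_scale A c f) = fls_tri (scale_mat (c powi s)) (ser s f)"
proof (rule fls_eqI)
  fix n
  have "c powi s \<noteq> 0" using assms(1) by simp
  then show "ser s (ls_scale A c f) $$ n = fls_tri (scale_mat (c powi s)) (ser s f) $$ n"
    using assms
    by (simp add: scale_nth ser_nth[of N] ls_scale_bound) (simp add: ls_scale_def lift_smult power_int_mult)
qed

lemma smult_zero_left: "x \<in> carrier A \<Longrightarrow> 0 \<odot> x = \<zero>"
  using lift_smult[of x 0] by (simp add: lift_eq_0_iff smult_closed)

lemma ls_shift_closed: "(\<And>n. f n \<in> carrier A) \<Longrightarrow> ls_shift A f n \<in> carrier A"
  by (auto simp: ls_shift_def intro!: finsum_closed smult_closed)

lemma lift_ls_shift:
  assumes f: "\<And>n. f n \<in> carrier A" and N: "\<And>n. n < N \<Longrightarrow> f (- n) = \<zero>"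
  shows "lift A (ls_shift A f (- n)) = tau (ser (- 1) f) $$ n"
proof -
  have N': "f (- 1 * n) = \<zero>" if "n < N" for n using N[OF that] by simp
  let ?S = "{i. - n \<le> i \<and> f i \<noteq> \<zero>}" and ?T = "uminus ` {N..n}"
  let ?c = "\<lambda>i. (of_int i gchoose nat (i + n)) * (-1) ^ nat (i + n) :: complex"
  have sub: "?S \<subseteq> ?T"
  proof
    fix i assume i: "i \<in> ?S"
    then have "\<not> - i < N" using N[of "- i"] by auto
    then show "i \<in> ?T" using i by (intro image_eqI[of _ _ "- i"]) auto
  qed
  have "lift A (ls_shift A f (- n)) = (\<Sum>i\<in>?S. sc (?c i) (lift A (f i)))"
    unfolding ls_shift_def using f by (simp add: lift_sum lift_smult smult_closed)
  also have "\<dots> = (\<Sum>i\<in>?T. sc (?c i) (lift A (f i)))"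
    by (rule sum.mono_neutral_left[OF _ sub]) (auto simp: lift_zero)
  also have "\<dots> = (\<Sum>j\<in>{N..n}. sc (shift_mat n j) (lift A (f (- j))))"
    by (subst sum.reindex) (auto simp: shift_mat_def intro!: sum.cong)
  also have "\<dots> = tau (ser (- 1) f) $$ n"
  proof -
    have "ord_ge N (ser (- 1) f)" by (rule ser_ord_ge) (simp add: N)
    then show ?thesis
      by (simp add: shift_mat.nth[of N _ "{N..n}"] ser_nth[of N] N)
  qed
  finally show ?thesis .
qed

lemma ls_shift_bound:
  assumes f: "\<And>n. f n \<in> carrier A" and N: "\<And>n. n < N \<Longrightarrow> f (- n) = \<zero>" and "n < N"
  shows "ls_shift A f (- n) = \<zero>"
proof -
  have "ord_ge N (ser (- 1) f)" by (rule ser_ord_ge) (simp add: N)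
  then have "tau (ser (- 1) f) $$ n = 0"
    using shift_mat.ord \<open>n < N\<close> by (blast dest: ord_geD)
  moreover have "lift A (ls_shift A f (- n)) = tau (ser (- 1) f) $$ n"
    by (rule lift_ls_shift[of f N]) (use f N in simp_all)
  ultimately have "lift A (ls_shift A f (- n)) = 0" by simp
  then show ?thesis using f by (simp add: lift_eq_0_iff ls_shift_closed)
qed

lemma ser_shift:
  assumes f: "\<And>n. f n \<in> carrier A" and N: "\<And>n. n < N \<Longrightarrow> f (- n) = \<zero>"
  shows "ser (- 1) (ls_shift A f) = tau (ser (- 1) f)"
proof (rule fls_eqI)
  fix n
  have "ser (- 1) (ls_shift A f) $$ n = lift A (ls_shift A f (- 1 * n))"
  proof (rule ser_nth[of N])
    show "ls_shift A f (- 1 * n) = \<zero>" if "n < N" for n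
      using ls_shift_bound[of f N n] f N that by simp
  qed
  moreover have "lift A (ls_shift A f (- n)) = tau (ser (- 1) f) $$ n"
    by (rule lift_ls_shift[of f N]) (use f N in simp_all)
  ultimately show "ser (- 1) (ls_shift A f) $$ n = tau (ser (- 1) f) $$ n"
    by simp
qed

lemma is_subalgebra_carrier: "is_subalgebra A (carrier A)"
  by (auto simp: is_subalgebra_def smult_closed)

lemma gen_subalgebra_minimal: "is_subalgebra A B \<Longrightarrow> S \<subseteq> B \<Longrightarrow> gen_subalgebra A S \<subseteq> B"
  by (auto simp: gen_subalgebra_def)

lemma is_subalgebra_gen: "S \<subseteq> carrier A \<Longrightarrow> is_subalgebra A (gen_subalgebra A S)"
  using gen_subalgebra_minimal[OF is_subalgebra_carrier]
  unfolding is_subalgebra_def[of _ "gen_subalgebra A S"] by (auto simp: gen_subalgebra_def is_subalgebra_def)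

lemma gen_subalgebra_superset: "S \<subseteq> gen_subalgebra A S"
  by (auto simp: gen_subalgebra_def)

lemma is_subalgebra_centralizer:
  "S \<subseteq> carrier A \<Longrightarrow> is_subalgebra A {x \<in> carrier A. \<forall>y\<in>S. x \<otimes> y = y \<otimes> x}"
  unfolding is_subalgebra_def
  by (auto simp: smult_closed smult_mult_left smult_mult_right l_distr r_distr subset_eq) (metis m_assoc)

text \<open>Centralizers are subalgebras. The centralizer of S contains S, hence the generated
  subalgebra; so the centralizer of the latter also contains S, hence the generated subalgebra
  itself.\<close>

lemma gen_subalgebra_commute:
  assumes S: "S \<subseteq> carrier A" "\<And>x y. x \<in> S \<Longrightarrow> y \<in> S \<Longrightarrow> x \<otimes> y = y \<otimes> x"
    and xy: "x \<in> gen_subalgebra A S" "y \<in> gen_subalgebra A S"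
  shows "x \<otimes> y = y \<otimes> x"
proof -
  have carrier: "gen_subalgebra A S \<subseteq> carrier A"
    by (rule gen_subalgebra_minimal[OF is_subalgebra_carrier S(1)])
  have 1: "gen_subalgebra A S \<subseteq> {x \<in> carrier A. \<forall>y\<in>S. x \<otimes> y = y \<otimes> x}"
    by (rule gen_subalgebra_minimal[OF is_subalgebra_centralizer[OF S(1)]]) (use S in auto)
  have "gen_subalgebra A S \<subseteq> {x \<in> carrier A. \<forall>y\<in>gen_subalgebra A S. x \<otimes> y = y \<otimes> x}"
    by (rule gen_subalgebra_minimal[OF is_subalgebra_centralizer[OF carrier]]) (use S 1 in fastforce)
  then show ?thesis using xy by blast
qed

text \<open>A commutative subalgebra satisfies the hypotheses of \<open>triangular.mult_tri_exists\<close>.\<close>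

lemma subalgebra_lift:
  assumes B: "is_subalgebra A B" and comm: "\<forall>x\<in>B. \<forall>y\<in>B. x \<otimes> y = y \<otimes> x"
  defines "C \<equiv> lift A ` B"
  shows "0 \<in> C" "lift A \<one> \<in> C" "\<And>x y. x \<in> C \<Longrightarrow> y \<in> C \<Longrightarrow> x + y \<in> C"
      "\<And>x y. x \<in> C \<Longrightarrow> y \<in> C \<Longrightarrow> x * y \<in> C" "\<And>a x. x \<in> C \<Longrightarrow> sc a x \<in> C"
      "\<And>x y. x \<in> C \<Longrightarrow> y \<in> C \<Longrightarrow> x * y = y * x" "\<And>x. x \<in> C \<Longrightarrow> lift A \<one> * x = x"
proof -
  have B: "B \<subseteq> carrier A" "\<one> \<in> B" "\<And>x y. x \<in> B \<Longrightarrow> y \<in> B \<Longrightarrow> x \<oplus> y \<in> B"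
    "\<And>x y. x \<in> B \<Longrightarrow> y \<in> B \<Longrightarrow> x \<otimes> y \<in> B" "\<And>c x. x \<in> B \<Longrightarrow> c \<odot> x \<in> B"
    using assms(1) by (auto simp: is_subalgebra_def)
  then have B': "x \<in> carrier A" if "x \<in> B" for x using that by blast
  have "\<zero> \<in> B" using B(5)[OF B(2), of 0] by (simp add: smult_zero_left)
  then show "0 \<in> C" unfolding C_def by (intro image_eqI[of _ _ \<zero>]) (simp_all add: lift_zero)
  show "lift A \<one> \<in> C" using B(2) by (simp add: C_def)
  show "x + y \<in> C" if "x \<in> C" "y \<in> C" for x y
    using that unfolding C_def by (auto simp: B' lift_add[symmetric] intro!: imageI B)
  show "x * y \<in> C" if "x \<in> C" "y \<in> C" for x y
    using that unfolding C_def by (auto simp: B' lift_mult[symmetric] intro!: imageI B)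
  show "sc a x \<in> C" if "x \<in> C" for a x
    using that unfolding C_def by (auto simp: B' lift_smult[symmetric] intro!: imageI B)
  show "x * y = y * x" if "x \<in> C" "y \<in> C" for x y
    using that unfolding C_def by (auto simp: B' comm lift_mult[symmetric])
  show "lift A \<one> * x = x" if "x \<in> C" for x
    using that unfolding C_def by (auto simp: B' lift_mult[symmetric])
qed

end

lemma fls_commuteI:
  fixes f g :: "'a::semiring_0 fls"
  assumes "\<And>i j. f $$ i * g $$ j = g $$ j * f $$ i"
  shows "f * g = g * f"
proof (rule fls_eqI)
  fix n
  obtain a where a: "ord_ge a f" by (rule ord_ge_exists)
  obtain b where b: "ord_ge b g" by (rule ord_ge_exists)
  have "(f * g) $$ n = (\<Sum>i\<in>{a..n-b}. f $$ i * g $$ (n - i))"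
    by (rule fls_times_nth_superset[OF a b]) auto
  also have "\<dots> = (\<Sum>i\<in>{b..n-a}. g $$ i * f $$ (n - i))"
    by (rule sum.reindex_bij_witness[of _ "\<lambda>i. n - i" "\<lambda>i. n - i"]) (auto simp: assms)
  also have "\<dots> = (g * f) $$ n"
    by (rule fls_times_nth_superset[OF b a, symmetric]) auto
  finally show "(f * g) $$ n = (g * f) $$ n" .
qed

lemma fls_mult_upper:
  fixes f g :: "'a::semiring_0 fls"
  assumes f: "\<And>n. n > a \<Longrightarrow> f $$ n = 0" and g: "\<And>n. n > b \<Longrightarrow> g $$ n = 0" 
  shows "n > a + b \<Longrightarrow> (f * g) $$ n = 0" "(f * g) $$ (a + b) = f $$ a * g $$ b"
proof -
  obtain c where c: "ord_ge c f" by (rule ord_ge_exists)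
  obtain d where d: "ord_ge d g" by (rule ord_ge_exists)
  have eq: "(f * g) $$ n = (\<Sum>i\<in>{c..n-d} \<union> {a}. f $$ i * g $$ (n - i))" for n
    by (rule fls_times_nth_superset[OF c d]) auto
  show "(f * g) $$ n = 0" if "n > a + b"
  proof -
    have "f $$ i * g $$ (n - i) = 0" for i
      using f[of i] g[of "n - i"] that by (cases "i > a") auto
    then show ?thesis unfolding eq by simp
  qed
  have "f $$ i * g $$ (a + b - i) = (if i = a then f $$ a * g $$ b else 0)" for i
    using f[of i] g[of "a + b - i"] by (cases "i > a") auto
  then show "(f * g) $$ (a + b) = f $$ a * g $$ b"
    unfolding eq by simp
qed

lemma pcoeff_mult:
  assumes "finite S" "{0..int (degree a)} \<subseteq> S"
  shows "pcoeff (a * b) n = (\<Sum>i\<in>S. pcoeff a i * pcoeff b (n - i))"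
proof -
  have "(\<Sum>i\<in>S. pcoeff a i * pcoeff b (n - i)) = (\<Sum>i\<in>{0..max n (int (degree a))}. pcoeff a i * pcoeff b (n - i))"
  proof (rule sum.mono_neutral_cong)
    fix i assume "i \<in> {0..max n (int (degree a))} - S"
    then have "i \<notin> {0..int (degree a)}" "i \<ge> 0" using assms by auto
    then show "pcoeff a i * pcoeff b (n - i) = 0"
      by (auto simp: pcoeff_def intro!: coeff_eq_0)
  next
    fix i assume "i \<in> S - {0..max n (int (degree a))}"
    then show "pcoeff a i * pcoeff b (n - i) = 0"
      by (auto simp: pcoeff_def intro!: coeff_eq_0)
  qed (use assms in auto)
  also have "\<dots> = (\<Sum>i\<in>{0..n}. pcoeff a i * pcoeff b (n - i))"
    by (rule sum.mono_neutral_right) (auto simp: pcoeff_def)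
  also have "\<dots> = pcoeff (a * b) n"
  proof (cases "n < 0")
    case False
    define k where "k = nat n"
    then have n: "n = int k" using False by simp
    have "(\<Sum>i\<in>{0..int k}. pcoeff a i * pcoeff b (int k - i)) = (\<Sum>i\<le>k. coeff a i * coeff b (k - i))"
      by (rule sum.reindex_bij_witness[of _ int nat]) (auto simp: pcoeff_def nat_diff_distrib)
    then show ?thesis by (simp add: n coeff_mult pcoeff_def)
  qed (simp add: pcoeff_def)
  finally show ?thesis ..
qed

text \<open>Applied to the right-hand sides of the defining equations, which are scalar series times
  one fixed element, the unit or phi_0.\<close>

lemma sc_convolution:
  fixes x y :: "'a::calgebra"
  assumes \<alpha>: "\<And>n. f $$ n = sc (\<alpha> n) x" and \<beta>: "\<And>n. g $$ n = sc (\<beta> n) y"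
    and bounds: "\<And>n. n < a \<Longrightarrow> \<alpha> n = 0" "\<And>n. n < b \<Longrightarrow> \<beta> n = 0"
  shows "(f * g) $$ n = sc (\<Sum>i\<in>{a..n-b}. \<alpha> i * \<beta> (n - i)) (x * y)"
proof -
  have "ord_ge a f" "ord_ge b g"
    using bounds by (simp_all add: ord_ge_def \<alpha> \<beta>)
  then show ?thesis
    by (simp add: fls_times_nth_superset[of a f b g "{a..n-b}"] \<alpha> \<beta> sc_mult_left sc_mult_right sc_sc sc_sum_left mult.commute)
qed

section \<open>Truncated Yangians\<close>

lemma monoid_word_monoid: "monoid word_monoid"
  by unfold_locales (auto simp: word_monoid_def)

lemma carrier_free_alg: "x \<in> carrier free_alg"
  by (simp add: free_alg_def monoid_alg_simps word_monoid_def)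

lemma calg_free_alg: "calg free_alg"
  unfolding free_alg_def by (rule calg_monoid_alg[OF monoid_word_monoid])

lemma calg_ideal_free: "calg_ideal free_alg (Idl\<^bsub>free_alg\<^esub> S)"
proof -
  interpret calg "free_alg :: ('g list \<Rightarrow>\<^sub>0 complex) calg" by (rule calg_free_alg)
  show ?thesis
    by (intro calg_ideal.intro calg_self genideal_ideal) (simp add: carrier_free_alg subset_eq)
qed

lemma free_ideal_self: "x \<in> S \<Longrightarrow> x \<in> Idl\<^bsub>free_alg\<^esub> S"
proof -
  interpret calg "free_alg :: ('g list \<Rightarrow>\<^sub>0 complex) calg" by (rule calg_free_alg)
  have "S \<subseteq> Idl\<^bsub>free_alg\<^esub> S"
    by (rule genideal_self) (simp add: carrier_free_alg subset_eq)
  then show "x \<in> S \<Longrightarrow> x \<in> Idl\<^bsub>free_alg\<^esub> S" by blast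
qed

lemma calg_ideal_Y_ideal: "calg_ideal free_alg Y_ideal"
  unfolding Y_ideal_def by (rule calg_ideal_free)

interpretation Y: calg Y
  using calg_ideal.calg_quot[OF calg_ideal_Y_ideal] by (simp add: Y_def)

lemma Yx_closed: "Yx e n \<in> carrier Y" and Yh_closed: "Yh n \<in> carrier Y"
  using calg_ideal.proj_closed[OF calg_ideal_Y_ideal]
  by (simp_all add: Yx_def Yh_def Y_def calg_ideal.proj_def[OF calg_ideal_Y_ideal] carrier_free_alg)

lemma sc_2: "sc 2 x = x + x" for x :: "'a::calgebra"
  using sc_add_left[of 1 1 x] by (simp add: sc_one)

lemma yangian_Y: "yangian (\<lambda>n. lift Y (Yx Pos n)) (\<lambda>n. lift Y (Yx Neg n)) (\<lambda>n. lift Y (Yh n)) (lift Y \<one>\<^bsub>Y\<^esub>)"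
proof -
  let ?x = "\<lambda>e n. free_gen (YX e n)" and ?h = "\<lambda>n. free_gen (YH n)" and ?F = "free_alg :: (Ygen list \<Rightarrow>\<^sub>0 complex) calg"
  interpret YI: calg_ideal "?F" Y_ideal by (rule calg_ideal_Y_ideal)
  have gens: "lift Y (Yx e n) = YI.LP (?x e n)" "lift Y (Yh n) = YI.LP (?h n)" for e n
    by (simp_all add: Yx_def Yh_def Y_def YI.LP_def YI.proj_def)
  have one: "lift Y \<one>\<^bsub>Y\<^esub> = YI.LP \<one>\<^bsub>?F\<^esub>"
    by (simp add: Y_def YI.LP_one)
  have rel: "YI.LP r = 0" if "r \<in> Y_relators free_alg ?x ?h" for r
    by (rule YI.LP_zero) (use that in \<open>simp add: Y_ideal_def free_ideal_self\<close>)
  note simps = YI.LP_commutator YI.LP_simps carrier_free_alg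
  have hh: "YI.LP (commutator ?F (?h r) (?h s)) = 0" for r s
    by (rule rel) (auto simp: Y_relators_def)
  have h0: "YI.LP (commutator ?F (?h 0) (?x e s) \<ominus>\<^bsub>?F\<^esub> of_int (2 * sg e) \<odot>\<^bsub>?F\<^esub> ?x e s) = 0" for e s
    by (rule rel) (unfold Y_relators_def, blast)
  have hx: "YI.LP ((commutator ?F (?h (Suc r)) (?x e s) \<ominus>\<^bsub>?F\<^esub> commutator ?F (?h r) (?x e (Suc s))) \<ominus>\<^bsub>?F\<^esub>
        of_int (sg e) \<odot>\<^bsub>?F\<^esub> (?h r \<otimes>\<^bsub>?F\<^esub> ?x e s \<oplus>\<^bsub>?F\<^esub> ?x e s \<otimes>\<^bsub>?F\<^esub> ?h r)) = 0" for e r s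
    by (rule rel) (unfold Y_relators_def, blast)
  have pm: "YI.LP (commutator ?F (?x Pos r) (?x Neg s) \<ominus>\<^bsub>?F\<^esub> ?h (r + s)) = 0" for r s
    by (rule rel) (unfold Y_relators_def, blast)
  have xx: "YI.LP ((commutator ?F (?x e (Suc r)) (?x e s) \<ominus>\<^bsub>?F\<^esub> commutator ?F (?x e r) (?x e (Suc s))) \<ominus>\<^bsub>?F\<^esub>
        of_int (sg e) \<odot>\<^bsub>?F\<^esub> (?x e r \<otimes>\<^bsub>?F\<^esub> ?x e s \<oplus>\<^bsub>?F\<^esub> ?x e s \<otimes>\<^bsub>?F\<^esub> ?x e r)) = 0" for e r s
    by (rule rel) (unfold Y_relators_def, blast)
  show ?thesis
    unfolding gens one
  proof
    fix r s
    show "YI.LP (?h r) * YI.LP (?h s) = YI.LP (?h s) * YI.LP (?h r)"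
      using hh[of r s] by (simp add: simps)
    show "YI.LP (?h 0) * YI.LP (?x Pos s) - YI.LP (?x Pos s) * YI.LP (?h 0) = YI.LP (?x Pos s) + YI.LP (?x Pos s)"
      "YI.LP (?h 0) * YI.LP (?x Neg s) - YI.LP (?x Neg s) * YI.LP (?h 0) = - (YI.LP (?x Neg s) + YI.LP (?x Neg s))"
      using h0[of Pos s] h0[of Neg s] by (simp_all add: simps sc_minus_left sc_2 algebra_simps)
    show "(YI.LP (?h (Suc r)) * YI.LP (?x Pos s) - YI.LP (?x Pos s) * YI.LP (?h (Suc r))) -
        (YI.LP (?h r) * YI.LP (?x Pos (Suc s)) - YI.LP (?x Pos (Suc s)) * YI.LP (?h r)) =
        YI.LP (?h r) * YI.LP (?x Pos s) + YI.LP (?x Pos s) * YI.LP (?h r)"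
      using hx[of r Pos s] by (simp add: simps sc_one)
    show "(YI.LP (?h (Suc r)) * YI.LP (?x Neg s) - YI.LP (?x Neg s) * YI.LP (?h (Suc r))) -
        (YI.LP (?h r) * YI.LP (?x Neg (Suc s)) - YI.LP (?x Neg (Suc s)) * YI.LP (?h r)) =
        - (YI.LP (?h r) * YI.LP (?x Neg s) + YI.LP (?x Neg s) * YI.LP (?h r))"
      using hx[of r Neg s] by (simp add: simps sc_one sc_minus_left eq_neg_iff_add_eq_0)
    show "YI.LP (?x Pos r) * YI.LP (?x Neg s) - YI.LP (?x Neg s) * YI.LP (?x Pos r) = YI.LP (?h (r + s))"
      using pm[of r s] by (simp add: simps)
    show "(YI.LP (?x Pos (Suc r)) * YI.LP (?x Pos s) - YI.LP (?x Pos s) * YI.LP (?x Pos (Suc r))) -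
        (YI.LP (?x Pos r) * YI.LP (?x Pos (Suc s)) - YI.LP (?x Pos (Suc s)) * YI.LP (?x Pos r)) =
        YI.LP (?x Pos r) * YI.LP (?x Pos s) + YI.LP (?x Pos s) * YI.LP (?x Pos r)"
      using xx[of Pos r s] by (simp add: simps sc_one)
    show "(YI.LP (?x Neg (Suc r)) * YI.LP (?x Neg s) - YI.LP (?x Neg s) * YI.LP (?x Neg (Suc r))) -
        (YI.LP (?x Neg r) * YI.LP (?x Neg (Suc s)) - YI.LP (?x Neg (Suc s)) * YI.LP (?x Neg r)) =
        - (YI.LP (?x Neg r) * YI.LP (?x Neg s) + YI.LP (?x Neg s) * YI.LP (?x Neg r))"
      using xx[of Neg r s] by (simp add: simps sc_one sc_minus_left eq_neg_iff_add_eq_0)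
    show "YI.LP \<one>\<^bsub>?F\<^esub> * YI.LP \<one>\<^bsub>?F\<^esub> = YI.LP \<one>\<^bsub>?F\<^esub>"
      using YI.LP_unit[of "\<one>\<^bsub>?F\<^esub>"] by (simp add: carrier_free_alg unit_on_def)
  qed (rule YI.LP_unit carrier_free_alg)+
qed

interpretation Yl: yangian "\<lambda>n. lift Y (Yx Pos n)" "\<lambda>n. lift Y (Yx Neg n)" "\<lambda>n. lift Y (Yh n)" "lift Y \<one>\<^bsub>Y\<^esub>"
  by (rule yangian_Y)

lemma Yh_commute: "x \<in> range Yh \<Longrightarrow> y \<in> range Yh \<Longrightarrow> x \<otimes>\<^bsub>Y\<^esub> y = y \<otimes>\<^bsub>Y\<^esub> x"
proof -
  have "Yh r \<otimes>\<^bsub>Y\<^esub> Yh s = Yh s \<otimes>\<^bsub>Y\<^esub> Yh r" for r s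
    using Yl.hh[of r s] by (simp add: Yh_closed flip: Y.lift_mult) (simp add: Yh_closed Y.lift_inj)
  then show "x \<in> range Yh \<Longrightarrow> y \<in> range Yh \<Longrightarrow> x \<otimes>\<^bsub>Y\<^esub> y = y \<otimes>\<^bsub>Y\<^esub> x"
    by (elim rangeE) simp
qed

lemma Y_cartan: "is_subalgebra Y Y_cartan" "range Yh \<subseteq> Y_cartan" "Y_cartan \<subseteq> carrier Y"
  "\<forall>x\<in>Y_cartan. \<forall>y\<in>Y_cartan. x \<otimes>\<^bsub>Y\<^esub> y = y \<otimes>\<^bsub>Y\<^esub> x"
proof -
  have r: "range Yh \<subseteq> carrier Y" using Yh_closed by auto
  show sub: "is_subalgebra Y Y_cartan" unfolding Y_cartan_def by (rule Y.is_subalgebra_gen[OF r])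
  then show "Y_cartan \<subseteq> carrier Y" by (simp add: is_subalgebra_def)
  show "range Yh \<subseteq> Y_cartan" unfolding Y_cartan_def by (rule Y.gen_subalgebra_superset)
  show "\<forall>x\<in>Y_cartan. \<forall>y\<in>Y_cartan. x \<otimes>\<^bsub>Y\<^esub> y = y \<otimes>\<^bsub>Y\<^esub> x"
    unfolding Y_cartan_def using Y.gen_subalgebra_commute[OF r Yh_commute] by blast
qed

abbreviation "Yu \<equiv> lift Y \<one>\<^bsub>Y\<^esub>"
abbreviation "Yser \<equiv> Y.ser (- 1)"

lemma Yh_series_closed: "Yh_series n \<in> Y_cartan" "Yh_series n \<in> carrier Y"
proof -
  have "\<zero>\<^bsub>Y\<^esub> \<in> Y_cartan"
    using Y_cartan(1) Y.smult_zero_left[OF Y.one_closed] unfolding is_subalgebra_def by metis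
  then show "Yh_series n \<in> Y_cartan"
    using Y_cartan(1,2) by (auto simp: Yh_series_def is_subalgebra_def)
  then show "Yh_series n \<in> carrier Y" using Y_cartan(3) by blast
qed

lemma Yser_h: "Yser Yh_series = Yl.H"
proof (rule fls_eqI)
  fix n
  have "Yser Yh_series $$ n = lift Y (Yh_series (- 1 * n))"
    by (rule Y.ser_nth[of 0]) (simp add: Yh_series_def)
  also have "\<dots> = Yl.H $$ n"
    by (auto simp: Yl.H_nth Yh_series_def Y.lift_zero)
  finally show "Yser Yh_series $$ n = Yl.H $$ n" .
qed

definition Y_rhs :: "complex poly \<Rightarrow> Yel pr fls" where
  "Y_rhs a = Yser (\<lambda>n. pcoeff a n \<odot>\<^bsub>Y\<^esub> \<one>\<^bsub>Y\<^esub>)"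

lemma Y_rhs_nth: "Y_rhs a $$ n = sc (pcoeff a (- n)) Yu"
proof -
  have "Y_rhs a $$ n = lift Y (pcoeff a (- 1 * n) \<odot>\<^bsub>Y\<^esub> \<one>\<^bsub>Y\<^esub>)"
    unfolding Y_rhs_def
    by (rule Y.ser_nth[of "- int (degree a)"])
      (auto simp: pcoeff_def coeff_eq_0 Y.smult_zero_left)
  then show ?thesis by (simp add: Y.lift_smult)
qed

definition Y_is_A :: "complex poly \<Rightarrow> Yel lser \<Rightarrow> bool" where
  "Y_is_A a A \<longleftrightarrow> range A \<subseteq> Y_cartan \<and> A (int (degree a div 2)) = \<one>\<^bsub>Y\<^esub> \<and> (\<forall>i>int (degree a div 2). A i = \<zero>\<^bsub>Y\<^esub>) \<and>
     ls_mult Y Yh_series (ls_mult Y A (ls_shift Y A)) = (\<lambda>n. pcoeff a n \<odot>\<^bsub>Y\<^esub> \<one>\<^bsub>Y\<^esub>)"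

text \<open>The bridge between the defining equation over \<open>Y\<close> and its Laurent series
  form. The way back rests on injectivity of \<open>ser\<close>, which is why closure and bounds of
  all partial products are recorded.\<close>

lemma Y_is_A_ser:
  assumes "range A \<subseteq> Y_cartan" "\<forall>i>m. A i = \<zero>\<^bsub>Y\<^esub>"
  shows "Yser A $$ n = lift Y (A (- n))" "ord_ge (- m) (Yser A)"
    and "ls_mult Y Yh_series (ls_mult Y A (ls_shift Y A)) = (\<lambda>n. pcoeff a n \<odot>\<^bsub>Y\<^esub> \<one>\<^bsub>Y\<^esub>) \<longleftrightarrow>
      Yl.H * (Yser A * tau (Yser A)) = Y_rhs a"
proof -
  have A: "A n \<in> carrier Y" for n using assms(1) Y_cartan(3) by auto
  have b: "A (- n) = \<zero>\<^bsub>Y\<^esub>" if "n < - m" for n using assms(2) that by auto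
  show "Yser A $$ n = lift Y (A (- n))"
    using Y.ser_nth[of "- m" A "- 1" n] b by simp
  show "ord_ge (- m) (Yser A)"
    by (rule Y.ser_ord_ge) (simp add: b)
  have sh: "ls_shift Y A n \<in> carrier Y" "ls_shift Y A (- n) = \<zero>\<^bsub>Y\<^esub>" if "n < - m" for n
    using Y.ls_shift_closed[of A n] Y.ls_shift_bound[of A "- m" n] A b that by auto
  have shc: "ls_shift Y A n \<in> carrier Y" for n using Y.ls_shift_closed[of A n] A by auto
  have m1: "Yser (ls_mult Y A (ls_shift Y A)) = Yser A * tau (Yser A)"
    using Y.ser_mult[of "- 1" A "ls_shift Y A" "- m" "- m"] Y.ser_shift[of A "- m"] A b sh shc by simp
  have b1: "ls_mult Y A (ls_shift Y A) (- n) = \<zero>\<^bsub>Y\<^esub>" if "n < - m + - m" for n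
    using Y.ls_mult_bound[of "- 1" A "ls_shift Y A" "- m" "- m" n] A b sh shc that by simp
  have c1: "ls_mult Y A (ls_shift Y A) n \<in> carrier Y" for n
    by (rule Y.ls_mult_closed) (simp_all add: A shc)
  have b0: "Yh_series (- n) = \<zero>\<^bsub>Y\<^esub>" if "n < 0" for n
    using that by (simp add: Yh_series_def)
  have m2: "Yser (ls_mult Y Yh_series (ls_mult Y A (ls_shift Y A))) = Yl.H * (Yser A * tau (Yser A))"
    using Y.ser_mult[of "- 1" Yh_series "ls_mult Y A (ls_shift Y A)" 0 "- m + - m"] b1 c1 b0 m1
    by (simp add: Yser_h Yh_series_closed)
  have b2: "ls_mult Y Yh_series (ls_mult Y A (ls_shift Y A)) (- n) = \<zero>\<^bsub>Y\<^esub>" if "n < 0 + (- m + - m)" for n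
    using Y.ls_mult_bound[of "- 1" Yh_series "ls_mult Y A (ls_shift Y A)" 0 "- m + - m" n] b1 c1 b0 that
    by (simp add: Yh_series_closed)
  have c2: "ls_mult Y Yh_series (ls_mult Y A (ls_shift Y A)) n \<in> carrier Y" for n
    by (rule Y.ls_mult_closed) (simp_all add: c1 Yh_series_closed)
  show "ls_mult Y Yh_series (ls_mult Y A (ls_shift Y A)) = (\<lambda>n. pcoeff a n \<odot>\<^bsub>Y\<^esub> \<one>\<^bsub>Y\<^esub>) \<longleftrightarrow>
      Yl.H * (Yser A * tau (Yser A)) = Y_rhs a"
  proof
    assume "Yl.H * (Yser A * tau (Yser A)) = Y_rhs a"
    then have eq: "Yser (ls_mult Y Yh_series (ls_mult Y A (ls_shift Y A))) = Yser (\<lambda>n. pcoeff a n \<odot>\<^bsub>Y\<^esub> \<one>\<^bsub>Y\<^esub>)"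
      by (simp add: m2 Y_rhs_def)
    show "ls_mult Y Yh_series (ls_mult Y A (ls_shift Y A)) = (\<lambda>n. pcoeff a n \<odot>\<^bsub>Y\<^esub> \<one>\<^bsub>Y\<^esub>)"
      by (rule Y.ser_inj[OF _ _ _ _ _ eq, of "min (- int (degree a)) (- m + - m)"])
        (auto simp: c2 b2 Y.smult_closed pcoeff_def coeff_eq_0 Y.smult_zero_left)
  qed (simp add: m2[symmetric] Y_rhs_def)
qed

lemma lift_cartan_commute: "x \<in> Y_cartan \<Longrightarrow> y \<in> Y_cartan \<Longrightarrow> lift Y x * lift Y y = lift Y y * lift Y x"
  using Y.subalgebra_lift(6)[OF Y_cartan(1,4)] by blast

lemma tau_coeffs_commute:
  assumes "\<And>i. f $$ i * x = x * f $$ i"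
  shows "tau f $$ n * x = x * tau f $$ n"
proof -
  obtain a where a: "ord_ge a f" by (rule ord_ge_exists)
  show ?thesis
    by (simp add: shift_mat.nth[OF a, of "{a..n}"] sum_distrib_left sum_distrib_right sc_mult_left sc_mult_right assms)
qed

lemma Y_is_A_yangian_A:
  assumes "Y_is_A a A"
  shows "yangian_A (\<lambda>n. lift Y (Yx Pos n)) (\<lambda>n. lift Y (Yx Neg n)) (\<lambda>n. lift Y (Yh n)) Yu (Yser A) (Y_rhs a)
    (- int (degree a div 2))"
proof -
  let ?m = "int (degree a div 2)"
  have A: "range A \<subseteq> Y_cartan" "A ?m = \<one>\<^bsub>Y\<^esub>" "\<forall>i>?m. A i = \<zero>\<^bsub>Y\<^esub>"
    using assms by (auto simp: Y_is_A_def)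
  note ser = Y_is_A_ser[OF A(1,3)]
  have AC: "A n \<in> Y_cartan" "A n \<in> carrier Y" for n using A(1) Y_cartan(3) by auto
  have hC: "Yh s \<in> Y_cartan" for s using Y_cartan(2) by auto
  have comm: "Yser A $$ i * Yser A $$ j = Yser A $$ j * Yser A $$ i" for i j
    by (simp add: ser(1) lift_cartan_commute AC)
  have rhs: "Y_rhs a * fls_const x = fls_const x * Y_rhs a" if "unit_on Yu x" for x
    using that by (intro fls_eqI) (simp add: Y_rhs_nth fls_const_times_nth fls_times_const_nth sc_mult_left sc_mult_right unit_on_def)
  have Hn: "Yl.H $$ n = lift Y (Yh_series (- n))" for n
    using Y.ser_nth[of 0 Yh_series "- 1" n] by (simp add: Yh_series_def flip: Yser_h)
  show ?thesis
  proof
    show "unit_on Yl.Uc (Yser A)"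
      by (simp add: unit_on_nth ser(1) Y.lift_unit AC)
    show "ord_ge (- ?m) (Yser A)" "Yser A $$ (- ?m) = Yu"
      by (simp_all add: ser A)
    show "fls_const (lift Y (Yh s)) * Yser A = Yser A * fls_const (lift Y (Yh s))" for s
      by (rule fls_eqI) (simp add: fls_const_times_nth fls_times_const_nth ser(1) lift_cartan_commute AC hC)
    show "tau (Yser A) * Yser A = Yser A * tau (Yser A)"
      by (rule fls_commuteI) (rule tau_coeffs_commute, rule comm)
    show "Yl.H * (Yser A * tau (Yser A)) = Y_rhs a"
      using assms ser(3) by (simp add: Y_is_A_def)
    show "Yl.P s * Y_rhs a = Y_rhs a * Yl.P s" "Yl.M s * Y_rhs a = Y_rhs a * Yl.M s" for s
      by (simp_all add: rhs Yl.up Yl.um)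
    show "Yser A * Yl.H = Yl.H * Yser A"
      by (rule fls_commuteI) (simp add: Hn ser(1) lift_cartan_commute AC Yh_series_closed)
  qed
qed

lemma Y_A_unique:
  assumes "Y_is_A a A" "Y_is_A a B"
  shows "A = B"
proof -
  let ?m = "int (degree a div 2)"
  interpret A: yangian_A "\<lambda>n. lift Y (Yx Pos n)" "\<lambda>n. lift Y (Yx Neg n)" "\<lambda>n. lift Y (Yh n)" Yu "Yser A" "Y_rhs a" "- ?m"
    by (rule Y_is_A_yangian_A) fact
  interpret B: yangian_A "\<lambda>n. lift Y (Yx Pos n)" "\<lambda>n. lift Y (Yx Neg n)" "\<lambda>n. lift Y (Yh n)" Yu "Yser B" "Y_rhs a" "- ?m"
    by (rule Y_is_A_yangian_A) fact
  have u: "unit_on Yu (Yser A $$ n)" "unit_on Yu (Yser B $$ n)" for n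
    using A.uA B.uA unfolding unit_on_nth by auto
  have "Yser A * Yl.H * tau (Yser A) = Yser B * Yl.H * tau (Yser B)"
    using A.HA B.HA by (simp add: A.HAc B.HAc mult.assoc)
  then have "Yser A = Yser B"
    by (intro shift_mat.mult_tri_unique[of "- ?m" "Yser A" Yu "Yser B" Yl.H Yu])
      (use u in \<open>auto simp: A.A_lead B.A_lead Yl.H_ord shift_mat_diag Yl.H_nth unit_on_def Yl.uu\<close>)
  moreover have "range A \<subseteq> Y_cartan" "range B \<subseteq> Y_cartan"
    using assms by (simp_all add: Y_is_A_def)
  then have "A n \<in> carrier Y" "B n \<in> carrier Y" for n
    using Y_cartan(3) by (meson range_subsetD subsetD)+
  moreover have "n < - ?m \<Longrightarrow> A (- 1 * n) = \<zero>\<^bsub>Y\<^esub>" "n < - ?m \<Longrightarrow> B (- 1 * n) = \<zero>\<^bsub>Y\<^esub>" for n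
    using assms by (auto simp: Y_is_A_def)
  ultimately show ?thesis
    by (intro Y.ser_inj[of "- 1" A B "- ?m"]) auto
qed

text \<open>A solution is constructed over the lifted Cartan subalgebra and brought back with
  \<open>lower\<close>. Even degree and leading coefficient 1 make the leading terms of both sides
  agree.\<close>

lemma Y_A_exists:
  assumes "lead_coeff a = 1" "even (degree a)"
  shows "\<exists>A. Y_is_A a A"
proof -
  let ?m = "int (degree a div 2)" and ?C = "lift Y ` Y_cartan"
  note C = Y.subalgebra_lift[OF Y_cartan(1,4)]
  have Hn: "Yl.H $$ n = lift Y (Yh_series (- n))" for n
    using Y.ser_nth[of 0 Yh_series "- 1" n] by (simp add: Yh_series_def flip: Yser_h)
  have deg: "?m + ?m = int (degree a)" using assms(2) by (metis even_two_times_div_two mult_2 of_nat_add)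
  have "\<exists>\<alpha>. ord_ge (- ?m) \<alpha> \<and> \<alpha> $$ (- ?m) = Yu \<and> (\<forall>n. \<alpha> $$ n \<in> ?C) \<and> \<alpha> * Yl.H * tau \<alpha> = Y_rhs a"
  proof (rule shift_mat.mult_tri_exists[OF C(1-6) _ Yl.H_ord])
    show "Yl.H $$ n \<in> ?C" for n
      unfolding Hn using Yh_series_closed by blast
    show "Yu * Yl.H $$ 0 = Yu" by (simp add: Yl.H_nth Yl.uu)
    show "ord_ge (- ?m + - ?m) (Y_rhs a)"
      using deg by (auto simp: ord_ge_def Y_rhs_nth pcoeff_def coeff_eq_0)
    show "Y_rhs a $$ n \<in> ?C" for n
      unfolding Y_rhs_nth by (rule C(5)[OF C(2)])
    have "- (- ?m + - ?m) = int (degree a)" using deg by simp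
    then show "Y_rhs a $$ (- ?m + - ?m) = Yl.H $$ 0"
      using assms(1) by (simp only: Y_rhs_nth) (simp add: pcoeff_def Yl.H_nth sc_one)
  qed (use C(2,7) in \<open>auto simp: shift_mat_diag\<close>)
  then obtain \<alpha> where \<alpha>: "ord_ge (- ?m) \<alpha>" "\<alpha> $$ (- ?m) = Yu" "\<And>n. \<alpha> $$ n \<in> ?C" "\<alpha> * Yl.H * tau \<alpha> = Y_rhs a"
    by blast
  define A where "A n = lower Y (\<alpha> $$ (- n))" for n
  have low: "lower Y (\<alpha> $$ n) \<in> Y_cartan" "lift Y (lower Y (\<alpha> $$ n)) = \<alpha> $$ n" for n
  proof -
    obtain x where "x \<in> Y_cartan" "\<alpha> $$ n = lift Y x" using \<alpha>(3)[of n] by blast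
    then show "lower Y (\<alpha> $$ n) \<in> Y_cartan" "lift Y (lower Y (\<alpha> $$ n)) = \<alpha> $$ n"
      using Y_cartan(3) by (auto simp: Y.lower_lift)
  qed
  have A: "range A \<subseteq> Y_cartan" "\<forall>i>?m. A i = \<zero>\<^bsub>Y\<^esub>"
    using low(1) \<alpha>(1) by (auto simp: A_def ord_ge_def Y.lower_ops)
  note ser = Y_is_A_ser[OF A]
  have "Yser A = \<alpha>"
    by (rule fls_eqI) (simp add: ser(1) A_def low)
  moreover have "\<alpha> * Yl.H = Yl.H * \<alpha>"
    by (rule fls_commuteI) (use C(6) \<alpha>(3) Yh_series_closed in \<open>auto simp: Hn\<close>)
  ultimately have "Yl.H * (Yser A * tau (Yser A)) = Y_rhs a"
    using \<alpha>(4) by (simp add: mult.assoc)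
  moreover have "A ?m = \<one>\<^bsub>Y\<^esub>"
    by (simp add: A_def \<alpha>(2) Y.lower_lift)
  ultimately have "Y_is_A a A"
    using A ser(3)[of a] unfolding Y_is_A_def by blast
  then show ?thesis by blast
qed

text \<open>Existence and uniqueness together make the definite description meaningful.\<close>

lemma Y_A_is_A:
  assumes "lead_coeff a = 1" "even (degree a)"
  shows "Y_is_A a (Y_A a)"
proof -
  have "Y_A a = (THE A. Y_is_A a A)"
    by (simp add: Y_A_def Y_is_A_def Let_def)
  then show ?thesis
    using theI'[of "Y_is_A a"] Y_A_exists[OF assms] Y_A_unique by metis
qed

lemma Y_A_closed:
  assumes "lead_coeff a = 1" "even (degree a)"
  shows "Y_A a i \<in> carrier Y"
  using Y_A_is_A[OF assms] Y_cartan(3) by (auto simp: Y_is_A_def)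

lemma calg_ideal_Y_trunc:
  assumes "lead_coeff a = 1" "even (degree a)"
  shows "calg_ideal Y (Y_trunc_ideal a)"
  unfolding Y_trunc_ideal_def
  by (intro calg_ideal.intro Y.calg_self Y.genideal_ideal) (auto simp: Y_A_closed[OF assms])

lemma Y_proj_A_zero:
  assumes "lead_coeff a = 1" "even (degree a)" "i < 0"
  shows "Y_proj a (Y_A a i) = \<zero>\<^bsub>Y_trunc a\<^esub>"
proof -
  interpret calg_ideal Y "Y_trunc_ideal a" by (rule calg_ideal_Y_trunc[OF assms(1,2)])
  have "Y_A a i \<in> Y_trunc_ideal a"
    unfolding Y_trunc_ideal_def
    using Y.genideal_self[of "{Y_A a i |i. i < 0}"] Y_A_closed[OF assms(1,2)] assms(3) by blast
  then show ?thesis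
    using proj_zero_iff[OF Y_A_closed[OF assms(1,2)], of i] by (simp add: Y_proj_def Y_trunc_def proj_def)
qed

theorem Y_trunc_coproduct:
  assumes a: "lead_coeff a = 1" "even (degree a)" and b: "lead_coeff b = 1" "even (degree b)"
    and \<Delta>: "Y_coproduct \<Delta>"
  shows "\<exists>\<Delta>' \<in> alg_hom (Y_trunc (a * b)) (tensor_alg (Y_trunc a) (Y_trunc b)).
         \<forall>y \<in> carrier Y. \<Delta>' (Y_proj (a * b) y) =
           tensor_map Y Y (Y_trunc a) (Y_trunc b) (Y_proj a) (Y_proj b) (\<Delta> y)"
proof -
  have nz: "a \<noteq> 0" "b \<noteq> 0" using a b by auto
  have ab: "lead_coeff (a * b) = 1" "even (degree (a * b))"
    using a b lead_coeff_mult[of a b] by (simp_all add: degree_mult_eq[OF nz])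
  interpret Ia: calg_ideal Y "Y_trunc_ideal a" by (rule calg_ideal_Y_trunc[OF a])
  interpret Ib: calg_ideal Y "Y_trunc_ideal b" by (rule calg_ideal_Y_trunc[OF b])
  interpret Iab: calg_ideal Y "Y_trunc_ideal (a * b)" by (rule calg_ideal_Y_trunc[OF ab])
  have pa: "Y_proj a = Ia.proj" "Y_trunc a = quot_alg Y (Y_trunc_ideal a)"
    and pb: "Y_proj b = Ib.proj" "Y_trunc b = quot_alg Y (Y_trunc_ideal b)"
    and pab: "Y_proj (a * b) = Iab.proj" "Y_trunc (a * b) = quot_alg Y (Y_trunc_ideal (a * b))"
    by (auto simp: Y_proj_def Y_trunc_def Ia.proj_def Ib.proj_def Iab.proj_def)
  interpret Ya: calg "Y_trunc a" unfolding pa by (rule Ia.calg_quot)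
  interpret Yb: calg "Y_trunc b" unfolding pb by (rule Ib.calg_quot)
  interpret T: calg_tensor "Y_trunc a" "Y_trunc b" by unfold_locales
  interpret YY: calg_tensor Y Y by unfold_locales
  let ?T = "tensor_alg (Y_trunc a) (Y_trunc b)"
  have hpa: "Y_proj a \<in> alg_hom Y (Y_trunc a)" and hpb: "Y_proj b \<in> alg_hom Y (Y_trunc b)"
    unfolding pa pb by (rule Ia.proj_hom Ib.proj_hom)+
  define tm where "tm = tensor_map Y Y (Y_trunc a) (Y_trunc b) (Y_proj a) (Y_proj b)"
  note tm = tensor_map_hom[OF Y.calg_self Y.calg_self Ya.calg_self Yb.calg_self hpa hpb, folded tm_def]
  have D: "\<Delta> \<in> alg_hom Y (tensor_alg Y Y)"
    using \<Delta> by (simp add: Y_coproduct_def Let_def)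
  define j1 where "j1 y = T.t (Y_proj a y) \<one>\<^bsub>Y_trunc b\<^esub>" for y
  define j2 where "j2 y = T.t \<one>\<^bsub>Y_trunc a\<^esub> (Y_proj b y)" for y
  define \<psi> where "\<psi> y = tm (\<Delta> y)" for y
  have j1: "j1 \<in> alg_hom Y ?T" unfolding j1_def by (rule alg_hom_comp[OF hpa T.left_hom])
  have j2: "j2 \<in> alg_hom Y ?T" unfolding j2_def by (rule alg_hom_comp[OF hpb T.right_hom])
  have psi: "\<psi> \<in> alg_hom Y ?T" unfolding \<psi>_def by (rule alg_hom_comp[OF D tm(1)])
  note closed = alg_homD(1)[OF j1] alg_homD(1)[OF j2] alg_homD(1)[OF psi]
  have tm_t: "tm (pure_tensor Y Y x y) = j1 x \<otimes>\<^bsub>?T\<^esub> j2 y" if "x \<in> carrier Y" "y \<in> carrier Y" for x y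
    using that by (simp add: tm(2) j1_def j2_def T.left_right alg_homD(1)[OF hpa] alg_homD(1)[OF hpb])
  have j1_one: "j1 \<one>\<^bsub>Y\<^esub> = \<one>\<^bsub>?T\<^esub>" and j2_one: "j2 \<one>\<^bsub>Y\<^esub> = \<one>\<^bsub>?T\<^esub>" and psi_one: "\<psi> \<one>\<^bsub>Y\<^esub> = \<one>\<^bsub>?T\<^esub>"
    by (rule alg_hom_one[OF j1] alg_hom_one[OF j2] alg_hom_one[OF psi])+
  note tm_add = alg_homD(2)[OF tm(1)]
  have psi_gen: "\<psi> (Yx e 0) = j1 (Yx e 0) \<oplus>\<^bsub>?T\<^esub> j2 (Yx e 0)" "\<psi> (Yh 0) = j1 (Yh 0) \<oplus>\<^bsub>?T\<^esub> j2 (Yh 0)"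
    "\<psi> (Yx Pos 1) = j1 (Yx Pos 1) \<oplus>\<^bsub>?T\<^esub> j2 (Yx Pos 1) \<oplus>\<^bsub>?T\<^esub> j1 (Yh 0) \<otimes>\<^bsub>?T\<^esub> j2 (Yx Pos 0)" for e
    using \<Delta> unfolding Y_coproduct_def Let_def \<psi>_def
    by (simp_all add: tm_add tm_t YY.t_closed Yx_closed Yh_closed j1_one j2_one closed)
  define J1 where "J1 x = lift ?T (j1 (lower Y x))" for x
  define J2 where "J2 x = lift ?T (j2 (lower Y x))" for x
  define Psi where "Psi x = lift ?T (\<psi> (lower Y x))" for x
  have morph: "calg_morph J1" "calg_morph J2" "calg_morph Psi"
    unfolding J1_def J2_def Psi_def
    by (rule calg_morph_alg_hom[OF Y.calg_self T.T.calg_self j1] calg_morph_alg_hom[OF Y.calg_self T.T.calg_self j2]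
      calg_morph_alg_hom[OF Y.calg_self T.T.calg_self psi])+
  interpret mJ1: calg_morph J1 by (rule morph)
  interpret mJ2: calg_morph J2 by (rule morph)
  interpret mPsi: calg_morph Psi by (rule morph)
  let ?ma = "- int (degree a div 2)" and ?mb = "- int (degree b div 2)"
  interpret CP: yangian_coproduct "\<lambda>n. lift Y (Yx Pos n)" "\<lambda>n. lift Y (Yx Neg n)" "\<lambda>n. lift Y (Yh n)" Yu
    "Yser (Y_A a)" "Y_rhs a" ?ma "Yser (Y_A b)" "Y_rhs b" ?mb J1 J2 Psi
  proof (intro yangian_coproduct.intro yangian_coproduct_axioms.intro Y_is_A_yangian_A Y_A_is_A a b morph)
    show "J2 y * J1 x = J1 x * J2 y" for x y
      unfolding J1_def J2_def
      by (simp add: closed Y.lower_closed j1_def j2_def T.left_right T.right_left alg_homD(1)[OF hpa] alg_homD(1)[OF hpb]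
          T.t_closed flip: T.T.lift_mult)
    note s = J1_def J2_def Psi_def Y.lower_lift Yx_closed Yh_closed psi_gen psi_gen(3)[unfolded One_nat_def] T.T.lift_add T.T.lift_mult closed j1_one j2_one psi_one
    show "Psi (lift Y (Yx Pos 0)) = J1 (lift Y (Yx Pos 0)) + J2 (lift Y (Yx Pos 0))"
      "Psi (lift Y (Yx Neg 0)) = J1 (lift Y (Yx Neg 0)) + J2 (lift Y (Yx Neg 0))"
      "Psi (lift Y (Yh 0)) = J1 (lift Y (Yh 0)) + J2 (lift Y (Yh 0))"
      "Psi (lift Y (Yx Pos 1)) = J1 (lift Y (Yx Pos 1)) + J2 (lift Y (Yx Pos 1)) + J1 (lift Y (Yh 0)) * J2 (lift Y (Yx Pos 0))"
      "J1 Yu = Psi Yu" "J2 Yu = Psi Yu"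
      by (simp_all add: s)
  qed
  have c: "fls_map Psi (Y_rhs (a * b)) = fls_map J1 (Y_rhs a) * fls_map J2 (Y_rhs b)"
  proof (rule fls_eqI)
    fix n
    have "(fls_map J1 (Y_rhs a) * fls_map J2 (Y_rhs b)) $$ n =
        sc (\<Sum>i\<in>{- int (degree a)..n - (- int (degree b))}. pcoeff a (- i) * pcoeff b (- (n - i))) (J1 Yu * J2 Yu)"
      by (rule sc_convolution) (auto simp: Y_rhs_nth mJ1.sc mJ2.sc pcoeff_def coeff_eq_0)
    also have "J1 Yu * J2 Yu = Psi Yu"
      by (simp add: CP.units CP.T.uu)
    also have "(\<Sum>i\<in>{- int (degree a)..n - (- int (degree b))}. pcoeff a (- i) * pcoeff b (- (n - i))) =
        (\<Sum>i\<in>{- int (degree a)..max 0 (n + int (degree b))}. pcoeff a (- i) * pcoeff b (- (n - i)))"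
      by (rule sum.mono_neutral_left) (auto simp: pcoeff_def intro!: coeff_eq_0)
    also have "\<dots> = (\<Sum>i\<in>{- max 0 (n + int (degree b))..int (degree a)}. pcoeff a i * pcoeff b (- n - i))"
      by (rule sum.reindex_bij_witness[of _ uminus uminus]) auto
    also have "\<dots> = pcoeff (a * b) (- n)"
      by (rule pcoeff_mult[symmetric]) auto
    finally show "fls_map Psi (Y_rhs (a * b)) $$ n = (fls_map J1 (Y_rhs a) * fls_map J2 (Y_rhs b)) $$ n"
      by (simp add: Y_rhs_nth mPsi.sc)
  qed
  \<comment> \<open>Halving the degrees is additive because both are even.\<close>
  have "- int (degree (a * b) div 2) = ?ma + ?mb"
    using a(2) b(2) by (auto simp: degree_mult_eq[OF nz] elim!: evenE)
  then have A: "fls_map Psi (Yser (Y_A (a * b))) = CP.\<A>"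
    using CP.coproduct_A[OF _ c] Y_is_A_yangian_A[OF Y_A_is_A[OF ab]] by simp
  have ser: "Yser (Y_A d) $$ n = lift Y (Y_A d (- n))" if "lead_coeff d = 1" "even (degree d)" for d n
    using Y_is_A_ser(1)[of "Y_A d" "int (degree d div 2)" n] Y_A_is_A[OF that] unfolding Y_is_A_def by blast
  have z1: "fls_map J1 (Yser (Y_A a)) $$ n = 0" if "n > 0" for n
    using that by (simp add: ser[OF a] J1_def Y.lower_lift Y_A_closed[OF a] j1_def Y_proj_A_zero[OF a])
      (use alg_hom_zero[OF Ya.calg_self T.T.calg_self T.left_hom] in \<open>simp add: T.T.lift_zero\<close>)
  have z2: "fls_map J2 (Yser (Y_A b)) $$ n = 0" if "n > 0" for n
    using that by (simp add: ser[OF b] J2_def Y.lower_lift Y_A_closed[OF b] j2_def Y_proj_A_zero[OF b])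
      (use alg_hom_zero[OF Yb.calg_self T.T.calg_self T.right_hom] in \<open>simp add: T.T.lift_zero\<close>)
  have z3: "fls_map J1 CP.Y1.mono.F $$ n = 0" if "n > 0" for n
    using z1[OF that] unfolding CP.Y1.mono.F_def
    by (simp add: fls_const_times_nth fls_times_const_nth mJ1.diff mJ1.mult)
  have z4: "fls_map J2 CP.Y2.mono.E $$ n = 0" if "n > 0" for n
    using z2[OF that] unfolding CP.Y2.mono.E_def
    by (simp add: fls_const_times_nth fls_times_const_nth mJ2.diff mJ2.mult)
  \<comment> \<open>A positive index stands for a negative power of z. The projected series A have
    no such terms, and neither have their commutators with x^+_0 and x^-_0.\<close>
  have A0: "CP.\<A> $$ n = 0" if "n > 0" for n
    unfolding CP.\<A>_def
    using that fls_mult_upper(1)[of 0 _ 0, OF z1 z2] fls_mult_upper(1)[of 0 _ 0, OF z3 z4] by simp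
  have kill: "\<psi> (Y_A (a * b) i) = \<zero>\<^bsub>?T\<^esub>" if "i < 0" for i
  proof -
    have "lift ?T (\<psi> (Y_A (a * b) i)) = fls_map Psi (Yser (Y_A (a * b))) $$ (- i)"
      by (simp add: ser[OF ab] Psi_def Y.lower_lift Y_A_closed[OF ab])
    also have "\<dots> = 0" unfolding A using that by (intro A0) simp
    finally show ?thesis
      by (simp add: T.T.lift_eq_0_iff closed Y_A_closed[OF ab])
  qed
  have "\<psi> y = \<zero>\<^bsub>?T\<^esub>" if "y \<in> Y_trunc_ideal (a * b)" for y
    using genideal_hom_zero[OF Y.calg_self T.T.calg_self psi _ _ that[unfolded Y_trunc_ideal_def]] kill Y_A_closed[OF ab] by blast
  note fac = Iab.factor[OF T.T.calg_self psi this]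
  show ?thesis
    by (rule bexI[OF _ fac(2)[folded pab(2)]]) (simp add: pab(1) fac(1), simp add: \<psi>_def tm_def)
qed

section \<open>Truncated quantum affine algebras\<close>

text \<open>f' and g' are f and g read backwards, twisted by powers of s and by the left factors x
  and y. Since y passes through f, the product is f g read backwards with the combined
  twist.\<close>

lemma fls_mult_reverse:
  fixes f g f' g' :: "'a::calgebra fls"
  assumes f: "ord_ge 0 f" "\<And>n. n > a \<Longrightarrow> f $$ n = 0" and g: "ord_ge 0 g" "\<And>n. n > b \<Longrightarrow> g $$ n = 0"
    and f': "\<And>n. f' $$ n = sc (c * s powi (a - n)) (x * f $$ (a - n))"
    and g': "\<And>n. g' $$ n = sc (d * s powi (b - n)) (y * g $$ (b - n))"
    and comm: "\<And>i. y * f $$ i = f $$ i * y" and s: "s \<noteq> 0"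
  shows "(f' * g') $$ n = sc (c * d * s powi (a + b - n)) (x * y * (f * g) $$ (a + b - n))"
proof -
  let ?m = "a + b - n"
  define N where "N = \<bar>a\<bar> + \<bar>b\<bar> + \<bar>n\<bar>"
  let ?S = "{a - N..N}"
  have o: "ord_ge 0 f'" "ord_ge 0 g'"
    by (auto simp: ord_ge_def f' g' f(2) g(2))
  have "(f' * g') $$ n = (\<Sum>i\<in>?S. f' $$ i * g' $$ (n - i))"
    by (rule fls_times_nth_superset[OF o]) (auto simp: N_def)
  also have "\<dots> = (\<Sum>i\<in>?S. f' $$ (a - i) * g' $$ (n - (a - i)))"
    by (rule sum.reindex_bij_witness[of _ "\<lambda>i. a - i" "\<lambda>i. a - i"]) auto
  also have "\<dots> = (\<Sum>i\<in>?S. sc (c * d * s powi ?m) (x * y * (f $$ i * g $$ (?m - i))))"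
  proof (rule sum.cong[OF refl])
    fix i
    have "f' $$ (a - i) * g' $$ (n - (a - i)) =
        sc (c * s powi i * (d * s powi (?m - i))) (x * (f $$ i * y) * g $$ (?m - i))"
      by (simp add: f' g' sc_mult_left sc_mult_right sc_sc mult.assoc algebra_simps)
    also have "c * s powi i * (d * s powi (?m - i)) = c * d * s powi ?m"
      using s by (simp add: power_int_diff)
    finally show "f' $$ (a - i) * g' $$ (n - (a - i)) = sc (c * d * s powi ?m) (x * y * (f $$ i * g $$ (?m - i)))"
      by (simp add: comm[symmetric] mult.assoc)
  qed
  also have "\<dots> = sc (c * d * s powi ?m) (x * y * (\<Sum>i\<in>?S. f $$ i * g $$ (?m - i)))"
    by (simp add: sc_sum_right sum_distrib_left)
  also have "(\<Sum>i\<in>?S. f $$ i * g $$ (?m - i)) = (f * g) $$ ?m"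
    by (rule fls_times_nth_superset[OF f(1) g(1), symmetric]) (auto simp: N_def)
  finally show ?thesis .
qed

text \<open>Coefficient n + 1 of the relations of index -1: the terms with index -1 contain A_(n+1),
  which J kills, and those with A_n and index 0 remain.\<close>

lemma (in qaff_A) top_commute:
  assumes "calg_morph J" "J (A $$ (n + 1)) = 0"
  shows "sc (1/p) (J (A $$ n) * J (xp 0)) = J (xp 0) * J (A $$ n)"
    and "J (A $$ n) * J (xm 0) = sc (1/p) (J (xm 0) * J (A $$ n))"
proof -
  interpret J: calg_morph J by fact
  have "J ((A * P (- 1) - P (- 1) * A - Z (sc (1/p) (A * P (- 1 + 1)) - P (- 1 + 1) * A)) $$ (n + 1)) = 0"
    "J ((A * M (- 1) - M (- 1) * A - Z (A * M (- 1 + 1) - sc (1/p) (M (- 1 + 1) * A))) $$ (n + 1)) = 0"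
    unfolding A_plus A_minus by (simp_all add: J.zero)
  then show "sc (1/p) (J (A $$ n) * J (xp 0)) = J (xp 0) * J (A $$ n)"
    "J (A $$ n) * J (xm 0) = sc (1/p) (J (xm 0) * J (A $$ n))"
    by (simp_all add: fls_times_const_nth fls_const_times_nth J.diff J.mult J.sc assms(2))
qed

text \<open>
  \<open>C\<close>, \<open>C1\<close>, \<open>C2\<close> are the series for the algebra with the roles of the two current families and of
  \<open>z\<close> and \<open>z\<^sup>-\<^sup>1\<close> exchanged; this exchange also swaps the tensor factors.
\<close>

lemma truncated_coproduct:
  fixes n1 n2 :: int
  assumes CP: "qaff_coproduct q xp xm php phm u A1 c1 A2 c2 J1 J2 Psi"
    and CM: "qaff_coproduct q (\<lambda>n. xm (- n)) (\<lambda>n. xp (- n)) (\<lambda>n. phm (- n)) (\<lambda>n. php (- n)) u C2 d2 C1 d1 J2 J1 Psi"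
    and A: "qaff_A q xp xm php phm u A c" "fls_map Psi c = fls_map J1 c1 * fls_map J2 c2"
    and C: "qaff_A q (\<lambda>n. xm (- n)) (\<lambda>n. xp (- n)) (\<lambda>n. phm (- n)) (\<lambda>n. php (- n)) u C d"
      "fls_map Psi d = fls_map J2 d2 * fls_map J1 d1"
    and top: "\<And>n. n > n1 \<Longrightarrow> J1 (A1 $$ n) = 0" "\<And>n. n > n2 \<Longrightarrow> J2 (A2 $$ n) = 0"
    and ref: "\<And>n. J1 (C1 $$ n) = sc ((q\<^sup>2) powi (n1 - n)) (J1 (C1 $$ n1) * J1 (A1 $$ (n1 - n)))"
      "\<And>n. J2 (C2 $$ n) = sc ((q\<^sup>2) powi (n2 - n)) (J2 (C2 $$ n2) * J2 (A2 $$ (n2 - n)))"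
  shows "n > n1 + n2 \<Longrightarrow> Psi (A $$ n) = 0"
    and "Psi (A $$ (n1 + n2)) = J1 (A1 $$ n1) * J2 (A2 $$ n2)"
    and "Psi (C $$ n) = sc ((q\<^sup>2) powi (n1 + n2 - n)) (Psi (C $$ (n1 + n2)) * Psi (A $$ (n1 + n2 - n)))"
proof -
  interpret CP: qaff_coproduct q xp xm php phm u A1 c1 A2 c2 J1 J2 Psi by fact
  interpret CM: qaff_coproduct q "\<lambda>n. xm (- n)" "\<lambda>n. xp (- n)" "\<lambda>n. phm (- n)" "\<lambda>n. php (- n)" u C2 d2 C1 d1 J2 J1 Psi
    by fact
  interpret G: qaff_A q xp xm php phm u A c by fact
  note nth = fls_times_const_nth fls_const_times_nth
  note J = CP.J1.calg_morph_axioms CP.J2.calg_morph_axioms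
  have PA: "fls_map Psi A = CP.\<A>" by (rule CP.coproduct_A[OF A])
  have PC: "fls_map Psi C = CM.\<A>" by (rule CM.coproduct_A[OF C])
  let ?F = "fls_map J1 CP.Y1.mono.F" and ?E = "fls_map J2 CP.Y2.mono.E"
  let ?A1 = "fls_map J1 A1" and ?A2 = "fls_map J2 A2"
  have F: "J1 (CP.Y1.mono.F $$ n) = J1 (A1 $$ n) * J1 (xm 0) - J1 (xm 0) * J1 (A1 $$ n)" for n
    by (simp add: CP.Y1.mono.F_def nth CP.J1.diff CP.J1.mult)
  have E: "J2 (CP.Y2.mono.E $$ n) = sc q (J2 (xp 0) * J2 (A2 $$ n)) - sc (1/q) (J2 (A2 $$ n) * J2 (xp 0))" for n
    by (simp add: CP.Y2.mono.E_def nth CP.J2.diff CP.J2.mult CP.J2.sc)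
  have A_ord: "ord_ge 0 ?A1" "ord_ge 0 ?A2"
    using CP.Y1.A_lead CP.Y2.A_lead by (auto intro: CP.J1.fls_map_ord_ge CP.J2.fls_map_ord_ge)
  have z: "J1 (A1 $$ n) = 0" "J2 (A2 $$ n) = 0" if "n < 0" for n
    using A_ord that by (simp_all add: ord_ge_def)
  have FE_ord: "ord_ge 0 ?F" "ord_ge 0 ?E"
    using z by (simp_all add: ord_ge_def F E)
  have FE_top: "?F $$ n = 0" if "n > n1" for n using that by (simp add: F top)
  \<comment> \<open>The top coefficient of A2 q-commutes with x^+_0 exactly so that the q-commutator
    E2 vanishes in degree n2. Hence F1 tensor E2 does not reach degree n1 + n2.\<close>
  have E_top: "?E $$ n = 0" if "n \<ge> n2" for n
  proof (cases "n = n2")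
    case True
    have "sc q (sc (1/q\<^sup>2) (J2 (A2 $$ n) * J2 (xp 0))) = sc q (J2 (xp 0) * J2 (A2 $$ n))"
      using CP.Y2.top_commute(1)[OF J(2), of n] top(2)[of "n + 1"] True by simp
    then show ?thesis by (simp add: E CP.Y1.sc_qp)
  qed (use that in \<open>simp add: E top\<close>)
  have top': "?A1 $$ n = 0" if "n > n1" for n using that top by simp
  have top'': "?A2 $$ n = 0" if "n > n2" for n using that top by simp
  note up = fls_mult_upper[of n1 ?A1 n2 ?A2, OF top' top''] fls_mult_upper[of n1 ?F n2 ?E, OF FE_top E_top]
  have Psi_A: "Psi (A $$ n) = CP.\<A> $$ n" for n using PA by (simp add: fls_eq_iff)
  show "n > n1 + n2 \<Longrightarrow> Psi (A $$ n) = 0"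
    unfolding Psi_A CP.\<A>_def by (simp add: up)
  show "Psi (A $$ (n1 + n2)) = J1 (A1 $$ n1) * J2 (A2 $$ n2)"
    unfolding Psi_A CP.\<A>_def using E_top[of n2] by (simp add: up)
  let ?g1 = "J1 (C1 $$ n1)" and ?g2 = "J2 (C2 $$ n2)"
  \<comment> \<open>Under the reflection, degree n1 + 1 of C1 corresponds to degree -1 of A1, where
    A1 vanishes; similarly for C2. So \<open>top_commute\<close> applies to the exchanged algebra
    too.\<close>
  have "J1 (C1 $$ (n1 + 1)) = 0" "J2 (C2 $$ (n2 + 1)) = 0"
    using ref(1)[of "n1 + 1"] ref(2)[of "n2 + 1"] by (simp_all add: z)
  then have g1: "J1 (xm 0) * ?g1 = sc (1/q\<^sup>2) (?g1 * J1 (xm 0))"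
    and g2: "?g2 * J2 (xp 0) = sc (1/q\<^sup>2) (J2 (xp 0) * ?g2)"
    using CM.Y2.top_commute(1)[OF J(1), of n1] CM.Y1.top_commute(2)[OF J(2), of n2] by simp_all
  have g2': "J2 (xp 0) * ?g2 = sc (q\<^sup>2) (?g2 * J2 (xp 0))"
    by (simp add: g2 CP.Y1.sc_pp)
  have q0: "q \<noteq> 0" by (rule CP.Y1.q0)
  \<comment> \<open>The reflection turns E2 into the F of the exchanged algebra and F1 into its E.
    The constants -q and -1/q multiply to 1, so both summands of the candidate are reflected with
    the same factor.\<close>
  have F': "fls_map J2 CM.Y1.mono.F $$ n = sc (- q * (q\<^sup>2) powi (n2 - n)) (?g2 * ?E $$ (n2 - n))" for n
  proof -
    let ?s = "(q\<^sup>2) powi (n2 - n)" and ?a = "J2 (A2 $$ (n2 - n))" and ?e = "J2 (xp 0)"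
    have "fls_map J2 CM.Y1.mono.F $$ n = sc ?s (?g2 * ?a) * ?e - ?e * sc ?s (?g2 * ?a)"
      unfolding CM.Y1.mono.F_def by (simp add: nth CP.J2.diff CP.J2.mult ref(2)[of n])
    also have "\<dots> = sc ?s (?g2 * (?a * ?e) - (?e * ?g2) * ?a)"
      by (simp add: sc_mult_left sc_mult_right sc_diff_right mult.assoc)
    also have "\<dots> = sc ?s (?g2 * (?a * ?e - sc (q\<^sup>2) (?e * ?a)))"
      by (simp add: g2' sc_mult_left sc_mult_right right_diff_distrib mult.assoc)
    also have "?a * ?e - sc (q\<^sup>2) (?e * ?a) = sc (- q) (?E $$ (n2 - n))"
      using q0 by (simp add: E sc_diff_right sc_sc sc_minus_left sc_one power2_eq_square)
    finally show ?thesis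
      by (simp add: sc_mult_right sc_sc mult.commute)
  qed
  have E': "fls_map J1 CM.Y2.mono.E $$ n = sc (- (1/q) * (q\<^sup>2) powi (n1 - n)) (?g1 * ?F $$ (n1 - n))" for n
  proof -
    let ?s = "(q\<^sup>2) powi (n1 - n)" and ?a = "J1 (A1 $$ (n1 - n))" and ?f = "J1 (xm 0)"
    have "fls_map J1 CM.Y2.mono.E $$ n = sc q (?f * sc ?s (?g1 * ?a)) - sc (1/q) (sc ?s (?g1 * ?a) * ?f)"
      unfolding CM.Y2.mono.E_def by (simp add: nth CP.J1.diff CP.J1.mult CP.J1.sc ref(1)[of n])
    also have "\<dots> = sc ?s (sc q ((?f * ?g1) * ?a) - sc (1/q) (?g1 * (?a * ?f)))"
      by (simp add: sc_mult_left sc_mult_right sc_diff_right sc_sc mult.assoc mult.commute[of ?s])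
    also have "\<dots> = sc ?s (?g1 * sc (1/q) (?f * ?a - ?a * ?f))"
      by (simp add: g1 sc_mult_left sc_mult_right sc_diff_right right_diff_distrib mult.assoc CP.Y1.sc_qp)
    also have "sc (1/q) (?f * ?a - ?a * ?f) = sc (- (1/q)) (?F $$ (n1 - n))"
      by (simp add: F sc_minus_left sc_diff_right)
    finally show ?thesis
      by (simp only: sc_mult_right sc_sc) (simp add: mult.commute)
  qed
  have C': "fls_map J2 C2 $$ n = sc (1 * (q\<^sup>2) powi (n2 - n)) (?g2 * ?A2 $$ (n2 - n))"
    "fls_map J1 C1 $$ n = sc (1 * (q\<^sup>2) powi (n1 - n)) (?g1 * ?A1 $$ (n1 - n))" for n
    using ref(1)[of n] ref(2)[of n] by simp_all
  have E_top': "?E $$ n = 0" if "n > n2" for n using that E_top by simp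
  have comm: "?g1 * ?A2 $$ n = ?A2 $$ n * ?g1" "?g1 * ?E $$ n = ?E $$ n * ?g1" for n
    by (simp_all add: CP.commJ)
  have p0: "q\<^sup>2 \<noteq> 0" using q0 by simp
  have Psi_C: "Psi (C $$ n) = sc ((q\<^sup>2) powi (n1 + n2 - n)) (?g2 * ?g1 * Psi (A $$ (n1 + n2 - n)))" for n
  proof -
    have "Psi (C $$ n) = CM.\<A> $$ n" using PC by (simp add: fls_eq_iff)
    also have "\<dots> = sc (1 * 1 * (q\<^sup>2) powi (n2 + n1 - n)) (?g2 * ?g1 * (?A2 * ?A1) $$ (n2 + n1 - n)) +
        sc (- q * - (1/q) * (q\<^sup>2) powi (n2 + n1 - n)) (?g2 * ?g1 * (?E * ?F) $$ (n2 + n1 - n))"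
      unfolding CM.\<A>_def fls_plus_nth
      using fls_mult_reverse[OF A_ord(2) top'' A_ord(1) top' C' comm(1) p0, of n]
        fls_mult_reverse[OF FE_ord(2) E_top' FE_ord(1) FE_top F' E' comm(2) p0, of n] by simp
    also have "\<dots> = sc ((q\<^sup>2) powi (n1 + n2 - n)) (?g2 * ?g1 * CP.\<A> $$ (n1 + n2 - n))"
      using q0 by (simp add: CP.\<A>_def CP.comm distrib_left sc_add_right add.commute[of n1])
    finally show ?thesis by (simp add: Psi_A)
  qed
  have "Psi u * Psi (A $$ m) = Psi (A $$ m)" for m
  proof -
    have "unit_on u (A $$ m)" using G.uA unfolding unit_on_nth by blast
    then show ?thesis by (simp add: unit_on_def flip: CP.Psi.mult)
  qed
  \<comment> \<open>The case n = n1 + n2 identifies the prefactor \<open>?g2 * ?g1\<close> with the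
    image of the top coefficient of C, since A has constant coefficient u.\<close>
  then show "Psi (C $$ n) = sc ((q\<^sup>2) powi (n1 + n2 - n)) (Psi (C $$ (n1 + n2)) * Psi (A $$ (n1 + n2 - n)))"
    using Psi_C[of n] Psi_C[of "n1 + n2"] G.A_lead(2) by (simp add: mult.assoc sc_one)
qed

text \<open>Every coefficient of c is a multiple of k, so c inherits the q-commutation of k with
  x^+_n and x^-_n.\<close>

lemma (in qaff) qaff_A_I:
  assumes "ord_ge 0 A" "A $$ 0 = u" "\<And>n. unit_on u (A $$ n)" "\<And>i j. A $$ i * A $$ j = A $$ j * A $$ i"
    and "\<And>i m. A $$ i * php m = php m * A $$ i" "\<And>i m. A $$ i * phm m = phm m * A $$ i"
    and "\<Phi> * (A * taq A) = c" "\<And>n. c $$ n = sc (\<kappa> n) k"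
  shows "qaff_A q xp xm php phm u A c"
proof
  show "unit_on Uc A" using assms(3) by (simp add: unit_on_nth)
  show "fls_const (php m) * A = A * fls_const (php m)" "fls_const (phm m) * A = A * fls_const (phm m)" for m
    by (rule fls_eqI, simp add: fls_const_times_nth fls_times_const_nth assms(5,6))+
  show "taq A * A = A * taq A"
    by (rule fls_commuteI) (simp add: scale_nth[OF p0] sc_mult_left sc_mult_right assms(4))
  show "A * \<Phi> = \<Phi> * A"
    by (rule fls_commuteI) (simp add: \<Phi>_nth assms(5))
  show "c * P n = sc p (P n * c)" "c * M n = sc (1/p) (M n * c)" for n
    by (rule fls_eqI, simp only: fls_const_times_nth fls_times_const_nth fls_nth_sc assms(8) sc_mult_left sc_mult_right kp km sc_sc mult.commute[of "\<kappa> _"])+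
qed (fact assms)+

section \<open>Exponential and logarithm of series without constant term\<close>

lemma wfrec_nat_exists:
  fixes G :: "(nat \<Rightarrow> 'b) \<Rightarrow> nat \<Rightarrow> 'b"
  assumes "\<And>f g n. (\<And>m. m < n \<Longrightarrow> f m = g m) \<Longrightarrow> G f n = G g n"
  shows "\<exists>f. \<forall>n. f n = G f n"
proof -
  have "adm_wf less_than G"
    unfolding adm_wf_def by (intro allI impI, rule assms) simp
  then have "wfrec less_than G = G (wfrec less_than G)"
    by (rule wfrec_fixpoint[OF wf_less_than])
  then show ?thesis by (intro exI allI) (rule fun_cong)
qed

context calg
begin

definition pos_series :: "int \<Rightarrow> (int \<Rightarrow> 'a) \<Rightarrow> bool" where
  "pos_series s f \<longleftrightarrow> (\<forall>n. f n \<in> carrier A) \<and> (\<forall>n\<le>0. f (s * n) = \<zero>)"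

abbreviation fpow :: "'a pr fls \<Rightarrow> nat \<Rightarrow> 'a pr fls" where
  "fpow f k \<equiv> ((*) f ^^ k) (fls_const (lift A \<one>))"

lemma fpow_ord: "ord_ge 1 f \<Longrightarrow> ord_ge (int k) (fpow f k)"
proof (induction k)
  case (Suc k)
  then show ?case using ord_ge_mult[of 1 f "int k" "fpow f k"] by (simp add: add.commute)
qed (simp add: ord_ge_const)

lemma ls_power:
  assumes s: "s * s = 1" and f: "pos_series s f"
  shows "ls_power A f k n \<in> carrier A \<and> (n < int k \<longrightarrow> ls_power A f k (s * n) = \<zero>)
    \<and> ser s (ls_power A f k) = fpow (ser s f) k"
proof (induction k arbitrary: n)
  case 0
  have [simp]: "s \<noteq> 0" using s by auto
  have "ser s (ls_one A) = fls_const (lift A \<one>)"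
    by (rule fls_eqI, subst ser_nth[of 0]) (auto simp: ls_one_def lift_zero)
  then show ?case by (auto simp: ls_power_def ls_one_def)
next
  case (Suc k)
  have f': "f n \<in> carrier A" "n < 1 \<Longrightarrow> f (s * n) = \<zero>" for n
    using f by (auto simp: pos_series_def)
  have g: "ls_power A f k n \<in> carrier A" "n < int k \<Longrightarrow> ls_power A f k (s * n) = \<zero>" for n
    using Suc by blast+
  have eq: "ls_power A f (Suc k) = ls_mult A f (ls_power A f k)"
    by (simp add: ls_power_def)
  show ?case
    unfolding eq
    using ls_mult_closed[of f "ls_power A f k", OF f'(1) g(1)] ls_mult_bound[where s = s and f = f and g = "ls_power A f k" and N = 1 and M = "int k" and n = n]
      ser_mult[where s = s and f = f and g = "ls_power A f k" and N = 1 and M = "int k"] s f' g Suc by simp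
qed

lemma ls_exp_nth:
  assumes s: "s * s = 1" and f: "pos_series s f"
  shows "ls_exp A f n \<in> carrier A"
    and "lift A (ls_exp A f (s * n)) = (\<Sum>k\<in>{..nat n}. sc (1 / fact k) (fpow (ser s f) k $$ n))"
proof -
  note pw = ls_power[OF s f]
  show "ls_exp A f n \<in> carrier A"
    using pw by (auto simp: ls_exp_def smult_closed intro!: finsum_closed)
  have sub: "{k. ls_power A f k (s * n) \<noteq> \<zero>} \<subseteq> {..nat n}"
  proof
    fix k assume "k \<in> {k. ls_power A f k (s * n) \<noteq> \<zero>}"
    then have "\<not> n < int k" using pw by blast
    then show "k \<in> {..nat n}" by simp
  qed
  have "lift A (ls_exp A f (s * n)) = (\<Sum>k\<in>{k. ls_power A f k (s * n) \<noteq> \<zero>}. sc (1 / fact k) (lift A (ls_power A f k (s * n))))"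
    unfolding ls_exp_def using pw by (simp add: lift_sum smult_closed lift_smult)
  also have "\<dots> = (\<Sum>k\<in>{..nat n}. sc (1 / fact k) (lift A (ls_power A f k (s * n))))"
    by (rule sum.mono_neutral_left[OF _ sub]) (auto simp: lift_zero)
  also have "\<dots> = (\<Sum>k\<in>{..nat n}. sc (1 / fact k) (fpow (ser s f) k $$ n))"
  proof (rule sum.cong[OF refl])
    fix k
    show "sc (1 / fact k) (lift A (ls_power A f k (s * n))) = sc (1 / fact k) (fpow (ser s f) k $$ n)"
      using pw[of k] ser_nth[of "int k" "ls_power A f k" s n] by simp
  qed
  finally show "lift A (ls_exp A f (s * n)) = (\<Sum>k\<in>{..nat n}. sc (1 / fact k) (fpow (ser s f) k $$ n))" .
qed

lemma ls_exp_nonpos: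
  assumes s: "s * s = 1" and f: "pos_series s f"
  shows "ls_exp A f 0 = \<one>" "n < 0 \<Longrightarrow> ls_exp A f (s * n) = \<zero>"
proof -
  note e = ls_exp_nth[OF s f]
  show "ls_exp A f 0 = \<one>"
    using e(2)[of 0] e(1)[of 0] by (simp add: sc_one lift_inj)
  show "ls_exp A f (s * n) = \<zero>" if "n < 0"
    using e(2)[of n] e(1)[of "s * n"] that by (simp add: lift_eq_0_iff)
qed

lemma pos_series_ser: "s * s = 1 \<Longrightarrow> pos_series s f \<Longrightarrow> ser s f $$ n = lift A (f (s * n))"
  "pos_series s f \<Longrightarrow> ord_ge 1 (ser s f)"
  by (rule ser_nth[of 1] ser_ord_ge, simp add: pos_series_def)+

text \<open>If f and g agree below degree n, then their k-th powers agree below degree n + k - 1. In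
  degree n of the exponential the difference is thus visible in the linear term alone.\<close>

lemma ls_exp_split:
  assumes s: "s * s = 1" and f: "pos_series s f" and g: "pos_series s g"
    and fg: "\<And>i. i < n \<Longrightarrow> f (s * i) = g (s * i)" and n: "n > 0" "g (s * n) = \<zero>"
  shows "ls_exp A f (s * n) = f (s * n) \<oplus> ls_exp A g (s * n)"
proof -
  let ?f = "ser s f" and ?g = "ser s g"
  note o = pos_series_ser(2)[OF f] pos_series_ser(2)[OF g]
  have d: "ord_ge n (?f - ?g)"
    using fg by (simp add: ord_ge_def pos_series_ser(1)[OF s f] pos_series_ser(1)[OF s g])
  have D: "ord_ge (n + int k) (fpow ?f (Suc k) - fpow ?g (Suc k))" for k
  proof (induction k)
    case 0
    then show ?case using ord_ge_mult[OF d ord_ge_const[of 0]] by (simp add: left_diff_distrib)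
  next
    case (Suc k)
    have "fpow ?f (Suc (Suc k)) - fpow ?g (Suc (Suc k)) =
        (?f - ?g) * fpow ?f (Suc k) + ?g * (fpow ?f (Suc k) - fpow ?g (Suc k))"
      by (simp add: algebra_simps)
    moreover have "ord_ge (n + int (Suc k)) ((?f - ?g) * fpow ?f (Suc k))"
      by (rule ord_ge_mult[OF d fpow_ord[OF o(1)]])
    moreover have "ord_ge (1 + (n + int k)) (?g * (fpow ?f (Suc k) - fpow ?g (Suc k)))"
      by (rule ord_ge_mult[OF o(2) Suc])
    ultimately show ?case
      using ord_ge_add[of "n + int (Suc k)"] by (simp add: add.commute add.left_commute)
  qed
  have K: "fpow ?f k $$ n = fpow ?g k $$ n + (if k = 1 then lift A (f (s * n)) else 0)" for k
  proof -
    consider "k = 0" | "k = 1" | j where "k = Suc (Suc j)" by (metis One_nat_def not0_implies_Suc)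
    then show ?thesis
    proof cases
      case 2
      have "lift A (f (s * n)) * lift A \<one> = lift A (f (s * n))"
        using lift_unit[of "f (s * n)"] f by (simp add: unit_on_def pos_series_def)
      then show ?thesis
        using 2 n(2) by (simp add: fls_times_const_nth pos_series_ser(1)[OF s f] pos_series_ser(1)[OF s g] lift_zero)
    next
      case 3
      have "(fpow ?f k - fpow ?g k) $$ n = 0"
        by (rule ord_geD[OF D[of "Suc j", folded 3]]) simp
      then show ?thesis using 3 by simp
    qed simp
  qed
  have fc: "f (s * n) \<in> carrier A" using f by (simp add: pos_series_def)
  have "lift A (ls_exp A f (s * n)) = (\<Sum>k\<in>{..nat n}. sc (1 / fact k) (fpow ?g k $$ n))
      + (\<Sum>k\<in>{..nat n}. if k = 1 then lift A (f (s * n)) else 0)"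
    unfolding ls_exp_nth(2)[OF s f] sum.distrib[symmetric]
    by (rule sum.cong) (auto simp: K sc_add_right sc_one)
  also have "\<dots> = lift A (f (s * n) \<oplus> ls_exp A g (s * n))"
    using n(1) fc ls_exp_nth(1)[OF s g, of "s * n"] Suc_leI[of 0 "nat n"]
    by (simp add: ls_exp_nth(2)[OF s g] lift_add add.commute)
  finally show ?thesis
    using ls_exp_nth(1)[OF s f, of "s * n"] ls_exp_nth(1)[OF s g, of "s * n"] fc by (simp add: lift_inj)
qed

text \<open>The carrier test makes the truncation a series over A for arbitrary f, as is required
  inside a recursion whose values are not yet known to lie in the carrier.\<close>

definition below :: "int \<Rightarrow> int \<Rightarrow> (int \<Rightarrow> 'a) \<Rightarrow> int \<Rightarrow> 'a" where
  "below s n f i = (if 0 < s * i \<and> s * i < n \<and> f i \<in> carrier A then f i else \<zero>)"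

lemma pos_series_below: "s * s = 1 \<Longrightarrow> pos_series s (below s n f)"
  by (auto simp: pos_series_def below_def simp flip: mult.assoc)

lemma ls_exp_below:
  assumes s: "s * s = 1" and f: "pos_series s f" and "n > 0"
  shows "ls_exp A f (s * n) = f (s * n) \<oplus> ls_exp A (below s n f) (s * n)"
  by (rule ls_exp_split[OF s f pos_series_below[OF s]])
    (use assms in \<open>auto simp: below_def pos_series_def simp flip: mult.assoc\<close>)

lemma ls_exp_first:
  assumes s: "s * s = 1" and f: "pos_series s f"
  shows "ls_exp A f s = f s"
proof -
  have b: "below s 1 f = (\<lambda>i. \<zero>)" by (auto simp: below_def fun_eq_iff)
  have z: "pos_series s (\<lambda>i. \<zero>)" by (simp add: pos_series_def)
  have "ser s (\<lambda>i. \<zero>) = 0"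
    by (rule fls_eqI) (simp add: pos_series_ser(1)[OF s z] lift_zero)
  then have "lift A (ls_exp A (\<lambda>i. \<zero>) (s * 1)) = 0"
    unfolding ls_exp_nth(2)[OF s z] by (simp add: atMost_Suc)
  then have "ls_exp A (\<lambda>i. \<zero>) s = \<zero>"
    using ls_exp_nth(1)[OF s z, of s] by (simp add: lift_eq_0_iff)
  then show ?thesis
    using ls_exp_below[OF s f, of 1] f by (simp add: b pos_series_def)
qed

lemma ls_exp_inj:
  assumes s: "s * s = 1" and f: "pos_series s f" and g: "pos_series s g" and eq: "ls_exp A f = ls_exp A g"
  shows "f = g"
proof -
  have ss: "s * (s * i) = i" for i using s by (simp flip: mult.assoc)
  have "f (s * int n) = g (s * int n)" for n
  proof (induction n rule: less_induct)
    case (less n)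
    show ?case
    proof (cases "n = 0")
      case False
      have "below s (int n) f i = below s (int n) g i" for i
      proof (cases "0 < s * i \<and> s * i < int n")
        case True
        then have "f (s * int (nat (s * i))) = g (s * int (nat (s * i)))"
          by (intro less) auto
        then show ?thesis using True by (simp add: below_def ss)
      qed (auto simp: below_def)
      then have b: "below s (int n) f = below s (int n) g" by blast
      have "f (s * int n) \<oplus> ls_exp A (below s (int n) g) (s * int n) = g (s * int n) \<oplus> ls_exp A (below s (int n) g) (s * int n)"
        using ls_exp_below[OF s f, of "int n"] ls_exp_below[OF s g, of "int n"] False by (simp add: eq b)
      then show ?thesis
        using f g ls_exp_nth(1)[OF s pos_series_below[OF s]] by (simp add: pos_series_def)
    qed (use f g in \<open>simp add: pos_series_def, metis mult_zero_right order_refl\<close>)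
  qed
  note * = this
  have "f (s * n) = g (s * n)" for n
    using f g *[of "nat n"] by (cases "n \<le> 0") (auto simp: pos_series_def)
  then show ?thesis by (metis ss ext)
qed

text \<open>The logarithm is built by recursion on the degree: its coefficient n is g_n minus the
  coefficient n of the exponential of the part already known.\<close>

lemma ls_exp_surj:
  assumes s: "s * s = 1" and g: "\<And>n. g n \<in> carrier A" "g 0 = \<one>" "\<And>n. n < 0 \<Longrightarrow> g (s * n) = \<zero>"
  shows "\<exists>f. pos_series s f \<and> ls_exp A f = g"
proof -
  have ss: "s * (s * i) = i" for i using s by (simp flip: mult.assoc)
  define G where "G f n = g (s * int n) \<ominus> ls_exp A (below s (int n) (\<lambda>i. f (nat (s * i)))) (s * int n)" for f n
  have "\<exists>f. \<forall>n. f n = G f n"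
  proof (rule wfrec_nat_exists)
    fix f h :: "nat \<Rightarrow> 'a" and n assume "\<And>m. m < n \<Longrightarrow> f m = h m"
    then have "below s (int n) (\<lambda>i. f (nat (s * i))) = below s (int n) (\<lambda>i. h (nat (s * i)))"
      by (auto simp: below_def fun_eq_iff)
    then show "G f n = G h n" by (simp add: G_def)
  qed
  then obtain f where f: "\<And>n. f n = G f n" by blast
  have fc: "f n \<in> carrier A" for n
    unfolding f[of n] G_def by (intro minus_closed g(1) ls_exp_nth(1)[OF s pos_series_below[OF s]])
  define F where "F i = (if s * i > 0 then f (nat (s * i)) else \<zero>)" for i
  have F: "pos_series s F" by (auto simp: pos_series_def F_def fc ss)
  have "ls_exp A F (s * n) = g (s * n)" for n
  proof (cases "n > 0")
    case True
    have b: "below s n F = below s n (\<lambda>i. f (nat (s * i)))"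
      by (auto simp: below_def F_def fun_eq_iff)
    have e: "ls_exp A (below s n F) (s * n) \<in> carrier A"
      by (rule ls_exp_nth(1)[OF s pos_series_below[OF s]])
    have "F (s * n) = g (s * n) \<ominus> ls_exp A (below s n F) (s * n)"
      using True f[of "nat n"] by (simp add: F_def G_def b ss)
    then have "F (s * n) \<oplus> ls_exp A (below s n F) (s * n) = g (s * n)"
      using e g(1)[of "s * n"] by (simp add: minus_eq a_assoc l_neg)
    then show ?thesis using ls_exp_below[OF s F True] by simp
  next
    case False
    then show ?thesis
      using ls_exp_nonpos[OF s F] g by (cases "n = 0") auto
  qed
  then have "ls_exp A F = g" by (metis ss ext)
  then show ?thesis using F by blast
qed

end

section \<open>The concrete quantum affine algebra and its series A\<close>

lemma calg_ideal_U_ideal: "calg_ideal free_alg (U_ideal q)"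
  unfolding U_ideal_def by (rule calg_ideal_free)

interpretation U: calg "U q" for q
  using calg_ideal.calg_quot[OF calg_ideal_U_ideal] by (simp add: U_def)

lemma Ux_closed: "Ux q e n \<in> carrier (U q)" and Uphi_closed: "Uphi q e n \<in> carrier (U q)"
  using calg_ideal.proj_closed[OF calg_ideal_U_ideal]
  by (simp_all add: Ux_def Uphi_def U_def calg_ideal.proj_def[OF calg_ideal_U_ideal] carrier_free_alg)

lemma qaff_U:
  assumes q0: "q \<noteq> 0" and qn: "\<And>j::nat. 0 < j \<Longrightarrow> q ^ j \<noteq> 1"
  shows "qaff q (\<lambda>n. lift (U q) (Ux q Pos n)) (\<lambda>n. lift (U q) (Ux q Neg n))
    (\<lambda>n. lift (U q) (Uphi q Pos n)) (\<lambda>n. lift (U q) (Uphi q Neg n)) (lift (U q) \<one>\<^bsub>U q\<^esub>)"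
proof -
  let ?x = "\<lambda>e n. free_gen (UX e n)" and ?f = "\<lambda>e n. free_gen (UPhi e n)" and ?F = "free_alg :: (Ugen list \<Rightarrow>\<^sub>0 complex) calg"
  interpret UI: calg_ideal "?F" "U_ideal q" by (rule calg_ideal_U_ideal)
  have gens: "lift (U q) (Ux q e n) = UI.LP (?x e n)" "lift (U q) (Uphi q e n) = UI.LP (?f e n)" for e n
    by (simp_all add: Ux_def Uphi_def U_def UI.LP_def UI.proj_def)
  have one: "lift (U q) \<one>\<^bsub>U q\<^esub> = UI.LP \<one>\<^bsub>?F\<^esub>"
    by (simp add: U_def UI.LP_one)
  have rel: "UI.LP r = 0" if "r \<in> U_relators q free_alg ?x ?f" for r
    by (rule UI.LP_zero) (use that in \<open>simp add: U_ideal_def free_ideal_self\<close>)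
  note simps = UI.LP_commutator UI.LP_simps carrier_free_alg
  let ?c = "\<lambda>e. q powi (2 * sg e)"
  have c: "?c Pos = q\<^sup>2" "?c Neg = 1 / q\<^sup>2"
    by (simp_all add: power_int_minus divide_inverse)
  have p0: "UI.LP (?f Pos m) = 0" if "m < 0" for m
    by (rule rel) (use that in \<open>unfold U_relators_def, blast\<close>)
  have m0: "UI.LP (?f Neg m) = 0" if "m > 0" for m
    by (rule rel) (use that in \<open>unfold U_relators_def, blast\<close>)
  have k: "UI.LP (?f Pos 0 \<otimes>\<^bsub>?F\<^esub> ?f Neg 0 \<ominus>\<^bsub>?F\<^esub> \<one>\<^bsub>?F\<^esub>) = 0"
    by (rule rel) (unfold U_relators_def, blast)
  have ff: "UI.LP (commutator ?F (?f e m) (?f d n)) = 0" for e d m n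
    by (rule rel) (unfold U_relators_def, blast)
  have pm: "UI.LP (commutator ?F (?x Pos m) (?x Neg n) \<ominus>\<^bsub>?F\<^esub>
        (1 / (q - 1 / q)) \<odot>\<^bsub>?F\<^esub> (?f Pos (m + n) \<ominus>\<^bsub>?F\<^esub> ?f Neg (m + n))) = 0" for m n
    by (rule rel) (unfold U_relators_def, blast)
  have fx: "UI.LP ((?f d (m + 1) \<otimes>\<^bsub>?F\<^esub> ?x e n \<ominus>\<^bsub>?F\<^esub> (?c e) \<odot>\<^bsub>?F\<^esub> (?f d m \<otimes>\<^bsub>?F\<^esub> ?x e (n + 1))) \<ominus>\<^bsub>?F\<^esub>
      ((?c e) \<odot>\<^bsub>?F\<^esub> (?x e n \<otimes>\<^bsub>?F\<^esub> ?f d (m + 1)) \<ominus>\<^bsub>?F\<^esub> ?x e (n + 1) \<otimes>\<^bsub>?F\<^esub> ?f d m)) = 0" for d e m n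
    by (rule rel) (unfold U_relators_def, blast)
  have xx: "UI.LP ((?x e (m + 1) \<otimes>\<^bsub>?F\<^esub> ?x e n \<ominus>\<^bsub>?F\<^esub> (?c e) \<odot>\<^bsub>?F\<^esub> (?x e m \<otimes>\<^bsub>?F\<^esub> ?x e (n + 1))) \<ominus>\<^bsub>?F\<^esub>
      ((?c e) \<odot>\<^bsub>?F\<^esub> (?x e n \<otimes>\<^bsub>?F\<^esub> ?x e (m + 1)) \<ominus>\<^bsub>?F\<^esub> ?x e (n + 1) \<otimes>\<^bsub>?F\<^esub> ?x e m)) = 0" for e m n
    by (rule rel) (unfold U_relators_def, blast)
  have ff': "UI.LP (?f e m) * UI.LP (?f d n) = UI.LP (?f d n) * UI.LP (?f e m)" for e d m n
    using ff[of e m d n] by (simp add: simps)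
  have fx': "UI.LP (?f d (m + 1)) * UI.LP (?x e n) - sc (?c e) (UI.LP (?f d m) * UI.LP (?x e (n + 1))) =
      sc (?c e) (UI.LP (?x e n) * UI.LP (?f d (m + 1))) - UI.LP (?x e (n + 1)) * UI.LP (?f d m)" for d e m n
    using fx[of d m e n] by (simp add: simps del: sg.simps)
  have xx': "UI.LP (?x e (m + 1)) * UI.LP (?x e n) - sc (?c e) (UI.LP (?x e m) * UI.LP (?x e (n + 1))) =
      sc (?c e) (UI.LP (?x e n) * UI.LP (?x e (m + 1))) - UI.LP (?x e (n + 1)) * UI.LP (?x e m)" for e m n
    using xx[of e m n] by (simp add: simps del: sg.simps)
  have k1: "UI.LP (?f Pos 0) * UI.LP (?f Neg 0) = UI.LP \<one>\<^bsub>?F\<^esub>"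
    using k by (simp add: simps)
  have pm': "UI.LP (?x Pos m) * UI.LP (?x Neg n) - UI.LP (?x Neg n) * UI.LP (?x Pos m) =
      sc (1 / (q - 1 / q)) (UI.LP (?f Pos (m + n)) - UI.LP (?f Neg (m + n)))" for m n
    using pm[of m n] by (simp add: simps)
  show ?thesis
    unfolding gens one
    by (rule qaff.intro) (fact q0 qn p0 m0 k1 ff' pm' fx'[of _ _ Pos, unfolded c] fx'[of _ _ Neg, unfolded c]
        xx'[of Pos, unfolded c] xx'[of Neg, unfolded c] UI.LP_unit[OF carrier_free_alg])+
qed

lemma sg_sq: "sg e * sg e = 1"
  by (cases e) simp_all

primrec opp :: "sign \<Rightarrow> sign" where
  "opp Pos = Neg"
| "opp Neg = Pos"

locale U_nonroot =
  fixes q :: complex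
  assumes q0: "q \<noteq> 0" and qn: "0 < (j::nat) \<Longrightarrow> q ^ j \<noteq> 1"
begin

abbreviation "lx e n \<equiv> lift (U q) (Ux q e n)"
abbreviation "lp e n \<equiv> lift (U q) (Uphi q e n)"
abbreviation "Uu \<equiv> lift (U q) \<one>\<^bsub>U q\<^esub>"

sublocale P: qaff q "\<lambda>n. lx Pos n" "\<lambda>n. lx Neg n" "\<lambda>n. lp Pos n" "\<lambda>n. lp Neg n" Uu
  by (rule qaff_U[OF q0 qn])

sublocale M: qaff q "\<lambda>n. lx Neg (- n)" "\<lambda>n. lx Pos (- n)" "\<lambda>n. lp Neg (- n)" "\<lambda>n. lp Pos (- n)" Uu
  by (rule qaff_swap[OF P.qaff_axioms])

lemma lp_zero: "sg e * n < 0 \<Longrightarrow> lp e n = 0"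
  by (cases e) (simp_all add: P.php0 P.phm0)

lemma Uphi_zero: "sg e * n < 0 \<Longrightarrow> Uphi q e n = \<zero>\<^bsub>U q\<^esub>"
  using lp_zero[of e n] by (simp add: U.lift_eq_0_iff Uphi_closed)

lemma lp_commute: "lp e m * lp d n = lp d n * lp e m"
  by (cases e; cases d) (simp_all add: P.php_php P.phm_phm P.php_phm)

lemma lp_opp: "lp (opp e) 0 * lp e 0 = Uu"
  by (cases e) (use P.kk' P.php_phm[of 0 0] in simp_all)

lemma lp_inverse: "unit_on Uu x \<Longrightarrow> lp (opp e) 0 * (lp e 0 * x) = x"
  using lp_opp[of e] by (simp add: unit_on_def flip: mult.assoc)

lemma Uphi_opp: "x \<in> carrier (U q) \<Longrightarrow> Uphi q (opp e) 0 \<otimes>\<^bsub>U q\<^esub> (Uphi q e 0 \<otimes>\<^bsub>U q\<^esub> x) = x"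
  "x \<in> carrier (U q) \<Longrightarrow> Uphi q e 0 \<otimes>\<^bsub>U q\<^esub> (Uphi q (opp e) 0 \<otimes>\<^bsub>U q\<^esub> x) = x"
proof -
  assume x: "x \<in> carrier (U q)"
  have "lift (U q) (Uphi q (opp e) 0 \<otimes>\<^bsub>U q\<^esub> (Uphi q e 0 \<otimes>\<^bsub>U q\<^esub> x)) = lift (U q) x" for e
    using x by (simp add: U.lift_mult Uphi_closed lp_inverse U.lift_unit)
  then have *: "Uphi q (opp e) 0 \<otimes>\<^bsub>U q\<^esub> (Uphi q e 0 \<otimes>\<^bsub>U q\<^esub> x) = x" for e
    using x by (simp add: U.lift_inj Uphi_closed)
  show "Uphi q (opp e) 0 \<otimes>\<^bsub>U q\<^esub> (Uphi q e 0 \<otimes>\<^bsub>U q\<^esub> x) = x" by (rule *)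
  show "Uphi q e 0 \<otimes>\<^bsub>U q\<^esub> (Uphi q (opp e) 0 \<otimes>\<^bsub>U q\<^esub> x) = x"
    using *[of "opp e"] by (cases e) simp_all
qed

definition log_arg :: "(int \<Rightarrow> Uel) \<Rightarrow> sign \<Rightarrow> int \<Rightarrow> Uel" where
  "log_arg h e = (\<lambda>s. if sg e * s > 0 then (of_int (sg e) * (q - 1 / q)) \<odot>\<^bsub>U q\<^esub> h s else \<zero>\<^bsub>U q\<^esub>)"

definition is_log :: "(int \<Rightarrow> Uel) \<Rightarrow> bool" where
  "is_log h \<longleftrightarrow> range h \<subseteq> carrier (U q) \<and> h 0 = \<zero>\<^bsub>U q\<^esub> \<and>
     (\<forall>e. Uphi q e = (\<lambda>n. Uphi q e 0 \<otimes>\<^bsub>U q\<^esub> ls_exp (U q) (log_arg h e) n))"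

text \<open>The series phi^e(z)/phi^e_0, since the zero modes of the two signs are inverse to each
  other.\<close>

definition ratio :: "sign \<Rightarrow> int \<Rightarrow> Uel" where
  "ratio e n = Uphi q (opp e) 0 \<otimes>\<^bsub>U q\<^esub> Uphi q e n"

lemma factor_nonzero: "of_int (sg e) * (q - 1 / q) \<noteq> 0"
  using P.q1(1) by (cases e) simp_all

lemma pos_series_log_arg: "range h \<subseteq> carrier (U q) \<Longrightarrow> U.pos_series q (sg e) (log_arg h e)"
  by (auto simp: U.pos_series_def log_arg_def sg_sq image_subset_iff simp flip: mult.assoc intro!: U.smult_closed)

lemma is_log_iff: "is_log h \<longleftrightarrow> range h \<subseteq> carrier (U q) \<and> h 0 = \<zero>\<^bsub>U q\<^esub> \<and>
     (\<forall>e. ls_exp (U q) (log_arg h e) = ratio e)"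
proof (cases "range h \<subseteq> carrier (U q)")
  case True
  have c: "ls_exp (U q) (log_arg h e) n \<in> carrier (U q)" for e n
    by (rule U.ls_exp_nth(1)[OF sg_sq pos_series_log_arg[OF True]])
  have "Uphi q e = (\<lambda>n. Uphi q e 0 \<otimes>\<^bsub>U q\<^esub> ls_exp (U q) (log_arg h e) n) \<longleftrightarrow>
      ls_exp (U q) (log_arg h e) = ratio e" (is "?l = ?r") for e
  proof
    assume ?l
    then have *: "Uphi q e n = Uphi q e 0 \<otimes>\<^bsub>U q\<^esub> ls_exp (U q) (log_arg h e) n" for n by (rule fun_cong)
    show ?r
    proof
      fix n
      show "ls_exp (U q) (log_arg h e) n = ratio e n"
        unfolding ratio_def by (subst *[of n]) (rule Uphi_opp(1)[OF c, symmetric])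
    qed
  next
    assume ?r
    then show ?l by (intro ext) (simp add: ratio_def Uphi_opp Uphi_closed)
  qed
  then show ?thesis by (simp add: is_log_def)
qed (simp add: is_log_def)

lemma is_log_exists: "\<exists>h. is_log h"
proof -
  have "\<exists>f. U.pos_series q (sg e) f \<and> ls_exp (U q) f = ratio e" for e
  proof (rule U.ls_exp_surj[OF sg_sq])
    show "ratio e n \<in> carrier (U q)" for n by (simp add: ratio_def Uphi_closed)
    have "lift (U q) (Uphi q (opp e) 0 \<otimes>\<^bsub>U q\<^esub> Uphi q e 0) = Uu"
      using lp_opp by (simp add: U.lift_mult Uphi_closed)
    then show "ratio e 0 = \<one>\<^bsub>U q\<^esub>"
      by (simp add: ratio_def U.lift_inj Uphi_closed)
    show "ratio e (sg e * n) = \<zero>\<^bsub>U q\<^esub>" if "n < 0" for n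
      using that Uphi_zero[of e "sg e * n"] by (simp add: ratio_def sg_sq Uphi_closed flip: mult.assoc)
  qed
  then obtain f where f: "\<And>e. U.pos_series q (sg e) (f e)" "\<And>e. ls_exp (U q) (f e) = ratio e" by metis
  have fc: "f e n \<in> carrier (U q)" for e n using f(1)[of e] by (simp add: U.pos_series_def)
  have f0: "f e n = \<zero>\<^bsub>U q\<^esub>" if "\<not> sg e * n > 0" for e n
    using f(1)[of e] that sg_sq[of e] unfolding U.pos_series_def
    by (metis linorder_not_less mult.assoc mult_1)
  define h where "h s = (if s = 0 then \<zero>\<^bsub>U q\<^esub> else
      let e = (if s > 0 then Pos else Neg) in (1 / (of_int (sg e) * (q - 1 / q))) \<odot>\<^bsub>U q\<^esub> f e s)" for s
  have h: "range h \<subseteq> carrier (U q)" "h 0 = \<zero>\<^bsub>U q\<^esub>"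
    by (auto simp: h_def U.smult_closed fc Let_def)
  have "log_arg h e s = f e s" for e s
  proof (cases "sg e * s > 0")
    case True
    then have "h s = (1 / (of_int (sg e) * (q - 1 / q))) \<odot>\<^bsub>U q\<^esub> f e s"
      by (cases e) (simp_all add: h_def)
    then have "log_arg h e s = ((of_int (sg e) * (q - 1 / q)) * (1 / (of_int (sg e) * (q - 1 / q)))) \<odot>\<^bsub>U q\<^esub> f e s"
      using True fc by (simp only: log_arg_def U.smult_smult if_True)
    then show ?thesis using factor_nonzero[of e] fc by (simp add: U.smult_one)
  qed (simp add: log_arg_def f0)
  then have "log_arg h e = f e" for e by blast
  then have "is_log h" unfolding is_log_iff using h f(2) by simp
  then show "\<exists>h. is_log h" by blast
qed

lemma is_log_unique:
  assumes h: "is_log h" and g: "is_log g"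
  shows "h = g"
proof
  have c: "h n \<in> carrier (U q)" "g n \<in> carrier (U q)" for n
    using h g by (auto simp: is_log_def)
  have eq: "log_arg h e = log_arg g e" for e
  proof (rule U.ls_exp_inj[OF sg_sq[of e]])
    show "U.pos_series q (sg e) (log_arg h e)" "U.pos_series q (sg e) (log_arg g e)"
      using c by (simp_all add: pos_series_log_arg image_subset_iff)
    show "ls_exp (U q) (log_arg h e) = ls_exp (U q) (log_arg g e)"
      using h g unfolding is_log_iff by simp
  qed
  have *: "h s = g s" if "sg e * s > 0" for e s
  proof -
    have "(of_int (sg e) * (q - 1 / q)) \<odot>\<^bsub>U q\<^esub> h s = (of_int (sg e) * (q - 1 / q)) \<odot>\<^bsub>U q\<^esub> g s"
      using fun_cong[OF eq[of e], of s] that by (simp add: log_arg_def)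
    then have "sc (of_int (sg e) * (q - 1 / q)) (lift (U q) (h s)) = sc (of_int (sg e) * (q - 1 / q)) (lift (U q) (g s))"
      using c by (simp only: U.lift_smult[symmetric])
    then have "lift (U q) (h s) = lift (U q) (g s)"
      using sc_cancel[OF factor_nonzero[of e]] by blast
    then show ?thesis using c by (simp only: U.lift_inj)
  qed
  fix s
  show "h s = g s"
    using *[of Pos s] *[of Neg s] h g by (cases "s = 0"; cases "s > 0") (auto simp: is_log_def)
qed

lemma Uh_is_log: "is_log (Uh q)"
proof -
  have "Uh q = (THE h. is_log h)"
    unfolding Uh_def is_log_def log_arg_def ..
  then show ?thesis using theI'[of is_log] is_log_exists is_log_unique by metis
qed

lemma Uh_closed: "Uh q n \<in> carrier (U q)"
  using Uh_is_log by (auto simp: is_log_def)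

lemma Uh_first: "lp e (sg e) = sc (of_int (sg e) * (q - 1 / q)) (lp e 0 * lift (U q) (Uh q (sg e)))"
proof -
  have r: "range (Uh q) \<subseteq> carrier (U q)" using Uh_closed by auto
  have "Uphi q e = (\<lambda>n. Uphi q e 0 \<otimes>\<^bsub>U q\<^esub> ls_exp (U q) (log_arg (Uh q) e) n)"
    using Uh_is_log by (simp add: is_log_def)
  then have "Uphi q e (sg e) = Uphi q e 0 \<otimes>\<^bsub>U q\<^esub> ls_exp (U q) (log_arg (Uh q) e) (sg e)"
    by (rule fun_cong)
  also have "ls_exp (U q) (log_arg (Uh q) e) (sg e) = (of_int (sg e) * (q - 1 / q)) \<odot>\<^bsub>U q\<^esub> Uh q (sg e)"
    unfolding U.ls_exp_first[OF sg_sq pos_series_log_arg[OF r]] by (simp add: log_arg_def sg_sq)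
  finally show ?thesis
    by (simp only: U.lift_mult U.lift_smult U.smult_closed Uphi_closed Uh_closed sc_mult_right)
qed

text \<open>The exponent in phi^-(z) carries the sign -1, which reappears in the mirrored
  algebra.\<close>

lemma h_Uh: "P.h = lift (U q) (Uh q 1)" "M.h = - lift (U q) (Uh q (- 1))"
proof -
  have *: "sc (1 / (q - 1/q)) (lp (opp e) 0 * lp e (sg e)) = sc (of_int (sg e)) (lift (U q) (Uh q (sg e)))" for e
    using P.q1(1) unfolding Uh_first[of e] by (simp add: sc_mult_right sc_sc lp_inverse U.lift_unit Uh_closed)
  show "P.h = lift (U q) (Uh q 1)" "M.h = - lift (U q) (Uh q (- 1))"
    using *[of Pos] *[of Neg] by (simp_all add: P.h_def M.h_def sc_one sc_minus_left)
qed

end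

context U_nonroot
begin

lemma Uphi_commute: "x \<in> {Uphi q e m | e m. True} \<Longrightarrow> y \<in> {Uphi q e m | e m. True} \<Longrightarrow> x \<otimes>\<^bsub>U q\<^esub> y = y \<otimes>\<^bsub>U q\<^esub> x"
proof -
  have "Uphi q e m \<otimes>\<^bsub>U q\<^esub> Uphi q d n = Uphi q d n \<otimes>\<^bsub>U q\<^esub> Uphi q e m" for e d m n
    using lp_commute[of e m d n] by (simp add: Uphi_closed flip: U.lift_mult) (simp add: Uphi_closed U.lift_inj)
  then show "x \<in> {Uphi q e m | e m. True} \<Longrightarrow> y \<in> {Uphi q e m | e m. True} \<Longrightarrow> x \<otimes>\<^bsub>U q\<^esub> y = y \<otimes>\<^bsub>U q\<^esub> x"
    by blast
qed

lemma U_cartan: "is_subalgebra (U q) (U_cartan q)" "Uphi q e m \<in> U_cartan q" "U_cartan q \<subseteq> carrier (U q)"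
  "\<forall>x\<in>U_cartan q. \<forall>y\<in>U_cartan q. x \<otimes>\<^bsub>U q\<^esub> y = y \<otimes>\<^bsub>U q\<^esub> x"
proof -
  have r: "{Uphi q e m | e m. True} \<subseteq> carrier (U q)" using Uphi_closed by auto
  show sub: "is_subalgebra (U q) (U_cartan q)" unfolding U_cartan_def by (rule U.is_subalgebra_gen[OF r])
  then show "U_cartan q \<subseteq> carrier (U q)" by (simp add: is_subalgebra_def)
  show "Uphi q e m \<in> U_cartan q"
    using U.gen_subalgebra_superset[of "{Uphi q e m | e m. True}" q] unfolding U_cartan_def by blast
  show "\<forall>x\<in>U_cartan q. \<forall>y\<in>U_cartan q. x \<otimes>\<^bsub>U q\<^esub> y = y \<otimes>\<^bsub>U q\<^esub> x"
    unfolding U_cartan_def using U.gen_subalgebra_commute[OF r Uphi_commute] by blast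
qed

lemma lift_cartan_commute: "x \<in> U_cartan q \<Longrightarrow> y \<in> U_cartan q \<Longrightarrow>
    lift (U q) x * lift (U q) y = lift (U q) y * lift (U q) x"
  using U.subalgebra_lift(6)[OF U_cartan(1,4)] by blast

abbreviation "ser e \<equiv> U.ser q (sg e)"
abbreviation "Ph e \<equiv> ser e (Uphi q e)"
abbreviation "scale_sg e \<equiv> scale_mat ((q\<^sup>2) powi sg e)"
abbreviation "ta e \<equiv> fls_tri (scale_sg e) :: Uel pr fls \<Rightarrow> Uel pr fls"

lemma triangular_mult_scale: "triangular_mult (scale_sg e)"
  by (rule triangular_mult_scale_mat) (simp add: q0)

lemma triangular_scale: "triangular (scale_sg e)"
  using triangular_mult_scale by (rule triangular_mult.axioms)

lemma scale_sg_diag: "scale_sg e 0 0 = 1" "1 + scale_sg e n n \<noteq> 0"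
  using P.pn[of "sg e * n"] by (simp_all add: scale_mat_def power_int_mult)

lemma Ph_nth: "Ph e $$ n = lp e (sg e * n)"
  by (rule U.ser_nth[of 0]) (simp add: Uphi_zero sg_sq flip: mult.assoc)

lemma Ph_ord: "ord_ge 0 (Ph e)"
  by (rule U.ser_ord_ge) (simp add: Uphi_zero sg_sq flip: mult.assoc)

lemma Ph_eq: "Ph Pos = P.\<Phi>" "Ph Neg = M.\<Phi>"
  using Ph_nth[of Pos] Ph_nth[of Neg] by (auto intro!: fls_eqI simp: P.\<Phi>_nth M.\<Phi>_nth)

text \<open>
  For \<open>e = Neg\<close> the series are in \<open>z\<^sup>-\<^sup>1\<close>, and \<open>a(z) z\<^sup>-\<^sup>2\<^sup>n\<close> is the reflected polynomial of \<open>a\<close> in \<open>z\<^sup>-\<^sup>1\<close>.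
\<close>

definition is_A :: "sign \<Rightarrow> complex poly \<Rightarrow> (int \<Rightarrow> Uel) \<Rightarrow> bool" where
  "is_A e r A \<longleftrightarrow> range A \<subseteq> U_cartan q \<and> A 0 = \<one>\<^bsub>U q\<^esub> \<and> (\<forall>k. sg e * k < 0 \<longrightarrow> A k = \<zero>\<^bsub>U q\<^esub>) \<and>
     ls_mult (U q) (Uphi q e) (ls_mult (U q) A (ls_scale (U q) (q\<^sup>2) A)) =
       (\<lambda>k. (pcoeff r (sg e * k) / coeff r 0) \<odot>\<^bsub>U q\<^esub> Uphi q e 0)"

definition rhs :: "sign \<Rightarrow> complex poly \<Rightarrow> Uel pr fls" where
  "rhs e r = ser e (\<lambda>k. (pcoeff r (sg e * k) / coeff r 0) \<odot>\<^bsub>U q\<^esub> Uphi q e 0)"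

lemma sg_cancel: "sg e * (sg e * n) = n"
  by (simp add: sg_sq flip: mult.assoc)

lemma rhs_nth: "rhs e r $$ n = sc (pcoeff r n / coeff r 0) (lp e 0)"
proof -
  have "rhs e r $$ n = lift (U q) ((pcoeff r (sg e * (sg e * n)) / coeff r 0) \<odot>\<^bsub>U q\<^esub> Uphi q e 0)"
    unfolding rhs_def by (rule U.ser_nth[of 0]) (simp add: sg_cancel pcoeff_def U.smult_zero_left Uphi_closed)
  then show ?thesis by (simp add: sg_cancel U.lift_smult Uphi_closed)
qed

lemma is_A_ser:
  assumes "range A \<subseteq> U_cartan q" "\<forall>k. sg e * k < 0 \<longrightarrow> A k = \<zero>\<^bsub>U q\<^esub>"
  shows "ser e A $$ n = lift (U q) (A (sg e * n))" "ord_ge 0 (ser e A)"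
    and "ls_mult (U q) (Uphi q e) (ls_mult (U q) A (ls_scale (U q) (q\<^sup>2) A)) =
       (\<lambda>k. (pcoeff r (sg e * k) / coeff r 0) \<odot>\<^bsub>U q\<^esub> Uphi q e 0) \<longleftrightarrow> Ph e * (ser e A * ta e (ser e A)) = rhs e r"
proof -
  let ?s = "sg e" and ?B = "ls_scale (U q) (q\<^sup>2) A"
  let ?m = "ls_mult (U q) A ?B"
  have A: "A n \<in> carrier (U q)" for n using assms(1) U_cartan(3) by auto
  have b: "A (?s * n) = \<zero>\<^bsub>U q\<^esub>" if "n < 0" for n using assms(2) that by (simp add: sg_cancel)
  show "ser e A $$ n = lift (U q) (A (?s * n))"
    by (rule U.ser_nth[of 0]) (rule b)
  show "ord_ge 0 (ser e A)"
    by (rule U.ser_ord_ge) (rule b)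
  have B: "?B n \<in> carrier (U q)" for n by (rule U.ls_scale_closed) (rule A)
  have bB: "?B (?s * n) = \<zero>\<^bsub>U q\<^esub>" if "n < 0" for n by (rule U.ls_scale_bound) (rule b[OF that])
  have p0: "q\<^sup>2 \<noteq> 0" using q0 by simp
  have m1: "ser e ?m = ser e A * ta e (ser e A)"
    using U.ser_mult[where s = ?s and f = A and g = ?B and N = 0 and M = 0]
      U.ser_scale[where c = "q\<^sup>2" and f = A and N = 0 and s = ?s] by (simp add: sg_sq A B b bB q0)
  have mc: "?m n \<in> carrier (U q)" for n
    by (rule U.ls_mult_closed) (rule A B)+
  have mb: "?m (?s * n) = \<zero>\<^bsub>U q\<^esub>" if "n < 0" for n
    using U.ls_mult_bound[where s = ?s and f = A and g = ?B and N = 0 and M = 0 and n = n] that by (simp add: sg_sq A B b bB)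
  have fb: "Uphi q e (?s * n) = \<zero>\<^bsub>U q\<^esub>" if "n < 0" for n
    using that by (simp add: Uphi_zero sg_cancel)
  have m2: "ser e (ls_mult (U q) (Uphi q e) ?m) = Ph e * (ser e A * ta e (ser e A))"
    using U.ser_mult[where s = ?s and f = "Uphi q e" and g = ?m and N = 0 and M = 0]
    by (simp add: sg_sq m1 mc mb fb Uphi_closed)
  have c2: "ls_mult (U q) (Uphi q e) ?m n \<in> carrier (U q)" for n
    by (rule U.ls_mult_closed) (rule Uphi_closed mc)+
  have b2: "ls_mult (U q) (Uphi q e) ?m (?s * n) = \<zero>\<^bsub>U q\<^esub>" if "n < 0" for n
    using U.ls_mult_bound[where s = ?s and f = "Uphi q e" and g = ?m and N = 0 and M = 0 and n = n] that
    by (simp add: sg_sq mc mb fb Uphi_closed)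
  let ?r = "\<lambda>k. (pcoeff r (?s * k) / coeff r 0) \<odot>\<^bsub>U q\<^esub> Uphi q e 0"
  show "ls_mult (U q) (Uphi q e) ?m = ?r \<longleftrightarrow> Ph e * (ser e A * ta e (ser e A)) = rhs e r"
  proof
    assume "Ph e * (ser e A * ta e (ser e A)) = rhs e r"
    then have eq: "ser e (ls_mult (U q) (Uphi q e) ?m) = ser e ?r"
      by (simp add: m2 rhs_def)
    show "ls_mult (U q) (Uphi q e) ?m = ?r"
      by (rule U.ser_inj[OF sg_sq c2 _ _ _ eq, of 0])
        (simp_all add: b2 U.smult_closed Uphi_closed sg_cancel pcoeff_def U.smult_zero_left)
  qed (simp add: m2[symmetric] rhs_def)
qed

lemma is_AD:
  assumes "is_A e r A"
  shows "ser e A $$ n = lift (U q) (A (sg e * n))" "ord_ge 0 (ser e A)" "Ph e * (ser e A * ta e (ser e A)) = rhs e r"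
    and "ser e A $$ 0 = Uu" "unit_on Uu (ser e A $$ n)" "ser e A $$ n \<in> lift (U q) ` U_cartan q"
proof -
  have A: "range A \<subseteq> U_cartan q" "\<forall>k. sg e * k < 0 \<longrightarrow> A k = \<zero>\<^bsub>U q\<^esub>" using assms by (simp_all add: is_A_def)
  show s: "ser e A $$ n = lift (U q) (A (sg e * n))" for n by (rule is_A_ser(1)[OF A])
  show "ord_ge 0 (ser e A)" by (rule is_A_ser(2)[OF A])
  show "Ph e * (ser e A * ta e (ser e A)) = rhs e r"
    using assms is_A_ser(3)[OF A] by (simp add: is_A_def)
  show "ser e A $$ 0 = Uu" using assms by (simp add: s is_A_def)
  show "ser e A $$ n \<in> lift (U q) ` U_cartan q" using A(1) by (auto simp: s)
  have "A (sg e * n) \<in> carrier (U q)" using A(1) U_cartan(3) by auto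
  then show "unit_on Uu (ser e A $$ n)" by (simp add: s U.lift_unit)
qed

lemma cartan_lp: "x \<in> lift (U q) ` U_cartan q \<Longrightarrow> x * lp e m = lp e m * x"
  using U_cartan(2) by (auto intro: lift_cartan_commute)

lemma is_A_unique:
  assumes "is_A e r A" "is_A e r B"
  shows "A = B"
proof -
  note A = is_AD[OF assms(1)] and B = is_AD[OF assms(2)]
  have comm: "ser e A * Ph e = Ph e * ser e A" "ser e B * Ph e = Ph e * ser e B"
    by (rule fls_commuteI, simp add: Ph_nth cartan_lp A(6) B(6))+
  have "ser e A * Ph e * ta e (ser e A) = ser e B * Ph e * ta e (ser e B)"
    using A(3) B(3) by (simp add: comm mult.assoc)
  moreover have "unit_on Uu (lp e 0)" by (rule U.lift_unit[OF Uphi_closed])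
  ultimately have "ser e A = ser e B"
    by (intro triangular.mult_tri_unique[OF triangular_scale[of e] A(2,4) B(2,4) Ph_ord, where g' = "lp (opp e) 0"])
      (use A(5) B(5) scale_sg_diag in \<open>auto simp: Ph_nth cartan_lp A(6) B(6) lp_inverse unit_on_def\<close>)
  moreover have "A n \<in> carrier (U q)" "B n \<in> carrier (U q)" for n
    using assms U_cartan(3) unfolding is_A_def by (meson range_subsetD subsetD)+
  moreover have "n < 0 \<Longrightarrow> A (sg e * n) = \<zero>\<^bsub>U q\<^esub>" "n < 0 \<Longrightarrow> B (sg e * n) = \<zero>\<^bsub>U q\<^esub>" for n
    using assms by (auto simp: is_A_def sg_cancel)
  ultimately show ?thesis
    by (intro U.ser_inj[OF sg_sq[of e], of A _ B 0]) auto
qed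

lemma is_A_exists:
  assumes "coeff r 0 \<noteq> 0"
  shows "\<exists>A. is_A e r A"
proof -
  let ?C = "lift (U q) ` U_cartan q"
  note C = U.subalgebra_lift[OF U_cartan(1,4)]
  have lpC: "lp d n \<in> ?C" for d n using U_cartan(2) by blast
  have "\<exists>\<alpha>. ord_ge 0 \<alpha> \<and> \<alpha> $$ 0 = Uu \<and> (\<forall>n. \<alpha> $$ n \<in> ?C) \<and> \<alpha> * Ph e * ta e \<alpha> = rhs e r"
  proof (rule triangular.mult_tri_exists[OF triangular_scale C(1-7) Ph_ord])
    show "Ph e $$ n \<in> ?C" for n by (simp add: Ph_nth lpC)
    show "lp (opp e) 0 \<in> ?C" by (rule lpC)
    show "lp (opp e) 0 * Ph e $$ 0 = Uu" by (simp add: Ph_nth lp_opp)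
    show "ord_ge (0 + 0) (rhs e r)" by (simp add: ord_ge_def rhs_nth pcoeff_def)
    show "rhs e r $$ n \<in> ?C" for n unfolding rhs_nth by (rule C(5)[OF lpC])
    show "rhs e r $$ (0 + 0) = Ph e $$ 0"
      using assms by (simp add: rhs_nth Ph_nth pcoeff_def sc_one)
  qed (assumption | rule scale_sg_diag)+
  then obtain \<alpha> where \<alpha>: "ord_ge 0 \<alpha>" "\<alpha> $$ 0 = Uu" "\<And>n. \<alpha> $$ n \<in> ?C" "\<alpha> * Ph e * ta e \<alpha> = rhs e r"
    by blast
  define A where "A n = lower (U q) (\<alpha> $$ (sg e * n))" for n
  have low: "lower (U q) (\<alpha> $$ n) \<in> U_cartan q" "lift (U q) (lower (U q) (\<alpha> $$ n)) = \<alpha> $$ n" for n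
  proof -
    obtain x where "x \<in> U_cartan q" "\<alpha> $$ n = lift (U q) x" using \<alpha>(3)[of n] by blast
    then show "lower (U q) (\<alpha> $$ n) \<in> U_cartan q" "lift (U q) (lower (U q) (\<alpha> $$ n)) = \<alpha> $$ n"
      using U_cartan(3) by (auto simp: U.lower_lift)
  qed
  have A: "range A \<subseteq> U_cartan q" "\<forall>k. sg e * k < 0 \<longrightarrow> A k = \<zero>\<^bsub>U q\<^esub>"
    using low(1) \<alpha>(1) by (auto simp: A_def ord_ge_def U.lower_ops)
  note ser = is_A_ser[OF A]
  have "ser e A = \<alpha>"
    by (rule fls_eqI) (simp add: ser(1) A_def low sg_cancel)
  moreover have "\<alpha> * Ph e = Ph e * \<alpha>"
    by (rule fls_commuteI) (simp add: Ph_nth cartan_lp \<alpha>(3))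
  ultimately have "Ph e * (ser e A * ta e (ser e A)) = rhs e r"
    using \<alpha>(4) by (simp add: mult.assoc)
  moreover have "A 0 = \<one>\<^bsub>U q\<^esub>"
    by (simp add: A_def \<alpha>(2) U.lower_lift)
  ultimately have "is_A e r A"
    using A ser(3)[of r] unfolding is_A_def by blast
  then show ?thesis by blast
qed

lemma is_A_the: "coeff r 0 \<noteq> 0 \<Longrightarrow> is_A e r (THE A. is_A e r A)"
  using theI'[of "is_A e r"] is_A_exists is_A_unique by metis

lemma pcoeff_reflect: "pcoeff (reflect_poly a) n = pcoeff a (int (degree a) - n)"
  by (auto simp: pcoeff_def coeff_reflect_poly coeff_eq_0 nat_diff_distrib)

lemma U_A_pos: "coeff a 0 \<noteq> 0 \<Longrightarrow> is_A Pos a (U_A_pos q a)"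
proof -
  have "U_A_pos q a = (THE A. is_A Pos a A)"
    by (simp add: U_A_pos_def is_A_def)
  then show "coeff a 0 \<noteq> 0 \<Longrightarrow> is_A Pos a (U_A_pos q a)" using is_A_the[of a Pos] by simp
qed

lemma U_A_neg: "a \<noteq> 0 \<Longrightarrow> is_A Neg (reflect_poly a) (U_A_neg q a)"
proof -
  have "U_A_neg q a = (THE A. is_A Neg (reflect_poly a) A)"
    by (simp add: U_A_neg_def is_A_def pcoeff_reflect add.commute)
  then show "a \<noteq> 0 \<Longrightarrow> is_A Neg (reflect_poly a) (U_A_neg q a)" using is_A_the[of "reflect_poly a" Neg] by simp
qed

definition A_pos :: "complex poly \<Rightarrow> Uel pr fls" where
  "A_pos a = ser Pos (U_A_pos q a)"

text \<open>In the variable w = 1/z the factor A(z q^2) is the value at q^(-2) w. Rescaling w by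
  q^(-2) exchanges the two factors, so that the equation has the factor q^2 expected by
  \<open>qaff_A\<close>.\<close>

definition A_neg :: "complex poly \<Rightarrow> Uel pr fls" where
  "A_neg a = fls_tri (scale_mat (1 / q\<^sup>2)) (ser Neg (U_A_neg q a))"

lemma A_pos_nth: "coeff a 0 \<noteq> 0 \<Longrightarrow> A_pos a $$ n = lift (U q) (U_A_pos q a n)"
  using is_AD(1)[OF U_A_pos] by (simp add: A_pos_def)

lemma A_neg_nth: "a \<noteq> 0 \<Longrightarrow> A_neg a $$ n = sc ((q\<^sup>2) powi (- n)) (lift (U q) (U_A_neg q a (- n)))"
proof -
  assume a: "a \<noteq> 0"
  have p0: "1 / q\<^sup>2 \<noteq> 0" using q0 by simp
  have "(1 / q\<^sup>2) powi n = (q\<^sup>2) powi (- n)"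
    by (simp add: power_int_minus power_int_divide_distrib inverse_eq_divide)
  moreover have "ser Neg (U_A_neg q a) $$ n = lift (U q) (U_A_neg q a (- n))"
    using is_AD(1)[OF U_A_neg[OF a], of n] by simp
  ultimately show ?thesis
    unfolding A_neg_def by (simp only: scale_nth[OF p0])
qed

lemma U_A_closed: "coeff a 0 \<noteq> 0 \<Longrightarrow> U_A_pos q a n \<in> carrier (U q)" "a \<noteq> 0 \<Longrightarrow> U_A_neg q a n \<in> carrier (U q)"
proof -
  have "A n \<in> carrier (U q)" if "is_A e r A" for e r A
    using that U_cartan(3) by (simp add: is_A_def range_subsetD subset_iff image_subset_iff)
  from this[OF U_A_pos] this[OF U_A_neg]
  show "coeff a 0 \<noteq> 0 \<Longrightarrow> U_A_pos q a n \<in> carrier (U q)" "a \<noteq> 0 \<Longrightarrow> U_A_neg q a n \<in> carrier (U q)"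
    by simp_all
qed

lemma qaff_A_pos:
  assumes "coeff a 0 \<noteq> 0"
  shows "qaff_A q (\<lambda>n. lx Pos n) (\<lambda>n. lx Neg n) (\<lambda>n. lp Pos n) (\<lambda>n. lp Neg n) Uu (A_pos a) (rhs Pos a)"
proof -
  note A = is_AD[OF U_A_pos[OF assms], folded A_pos_def]
  show ?thesis
  proof (rule P.qaff_A_I[OF A(2,4,5)])
    show "A_pos a $$ i * A_pos a $$ j = A_pos a $$ j * A_pos a $$ i" for i j
      using A(6)[of i] A(6)[of j] by (auto intro: lift_cartan_commute)
    show "P.\<Phi> * (A_pos a * P.taq (A_pos a)) = rhs Pos a"
      using A(3)[unfolded Ph_eq] by simp
  qed (simp_all add: cartan_lp A(6) rhs_nth)
qed

lemma qaff_A_neg: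
  assumes "a \<noteq> 0"
  shows "qaff_A q (\<lambda>n. lx Neg (- n)) (\<lambda>n. lx Pos (- n)) (\<lambda>n. lp Neg (- n)) (\<lambda>n. lp Pos (- n)) Uu
    (A_neg a) (rhs Neg (reflect_poly a))"
proof -
  let ?B = "ser Neg (U_A_neg q a)"
  note B = is_AD[OF U_A_neg[OF assms]]
  have p0: "q\<^sup>2 \<noteq> 0" "1 / q\<^sup>2 \<noteq> 0" using q0 by simp_all
  have n: "A_neg a $$ n = sc ((1 / q\<^sup>2) powi n) (?B $$ n)" for n
    by (simp only: A_neg_def scale_nth[OF p0(2)])
  have pp: "(q\<^sup>2) powi n * (1 / q\<^sup>2) powi n = 1" for n
    using p0 by (simp flip: power_int_mult_distrib)
  have t: "P.taq (A_neg a) = ?B"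
    by (rule fls_eqI) (simp only: scale_nth[OF p0(1)] n sc_sc pp sc_one)
  have taN: "ta Neg ?B = A_neg a"
    by (simp add: A_neg_def power_int_minus divide_inverse)
  have BB: "?B $$ i * ?B $$ j = ?B $$ j * ?B $$ i" for i j
    using B(6)[of i] B(6)[of j] by (auto intro: lift_cartan_commute)
  have AB: "A_neg a * ?B = ?B * A_neg a"
    by (rule fls_commuteI) (simp only: n sc_mult_left sc_mult_right BB)
  show ?thesis
  proof (rule M.qaff_A_I)
    show "ord_ge 0 (A_neg a)" "A_neg a $$ 0 = Uu" "unit_on Uu (A_neg a $$ i)" for i
      using B(2,4) B(5)[of i] by (simp_all add: n ord_ge_def sc_one unit_on_sc)
    show "A_neg a $$ i * A_neg a $$ j = A_neg a $$ j * A_neg a $$ i" for i j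
      by (simp only: n sc_mult_left sc_mult_right BB sc_sc mult.commute)
    have "A_neg a $$ i * lp d m = lp d m * A_neg a $$ i" for i d m
      by (simp only: n sc_mult_left sc_mult_right cartan_lp[OF B(6)])
    then show "A_neg a $$ i * lp Neg (- m) = lp Neg (- m) * A_neg a $$ i"
      "A_neg a $$ i * lp Pos (- m) = lp Pos (- m) * A_neg a $$ i" for i m
      by blast+
    show "M.\<Phi> * (A_neg a * M.taq (A_neg a)) = rhs Neg (reflect_poly a)"
      using B(3)[unfolded Ph_eq] by (simp only: t taN AB)
  qed (simp add: rhs_nth)
qed

text \<open>The polynomials are normalised to constant term 1 and the image of phi_0 is the product
  of its two images, so the right-hand sides multiply.\<close>

lemma rhs_mult:
  assumes "calg_morph J" "calg_morph J'" "calg_morph J''" and k: "J'' (lp e 0) = J (lp e 0) * J' (lp e 0)"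
  shows "fls_map J'' (rhs e (r * s)) = fls_map J (rhs e r) * fls_map J' (rhs e s)"
proof (rule fls_eqI)
  fix n
  interpret J: calg_morph J by fact
  interpret J': calg_morph J' by fact
  interpret J'': calg_morph J'' by fact
  let ?f = "\<lambda>i. pcoeff r i / coeff r 0" and ?g = "\<lambda>i. pcoeff s i / coeff s 0"
  have "(fls_map J (rhs e r) * fls_map J' (rhs e s)) $$ n = sc (\<Sum>i\<in>{0..n - 0}. ?f i * ?g (n - i)) (J (lp e 0) * J' (lp e 0))"
    by (rule sc_convolution) (auto simp: rhs_nth J.sc J'.sc pcoeff_def)
  also have "(\<Sum>i\<in>{0..n - 0}. ?f i * ?g (n - i)) = (\<Sum>i\<in>{0..max n (int (degree r))}. ?f i * ?g (n - i))"
    by (rule sum.mono_neutral_left) (auto simp: pcoeff_def)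
  also have "\<dots> = (\<Sum>i\<in>{0..max n (int (degree r))}. pcoeff r i * pcoeff s (n - i)) / (coeff r 0 * coeff s 0)"
    by (simp add: sum_divide_distrib)
  also have "(\<Sum>i\<in>{0..max n (int (degree r))}. pcoeff r i * pcoeff s (n - i)) = pcoeff (r * s) n"
    by (rule pcoeff_mult[symmetric]) auto
  finally show "fls_map J'' (rhs e (r * s)) $$ n = (fls_map J (rhs e r) * fls_map J' (rhs e s)) $$ n"
    by (simp add: rhs_nth J''.sc k coeff_mult_0)
qed

section \<open>Descent to the truncated quantum affine algebras\<close>

definition trunc_gens :: "complex poly \<Rightarrow> Uel set" where
  "trunc_gens a = (let n = int (degree a div 2); A\<^sub>p = U_A_pos q a; A\<^sub>n = U_A_neg q a in
         ({A\<^sub>p k | k. k > n} \<union>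
          {A\<^sub>n k \<ominus>\<^bsub>U q\<^esub> A\<^sub>n (- n) \<otimes>\<^bsub>U q\<^esub> A\<^sub>p (k + n) | k. True} \<union>
          {lead_coeff a \<odot>\<^bsub>U q\<^esub> (Uphi q Pos 0 \<otimes>\<^bsub>U q\<^esub> Uphi q Pos 0) \<ominus>\<^bsub>U q\<^esub>
             (coeff a 0 * q powi (2 * n)) \<odot>\<^bsub>U q\<^esub> (A\<^sub>p n \<otimes>\<^bsub>U q\<^esub> A\<^sub>p n)}))"

lemma U_trunc_ideal_gens: "U_trunc_ideal q a = Idl\<^bsub>U q\<^esub> (trunc_gens a)"
  by (simp add: U_trunc_ideal_def trunc_gens_def Let_def)

lemma trunc_gens_closed:
  assumes "coeff a 0 \<noteq> 0"
  shows "trunc_gens a \<subseteq> carrier (U q)"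
proof -
  have "a \<noteq> 0" using assms by auto
  then show ?thesis
    using assms by (auto simp: trunc_gens_def Let_def U_A_closed Uphi_closed U.smult_closed)
qed

lemma calg_ideal_U_trunc:
  assumes "coeff a 0 \<noteq> 0"
  shows "calg_ideal (U q) (U_trunc_ideal q a)"
  unfolding U_trunc_ideal_gens
  by (intro calg_ideal.intro U.calg_self U.genideal_ideal trunc_gens_closed assms)

lemma U_proj_gens_zero:
  assumes "coeff a 0 \<noteq> 0" "x \<in> trunc_gens a"
  shows "U_proj q a x = \<zero>\<^bsub>U_trunc q a\<^esub>"
proof -
  interpret calg_ideal "U q" "U_trunc_ideal q a" by (rule calg_ideal_U_trunc[OF assms(1)])
  have "x \<in> carrier (U q)" "x \<in> U_trunc_ideal q a"
    using trunc_gens_closed[OF assms(1)] U.genideal_self[of "trunc_gens a" q] assms(2)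
    unfolding U_trunc_ideal_gens by auto
  then show ?thesis
    using proj_zero_iff by (simp add: U_proj_def U_trunc_def proj_def)
qed

text \<open>The power of q^2 is the effect of the rescaling in \<open>A_neg\<close>. The equivalence
  is read from left to right for a and b, and from right to left for their product.\<close>

lemma trunc_gens_zero_iff:
  assumes a: "coeff a 0 \<noteq> 0" and J: "calg_morph J"
  defines "n \<equiv> int (degree a div 2)"
  shows "(\<forall>x\<in>trunc_gens a. J (lift (U q) x) = 0) \<longleftrightarrow>
    (\<forall>k>n. J (A_pos a $$ k) = 0) \<and>
    (\<forall>k. J (A_neg a $$ k) = sc ((q\<^sup>2) powi (n - k)) (J (A_neg a $$ n) * J (A_pos a $$ (n - k)))) \<and>
    sc (lead_coeff a) (J (lp Pos 0) * J (lp Pos 0)) =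
      sc (coeff a 0 * q powi (2 * n)) (J (A_pos a $$ n) * J (A_pos a $$ n))"
proof -
  interpret J: calg_morph J by (rule J)
  have a0: "a \<noteq> 0" using a by auto
  have p0: "q\<^sup>2 \<noteq> 0" using q0 by simp
  note cl = U_A_closed(1)[OF a] U_A_closed(2)[OF a0] Uphi_closed
  let ?p = "\<lambda>k. lift (U q) (U_A_pos q a k)" and ?n = "\<lambda>k. lift (U q) (U_A_neg q a k)"
  have 1: "(\<forall>x\<in>trunc_gens a. J (lift (U q) x) = 0) \<longleftrightarrow>
    (\<forall>k>n. J (?p k) = 0) \<and> (\<forall>k. J (?n k) = J (?n (- n)) * J (?p (k + n))) \<and>
    sc (lead_coeff a) (J (lp Pos 0) * J (lp Pos 0)) = sc (coeff a 0 * q powi (2 * n)) (J (?p n) * J (?p n))"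
  proof -
    have g2: "J (lift (U q) (U_A_neg q a k \<ominus>\<^bsub>U q\<^esub> U_A_neg q a (- n) \<otimes>\<^bsub>U q\<^esub> U_A_pos q a (k + n))) =
        J (?n k) - J (?n (- n)) * J (?p (k + n))" for k
      by (simp add: U.lift_minus U.lift_mult cl J.diff J.mult)
    have g3: "J (lift (U q) (lead_coeff a \<odot>\<^bsub>U q\<^esub> (Uphi q Pos 0 \<otimes>\<^bsub>U q\<^esub> Uphi q Pos 0) \<ominus>\<^bsub>U q\<^esub>
             (coeff a 0 * q powi (2 * n)) \<odot>\<^bsub>U q\<^esub> (U_A_pos q a n \<otimes>\<^bsub>U q\<^esub> U_A_pos q a n))) =
        sc (lead_coeff a) (J (lp Pos 0) * J (lp Pos 0)) - sc (coeff a 0 * q powi (2 * n)) (J (?p n) * J (?p n))"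
      by (simp only: U.lift_minus U.lift_mult U.lift_smult U.smult_closed U.m_closed cl J.diff J.mult J.sc)
    have ball: "(\<forall>x\<in>{f k |k. R k}. Q x) \<longleftrightarrow> (\<forall>k. R k \<longrightarrow> Q (f k))" for f :: "int \<Rightarrow> Uel" and R Q by blast
    show ?thesis
      unfolding trunc_gens_def Let_def n_def[symmetric] ball_Un ball
      by (simp only: ball_simps g2 g3 right_minus_eq simp_thms conj_assoc)
  qed
  have 2: "(\<forall>k. J (A_neg a $$ k) = sc ((q\<^sup>2) powi (n - k)) (J (A_neg a $$ n) * J (A_pos a $$ (n - k)))) \<longleftrightarrow>
    (\<forall>k. J (?n k) = J (?n (- n)) * J (?p (k + n)))" (is "(\<forall>k. ?L k) \<longleftrightarrow> (\<forall>k. ?R k)")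
  proof -
    have "?L k \<longleftrightarrow> ?R (- k)" for k
    proof -
      have "sc ((q\<^sup>2) powi (n - k)) (J (A_neg a $$ n) * J (A_pos a $$ (n - k))) =
          sc ((q\<^sup>2) powi (n - k) * (q\<^sup>2) powi (- n)) (J (?n (- n)) * J (?p (- k + n)))"
        by (simp only: A_neg_nth[OF a0] A_pos_nth[OF a] J.sc sc_mult_left sc_sc) simp
      also have "(q\<^sup>2) powi (n - k) * (q\<^sup>2) powi (- n) = (q\<^sup>2) powi (- k)"
        using p0 by (simp flip: power_int_add)
      finally have "?L k \<longleftrightarrow> sc ((q\<^sup>2) powi (- k)) (J (?n (- k))) = sc ((q\<^sup>2) powi (- k)) (J (?n (- n)) * J (?p (- k + n)))"
        by (simp only: A_neg_nth[OF a0] J.sc)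
      also have "\<dots> \<longleftrightarrow> ?R (- k)"
        by (rule sc_cancel) (use p0 in simp)
      finally show ?thesis .
    qed
    then have "(\<forall>k. ?L k) \<longleftrightarrow> (\<forall>k. ?R (- k))" by blast
    also have "\<dots> \<longleftrightarrow> (\<forall>k. ?R k)" by (metis minus_minus)
    finally show ?thesis .
  qed
  show ?thesis
    unfolding 1 2[symmetric] A_pos_nth[OF a] ..
qed

end

theorem (in U_nonroot) U_trunc_coproduct:
  assumes a: "even (degree a)" "coeff a 0 \<noteq> 0" and b: "even (degree b)" "coeff b 0 \<noteq> 0"
    and \<Delta>: "U_coproduct q \<Delta>"
  shows "\<exists>\<Delta>' \<in> alg_hom (U_trunc q (a * b)) (tensor_alg (U_trunc q a) (U_trunc q b)).
         \<forall>u \<in> carrier (U q). \<Delta>' (U_proj q (a * b) u) =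
           tensor_map (U q) (U q) (U_trunc q a) (U_trunc q b) (U_proj q a) (U_proj q b) (\<Delta> u)"
proof -
  have nz: "a \<noteq> 0" "b \<noteq> 0" using a b by auto
  then have nz': "a * b \<noteq> 0" by simp
  have ab: "coeff (a * b) 0 \<noteq> 0"
    using a b by (simp add: coeff_mult_0)
  let ?I = "U_trunc_ideal q"
  interpret Ia: calg_ideal "U q" "?I a" by (rule calg_ideal_U_trunc[OF a(2)])
  interpret Ib: calg_ideal "U q" "?I b" by (rule calg_ideal_U_trunc[OF b(2)])
  interpret Iab: calg_ideal "U q" "?I (a * b)" by (rule calg_ideal_U_trunc[OF ab])
  have pa: "U_proj q a = Ia.proj" "U_trunc q a = quot_alg (U q) (?I a)"
    and pb: "U_proj q b = Ib.proj" "U_trunc q b = quot_alg (U q) (?I b)"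
    and pab: "U_proj q (a * b) = Iab.proj" "U_trunc q (a * b) = quot_alg (U q) (?I (a * b))"
    by (auto simp: U_proj_def U_trunc_def Ia.proj_def Ib.proj_def Iab.proj_def)
  interpret Ua: calg "U_trunc q a" unfolding pa by (rule Ia.calg_quot)
  interpret Ub: calg "U_trunc q b" unfolding pb by (rule Ib.calg_quot)
  interpret T: calg_tensor "U_trunc q a" "U_trunc q b" by unfold_locales
  interpret UU: calg_tensor "U q" "U q" by unfold_locales
  let ?T = "tensor_alg (U_trunc q a) (U_trunc q b)"
  have hpa: "U_proj q a \<in> alg_hom (U q) (U_trunc q a)" and hpb: "U_proj q b \<in> alg_hom (U q) (U_trunc q b)"
    unfolding pa pb by (rule Ia.proj_hom Ib.proj_hom)+
  define tm where "tm = tensor_map (U q) (U q) (U_trunc q a) (U_trunc q b) (U_proj q a) (U_proj q b)"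
  note tm = tensor_map_hom[OF U.calg_self U.calg_self Ua.calg_self Ub.calg_self hpa hpb, folded tm_def]
  have D: "\<Delta> \<in> alg_hom (U q) (tensor_alg (U q) (U q))"
    using \<Delta> by (simp add: U_coproduct_def Let_def)
  define j1 where "j1 y = T.t (U_proj q a y) \<one>\<^bsub>U_trunc q b\<^esub>" for y
  define j2 where "j2 y = T.t \<one>\<^bsub>U_trunc q a\<^esub> (U_proj q b y)" for y
  define \<psi> where "\<psi> y = tm (\<Delta> y)" for y
  have j1: "j1 \<in> alg_hom (U q) ?T" unfolding j1_def by (rule alg_hom_comp[OF hpa T.left_hom])
  have j2: "j2 \<in> alg_hom (U q) ?T" unfolding j2_def by (rule alg_hom_comp[OF hpb T.right_hom])
  have psi: "\<psi> \<in> alg_hom (U q) ?T" unfolding \<psi>_def by (rule alg_hom_comp[OF D tm(1)])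
  note closed = alg_homD(1)[OF j1] alg_homD(1)[OF j2] alg_homD(1)[OF psi]
  have tm_t: "tm (pure_tensor (U q) (U q) x y) = j1 x \<otimes>\<^bsub>?T\<^esub> j2 y" if "x \<in> carrier (U q)" "y \<in> carrier (U q)" for x y
    using that by (simp add: tm(2) j1_def j2_def T.left_right alg_homD(1)[OF hpa] alg_homD(1)[OF hpb])
  have j1_one: "j1 \<one>\<^bsub>U q\<^esub> = \<one>\<^bsub>?T\<^esub>" and j2_one: "j2 \<one>\<^bsub>U q\<^esub> = \<one>\<^bsub>?T\<^esub>" and psi_one: "\<psi> \<one>\<^bsub>U q\<^esub> = \<one>\<^bsub>?T\<^esub>"
    by (rule alg_hom_one[OF j1] alg_hom_one[OF j2] alg_hom_one[OF psi])+
  note gens = Ux_closed Uphi_closed Uh_closed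
  let ?c = "q powi 2 - q powi (-2)"
  note tm_ops = alg_homD(2,4)[OF tm(1)] alg_hom_minus[OF UU.T.calg_self T.T.calg_self tm(1)]
  have psi_gen: "\<psi> (Ux q Pos 0) = j1 (Ux q Pos 0) \<oplus>\<^bsub>?T\<^esub> j1 (Uphi q Pos 0) \<otimes>\<^bsub>?T\<^esub> j2 (Ux q Pos 0)"
    "\<psi> (Ux q Neg 0) = j2 (Ux q Neg 0) \<oplus>\<^bsub>?T\<^esub> j1 (Ux q Neg 0) \<otimes>\<^bsub>?T\<^esub> j2 (Uphi q Neg 0)"
    "\<psi> (Uphi q e 0) = j1 (Uphi q e 0) \<otimes>\<^bsub>?T\<^esub> j2 (Uphi q e 0)"
    "\<psi> (Uh q (-1)) = j2 (Uh q (-1)) \<oplus>\<^bsub>?T\<^esub> j1 (Uh q (-1)) \<oplus>\<^bsub>?T\<^esub> ?c \<odot>\<^bsub>?T\<^esub> (j1 (Ux q Neg 0) \<otimes>\<^bsub>?T\<^esub> j2 (Ux q Pos (-1)))"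
    "\<psi> (Uh q 1) = j2 (Uh q 1) \<oplus>\<^bsub>?T\<^esub> j1 (Uh q 1) \<ominus>\<^bsub>?T\<^esub> ?c \<odot>\<^bsub>?T\<^esub> (j1 (Ux q Neg 1) \<otimes>\<^bsub>?T\<^esub> j2 (Ux q Pos 0))" for e
    using \<Delta> unfolding U_coproduct_def Let_def \<psi>_def
    by (simp_all only: tm_ops tm_t UU.t_closed UU.T.smult_closed UU.T.a_closed gens U.one_closed j1_one j2_one closed
        T.T.l_one T.T.r_one)
  define J1 where "J1 x = lift ?T (j1 (lower (U q) x))" for x
  define J2 where "J2 x = lift ?T (j2 (lower (U q) x))" for x
  define Psi where "Psi x = lift ?T (\<psi> (lower (U q) x))" for x
  have morph: "calg_morph J1" "calg_morph J2" "calg_morph Psi"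
    unfolding J1_def J2_def Psi_def
    by (rule calg_morph_alg_hom[OF U.calg_self T.T.calg_self j1] calg_morph_alg_hom[OF U.calg_self T.T.calg_self j2]
      calg_morph_alg_hom[OF U.calg_self T.T.calg_self psi])+
  interpret mJ1: calg_morph J1 by (rule morph)
  interpret mJ2: calg_morph J2 by (rule morph)
  interpret mPsi: calg_morph Psi by (rule morph)
  have lifted: "J1 (lift (U q) x) = lift ?T (j1 x)" "J2 (lift (U q) x) = lift ?T (j2 x)" "Psi (lift (U q) x) = lift ?T (\<psi> x)"
    if "x \<in> carrier (U q)" for x
    using that by (simp_all add: J1_def J2_def Psi_def U.lower_lift)
  have commJ: "J2 y * J1 x = J1 x * J2 y" for x y
    unfolding J1_def J2_def
    by (simp add: closed U.lower_closed j1_def j2_def T.left_right T.right_left alg_homD(1)[OF hpa] alg_homD(1)[OF hpb]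
        T.t_closed flip: T.T.lift_mult)
  note s = lifted gens psi_gen T.T.lift_add T.T.lift_mult T.T.lift_minus T.T.lift_smult closed
    T.T.m_closed T.T.smult_closed T.T.a_closed U.one_closed j1_one j2_one psi_one
  have Psi_gen: "Psi (lx Pos 0) = J1 (lx Pos 0) + J1 (lp Pos 0) * J2 (lx Pos 0)"
    "Psi (lx Neg 0) = J2 (lx Neg 0) + J1 (lx Neg 0) * J2 (lp Neg 0)"
    "Psi (lp e 0) = J1 (lp e 0) * J2 (lp e 0)"
    "Psi (lift (U q) (Uh q (-1))) = J2 (lift (U q) (Uh q (-1))) + J1 (lift (U q) (Uh q (-1))) + sc ?c (J1 (lx Neg 0) * J2 (lx Pos (-1)))"
    "Psi (lift (U q) (Uh q 1)) = J2 (lift (U q) (Uh q 1)) + J1 (lift (U q) (Uh q 1)) - sc ?c (J1 (lx Neg 1) * J2 (lx Pos 0))"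
    "J1 Uu = Psi Uu" "J2 Uu = Psi Uu" for e
    by (simp_all only: s)
  have c': "q powi (- 2) = 1 / q\<^sup>2"
    by (simp add: power_int_minus divide_inverse)
  have c: "?c = q\<^sup>2 - 1 / q\<^sup>2"
    by (simp add: c')
  let ?ra = "reflect_poly a" and ?rb = "reflect_poly b"
  have CP: "qaff_coproduct q (\<lambda>n. lx Pos n) (\<lambda>n. lx Neg n) (\<lambda>n. lp Pos n) (\<lambda>n. lp Neg n) Uu
      (A_pos a) (rhs Pos a) (A_pos b) (rhs Pos b) J1 J2 Psi"
  proof (intro qaff_coproduct.intro qaff_coproduct_axioms.intro qaff_A_pos a b morph)
    show "Psi P.h = J1 P.h + J2 P.h - sc (q\<^sup>2 - 1 / q\<^sup>2) (J1 (lx Neg 1) * J2 (lx Pos 0))"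
      unfolding h_Uh Psi_gen c by (simp add: add.commute)
  qed (rule Psi_gen commJ)+
  \<comment> \<open>Replacing z by 1/z reverses the order of the tensor factors, hence b comes
    before a and J2 before J1. The minus sign in \<open>M.h\<close> turns the prescribed value at
    h_(-1) into the form demanded for h_1.\<close>
  have CM: "qaff_coproduct q (\<lambda>n. lx Neg (- n)) (\<lambda>n. lx Pos (- n)) (\<lambda>n. lp Neg (- n)) (\<lambda>n. lp Pos (- n)) Uu
      (A_neg b) (rhs Neg ?rb) (A_neg a) (rhs Neg ?ra) J2 J1 Psi"
  proof (intro qaff_coproduct.intro qaff_coproduct_axioms.intro qaff_A_neg nz morph)
    show "Psi M.h = J2 M.h + J1 M.h - sc (q\<^sup>2 - 1 / q\<^sup>2) (J2 (lx Pos (- 1)) * J1 (lx Neg (- 0)))"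
      unfolding h_Uh by (simp add: mJ1.minus mJ2.minus mPsi.minus Psi_gen commJ c')
  qed (simp_all add: Psi_gen commJ)
  have A: "qaff_A q (\<lambda>n. lx Pos n) (\<lambda>n. lx Neg n) (\<lambda>n. lp Pos n) (\<lambda>n. lp Neg n) Uu (A_pos (a * b)) (rhs Pos (a * b))"
    by (rule qaff_A_pos[OF ab])
  have cA: "fls_map Psi (rhs Pos (a * b)) = fls_map J1 (rhs Pos a) * fls_map J2 (rhs Pos b)"
    by (rule rhs_mult[OF morph Psi_gen(3)])
  have C: "qaff_A q (\<lambda>n. lx Neg (- n)) (\<lambda>n. lx Pos (- n)) (\<lambda>n. lp Neg (- n)) (\<lambda>n. lp Pos (- n)) Uu
      (A_neg (a * b)) (rhs Neg (reflect_poly (a * b)))"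
    by (rule qaff_A_neg[OF nz'])
  have cC: "fls_map Psi (rhs Neg (reflect_poly (a * b))) = fls_map J2 (rhs Neg ?rb) * fls_map J1 (rhs Neg ?ra)"
    unfolding mult.commute[of a b] reflect_poly_mult
    by (rule rhs_mult[OF morph(2,1,3)]) (simp add: Psi_gen commJ)
  let ?na = "int (degree a div 2)" and ?nb = "int (degree b div 2)"
  have z1: "\<forall>x\<in>trunc_gens a. J1 (lift (U q) x) = 0"
  proof
    fix x assume x: "x \<in> trunc_gens a"
    then have "x \<in> carrier (U q)" using trunc_gens_closed[OF a(2)] by blast
    then show "J1 (lift (U q) x) = 0"
      using alg_hom_zero[OF Ua.calg_self T.T.calg_self T.left_hom]
      by (simp add: lifted j1_def U_proj_gens_zero[OF a(2) x] T.T.lift_zero)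
  qed
  have z2: "\<forall>x\<in>trunc_gens b. J2 (lift (U q) x) = 0"
  proof
    fix x assume x: "x \<in> trunc_gens b"
    then have "x \<in> carrier (U q)" using trunc_gens_closed[OF b(2)] by blast
    then show "J2 (lift (U q) x) = 0"
      using alg_hom_zero[OF Ub.calg_self T.T.calg_self T.right_hom]
      by (simp add: lifted j2_def U_proj_gens_zero[OF b(2) x] T.T.lift_zero)
  qed
  note r1 = z1[unfolded trunc_gens_zero_iff[OF a(2) morph(1)]]
    and r2 = z2[unfolded trunc_gens_zero_iff[OF b(2) morph(2)]]
  have r: "k > ?na \<Longrightarrow> J1 (A_pos a $$ k) = 0" "k > ?nb \<Longrightarrow> J2 (A_pos b $$ k) = 0"
    "J1 (A_neg a $$ k) = sc ((q\<^sup>2) powi (?na - k)) (J1 (A_neg a $$ ?na) * J1 (A_pos a $$ (?na - k)))"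
    "J2 (A_neg b $$ k) = sc ((q\<^sup>2) powi (?nb - k)) (J2 (A_neg b $$ ?nb) * J2 (A_pos b $$ (?nb - k)))" for k
    by (rule r1[THEN conjunct1, rule_format] r2[THEN conjunct1, rule_format], assumption)+
      (rule r1[THEN conjunct2, THEN conjunct1, rule_format] r2[THEN conjunct2, THEN conjunct1, rule_format])+
  have l1: "sc (lead_coeff a) (J1 (lp Pos 0) * J1 (lp Pos 0)) =
      sc (coeff a 0 * q powi (2 * ?na)) (J1 (A_pos a $$ ?na) * J1 (A_pos a $$ ?na))"
    and l2: "sc (lead_coeff b) (J2 (lp Pos 0) * J2 (lp Pos 0)) =
      sc (coeff b 0 * q powi (2 * ?nb)) (J2 (A_pos b $$ ?nb) * J2 (A_pos b $$ ?nb))"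
    by (rule r1[THEN conjunct2, THEN conjunct2] r2[THEN conjunct2, THEN conjunct2])+
  note tr = truncated_coproduct[OF CP CM A cA C cC r]
  have deg: "int (degree (a * b) div 2) = ?na + ?nb"
    using a b by (auto simp: degree_mult_eq[OF nz] elim!: evenE)
  \<comment> \<open>The third relation is multiplicative: phi^+_0 is group-like, the top coefficient
    of A goes to the product of the two top coefficients, and the degrees add in the power of
    q.\<close>
  have l12: "sc (lead_coeff (a * b)) (Psi (lp Pos 0) * Psi (lp Pos 0)) =
      sc (coeff (a * b) 0 * q powi (2 * (?na + ?nb))) (Psi (A_pos (a * b) $$ (?na + ?nb)) * Psi (A_pos (a * b) $$ (?na + ?nb)))"
  proof -
    have sq: "J1 x * J2 y * (J1 x * J2 y) = (J1 x * J1 x) * (J2 y * J2 y)" for x y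
    proof -
      have "J1 x * J2 y * (J1 x * J2 y) = J1 x * (J2 y * J1 x) * J2 y" by (simp only: mult.assoc)
      then show ?thesis by (simp only: commJ mult.assoc)
    qed
    have "sc (lead_coeff (a * b)) (Psi (lp Pos 0) * Psi (lp Pos 0)) =
        sc (lead_coeff a) (J1 (lp Pos 0) * J1 (lp Pos 0)) * sc (lead_coeff b) (J2 (lp Pos 0) * J2 (lp Pos 0))"
      by (simp only: Psi_gen sq lead_coeff_mult sc_mult_left sc_mult_right sc_sc mult.commute[of "lead_coeff b"])
    also have "\<dots> = sc ((coeff a 0 * q powi (2 * ?na)) * (coeff b 0 * q powi (2 * ?nb)))
        ((J1 (A_pos a $$ ?na) * J1 (A_pos a $$ ?na)) * (J2 (A_pos b $$ ?nb) * J2 (A_pos b $$ ?nb)))"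
      by (simp only: l1 l2 sc_mult_left sc_mult_right sc_sc mult.commute[of "coeff b 0 * _"])
    also have "(coeff a 0 * q powi (2 * ?na)) * (coeff b 0 * q powi (2 * ?nb)) = coeff (a * b) 0 * q powi (2 * (?na + ?nb))"
      using q0 by (simp add: coeff_mult_0 distrib_left power_int_add)
    finally show ?thesis
      by (simp only: tr(2) sq)
  qed
  have "\<forall>x\<in>trunc_gens (a * b). Psi (lift (U q) x) = 0"
    unfolding trunc_gens_zero_iff[OF ab morph(3)] deg by (intro conjI allI impI l12 tr(1,3))
  then have kill: "\<psi> x = \<zero>\<^bsub>?T\<^esub>" if "x \<in> trunc_gens (a * b)" for x
    using that trunc_gens_closed[OF ab] lifted(3)[of x] closed(3)[of x] T.T.lift_eq_0_iff by auto
  have "\<psi> y = \<zero>\<^bsub>?T\<^esub>" if "y \<in> ?I (a * b)" for y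
    by (rule genideal_hom_zero[OF U.calg_self T.T.calg_self psi trunc_gens_closed[OF ab] kill that[unfolded U_trunc_ideal_gens]])
  note fac = Iab.factor[OF T.T.calg_self psi this]
  show ?thesis
    by (rule bexI[OF _ fac(2)[folded pab(2)]]) (simp add: pab(1) fac(1), simp add: \<psi>_def tm_def)
qed

theorem mainTheorem1:
  shows "(\<forall>(a :: complex poly) (b :: complex poly) \<Delta>.
      lead_coeff a = 1 \<and> even (degree a) \<and> lead_coeff b = 1 \<and> even (degree b) \<and>
      Y_coproduct \<Delta> \<longrightarrow>
      (\<exists>\<Delta>' \<in> alg_hom (Y_trunc (a * b)) (tensor_alg (Y_trunc a) (Y_trunc b)).
         \<forall>y \<in> carrier Y. \<Delta>' (Y_proj (a * b) y) =
           tensor_map Y Y (Y_trunc a) (Y_trunc b) (Y_proj a) (Y_proj b) (\<Delta> y)))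
    \<and>
    (\<forall>(q :: complex) (a :: complex poly) (b :: complex poly) \<Delta>.
      q \<noteq> 0 \<and> (\<forall>n::nat. n > 0 \<longrightarrow> q ^ n \<noteq> 1) \<and>
      even (degree a) \<and> coeff a 0 \<noteq> 0 \<and> even (degree b) \<and> coeff b 0 \<noteq> 0 \<and>
      U_coproduct q \<Delta> \<longrightarrow>
      (\<exists>\<Delta>' \<in> alg_hom (U_trunc q (a * b)) (tensor_alg (U_trunc q a) (U_trunc q b)).
         \<forall>u \<in> carrier (U q). \<Delta>' (U_proj q (a * b) u) =
           tensor_map (U q) (U q) (U_trunc q a) (U_trunc q b) (U_proj q a) (U_proj q b) (\<Delta> u)))"
  by (intro conjI allI impI; elim conjE)
    (rule Y_trunc_coproduct U_nonroot.U_trunc_coproduct[OF U_nonroot.intro]; simp)+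

end
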